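(* Let $\mathfrak{f}=\sum_{k=0}^d \mathfrak{f}_kT^k\in\mathbb{Z}_p[T]$ be a random $p$-adic polynomial of degree $d$, i.e. the $\mathfrak{f}_k$ are independent random $p$-adic integers uniformly distributed in $\mathbb{Z}_p$ (Haar probability measure). Then the algorithm STRASSMAN (described in the context) finds approximations of all roots of $\mathfrak{f}$ in $\mathbb{Z}_p$, in the sense that Newton's method started at each returned center converges quadratically to a root, and every root of $\mathfrak{f}$ in $\mathbb{Z}_p$ is obtained this way, using $\mathcal{O}(d^2\log^3 d\,\log p)$ arithmetic operations on average. Furthermore, the precision needed by STRASSMAN on average to guarantee correctness is $d+\mathcal{O}(1)$ $p$-adic digits. Moreover, if $p\le \mathcal{O}(d)$, then the average number of arithmetic operations can be reduced to $\mathcal{O}(dp)\le\mathcal{O}(d^2)$.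
   Context: $|\cdot|$ is the $p$-adic absolute value with $|p|=1/p$. For $f=\sum_k f_kT^k\in\mathbb{Q}_p[T]$ nonzero, the Strassman count is $\mathrm{St}(f):=\max\{k\in\mathbb{N}: |f_l|\le|f_k| \text{ for all } l<k\}$ (with $f_k=0$ for $k>\deg f$), and for $x\in\mathbb{Z}_p$, $s\in\mathbb{Z}$, $\mathrm{St}(f;x,p^{-s}):=\mathrm{St}(f(x+p^sT))$. Algorithm STRASSMAN, on input $f\in\mathbb{Q}_p[T]$ without singular roots in $\mathbb{Z}_p$: set $\ell_{in}=\mathrm{St}(f;0,1)$, $f_{in}=\sum_{k=0}^{\ell_{in}}(f_k/f_{\ell_{in}})T^k$, $\mathcal{S}=\{(f_{in};0,1;\ell_{in})\}$, $\mathcal{Z}=\emptyset$. Repeat until $\mathcal{S}=\emptyset$: remove some $(g;x,p^{-s};\ell)$ from $\mathcal{S}$; find all $a\in\{0,\dots,p-1\}$ with $|g(a)|<1$ (i.e. the roots of $g \bmod p$ in $\mathbb{F}_p$; this is done either by exhaustive search over $\mathbb{F}_p$, or by computing $\gcd(g,T^p-T)\bmod p$ and applying the randomized Cantor–Zassenhaus factorization algorithm); for each such $a$: put $x'=x+ap^s$, let $h$ be $f(x'+p^{s+1}T)$ truncated at degree $\ell$, $\ell'=\mathrm{St}(h)$; if $\ell'>1$ add $(\sum_{k=0}^{\ell'}(h_k/h_{\ell'})T^k;x',p^{-(s+1)};\ell')$ to $\mathcal{S}$; if $\ell'=1$ add $(x',p^{-(s+1)})$ to $\mathcal{Z}$;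 if $\ell'=0$ discard. Output $\mathcal{Z}$. Precision is measured in the flat model: every $p$-adic number is stored with the same number $b$ of digits of absolute precision (i.e. modulo $p^b$). "On average" refers to the expectation over the random polynomial (and the internal randomness of the factorization subroutine). *)

theory Defs
  imports
    "HOL-Probability.Probability"
    "HOL-Algebra.Divisibility"
    "HOL-Number_Theory.Residues"
begin

hide_const (open) Divisibility.prime

section \<open>The p-adic integers\<close>

text \<open>
  The prime is a value and not a type, because the implied constants of the complexity bounds are
  uniform in it. A p-adic integer is its sequence of least nonnegative residues: \<open>x n\<close> is \<open>x\<close>
  modulo \<open>p ^ n\<close>.
\<close>

definition padic_int :: "nat \<Rightarrow> (nat \<Rightarrow> int) ring" where
  "padic_int p =
     \<lparr>carrier = {x. \<forall>n. 0 \<le> x n \<and> x n < int p ^ n \<and> x (Suc n) mod int p ^ n = x n},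
      monoid.mult = (\<lambda>x y n. (x n * y n) mod int p ^ n),
      one = (\<lambda>n. 1 mod int p ^ n),
      zero = (\<lambda>n. 0),
      add = (\<lambda>x y n. (x n + y n) mod int p ^ n)\<rparr>"

definition padic_of_int :: "nat \<Rightarrow> int \<Rightarrow> nat \<Rightarrow> int" where
  "padic_of_int p i = (\<lambda>n. i mod int p ^ n)"

definition nat_in :: "('a, 'm) ring_scheme \<Rightarrow> nat \<Rightarrow> 'a" where
  "nat_in R n = [n] \<cdot>\<^bsub>R\<^esub> \<one>\<^bsub>R\<^esub>"

text \<open>
  The following two notions are used both for \<open>padic_int p\<close> and for its approximation
  \<open>residue_ring (p ^ b)\<close>. In the latter, quotients are not unique; \<open>quot\<close> then is an arbitrary one.
\<close>

definition padic_abs :: "nat \<Rightarrow> ('a, 'm) ring_scheme \<Rightarrow> 'a \<Rightarrow> real" where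
  "padic_abs p R x =
     (if x = \<zero>\<^bsub>R\<^esub> then 0 else 1 / real p ^ (GREATEST n. nat_in R (p ^ n) divides\<^bsub>R\<^esub> x))"

definition quot :: "('a, 'm) ring_scheme \<Rightarrow> 'a \<Rightarrow> 'a \<Rightarrow> 'a" where
  "quot R x y = (SOME z. z \<in> carrier R \<and> z \<otimes>\<^bsub>R\<^esub> y = x)"

text \<open>
  The uniform (Haar) probability measure: the base-\<open>p\<close> digits are independent and uniformly
  distributed. The \<open>\<sigma>\<close>-algebra is generated by the residue classes modulo powers of \<open>p\<close>, which
  are the balls.
\<close>

definition padic_haar :: "nat \<Rightarrow> (nat \<Rightarrow> int) measure" where
  "padic_haar p =
     distr (\<Pi>\<^sub>M i\<in>(UNIV :: nat set). uniform_count_measure {..<p})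
       (restrict_space (\<Pi>\<^sub>M n\<in>(UNIV :: nat set). count_space (UNIV :: int set)) (carrier (padic_int p)))
       (\<lambda>digit n. \<Sum>i<n. int (digit i) * int p ^ i)"

definition random_coeffs :: "nat \<Rightarrow> nat \<Rightarrow> (nat \<Rightarrow> nat \<Rightarrow> int) measure" where
  "random_coeffs p d = (\<Pi>\<^sub>M k\<in>{..d}. padic_haar p)"

text \<open>Polynomials are lists of coefficients, constant term first.\<close>

definition poly_of :: "nat \<Rightarrow> (nat \<Rightarrow> 'a) \<Rightarrow> 'a list" where
  "poly_of d F = map F [0..<Suc d]"


section \<open>Roots and Newton's method\<close>

fun peval :: "('a, 'm) ring_scheme \<Rightarrow> 'a list \<Rightarrow> 'a \<Rightarrow> 'a" where
  "peval R [] x = \<zero>\<^bsub>R\<^esub>"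
| "peval R (c # cs) x = c \<oplus>\<^bsub>R\<^esub> x \<otimes>\<^bsub>R\<^esub> peval R cs x"

definition pderivative :: "('a, 'm) ring_scheme \<Rightarrow> 'a list \<Rightarrow> 'a list" where
  "pderivative R cs = map (\<lambda>k. nat_in R k \<otimes>\<^bsub>R\<^esub> cs ! k) [1..<length cs]"

definition padic_roots :: "nat \<Rightarrow> (nat \<Rightarrow> int) list \<Rightarrow> (nat \<Rightarrow> int) set" where
  "padic_roots p f = {z \<in> carrier (padic_int p). peval (padic_int p) f z = \<zero>\<^bsub>padic_int p\<^esub>}"

definition no_singular_roots :: "nat \<Rightarrow> (nat \<Rightarrow> int) list \<Rightarrow> bool" where
  "no_singular_roots p f \<longleftrightarrow>
     padic_roots p f \<inter> padic_roots p (pderivative (padic_int p) f) = {}"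

text \<open>
  The third conjunct is \<open>y (n + 1) = y n - f (y n) / f' (y n)\<close>, including that the quotient is a
  \<open>p\<close>-adic integer.
\<close>

definition newton_converges_quadratically ::
    "nat \<Rightarrow> (nat \<Rightarrow> int) list \<Rightarrow> (nat \<Rightarrow> int) \<Rightarrow> (nat \<Rightarrow> int) \<Rightarrow> bool" where
  "newton_converges_quadratically p f x z \<longleftrightarrow>
     (let R = padic_int p; f' = pderivative R f; err = (\<lambda>u. padic_abs p R (u \<ominus>\<^bsub>R\<^esub> z)) in
      \<exists>y. y 0 = x \<and>
        (\<forall>n. y n \<in> carrier R \<and> peval R f' (y n) \<noteq> \<zero>\<^bsub>R\<^esub>) \<and>
        (\<forall>n. (y n \<ominus>\<^bsub>R\<^esub> y (Suc n)) \<otimes>\<^bsub>R\<^esub> peval R f' (y n) = peval R f (y n)) \<and>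
        (\<lambda>n. err (y n)) \<longlonglongrightarrow> 0 \<and>
        (\<exists>K. \<forall>n. err (y (Suc n)) \<le> K * (err (y n))\<^sup>2))"

text \<open>\<open>Z\<close> is a set of pairs \<open>(x, s)\<close>, standing for a center \<open>x\<close> with radius \<open>p ^ - s\<close>.\<close>

definition approximates_all_roots ::
    "nat \<Rightarrow> (nat \<Rightarrow> int) list \<Rightarrow> ((nat \<Rightarrow> int) \<times> nat) set \<Rightarrow> bool" where
  "approximates_all_roots p f Z \<longleftrightarrow>
     Z \<subseteq> carrier (padic_int p) \<times> UNIV \<and>
     (\<forall>(x, s) \<in> Z. \<exists>z \<in> padic_roots p f. newton_converges_quadratically p f x z) \<and>
     (\<forall>z \<in> padic_roots p f. \<exists>(x, s) \<in> Z. newton_converges_quadratically p f x z)"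


section \<open>Computations that count operations\<close>

text \<open>
  Every operation and every comparison (of absolute values, or with zero) in \<open>\<int>\<^sub>p\<close> or \<open>\<int>/p\<close>, every
  reduction modulo \<open>p\<close> of an element of \<open>\<int>\<^sub>p\<close> and every random choice of an element of \<open>\<int>/p\<close>
  counts as one operation. The integers \<open>0, \<dots>, p\<close> are available as constants.
\<close>

type_synonym 'a counted = "'a \<times> nat"

definition ret :: "'a \<Rightarrow> 'a counted" where "ret x = (x, 0)"

definition tick :: "'a \<Rightarrow> 'a counted" where "tick x = (x, 1)"

definition bind_counted :: "'a counted \<Rightarrow> ('a \<Rightarrow> 'b counted) \<Rightarrow> 'b counted" where
  "bind_counted m k = (fst (k (fst m)), snd m + snd (k (fst m)))"

adhoc_overloading Monad_Syntax.bind \<rightleftharpoons> bind_counted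

lemma bind_counted_cong [fundef_cong]:
  "m = m' \<Longrightarrow> (\<And>x. x = fst m' \<Longrightarrow> k x = k' x) \<Longrightarrow> bind_counted m k = bind_counted m' k'"
  by (simp add: bind_counted_def)

fun map_counted :: "('a \<Rightarrow> 'b counted) \<Rightarrow> 'a list \<Rightarrow> 'b list counted" where
  "map_counted f [] = ret []"
| "map_counted f (x # xs) = do { y \<leftarrow> f x; ys \<leftarrow> map_counted f xs; ret (y # ys) }"

lemma length_map_counted: "length (fst (map_counted f xs)) = length xs"
  by (induction xs) (simp_all add: bind_counted_def ret_def)

partial_function (spmf) while_spmf ::
    "('s \<Rightarrow> bool) \<Rightarrow> ('s \<Rightarrow> 's spmf) \<Rightarrow> 's \<Rightarrow> 's spmf" where
  "while_spmf b c s = (if b s then bind_spmf (c s) (while_spmf b c) else return_spmf s)"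


section \<open>Root finding in \<open>\<int>/p\<close>\<close>

fun horner :: "('a, 'm) ring_scheme \<Rightarrow> 'a list \<Rightarrow> 'a \<Rightarrow> 'a counted" where
  "horner R [] x = ret \<zero>\<^bsub>R\<^esub>"
| "horner R (c # cs) x =
     do { v \<leftarrow> horner R cs x; v \<leftarrow> tick (x \<otimes>\<^bsub>R\<^esub> v); tick (c \<oplus>\<^bsub>R\<^esub> v) }"

definition exhaustive_roots :: "nat \<Rightarrow> ('a, 'm) ring_scheme \<Rightarrow> 'a list \<Rightarrow> nat list counted" where
  "exhaustive_roots p R g =
     do { ts \<leftarrow> map_counted
            (\<lambda>a. do { v \<leftarrow> horner R g (nat_in R a); t \<leftarrow> tick (padic_abs p R v < 1); ret (a, t) })
            [0..<p];
          ret (map fst (filter snd ts)) }"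

text \<open>
  Schoolbook arithmetic in \<open>F[T]\<close>, where in this part of the theory lists of coefficients have the
  leading coefficient first. A list \<open>ms\<close> of length \<open>n\<close> stands for the monic polynomial \<open>m\<close> with
  coefficients \<open>1 # ms\<close>, and \<open>F[T]/(m)\<close> is represented by lists of length \<open>n\<close>.
\<close>

definition add_scaled :: "('a, 'm) ring_scheme \<Rightarrow> 'a list \<Rightarrow> 'a \<Rightarrow> 'a list \<Rightarrow> 'a list counted" where
  "add_scaled F xs t ys =
     map_counted (\<lambda>(x, y). do { v \<leftarrow> tick (t \<otimes>\<^bsub>F\<^esub> y); tick (x \<oplus>\<^bsub>F\<^esub> v) }) (zip xs ys)"

text \<open>\<open>shift_in F ms us c\<close> is \<open>u * T + c\<close> modulo \<open>m\<close>.\<close>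

fun shift_in :: "('a, 'm) ring_scheme \<Rightarrow> 'a list \<Rightarrow> 'a list \<Rightarrow> 'a \<Rightarrow> 'a list counted" where
  "shift_in F ms [] c = ret []"
| "shift_in F ms (u # us) c = do { t \<leftarrow> tick (\<ominus>\<^bsub>F\<^esub> u); add_scaled F (us @ [c]) t ms }"

fun shift_in_all :: "('a, 'm) ring_scheme \<Rightarrow> 'a list \<Rightarrow> 'a list \<Rightarrow> 'a list \<Rightarrow> 'a list counted" where
  "shift_in_all F ms us [] = ret us"
| "shift_in_all F ms us (c # cs) = do { us \<leftarrow> shift_in F ms us c; shift_in_all F ms us cs }"

definition reduce :: "('a, 'm) ring_scheme \<Rightarrow> 'a list \<Rightarrow> 'a list \<Rightarrow> 'a list counted" where
  "reduce F ms us =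
     (let n = length ms; vs = replicate (n - length us) \<zero>\<^bsub>F\<^esub> @ us
      in shift_in_all F ms (take n vs) (drop n vs))"

fun mult_add_mod ::
    "('a, 'm) ring_scheme \<Rightarrow> 'a list \<Rightarrow> 'a list \<Rightarrow> 'a list \<Rightarrow> 'a list \<Rightarrow> 'a list counted" where
  "mult_add_mod F ms acc [] vs = ret acc"
| "mult_add_mod F ms acc (u # us) vs =
     do { acc \<leftarrow> shift_in F ms acc \<zero>\<^bsub>F\<^esub>;
          acc \<leftarrow> add_scaled F acc u vs;
          mult_add_mod F ms acc us vs }"

definition mult_mod :: "('a, 'm) ring_scheme \<Rightarrow> 'a list \<Rightarrow> 'a list \<Rightarrow> 'a list \<Rightarrow> 'a list counted" where
  "mult_mod F ms us vs = mult_add_mod F ms (replicate (length ms) \<zero>\<^bsub>F\<^esub>) us vs"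

fun power_mod :: "('a, 'm) ring_scheme \<Rightarrow> 'a list \<Rightarrow> 'a list \<Rightarrow> nat \<Rightarrow> 'a list counted" where
  "power_mod F ms us e =
     (if e = 0 then reduce F ms [\<one>\<^bsub>F\<^esub>]
      else do { vs \<leftarrow> power_mod F ms us (e div 2);
                vs \<leftarrow> mult_mod F ms vs vs;
                if even e then ret vs else mult_mod F ms vs us })"

declare power_mod.simps [simp del]

lemma length_shift_in:
  "length us = length ms \<Longrightarrow> length (fst (shift_in F ms us c)) = length ms"
  by (cases us)
    (auto simp add: bind_counted_def ret_def tick_def add_scaled_def length_map_counted)

lemma length_shift_in_all:
  "length us = length ms \<Longrightarrow> length (fst (shift_in_all F ms us cs)) = length ms"
  by (induction cs arbitrary: us) (simp_all add: bind_counted_def ret_def length_shift_in)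

lemma length_reduce: "length (fst (reduce F ms us)) = length ms"
  by (simp add: reduce_def Let_def length_shift_in_all)

text \<open>
  The Euclidean algorithm for \<open>m\<close> and a polynomial \<open>u\<close> of smaller degree; the result is the monic gcd
  without its leading coefficient. Finding the leading coefficient of \<open>u\<close> takes at most \<open>length us\<close>
  comparisons with zero.
\<close>

function monic_gcd :: "('a, 'm) ring_scheme \<Rightarrow> 'a list \<Rightarrow> 'a list \<Rightarrow> 'a list counted" where
  "monic_gcd F ms us =
     do { vs \<leftarrow> (dropWhile (\<lambda>u. u = \<zero>\<^bsub>F\<^esub>) us, length us);
          (case vs of
             [] \<Rightarrow> ret ms
           | c # cs \<Rightarrow>
               do { c' \<leftarrow> tick (inv\<^bsub>F\<^esub> c);
                    cs' \<leftarrow> map_counted (\<lambda>u. tick (u \<otimes>\<^bsub>F\<^esub> c')) cs;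
                    rs \<leftarrow> reduce F cs' (\<one>\<^bsub>F\<^esub> # ms);
                    monic_gcd F cs' rs }) }"
  by pat_completeness auto
termination
proof (relation "Wellfounded.measure (\<lambda>(F, ms, us). length us)")
  fix F :: "('a, 'm) ring_scheme" and ms us vs c cs c' cs' rs
  assume vs: "vs = fst (dropWhile (\<lambda>u. u = \<zero>\<^bsub>F\<^esub>) us, length us)" "vs = c # cs"
    and cs': "cs' = fst (map_counted (\<lambda>u. tick (u \<otimes>\<^bsub>F\<^esub> c')) cs)"
    and rs: "rs = fst (reduce F cs' (\<one>\<^bsub>F\<^esub> # ms))"
  have "length (c # cs) \<le> length us"
    unfolding vs(2)[symmetric] vs(1) by (simp add: length_dropWhile_le)
  then show "((F, cs', rs), (F, ms, us)) \<in> Wellfounded.measure (\<lambda>(F, ms, us). length us)"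
    by (simp add: rs cs' length_reduce length_map_counted)
qed simp

declare monic_gcd.simps [simp del]

text \<open>
  Cantor-Zassenhaus: a monic product of at least two distinct linear factors is split by means of a
  random residue \<open>r\<close>, according to whether \<open>r ^ ((p - 1) div 2)\<close> is \<open>0\<close>, \<open>1\<close> or \<open>- 1\<close> at a root. The
  state consists of the polynomials left to be split, the roots found and the number of operations.
\<close>

definition cantor_zassenhaus_step ::
    "nat \<Rightarrow> int list list \<times> int list \<times> nat \<Rightarrow> (int list list \<times> int list \<times> nat) spmf" where
  "cantor_zassenhaus_step p st =
     (let F = residue_ring (int p); (stack, roots, ops) = st; ms = hd stack; n = length ms in
      if n = 0 then return_spmf (tl stack, roots, ops)
      else if n = 1 then return_spmf (tl stack, \<ominus>\<^bsub>F\<^esub> (hd ms) # roots, ops + 1)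
      else do {
        r \<leftarrow> spmf_of_set {r. length r = n \<and> set r \<subseteq> carrier F};
        let (new, k) =
          do { w \<leftarrow> power_mod F ms r ((p - 1) div 2);
               minus \<leftarrow> tick (last w \<ominus>\<^bsub>F\<^esub> \<one>\<^bsub>F\<^esub>);
               plus \<leftarrow> tick (last w \<oplus>\<^bsub>F\<^esub> \<one>\<^bsub>F\<^esub>);
               m0 \<leftarrow> monic_gcd F ms r;
               m1 \<leftarrow> monic_gcd F ms (butlast w @ [minus]);
               m2 \<leftarrow> monic_gcd F ms (butlast w @ [plus]);
               ret [m0, m1, m2] };
        return_spmf (new @ tl stack, roots, ops + n + k) })"

definition residue :: "nat \<Rightarrow> ('a, 'm) ring_scheme \<Rightarrow> 'a \<Rightarrow> int" where
  "residue p R x = int (THE a. a < p \<and> padic_abs p R (x \<ominus>\<^bsub>R\<^esub> nat_in R a) < 1)"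

text \<open>
  Here \<open>g\<close> is monic. In characteristic 2 the splitting step is not available, but there are only two
  candidates for a root.
\<close>

definition cantor_zassenhaus_roots ::
    "nat \<Rightarrow> ('a, 'm) ring_scheme \<Rightarrow> 'a list \<Rightarrow> nat list counted spmf" where
  "cantor_zassenhaus_roots p R g =
     (if p = 2 then return_spmf (exhaustive_roots p R g)
      else do {
        let F = residue_ring (int p);
        let (m, k) =
          do { ms \<leftarrow> map_counted (\<lambda>c. tick (residue p R c)) (tl (rev g));
               t \<leftarrow> reduce F ms [\<one>\<^bsub>F\<^esub>, \<zero>\<^bsub>F\<^esub>];
               w \<leftarrow> power_mod F ms t p;
               w \<leftarrow> map_counted (\<lambda>(x, y). tick (x \<ominus>\<^bsub>F\<^esub> y)) (zip w t);
               monic_gcd F ms w };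
        (_, roots, ops) \<leftarrow>
          while_spmf (\<lambda>(stack, _, _). stack \<noteq> []) (cantor_zassenhaus_step p) ([m], [], k);
        return_spmf (map nat roots, ops) })"

datatype root_finder = Exhaustive_Search | Cantor_Zassenhaus

definition roots_mod ::
    "root_finder \<Rightarrow> nat \<Rightarrow> ('a, 'm) ring_scheme \<Rightarrow> 'a list \<Rightarrow> nat list counted spmf" where
  "roots_mod rf p R g =
     (case rf of
        Exhaustive_Search \<Rightarrow> return_spmf (exhaustive_roots p R g)
      | Cantor_Zassenhaus \<Rightarrow> cantor_zassenhaus_roots p R g)"


section \<open>Algorithm STRASSMAN\<close>

text \<open>
  For a nonzero polynomial it makes no difference that only the coefficients in the list are
  considered.
\<close>

definition strassman_count :: "nat \<Rightarrow> ('a, 'm) ring_scheme \<Rightarrow> 'a list \<Rightarrow> nat" where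
  "strassman_count p R cs =
     Max {k. k < length cs \<and> (\<forall>l<k. padic_abs p R (cs ! l) \<le> padic_abs p R (cs ! k))}"

text \<open>The Strassman count is found in one pass, keeping the last maximal absolute value.\<close>

definition count_op :: "nat \<Rightarrow> ('a, 'm) ring_scheme \<Rightarrow> 'a list \<Rightarrow> nat counted" where
  "count_op p R cs = (strassman_count p R cs, length cs)"

text \<open>Quotient and remainder of the division by \<open>T - x\<close>; the quotient is padded with a zero.\<close>

fun synthetic_division :: "('a, 'm) ring_scheme \<Rightarrow> 'a list \<Rightarrow> 'a \<Rightarrow> ('a list \<times> 'a) counted" where
  "synthetic_division R [] x = ret ([], \<zero>\<^bsub>R\<^esub>)"
| "synthetic_division R (c # cs) x =
     do { (q, r) \<leftarrow> synthetic_division R cs x;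
          v \<leftarrow> tick (x \<otimes>\<^bsub>R\<^esub> r);
          v \<leftarrow> tick (c \<oplus>\<^bsub>R\<^esub> v);
          ret (r # q, v) }"

text \<open>The coefficients of \<open>f(x + T)\<close> up to degree \<open>n\<close>.\<close>

fun taylor :: "('a, 'm) ring_scheme \<Rightarrow> 'a list \<Rightarrow> 'a \<Rightarrow> nat \<Rightarrow> 'a list counted" where
  "taylor R cs x 0 = do { (q, r) \<leftarrow> synthetic_division R cs x; ret [r] }"
| "taylor R cs x (Suc n) =
     do { (q, r) \<leftarrow> synthetic_division R cs x; rs \<leftarrow> taylor R q x n; ret (r # rs) }"

text \<open>\<open>scale R cs q u\<close> has the coefficients \<open>u * q ^ k * (cs ! k)\<close>.\<close>

fun scale :: "('a, 'm) ring_scheme \<Rightarrow> 'a list \<Rightarrow> 'a \<Rightarrow> 'a \<Rightarrow> 'a list counted" where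
  "scale R [] q u = ret []"
| "scale R (c # cs) q u =
     do { v \<leftarrow> tick (u \<otimes>\<^bsub>R\<^esub> c); u \<leftarrow> tick (u \<otimes>\<^bsub>R\<^esub> q); vs \<leftarrow> scale R cs q u; ret (v # vs) }"

text \<open>The polynomial \<open>f(x + q * T)\<close> truncated at degree \<open>n\<close>.\<close>

definition substitute_truncated ::
    "('a, 'm) ring_scheme \<Rightarrow> 'a list \<Rightarrow> 'a \<Rightarrow> 'a \<Rightarrow> nat \<Rightarrow> 'a list counted" where
  "substitute_truncated R f x q n = do { cs \<leftarrow> taylor R f x n; scale R cs q \<one>\<^bsub>R\<^esub> }"

definition normalized :: "('a, 'm) ring_scheme \<Rightarrow> 'a list \<Rightarrow> nat \<Rightarrow> 'a list counted" where
  "normalized R h l = map_counted (\<lambda>c. tick (quot R c (h ! l))) (take (Suc l) h)"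

text \<open>The multiplicity of the root \<open>a\<close> of \<open>g\<close> modulo \<open>p\<close>, but at most \<open>n\<close>.\<close>

fun root_multiplicity :: "nat \<Rightarrow> ('a, 'm) ring_scheme \<Rightarrow> 'a list \<Rightarrow> nat \<Rightarrow> nat \<Rightarrow> nat counted" where
  "root_multiplicity p R g a 0 = ret 0"
| "root_multiplicity p R g a (Suc n) =
     do { (q, r) \<leftarrow> synthetic_division R g (nat_in R a);
          t \<leftarrow> tick (padic_abs p R r < 1);
          if t then do { k \<leftarrow> root_multiplicity p R q a n; ret (Suc k) } else ret 0 }"

text \<open>
  The degree at which \<open>h\<close> is truncated: \<open>l\<close> for \<open>At_Count\<close>, which is the original algorithm.
  The Strassman count \<open>l'\<close> of \<open>h\<close> never exceeds the multiplicity of \<open>a\<close> as a root of \<open>g\<close> modulo \<open>p\<close>, and the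
  coefficients of \<open>h\<close> beyond \<open>l'\<close> are discarded, so with \<open>At_Multiplicity\<close> the same is computed
  with fewer operations.
\<close>

datatype truncation = At_Count | At_Multiplicity

text \<open>
  An item \<open>(g, x, s, q, l)\<close> stands for \<open>(g; x, p ^ - s; l)\<close>; the last but one component is \<open>p ^ s\<close> as
  a ring element. The result consists of the additions to \<open>\<S>\<close> and to \<open>\<Z>\<close>.
\<close>

type_synonym 'a item = "'a list \<times> 'a \<times> nat \<times> 'a \<times> nat"

definition refine ::
    "truncation \<Rightarrow> nat \<Rightarrow> ('a, 'm) ring_scheme \<Rightarrow> 'a list \<Rightarrow> 'a item \<Rightarrow> nat \<Rightarrow>
      ('a item list \<times> ('a \<times> nat) list) counted" where
  "refine tr p R f it a =
     (let (g, x, s, q, l) = it in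
      do { v \<leftarrow> tick (nat_in R a \<otimes>\<^bsub>R\<^esub> q);
           x' \<leftarrow> tick (x \<oplus>\<^bsub>R\<^esub> v);
           q' \<leftarrow> tick (nat_in R p \<otimes>\<^bsub>R\<^esub> q);
           n \<leftarrow> (case tr of
                  At_Count \<Rightarrow> ret l
                | At_Multiplicity \<Rightarrow> root_multiplicity p R g a l);
           h \<leftarrow> substitute_truncated R f x' q' n;
           l' \<leftarrow> count_op p R h;
           if l' > 1 then do { g' \<leftarrow> normalized R h l'; ret ([(g', x', Suc s, q', l')], []) }
           else if l' = 1 then ret ([], [(x', Suc s)])
           else ret ([], []) })"

text \<open>A state consists of \<open>\<S>\<close>, organized as a stack, \<open>\<Z>\<close> and the number of operations so far.\<close>

definition strassman_step ::
    "root_finder \<Rightarrow> truncation \<Rightarrow> nat \<Rightarrow> ('a, 'm) ring_scheme \<Rightarrow> 'a list \<Rightarrow>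
      'a item list \<times> ('a \<times> nat) list \<times> nat \<Rightarrow> ('a item list \<times> ('a \<times> nat) list \<times> nat) spmf" where
  "strassman_step rf tr p R f st =
     (let (S, Z, ops) = st; it = hd S in
      do { (as, i) \<leftarrow> roots_mod rf p R (fst it);
           let (new, j) = map_counted (refine tr p R f it) as;
           return_spmf (concat (map fst new) @ tl S, concat (map snd new) @ Z, ops + i + j) })"

definition strassman ::
    "root_finder \<Rightarrow> truncation \<Rightarrow> nat \<Rightarrow> ('a, 'm) ring_scheme \<Rightarrow> 'a list \<Rightarrow>
      (('a \<times> nat) set \<times> nat) spmf" where
  "strassman rf tr p R f =
     (let ((g, l), k) = do { l \<leftarrow> count_op p R f; g \<leftarrow> normalized R f l; ret (g, l) } in
      map_spmf (\<lambda>(S, Z, ops). (set Z, ops))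
        (while_spmf (\<lambda>(S, Z, ops). S \<noteq> []) (strassman_step rf tr p R f)
          ([(g, \<zero>\<^bsub>R\<^esub>, 0, \<one>\<^bsub>R\<^esub>, l)], [], k)))"


section \<open>Correctness, cost and precision\<close>

definition run_correct ::
    "nat \<Rightarrow> (nat \<Rightarrow> int) list \<Rightarrow> (((nat \<Rightarrow> int) \<times> nat) set \<times> nat) spmf \<Rightarrow> bool" where
  "run_correct p f run \<longleftrightarrow>
     lossless_spmf run \<and> (\<forall>(Z, ops) \<in> set_spmf run. approximates_all_roots p f Z)"

definition expected_operations :: "('b \<times> nat) spmf \<Rightarrow> ennreal" where
  "expected_operations run =
     (if lossless_spmf run then \<integral>\<^sup>+ (Z, ops). of_nat ops \<partial>measure_spmf run else \<infinity>)"

text \<open>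
  With \<open>b\<close> digits of absolute precision only the coefficients modulo \<open>p ^ b\<close> are available, and all
  computations take place modulo \<open>p ^ b\<close>. Correctness is guaranteed if the output is correct for
  every polynomial having these approximate coefficients.
\<close>

definition truncated_run ::
    "root_finder \<Rightarrow> truncation \<Rightarrow> nat \<Rightarrow> nat \<Rightarrow> int list \<Rightarrow>
      (((nat \<Rightarrow> int) \<times> nat) set \<times> nat) spmf" where
  "truncated_run rf tr p b cs =
     map_spmf (\<lambda>(Z, ops). ((\<lambda>(x, s). (padic_of_int p x, s)) ` Z, ops))
       (strassman rf tr p (residue_ring (int p ^ b)) cs)"

definition precision_suffices ::
    "root_finder \<Rightarrow> truncation \<Rightarrow> nat \<Rightarrow> (nat \<Rightarrow> int) list \<Rightarrow> nat \<Rightarrow> bool" where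
  "precision_suffices rf tr p f b \<longleftrightarrow>
     (\<forall>f'. set f' \<subseteq> carrier (padic_int p) \<and> map (\<lambda>c. c b) f' = map (\<lambda>c. c b) f \<longrightarrow>
        run_correct p f' (truncated_run rf tr p b (map (\<lambda>c. c b) f)))"

definition precision_needed ::
    "root_finder \<Rightarrow> truncation \<Rightarrow> nat \<Rightarrow> (nat \<Rightarrow> int) list \<Rightarrow> ennreal" where
  "precision_needed rf tr p f = (INF b \<in> {b. \<forall>b'\<ge>b. precision_suffices rf tr p f b'}. of_nat b)"

text \<open>
  The completion makes the behaviour on null sets, such as on polynomials with singular roots,
  irrelevant for measurability.
\<close>

definition average_at_most :: "'b measure \<Rightarrow> ('b \<Rightarrow> ennreal) \<Rightarrow> real \<Rightarrow> bool" where
  "average_at_most M X c \<longleftrightarrow>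
     X \<in> borel_measurable (completion M) \<and> (\<integral>\<^sup>+ x. X x \<partial>completion M) \<le> ennreal c"

end

theory Submission
  imports Defs
begin

text \<open>
  Call the data \<open>p, b, t\<close> resolved for \<open>f\<close> if no disc of radius \<open>p ^ - t\<close> has a Strassman count above 1 and
  \<open>b\<close> digits suffice to see the counts of all larger discs. Then the runs over \<open>\<int>\<^sub>p\<close> and over
  \<open>\<int>/p ^ b\<close> are both described by the same finite tree of discs; a disc in the output has count 1, so that
  Newton's method converges on it, and counts of 0 exclude roots.

  A count of at least \<open>j\<close> on the disc of radius \<open>p ^ - i\<close> around \<open>y\<close> forces the Taylor coefficient of order
  \<open>k < j\<close> at \<open>y\<close> to be divisible by \<open>p ^ (i * (j - k))\<close>. Since the Taylor coefficients arise from the coefficients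
  by a unitriangular substitution, this has probability at most \<open>p ^ - (i * j * (j + 1) / 2)\<close>. Summing over the
  \<open>p ^ i\<close> discs, the expected contribution of all levels \<open>i \<ge> 1\<close> is a convergent geometric series, so the
  root of the tree dominates the cost. In the same way \<open>b\<close> digits fail to resolve \<open>f\<close> with probability
  \<open>O(2 ^ - b)\<close>, which bounds the expected precision even by a constant.
\<close>

hide_const (open) up_ring.coeff up_ring.monom module.smult Order.top Order.bottom

section \<open>Probabilistic loops\<close>

text \<open>The two sources of randomness separate. For a fixed resolved polynomial the tree is
  deterministic, although the roots modulo \<open>p\<close> may be found in random order; so the
  expected cost of a run is a sum over discs, and only then is the average over polynomials taken.
  Over \<int>/p^b quotients are not unique, hence the coefficients of an item are guaranteed only
  modulo \<open>p\<close>; the tree is therefore defined from residues, counts and integer centers,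
  which both rings share. As the prime is a value, F_p[T] is represented by integer polynomials up
  to congruence modulo the ideal generated by \<open>p\<close> and a modulus. Whether a disc is
  reached depends on its ancestors. This dependence is avoided by charging every disc of a level,
  reached or not, for a count of at least 2. Counts of 1 have to be left out: the bound on their
  expected number is 1 on every level, with a divergent sum. The cost of a disc below the root has a
  factor \<open>p\<close>, compensated by a factor 1/p in the probability. At the root the cost
  depends on the multiplicities of the roots modulo \<open>p\<close>, whose sum has expectation at
  most 2.\<close>

lemma nn_integral_bind_spmf:
  "(\<integral>\<^sup>+ x. f x \<partial>measure_spmf (bind_spmf p g)) = (\<integral>\<^sup>+ y. (\<integral>\<^sup>+ x. f x \<partial>measure_spmf (g y)) \<partial>measure_spmf p)"
  unfolding measure_spmf_bind
  by (subst nn_integral_bind[where B = "count_space UNIV"])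
     (auto simp: space_subprob_algebra measure_spmf.subprob_space_axioms)

lemma nn_integral_return_spmf: "(\<integral>\<^sup>+ x. f x \<partial>measure_spmf (return_spmf y)) = f y"
  by (simp add: measure_spmf_return_spmf nn_integral_return)

lemma nn_integral_const_spmf_lossless:
  assumes "lossless_spmf p"
  shows "(\<integral>\<^sup>+ x. c \<partial>measure_spmf p) = c"
proof -
  have "emeasure (measure_spmf p) UNIV = 1"
    using lossless_weight_spmfD[OF assms] by (simp add: measure_spmf.emeasure_eq_measure weight_spmf_def)
  then show ?thesis by (simp add: space_measure_spmf)
qed

lemma nn_integral_const_spmf_le: "(\<integral>\<^sup>+ x. c \<partial>measure_spmf p) \<le> c"
  by (simp add: measure_spmf.emeasure_space_le_1 mult_left_le)

lemma nn_integral_spmf_mono: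
  "(\<And>x. x \<in> set_spmf p \<Longrightarrow> f x \<le> g x) \<Longrightarrow> (\<integral>\<^sup>+ x. f x \<partial>measure_spmf p) \<le> (\<integral>\<^sup>+ x. g x \<partial>measure_spmf p)"
  by (rule nn_integral_mono_AE) simp

lemma nn_integral_spmf_cong:
  "(\<And>x. x \<in> set_spmf p \<Longrightarrow> f x = g x) \<Longrightarrow> (\<integral>\<^sup>+ x. f x \<partial>measure_spmf p) = (\<integral>\<^sup>+ x. g x \<partial>measure_spmf p)"
  by (rule nn_integral_cong_AE) simp

text \<open>Ranks are extended reals, so expectations always exist. A loss of 1 per iteration in
  expectation makes the initial rank a bound for the expected number of iterations, which replaces a
  deterministic termination measure.\<close>

locale terminating_loop =
  fixes I b :: "'s \<Rightarrow> bool" and c :: "'s \<Rightarrow> 's spmf" and rank :: "'s \<Rightarrow> ennreal"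
  assumes invariant: "\<And>s t. I s \<Longrightarrow> b s \<Longrightarrow> t \<in> set_spmf (c s) \<Longrightarrow> I t"
    and lossless_body: "\<And>s. I s \<Longrightarrow> b s \<Longrightarrow> lossless_spmf (c s)"
    and rank_decreases: "\<And>s. I s \<Longrightarrow> b s \<Longrightarrow> (\<integral>\<^sup>+ t. rank t \<partial>measure_spmf (c s)) + 1 \<le> rank s"
begin

text \<open>Iterating the loop \<open>k\<close> times shows \<open>k * u s \<le> k * V s + M * rank s\<close>.\<close>

lemma subharmonic_le_superharmonic:
  fixes u V :: "'s \<Rightarrow> ennreal"
  assumes V: "\<And>s. I s \<Longrightarrow> b s \<Longrightarrow> (\<integral>\<^sup>+ t. V t \<partial>measure_spmf (c s)) \<le> V s"
    and u: "\<And>s. I s \<Longrightarrow> b s \<Longrightarrow> u s \<le> (\<integral>\<^sup>+ t. u t \<partial>measure_spmf (c s))"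
    and bound: "\<And>s. u s \<le> M" "M < \<infinity>"
    and final: "\<And>s. I s \<Longrightarrow> \<not> b s \<Longrightarrow> u s \<le> V s"
    and s: "I s" "rank s < \<infinity>"
  shows "u s \<le> V s"
proof -
  \<comment> \<open>One of the copies of \<open>u s\<close> is replaced by \<open>M\<close>, paid by
    the unit drop of \<open>rank\<close>; the others move on to the next state. In a final state all
    copies are bounded by \<open>V s\<close>.\<close>
  have *: "of_nat k * u s \<le> of_nat k * V s + M * rank s" if "I s" for k s
    using that
  proof (induction k arbitrary: s)
    case (Suc k)
    show ?case
    proof (cases "b s")
      case False
      then have "of_nat (Suc k) * u s \<le> of_nat (Suc k) * V s"
        using final Suc.prems by (intro mult_left_mono) auto
      then show ?thesis by (metis add_increasing2 zero_le)
    next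
      case True
      have "of_nat (Suc k) * u s = of_nat k * u s + u s" by (simp add: distrib_right add.commute)
      also have "\<dots> \<le> of_nat k * (\<integral>\<^sup>+ t. u t \<partial>measure_spmf (c s)) + M"
        by (intro add_mono mult_left_mono u Suc.prems True bound) auto
      also have "of_nat k * (\<integral>\<^sup>+ t. u t \<partial>measure_spmf (c s)) = (\<integral>\<^sup>+ t. of_nat k * u t \<partial>measure_spmf (c s))"
        by (simp add: nn_integral_cmult)
      also have "\<dots> \<le> (\<integral>\<^sup>+ t. of_nat k * V t + M * rank t \<partial>measure_spmf (c s))"
        by (intro nn_integral_spmf_mono Suc.IH) (use invariant Suc.prems True in auto)
      also have "\<dots> = of_nat k * (\<integral>\<^sup>+ t. V t \<partial>measure_spmf (c s)) + M * (\<integral>\<^sup>+ t. rank t \<partial>measure_spmf (c s))"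
        by (simp add: nn_integral_cmult nn_integral_add)
      also have "\<dots> + M \<le> of_nat k * V s + M * ((\<integral>\<^sup>+ t. rank t \<partial>measure_spmf (c s)) + 1)"
        using V[OF Suc.prems True] by (auto simp: distrib_left add.assoc intro!: add_mono mult_left_mono)
      also have "\<dots> \<le> of_nat (Suc k) * V s + M * rank s"
        using rank_decreases[OF Suc.prems True]
        by (intro add_mono mult_left_mono mult_right_mono) auto
      finally show ?thesis by simp
    qed
  qed simp
  show ?thesis
  proof (cases "V s = \<infinity>")
    case False
    have "M * rank s < \<infinity>"
      using bound(2) s(2) by (simp add: ennreal_mult_less_top)
    moreover have "u s < \<infinity>" using bound(1)[of s] bound(2) by (rule le_less_trans)
    ultimately obtain x y z where xyz: "u s = ennreal x" "V s = ennreal y" "M * rank s = ennreal z"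
      "0 \<le> x" "0 \<le> y" "0 \<le> z"
      using False by (cases "u s"; cases "V s"; cases "M * rank s") auto
    have "real k * x \<le> real k * y + z" for k
      using *[OF s(1), of k] xyz
      by (simp add: ennreal_of_nat_eq_real_of_nat flip: ennreal_mult ennreal_plus)
    \<comment> \<open>After division by \<open>k\<close> the error \<open>z / k\<close> tends to
      0.\<close>
    moreover have "x \<le> y" if "\<And>k. real k * x \<le> real k * y + z"
    proof (rule ccontr)
      assume "\<not> x \<le> y"
      then obtain k where "z / (x - y) < real k" using reals_Archimedean2 by blast
      with \<open>\<not> x \<le> y\<close> that[of k] show False by (simp add: field_simps)
    qed
    ultimately show ?thesis using xyz by (simp add: ennreal_leI)
  qed simp
qed

text \<open>The probability of not terminating equals its own expectation after one iteration and
  vanishes in final states, so it is dominated by the constant 0.\<close>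

lemma lossless_while:
  assumes "I s" "rank s < \<infinity>"
  shows "lossless_spmf (while_spmf b c s)"
proof -
  have "ennreal (pmf (while_spmf b c s) None) \<le> 0"
  proof (rule subharmonic_le_superharmonic[where u = "\<lambda>s. ennreal (pmf (while_spmf b c s) None)" and V = "\<lambda>_. 0" and M = 1])
    fix s assume s: "I s" "b s"
    have "pmf (while_spmf b c s) None = (\<integral>t. pmf (while_spmf b c t) None \<partial>measure_spmf (c s))"
      using lossless_body[OF s] s
      by (subst while_spmf.simps) (simp add: pmf_bind_spmf_None lossless_iff_pmf_None)
    also have "ennreal \<dots> = (\<integral>\<^sup>+ t. ennreal (pmf (while_spmf b c t) None) \<partial>measure_spmf (c s))"
      by (rule nn_integral_eq_integral[symmetric])
         (auto intro!: measure_spmf.integrable_const_bound[where B = 1] simp: pmf_le_1)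
    finally show "ennreal (pmf (while_spmf b c s) None)
       \<le> (\<integral>\<^sup>+ t. ennreal (pmf (while_spmf b c t) None) \<partial>measure_spmf (c s))" by simp
  next
    fix s assume "I s" "\<not> b s"
    then show "ennreal (pmf (while_spmf b c s) None) \<le> 0"
      by (subst while_spmf.simps) simp
  qed (use assms in \<open>auto simp: pmf_le_1\<close>)
  then show ?thesis by (simp add: lossless_iff_pmf_None)
qed

text \<open>The same argument, applied to the probability of leaving the loop in a state that
  violates the claim.\<close>

lemma set_while:
  assumes "I s" "rank s < \<infinity>" "t \<in> set_spmf (while_spmf b c s)"
  shows "I t \<and> \<not> b t"
proof -
  let ?u = "\<lambda>s. \<integral>\<^sup>+ t. indicator {t. \<not> (I t \<and> \<not> b t)} t \<partial>measure_spmf (while_spmf b c s)"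
  have "?u s \<le> 0"
  proof (rule subharmonic_le_superharmonic[where u = ?u and V = "\<lambda>_. 0" and M = 1])
    fix s assume "I s" "b s"
    then show "?u s \<le> (\<integral>\<^sup>+ t. ?u t \<partial>measure_spmf (c s))"
      by (subst while_spmf.simps) (simp add: nn_integral_bind_spmf del: nn_integral_indicator)
  next
    fix s assume "I s" "\<not> b s"
    then show "?u s \<le> 0"
      by (subst while_spmf.simps) (simp add: nn_integral_return_spmf del: nn_integral_indicator)
  next
    fix s show "?u s \<le> 1"
      by (simp add: measure_spmf.subprob_emeasure_le_1)
  qed (use assms in auto)
  then have "AE t in measure_spmf (while_spmf b c s). indicator {t. \<not> (I t \<and> \<not> b t)} t = (0::ennreal)"
    by (subst (asm) le_zero_eq) (subst (asm) nn_integral_0_iff_AE, auto)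
  then show ?thesis using assms(3) by (auto simp: indicator_def split: if_splits)
qed

text \<open>\<open>f\<close> is truncated at \<open>n\<close> to obtain a bounded function, and
  monotone convergence removes the truncation. A useful \<open>V\<close> adds a bound for the cost
  to come to the cost already incurred.\<close>

lemma nn_integral_while_le:
  fixes f :: "'s \<Rightarrow> nat" and V :: "'s \<Rightarrow> ennreal"
  assumes V: "\<And>s. I s \<Longrightarrow> b s \<Longrightarrow> (\<integral>\<^sup>+ t. V t \<partial>measure_spmf (c s)) \<le> V s"
    and final: "\<And>s. I s \<Longrightarrow> \<not> b s \<Longrightarrow> of_nat (f s) \<le> V s"
    and s: "I s" "rank s < \<infinity>"
  shows "(\<integral>\<^sup>+ t. of_nat (f t) \<partial>measure_spmf (while_spmf b c s)) \<le> V s"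
proof -
  let ?u = "\<lambda>n s. \<integral>\<^sup>+ t. of_nat (min (f t) n) \<partial>measure_spmf (while_spmf b c s)"
  have "?u n s \<le> V s" for n
  proof (rule subharmonic_le_superharmonic[where u = "?u n" and M = "of_nat n"])
    fix s assume "I s" "b s"
    then show "?u n s \<le> (\<integral>\<^sup>+ t. ?u n t \<partial>measure_spmf (c s))"
      by (subst while_spmf.simps) (simp add: nn_integral_bind_spmf)
  next
    fix s assume *: "I s" "\<not> b s"
    have "of_nat (min (f s) n) \<le> (of_nat (f s) :: ennreal)"
      by (rule of_nat_mono) simp
    also note final[OF *]
    finally show "?u n s \<le> V s"
      using * by (subst while_spmf.simps) (simp add: nn_integral_return_spmf)
  next
    fix s
    have "?u n s \<le> (\<integral>\<^sup>+ t. of_nat n \<partial>measure_spmf (while_spmf b c s))"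
      by (rule nn_integral_mono, rule of_nat_mono) simp
    also have "\<dots> \<le> of_nat n" by (rule nn_integral_const_spmf_le)
    finally show "?u n s \<le> of_nat n" .
  qed (use V s in \<open>auto simp: of_nat_less_top\<close>)
  moreover have "of_nat (f t) = (SUP n. of_nat (min (f t) n) :: ennreal)" for t
    by (rule antisym, rule SUP_upper2[of "f t"]) (auto intro!: SUP_least of_nat_mono)
  then have "(\<integral>\<^sup>+ t. of_nat (f t) \<partial>measure_spmf (while_spmf b c s)) = (SUP n. ?u n s)"
    by (simp only:) (rule nn_integral_monotone_convergence_SUP,
      auto simp: incseq_def le_fun_def intro!: of_nat_mono min.mono)
  ultimately show ?thesis by (simp add: SUP_least)
qed

end

section \<open>Polynomials modulo \<open>p\<close>\<close>

text \<open>Congruence modulo the ideal generated by \<open>c\<close> and \<open>d\<close>. With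
  \<open>c = [:p:]\<close> and \<open>d = M\<close> it is equality in F_p[T]/(M); with
  \<open>d = 0\<close> it is congruence of all coefficients; \<open>icong c d x 0\<close> says that
  \<open>d\<close> divides \<open>x\<close> modulo \<open>c\<close>.\<close>

definition icong :: "'a::comm_ring_1 \<Rightarrow> 'a \<Rightarrow> 'a \<Rightarrow> 'a \<Rightarrow> bool" where
  "icong c d x y \<longleftrightarrow> (\<exists>s t. x - y = c * s + d * t)"

lemma icongI: "x - y = c * s + d * t \<Longrightarrow> icong c d x y"
  by (auto simp: icong_def)

lemma icong_refl [simp]: "icong c d x x"
  by (rule icongI[of _ _ _ 0 _ 0]) simp

lemma icong_sym: "icong c d x y \<Longrightarrow> icong c d y x"
proof -
  assume "icong c d x y"
  then obtain s t where "x - y = c * s + d * t" by (auto simp: icong_def)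
  then have "y - x = c * (- s) + d * (- t)" by (simp add: algebra_simps)
  then show ?thesis by (rule icongI)
qed

lemma icong_trans [trans]: "icong c d x y \<Longrightarrow> icong c d y z \<Longrightarrow> icong c d x z"
proof -
  assume "icong c d x y" "icong c d y z"
  then obtain s t s' t' where "x - y = c * s + d * t" "y - z = c * s' + d * t'"
    by (auto simp: icong_def)
  then have "x - z = c * (s + s') + d * (t + t')" by (simp add: algebra_simps)
  then show ?thesis by (rule icongI)
qed

lemma icong_add: "icong c d x y \<Longrightarrow> icong c d x' y' \<Longrightarrow> icong c d (x + x') (y + y')"
proof -
  assume "icong c d x y" "icong c d x' y'"
  then obtain s t s' t' where "x - y = c * s + d * t" "x' - y' = c * s' + d * t'"
    by (auto simp: icong_def)
  then have "(x + x') - (y + y') = c * (s + s') + d * (t + t')" by (simp add: algebra_simps)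
  then show ?thesis by (rule icongI)
qed

lemma icong_mult: "icong c d x y \<Longrightarrow> icong c d x' y' \<Longrightarrow> icong c d (x * x') (y * y')"
proof -
  assume "icong c d x y" "icong c d x' y'"
  then obtain s t s' t' where *: "x - y = c * s + d * t" "x' - y' = c * s' + d * t'"
    by (auto simp: icong_def)
  have "x * x' - y * y' = x * (x' - y') + (x - y) * y'" by (simp add: algebra_simps)
  also have "\<dots> = c * (x * s' + s * y') + d * (x * t' + t * y')"
    unfolding * by (simp add: algebra_simps)
  finally show ?thesis by (rule icongI)
qed

lemma icong_uminus: "icong c d x y \<Longrightarrow> icong c d (- x) (- y)"
  using icong_mult[of c d "- 1" "- 1" x y] by simp

lemma icong_diff: "icong c d x y \<Longrightarrow> icong c d x' y' \<Longrightarrow> icong c d (x - x') (y - y')"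
  using icong_add[of c d x y "- x'" "- y'"] icong_uminus[of c d x' y'] by simp

lemma icong_diff_self: "icong c d (x - d * y) x"
  by (rule icongI[of _ _ _ 0 _ "- y"]) simp

text \<open>A divisor \<open>e\<close> of the modulus \<open>d\<close> generates a larger
  ideal.\<close>

lemma icong_dvd:
  assumes "icong c e d 0" "icong c d x y"
  shows "icong c e x y"
proof -
  obtain s t s' t' where *: "d - 0 = c * s + e * t" "x - y = c * s' + d * t'"
    using assms by (auto simp: icong_def)
  then have d: "d = c * s + e * t" by simp
  have "x - y = c * (s' + s * t') + e * (t * t')"
    unfolding *(2) by (subst d) (simp add: algebra_simps)
  then show ?thesis by (rule icongI)
qed

lemma poly_icong:
  fixes m :: int
  assumes "icong [:m:] M A B" "m dvd poly M a"
  shows "m dvd poly A a - poly B a"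
proof -
  obtain S T where "A - B = [:m:] * S + M * T" using assms(1) by (auto simp: icong_def)
  then have "poly (A - B) a = m * poly S a + poly M a * poly T a" by simp
  then show ?thesis using assms(2) by simp
qed

lemma poly_icong_iff:
  fixes m :: int
  assumes "icong [:m:] M A B" "m dvd poly M a"
  shows "m dvd poly A a \<longleftrightarrow> m dvd poly B a"
  using poly_icong[OF assms] by (metis diff_add_cancel dvd_add_right_iff)

lemma coeff_icong_0:
  fixes m :: int
  assumes "icong [:m:] 0 A B"
  shows "m dvd coeff A k - coeff B k"
proof -
  obtain S T where "A - B = [:m:] * S + 0 * T" using assms by (auto simp: icong_def)
  then have "coeff (A - B) k = m * coeff S k" by simp
  then show ?thesis by simp
qed

lemma icong_0_coeffI:
  fixes m :: int
  assumes "\<And>k. m dvd coeff A k - coeff B k"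
  shows "icong [:m:] M A B"
proof -
  have "[:m:] dvd A - B" using assms by (simp add: const_poly_dvd_iff)
  then obtain S where "A - B = [:m:] * S" by (rule dvdE)
  then have "A - B = [:m:] * S + M * 0" by simp
  then show ?thesis by (rule icongI)
qed

text \<open>A product with a monic \<open>B\<close> keeps the leading coefficient of the cofactor,
  in a degree too high for the remainder \<open>r\<close>.\<close>

lemma monic_remainder_unique:
  fixes m :: int
  assumes "m > 0" "lead_coeff B = 1" "icong [:m:] 0 (B * S) r" "r = 0 \<or> degree r < degree B"
  shows "icong [:m:] 0 S 0"
proof -
  \<comment> \<open>Reduced coefficients ensure that the leading coefficient of \<open>S'\<close>
    does not vanish modulo \<open>m\<close>, unless \<open>S'\<close> is zero.\<close>
  define S' where "S' = map_poly (\<lambda>c. c mod m) S"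
  have S': "coeff S' k = coeff S k mod m" for k
    by (simp add: S'_def coeff_map_poly)
  have "icong [:m:] 0 S' S"
    by (rule icong_0_coeffI) (simp add: S' mod_eq_dvd_iff[symmetric])
  moreover have "S' = 0"
  proof (rule ccontr)
    assume "S' \<noteq> 0"
    have "icong [:m:] 0 (B * S') r"
      using icong_mult[OF icong_refl \<open>icong [:m:] 0 S' S\<close>] assms(3) by (rule icong_trans)
    then have "m dvd coeff (B * S') (degree B + degree S') - coeff r (degree B + degree S')"
      by (rule coeff_icong_0)
    moreover have "coeff r (degree B + degree S') = 0"
      using assms(4) by (auto intro: coeff_eq_0)
    ultimately have "m dvd lead_coeff S'"
      using assms(2) by (simp add: coeff_mult_degree_sum)
    moreover have "lead_coeff S' = lead_coeff S' mod m" unfolding S' by simp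
    ultimately have "lead_coeff S' = 0" by (metis dvd_imp_mod_0)
    with \<open>S' \<noteq> 0\<close> show False by simp
  qed
  ultimately show ?thesis using icong_sym by blast
qed

text \<open>The congruence only provides some multiplier \<open>T\<close>. Exact division by the
  monic \<open>B\<close> provides a monic \<open>Q\<close>, and uniqueness of the remainder makes
  \<open>Q\<close> congruent to \<open>T\<close>. Being monic, \<open>Q\<close> is subject to the
  bound on the number of roots.\<close>

lemma monic_cofactor:
  fixes m :: int
  assumes "m > 0" "lead_coeff B = 1" "lead_coeff A = 1" "degree B \<le> degree A" "icong [:m:] B A 0"
  obtains Q where "lead_coeff Q = 1" "degree Q = degree A - degree B" "icong [:m:] 0 A (B * Q)"
proof -
  obtain Q r where qr: "pseudo_divmod A B = (Q, r)" by (cases "pseudo_divmod A B")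
  have B0: "B \<noteq> 0" using assms(2) by auto
  from pseudo_divmod[OF B0 qr] assms(2) have A: "A = B * Q + r" "r = 0 \<or> degree r < degree B"
    by auto
  have Q0: "Q \<noteq> 0" using A assms(3,4) by auto
  have deg: "degree (B * Q) = degree B + degree Q" using B0 Q0 by (rule degree_mult_eq)
  have r: "r = 0 \<or> degree r < degree (B * Q)" using A(2) deg by auto
  then have "degree A = degree (B * Q)" unfolding A(1)
    by (metis add.right_neutral degree_add_eq_left)
  moreover have "lead_coeff A = lead_coeff (B * Q)"
    using r unfolding A(1) by (metis add.right_neutral lead_coeff_add_le add.commute)
  ultimately have "lead_coeff Q = 1" "degree Q = degree A - degree B"
    using deg assms(2,3) by (auto simp: lead_coeff_mult coeff_mult_degree_sum)
  moreover obtain S T where "A - 0 = [:m:] * S + B * T" using assms(5) by (auto simp: icong_def)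
  then have "B * (Q - T) - (- r) = [:m:] * S + 0 * 0" using A(1) by (simp add: algebra_simps)
  then have "icong [:m:] 0 (B * (Q - T)) (- r)" by (rule icongI)
  from monic_remainder_unique[OF assms(1,2) this] A(2) have "icong [:m:] 0 (Q - T) 0" by auto
  then have "icong [:m:] 0 (B * (Q - T)) (B * 0)" by (rule icong_mult[OF icong_refl])
  then have "icong [:m:] 0 (B * T + B * (Q - T)) (B * T + B * 0)" by (rule icong_add[OF icong_refl])
  then have "icong [:m:] 0 (B * Q) (B * T)" by (simp add: algebra_simps)
  moreover have "icong [:m:] 0 A (B * T)"
    using \<open>A - 0 = _\<close> by (intro icongI[of _ _ _ S _ 0]) simp
  ultimately show ?thesis using that icong_sym icong_trans by metis
qed

section \<open>Roots modulo a prime\<close>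

definition roots_modulo :: "nat \<Rightarrow> int poly \<Rightarrow> int set" where
  "roots_modulo p P = {a \<in> {0..<int p}. int p dvd poly P a}"

lemma finite_roots_modulo [simp]: "finite (roots_modulo p P)"
  unfolding roots_modulo_def by (rule finite_subset[of _ "{0..<int p}"]) auto

lemma card_roots_modulo_le:
  assumes "prime p" "lead_coeff P = 1"
  shows "card (roots_modulo p P) \<le> degree P"
  using assms(2)
proof (induction "degree P" arbitrary: P)
  case 0
  then have "P = 1" by (metis degree_0_id one_pCons)
  then show ?case using assms(1) prime_gt_1_nat[of p] by (auto simp: roots_modulo_def)
next
  case (Suc n)
  show ?case
  proof (cases "roots_modulo p P = {}")
    case False
    then obtain a where a: "a \<in> roots_modulo p P" by auto
    define Q where "Q = synthetic_div P a"
    have P: "P = [:- a, 1:] * Q + [:poly P a:]" unfolding Q_def by (simp only: synthetic_div_correct')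
    have dQ: "degree Q = n" using Suc(2) by (simp add: Q_def degree_synthetic_div)
    have "coeff P (Suc n) = coeff Q n - a * coeff Q (Suc n)"
      by (subst P) (simp del: synthetic_div_correct')
    with dQ Suc.hyps(2) Suc.prems have "lead_coeff Q = 1" by (simp add: coeff_eq_0)
    with Suc.hyps(1)[of Q] dQ have "card (roots_modulo p Q) \<le> n" by simp
    moreover have "roots_modulo p P \<subseteq> insert a (roots_modulo p Q)"
    proof
      fix b assume b: "b \<in> roots_modulo p P"
      have "poly P b - poly P a = (b - a) * poly Q b"
        by (subst P) (simp add: algebra_simps)
      then have "int p dvd (b - a) * poly Q b"
        using a b by (metis (mono_tags) dvd_diff roots_modulo_def mem_Collect_eq)
      then have "int p dvd b - a \<or> int p dvd poly Q b"
        using assms(1) by (simp add: prime_dvd_mult_iff)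
      moreover have "b = a" if "int p dvd b - a"
        using that a b by (auto simp: roots_modulo_def mod_eq_dvd_iff[symmetric])
      ultimately show "b \<in> insert a (roots_modulo p Q)" using b by (auto simp: roots_modulo_def)
    qed
    then have "card (roots_modulo p P) \<le> card (insert a (roots_modulo p Q))"
      by (intro card_mono) simp_all
    then have "card (roots_modulo p P) \<le> Suc (card (roots_modulo p Q))"
      by (simp add: card_insert_if split: if_splits)
    ultimately show ?thesis using Suc(2) by simp
  qed simp
qed

lemma roots_modulo_icong:
  "icong [:int p:] 0 A B \<Longrightarrow> roots_modulo p A = roots_modulo p B"
  unfolding roots_modulo_def using poly_icong_iff[of "int p" 0 A B] by auto

lemma roots_modulo_mult:
  "prime p \<Longrightarrow> roots_modulo p (A * B) = roots_modulo p A \<union> roots_modulo p B"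
  by (auto simp: roots_modulo_def prime_dvd_mult_iff)

text \<open>The cofactor has at most as many roots as its degree, so a polynomial with the maximal
  number of roots leaves the maximal number to each monic divisor.\<close>

lemma split_factor:
  assumes "prime p" "lead_coeff B = 1" "lead_coeff A = 1" "degree B \<le> degree A"
    and "icong [:int p:] B A 0" "degree A \<le> card (roots_modulo p A)"
  shows "card (roots_modulo p B) = degree B"
proof -
  have "int p > 0" using assms(1) prime_gt_0_nat by simp
  from monic_cofactor[OF this assms(2-5)] obtain Q where
    Q: "lead_coeff Q = 1" "degree Q = degree A - degree B" "icong [:int p:] 0 A (B * Q)" by blast
  have "degree A \<le> card (roots_modulo p (B * Q))"
    using assms(6) roots_modulo_icong[OF Q(3)] by simp
  also have "\<dots> \<le> card (roots_modulo p B) + card (roots_modulo p Q)"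
    by (simp add: roots_modulo_mult assms(1) card_Un_le)
  also have "card (roots_modulo p Q) \<le> degree A - degree B"
    using card_roots_modulo_le[OF assms(1) Q(1)] Q(2) by simp
  finally show ?thesis using card_roots_modulo_le[OF assms(1,2)] assms(4) by linarith
qed

section \<open>Coefficient lists as integer polynomials\<close>

definition lpoly :: "int list \<Rightarrow> int poly" where
  "lpoly us = Poly (rev us)"

definition mpoly :: "int list \<Rightarrow> int poly" where
  "mpoly ms = lpoly (1 # ms)"

lemma lpoly_Nil [simp]: "lpoly [] = 0"
  by (simp add: lpoly_def)

lemma lpoly_snoc [simp]: "lpoly (us @ [c]) = pCons c (lpoly us)"
  by (simp add: lpoly_def)

lemma lpoly_append: "lpoly (us @ vs) = lpoly us * monom 1 (length vs) + lpoly vs"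
  by (simp add: lpoly_def Poly_append mult.commute add.commute)

lemma lpoly_Cons: "lpoly (u # us) = monom u (length us) + lpoly us"
  using lpoly_append[of "[u]" us] by (simp add: lpoly_def smult_monom)

lemma lpoly_0_Cons [simp]: "lpoly (0 # us) = lpoly us"
  by (simp add: lpoly_Cons)

lemma lpoly_replicate_0 [simp]: "lpoly (replicate n 0 @ us) = lpoly us"
  by (induction n) auto

lemma lpoly_dropWhile: "lpoly (dropWhile (\<lambda>u. u = 0) us) = lpoly us"
  by (induction us) auto

lemma coeff_lpoly_length: "length us \<le> k \<Longrightarrow> coeff (lpoly us) k = 0"
  by (simp add: lpoly_def nth_default_def)

lemma mpoly_eq: "mpoly ms = monom 1 (length ms) + lpoly ms"
  by (simp add: mpoly_def lpoly_Cons)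

lemma degree_mpoly [simp]: "degree (mpoly ms) = length ms"
  and lead_coeff_mpoly [simp]: "coeff (mpoly ms) (length ms) = 1"
proof -
  show *: "coeff (mpoly ms) (length ms) = 1"
    by (simp add: mpoly_eq coeff_lpoly_length)
  show "degree (mpoly ms) = length ms"
    using * by (intro antisym degree_le le_degree) (auto simp: mpoly_eq coeff_lpoly_length)
qed

lemma lpoly_mod: "icong [:m:] M (lpoly (map (\<lambda>x. x mod m) xs)) (lpoly xs)"
proof (induction xs)
  case (Cons x xs)
  have "icong [:m:] M (monom (x mod m) (length xs)) (monom x (length xs))"
    by (rule icong_0_coeffI) (simp add: mod_eq_dvd_iff[symmetric])
  from icong_add[OF this Cons] show ?case by (simp add: lpoly_Cons)
qed simp

section \<open>Value and cost of arithmetic modulo a monic polynomial\<close>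

lemmas counted_simps = bind_counted_def ret_def tick_def

lemma fst_map_counted: "fst (map_counted f xs) = map (\<lambda>x. fst (f x)) xs"
  by (induction xs) (simp_all add: counted_simps)

lemma snd_map_counted: "snd (map_counted f xs) = (\<Sum>x\<leftarrow>xs. snd (f x))"
  by (induction xs) (simp_all add: counted_simps)

lemma snd_add_scaled: "snd (add_scaled F xs t ys) = 2 * min (length xs) (length ys)"
  by (simp add: add_scaled_def snd_map_counted counted_simps case_prod_beta sum_list_triv)

lemma residue_ring_simps [simp]:
  "monoid.mult (residue_ring m) x y = (x * y) mod m"
  "ring.add (residue_ring m) x y = (x + y) mod m"
  "ring.zero (residue_ring m) = 0"
  "monoid.one (residue_ring m) = 1"
  "carrier (residue_ring m) = {0..m - 1}"
  by (simp_all add: residue_ring_def)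

lemma residue_ring_uminus:
  assumes "m > 1" "x \<in> {0..m - 1}"
  shows "a_inv (residue_ring m) x = (- x) mod m"
  using residues.res_neg_eq[OF residues.intro[OF assms(1)]] by simp

lemma residue_ring_minus:
  assumes "m > 1" "y \<in> {0..m - 1}"
  shows "a_minus (residue_ring m) x y = (x - y) mod m"
  by (simp add: a_minus_def residue_ring_uminus[OF assms] mod_simps)

lemma fst_add_scaled:
  "fst (add_scaled (residue_ring m) xs t ys) = map (\<lambda>z. z mod m) (map2 (\<lambda>x y. x + t * y) xs ys)"
  by (simp add: add_scaled_def fst_map_counted counted_simps case_prod_beta mod_simps)

lemma lpoly_map2:
  "length xs = length ys \<Longrightarrow> lpoly (map2 (\<lambda>x y. x + t * y) xs ys) = lpoly xs + smult t (lpoly ys)"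
  by (induction xs ys rule: list_induct2)
     (simp_all add: lpoly_Cons smult_add_right smult_monom add_monom[symmetric])

lemma lpoly_add_scaled:
  "length xs = length ys \<Longrightarrow>
   icong [:m:] M (lpoly (fst (add_scaled (residue_ring m) xs t ys))) (lpoly xs + smult t (lpoly ys))"
  using lpoly_mod[of m M "map2 (\<lambda>x y. x + t * y) xs ys"] by (simp add: fst_add_scaled lpoly_map2)

lemma set_map_mod: "m > 0 \<Longrightarrow> set (map (\<lambda>z. z mod m) xs) \<subseteq> {0..m - (1::int)}"
  by auto

lemma length_add_scaled: "length (fst (add_scaled F xs t ys)) = min (length xs) (length ys)"
  by (simp add: add_scaled_def length_map_counted)

lemma set_add_scaled:
  "m > 0 \<Longrightarrow> set (fst (add_scaled (residue_ring m) xs t ys)) \<subseteq> {0..m - 1}"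
  unfolding fst_add_scaled by (rule set_map_mod)

lemma snd_shift_in: "length us = length ms \<Longrightarrow> snd (shift_in F ms us c) \<le> 2 * length ms + 1"
  by (cases us) (auto simp: counted_simps snd_add_scaled)

lemma set_shift_in:
  "m > 0 \<Longrightarrow> set (fst (shift_in (residue_ring m) ms us c)) \<subseteq> {0..m - 1}"
  using set_add_scaled by (cases us) (auto simp: counted_simps)

lemma icong_smult_mod: "icong [:m::int:] M (smult (a mod m) P) (smult a P)"
  by (rule icong_0_coeffI)
     (metis coeff_smult dvd_mult2 left_diff_distrib mod_eq_dvd_iff mod_mod_trivial)

text \<open>The coefficient \<open>u\<close> that moves up to the degree of the modulus is cancelled
  by subtracting \<open>u\<close> times the modulus.\<close>

lemma lpoly_shift_in:
  assumes "m > 1" "length us = length ms" "set us \<subseteq> {0..m - 1}"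
  shows "icong [:m:] (mpoly ms) (lpoly (fst (shift_in (residue_ring m) ms us c))) (pCons c (lpoly us))"
proof (cases us)
  case Nil
  \<comment> \<open>For an empty list the modulus is 1, and any two polynomials are
    congruent.\<close>
  then have "mpoly ms = 1" using assms(2) by (simp add: mpoly_eq)
  then have "(x - y) = [:m:] * 0 + mpoly ms * (x - y)" for x y by simp
  then show ?thesis by (rule icongI)
next
  case (Cons u us')
  have "icong [:m:] (mpoly ms) (lpoly (fst (shift_in (residue_ring m) ms us c)))
     (lpoly (us' @ [c]) + smult ((- u) mod m) (lpoly ms))"
    using lpoly_add_scaled[of "us' @ [c]" ms m] assms Cons
    by (simp add: counted_simps residue_ring_uminus)
  also have "icong [:m:] (mpoly ms) \<dots> (lpoly (us' @ [c]) + smult (- u) (lpoly ms))"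
    by (intro icong_add icong_refl icong_smult_mod)
  also have "lpoly (us' @ [c]) + smult (- u) (lpoly ms) = pCons c (lpoly us) - mpoly ms * [:u:]"
  proof -
    have "pCons c (lpoly us) = lpoly (u # (us' @ [c]))" using Cons by (simp flip: lpoly_snoc)
    also have "\<dots> = monom u (length ms) + lpoly (us' @ [c])"
      using Cons assms(2) by (simp add: lpoly_Cons)
    finally show ?thesis by (simp add: mpoly_eq smult_add_right smult_monom)
  qed
  also have "icong [:m:] (mpoly ms) \<dots> (pCons c (lpoly us))"
    by (rule icong_diff_self)
  finally show ?thesis .
qed

lemma shift_in_all_correct:
  assumes "m > 1" "length us = length ms" "set us \<subseteq> {0..m - 1}"
  shows "icong [:m:] (mpoly ms) (lpoly (fst (shift_in_all (residue_ring m) ms us cs))) (lpoly (us @ cs))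
    \<and> set (fst (shift_in_all (residue_ring m) ms us cs)) \<subseteq> {0..m - 1}
    \<and> snd (shift_in_all (residue_ring m) ms us cs) \<le> length cs * (2 * length ms + 1)"
  using assms(2,3)
proof (induction cs arbitrary: us)
  case (Cons c cs)
  let ?vs = "fst (shift_in (residue_ring m) ms us c)"
  have len: "length ?vs = length ms" by (rule length_shift_in) fact
  have set: "set ?vs \<subseteq> {0..m - 1}" using assms(1) by (intro set_shift_in) simp
  note IH = Cons.IH[OF len set]
  have "icong [:m:] (mpoly ms) (lpoly (?vs @ cs)) (lpoly ((us @ [c]) @ cs))"
    unfolding lpoly_append[of _ cs] using lpoly_shift_in[OF assms(1) Cons.prems, of c]
    by (intro icong_add icong_mult icong_refl) simp
  with IH snd_shift_in[OF Cons.prems(1), of "residue_ring m" c] show ?case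
    by (auto simp: counted_simps intro: icong_trans)
qed (simp add: counted_simps)

lemma reduce_correct:
  assumes "m > 1" "set us \<subseteq> {0..m - 1}"
  shows "icong [:m:] (mpoly ms) (lpoly (fst (reduce (residue_ring m) ms us))) (lpoly us)"
    and "set (fst (reduce (residue_ring m) ms us)) \<subseteq> {0..m - 1}"
    and "snd (reduce (residue_ring m) ms us) \<le> (length us - length ms) * (2 * length ms + 1)"
proof -
  let ?vs = "replicate (length ms - length us) 0 @ us"
  have set: "set ?vs \<subseteq> {0..m - 1}" using assms by auto
  have 1: "length (take (length ms) ?vs) = length ms" by simp
  have 2: "set (take (length ms) ?vs) \<subseteq> {0..m - 1}" using set set_take_subset by fast
  note * = shift_in_all_correct[OF assms(1) 1 2, of "drop (length ms) ?vs"]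
  have "lpoly (take (length ms) ?vs @ drop (length ms) ?vs) = lpoly us"
    unfolding append_take_drop_id by simp
  then show "icong [:m:] (mpoly ms) (lpoly (fst (reduce (residue_ring m) ms us))) (lpoly us)"
    using * by (simp add: reduce_def Let_def)
  show "set (fst (reduce (residue_ring m) ms us)) \<subseteq> {0..m - 1}"
    using * by (simp add: reduce_def Let_def)
  have "length (drop (length ms) ?vs) = length us - length ms" by simp
  then show "snd (reduce (residue_ring m) ms us) \<le> (length us - length ms) * (2 * length ms + 1)"
    using * by (simp only: reduce_def Let_def residue_ring_simps)
qed

text \<open>Horner's scheme in \<open>T\<close>: the accumulator is shifted once per coefficient of
  \<open>us\<close>, which yields the factor \<open>monom 1 (length us)\<close>.\<close>

lemma mult_add_mod_correct:
  assumes "m > 1" "length acc = length ms" "set acc \<subseteq> {0..m - 1}" "length vs = length ms"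
  shows "icong [:m:] (mpoly ms) (lpoly (fst (mult_add_mod (residue_ring m) ms acc us vs)))
      (lpoly acc * monom 1 (length us) + lpoly us * lpoly vs)
    \<and> length (fst (mult_add_mod (residue_ring m) ms acc us vs)) = length ms
    \<and> set (fst (mult_add_mod (residue_ring m) ms acc us vs)) \<subseteq> {0..m - 1}
    \<and> snd (mult_add_mod (residue_ring m) ms acc us vs) \<le> length us * (4 * length ms + 1)"
  using assms(2,3)
proof (induction us arbitrary: acc)
  case Nil
  then show ?case by (simp add: counted_simps)
next
  case (Cons u us)
  define a where "a = fst (shift_in (residue_ring m) ms acc 0)"
  define b where "b = fst (add_scaled (residue_ring m) a u vs)"
  have a: "length a = length ms" "set a \<subseteq> {0..m - 1}"
    unfolding a_def using assms(1) Cons.prems by (simp_all add: length_shift_in set_shift_in)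
  have b: "length b = length ms" "set b \<subseteq> {0..m - 1}"
    unfolding b_def using assms(1,4) a by (simp_all add: length_add_scaled set_add_scaled)
  note IH = Cons.IH[OF b]
  have "icong [:m:] (mpoly ms) (lpoly b) (lpoly a + smult u (lpoly vs))"
    unfolding b_def using a assms(4) by (intro lpoly_add_scaled) simp
  also have "icong [:m:] (mpoly ms) \<dots> (pCons 0 (lpoly acc) + smult u (lpoly vs))"
    unfolding a_def by (intro icong_add icong_refl lpoly_shift_in assms(1) Cons.prems)
  finally have "icong [:m:] (mpoly ms) (lpoly b * monom 1 (length us) + lpoly us * lpoly vs)
    ((pCons 0 (lpoly acc) + smult u (lpoly vs)) * monom 1 (length us) + lpoly us * lpoly vs)"
    by (intro icong_add icong_mult icong_refl)
  also have "(pCons 0 (lpoly acc) + smult u (lpoly vs)) * monom 1 (length us) + lpoly us * lpoly vs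
    = lpoly acc * monom 1 (length (u # us)) + lpoly (u # us) * lpoly vs"
  proof -
    have 1: "pCons 0 (lpoly acc) = lpoly acc * monom 1 1"
      by (simp add: monom_altdef)
    have 2: "monom u (length us) = smult u (monom 1 (length us))" by (simp add: smult_monom)
    have 3: "monom (1::int) (length (u # us)) = monom 1 1 * monom 1 (length us)"
      by (simp add: mult_monom)
    show ?thesis unfolding lpoly_Cons 1 2 3 by (simp add: algebra_simps)
  qed
  finally have "icong [:m:] (mpoly ms) (lpoly b * monom 1 (length us) + lpoly us * lpoly vs)
    (lpoly acc * monom 1 (length (u # us)) + lpoly (u # us) * lpoly vs)" .
  moreover have "snd (shift_in (residue_ring m) ms acc 0) \<le> 2 * length ms + 1"
    by (rule snd_shift_in) fact
  moreover have "snd (add_scaled (residue_ring m) a u vs) = 2 * length ms"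
    using a assms(4) by (simp add: snd_add_scaled)
  ultimately show ?case using IH
    by (auto simp: counted_simps a_def[symmetric] b_def[symmetric] intro: icong_trans)
qed

lemma mult_mod_correct:
  assumes "m > 1" "length us = length ms" "length vs = length ms"
  shows "icong [:m:] (mpoly ms) (lpoly (fst (mult_mod (residue_ring m) ms us vs))) (lpoly us * lpoly vs)"
    and "length (fst (mult_mod (residue_ring m) ms us vs)) = length ms"
    and "set (fst (mult_mod (residue_ring m) ms us vs)) \<subseteq> {0..m - 1}"
    and "snd (mult_mod (residue_ring m) ms us vs) \<le> length ms * (4 * length ms + 1)"
proof -
  have "set (replicate (length ms) 0) \<subseteq> {0..m - 1}" using assms(1) by auto
  note * = mult_add_mod_correct[OF assms(1) length_replicate this assms(3), of us]
  have "lpoly (replicate (length ms) 0) = 0" using lpoly_replicate_0[of "length ms" "[]"] by simp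
  with * assms(2) show "icong [:m:] (mpoly ms) (lpoly (fst (mult_mod (residue_ring m) ms us vs))) (lpoly us * lpoly vs)"
    and "length (fst (mult_mod (residue_ring m) ms us vs)) = length ms"
    and "set (fst (mult_mod (residue_ring m) ms us vs)) \<subseteq> {0..m - 1}"
    and "snd (mult_mod (residue_ring m) ms us vs) \<le> length ms * (4 * length ms + 1)"
    by (simp_all add: mult_mod_def)
qed

text \<open>\<open>k\<close> bounds the number of binary digits of \<open>e\<close>; each digit
  costs one squaring and at most one further product.\<close>

lemma power_mod_correct:
  assumes "m > 1" "length us = length ms" "e < 2 ^ k"
  shows "icong [:m:] (mpoly ms) (lpoly (fst (power_mod (residue_ring m) ms us e))) (lpoly us ^ e)
    \<and> length (fst (power_mod (residue_ring m) ms us e)) = length ms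
    \<and> set (fst (power_mod (residue_ring m) ms us e)) \<subseteq> {0..m - 1}
    \<and> snd (power_mod (residue_ring m) ms us e) \<le> 1 + k * (2 * (length ms * (4 * length ms + 1)))"
  using assms(3)
proof (induction k arbitrary: e)
  case (Suc k)
  show ?case
  proof (cases "e = 0")
    case True
    \<comment> \<open>The list \<open>[1]\<close> needs a reduction step only if the modulus is the
      constant 1.\<close>
    have "snd (reduce (residue_ring m) ms [1]) \<le> (1 - length ms) * (2 * length ms + 1)"
      using reduce_correct(3)[of m "[1]" ms] assms(1) by simp
    also have "\<dots> \<le> 1" by (cases "length ms") auto
    finally show ?thesis using True reduce_correct(1,2)[of m "[1]" ms] assms(1)
      by (subst (1 2 3 4) power_mod.simps) (simp add: length_reduce lpoly_Cons one_pCons monom_0)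
  next
    case False
    have "e div 2 < 2 ^ k" using Suc.prems by simp
    note IH = Suc.IH[OF this]
    define v where "v = fst (power_mod (residue_ring m) ms us (e div 2))"
    define w where "w = fst (mult_mod (residue_ring m) ms v v)"
    have len: "length v = length ms" using IH by (simp add: v_def)
    note w = mult_mod_correct[OF assms(1) len len, folded w_def]
    note r = mult_mod_correct[OF assms(1) w(2) assms(2)]
    have "icong [:m:] (mpoly ms) (lpoly w) (lpoly us ^ (e div 2) * lpoly us ^ (e div 2))"
      using icong_trans[OF w(1)] IH icong_mult unfolding v_def by blast
    also have "lpoly us ^ (e div 2) * lpoly us ^ (e div 2) = lpoly us ^ (2 * (e div 2))"
      by (simp add: mult_2 power_add)
    finally have sq: "icong [:m:] (mpoly ms) (lpoly w) (lpoly us ^ (2 * (e div 2)))" .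
    show ?thesis
    proof (cases "even e")
      case True
      then show ?thesis using False IH w sq
        by (subst (1 2 3 4) power_mod.simps)
           (simp add: counted_simps v_def[symmetric] w_def[symmetric])
    next
      case odd: False
      have "icong [:m:] (mpoly ms) (lpoly (fst (mult_mod (residue_ring m) ms w us)))
        (lpoly us ^ (2 * (e div 2)) * lpoly us)"
        using icong_trans[OF r(1) icong_mult[OF sq icong_refl]] .
      also have "lpoly us ^ (2 * (e div 2)) * lpoly us = lpoly us ^ e"
        using odd by (metis odd_two_times_div_two_succ power_Suc2 Suc_eq_plus1)
      finally show ?thesis using False odd IH w r
        by (subst (1 2 3 4) power_mod.simps)
           (simp add: counted_simps v_def[symmetric] w_def[symmetric])
    qed
  qed
next
  case 0
  then have e: "e = 0" by simp
  have "snd (reduce (residue_ring m) ms [1]) \<le> (1 - length ms) * (2 * length ms + 1)"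
    using reduce_correct(3)[of m "[1]" ms] assms(1) by simp
  also have "\<dots> \<le> 1" by (cases "length ms") auto
  finally show ?case using e reduce_correct(1,2)[of m "[1]" ms] assms(1)
    by (subst (1 2 3 4) power_mod.simps) (simp add: length_reduce lpoly_Cons one_pCons monom_0)
qed

lemma lpoly_map_mult:
  "icong [:m:] M (lpoly (map (\<lambda>u. (u * c) mod m) us)) (smult c (lpoly us))"
proof -
  have "lpoly (map (\<lambda>u. u * c) us) = smult c (lpoly us)"
    by (induction us) (simp_all add: lpoly_Cons smult_add_right smult_monom mult.commute)
  then show ?thesis using lpoly_mod[of m M "map (\<lambda>u. u * c) us"] by (simp add: comp_def)
qed

lemma residue_ring_inverse:
  assumes "prime p" "c \<in> {0..int p - 1}" "c \<noteq> 0"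
  shows "inv\<^bsub>residue_ring (int p)\<^esub> c \<in> {0..int p - 1}"
    and "int p dvd c * inv\<^bsub>residue_ring (int p)\<^esub> c - 1"
proof -
  have p1: "int p > 1" using prime_gt_1_nat[OF assms(1)] by simp
  have "cring (residue_ring (int p))" by (rule residues.cring[OF residues.intro[OF p1]])
  then have R: "monoid (residue_ring (int p))" by (intro comm_monoid.axioms(1) cring.axioms(2))
  have "c \<in> Units (residue_ring (int p))"
    using assms by (simp add: residues_prime.res_prime_units_eq[OF residues_prime.intro])
  from monoid.Units_inv_closed[OF R this] monoid.Units_r_inv[OF R this]
  have i: "inv\<^bsub>residue_ring (int p)\<^esub> c \<in> {0..int p - 1}"
    "(c * inv\<^bsub>residue_ring (int p)\<^esub> c) mod int p = 1"
    by simp_all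
  from i(1) show "inv\<^bsub>residue_ring (int p)\<^esub> c \<in> {0..int p - 1}" .
  have "(1::int) mod int p = 1" using prime_gt_1_nat[OF assms(1)] by simp
  with i(2) show "int p dvd c * inv\<^bsub>residue_ring (int p)\<^esub> c - 1"
    by (simp only: mod_eq_dvd_iff[symmetric])
qed

text \<open>A greatest common divisor enters the analysis only through two facts: it divides both
  polynomials modulo \<open>p\<close>, and it vanishes at their common roots. Both pass through a
  division step, because the remainder is congruent to the dividend modulo the divisor.\<close>

lemma monic_gcd_correct:
  assumes "prime p" "set ms \<subseteq> {0..int p - 1}" "set us \<subseteq> {0..int p - 1}" "length us \<le> length ms"
  defines "F \<equiv> residue_ring (int p)"
  shows "set (fst (monic_gcd F ms us)) \<subseteq> {0..int p - 1}
    \<and> length (fst (monic_gcd F ms us)) \<le> length ms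
    \<and> icong [:int p:] (mpoly (fst (monic_gcd F ms us))) (mpoly ms) 0
    \<and> icong [:int p:] (mpoly (fst (monic_gcd F ms us))) (lpoly us) 0
    \<and> (\<forall>a. int p dvd poly (mpoly ms) a \<and> int p dvd poly (lpoly us) a \<longrightarrow>
          int p dvd poly (mpoly (fst (monic_gcd F ms us))) a)
    \<and> snd (monic_gcd F ms us) \<le> 6 * (length ms + 1)\<^sup>2"
  using assms(2-4)
proof (induction "length us" arbitrary: ms us rule: less_induct)
  case less
  let ?p = "int p"
  have p1: "int p > 1" using prime_gt_1_nat[OF assms(1)] by simp
  define vs where "vs = dropWhile (\<lambda>u. u = 0) us"
  have dw: "dropWhile (\<lambda>u. u = \<zero>\<^bsub>F\<^esub>) us = vs" by (simp add: vs_def F_def)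
  have vs: "lpoly vs = lpoly us" "length vs \<le> length us" "set vs \<subseteq> {0..?p - 1}"
    using less.prems(2) by (auto simp: vs_def lpoly_dropWhile length_dropWhile_le dest: set_dropWhileD)
  show ?case
  proof (cases vs)
    case Nil
    then have "monic_gcd F ms us = (ms, length us)"
      by (subst monic_gcd.simps) (simp only: dw bind_counted_def ret_def fst_conv snd_conv list.case add_0_right)
    moreover have "lpoly us = 0" using vs Nil by simp
    moreover have "icong [:int p:] (mpoly ms) (mpoly ms) 0"
      by (rule icongI[of _ _ _ 0 _ 1]) simp
    moreover have "length us \<le> 6 * (length ms + 1)\<^sup>2"
      using less.prems(3) by (simp add: power2_eq_square)
    ultimately show ?thesis using less.prems by simp
  next
    case (Cons c cs)
    have c: "c \<in> {0..?p - 1}" "c \<noteq> 0"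
      using vs(3) Cons hd_dropWhile[of "\<lambda>u. u = 0" us] by (auto simp: vs_def)
    define c' where "c' = inv\<^bsub>F\<^esub> c"
    have c': "c' \<in> {0..?p - 1}" "?p dvd c * c' - 1"
      unfolding c'_def F_def using residue_ring_inverse[OF assms(1) c] by auto
    define ds where "ds = map (\<lambda>u. (u * c') mod ?p) cs"
    define rs where "rs = fst (reduce F ds (1 # ms))"
    define r where "r = fst (monic_gcd F ds rs)"
    have ds: "length ds = length cs" "set ds \<subseteq> {0..?p - 1}"
      using p1 set_map_mod[of ?p "map (\<lambda>u. u * c') cs"] by (auto simp: ds_def)
    have set1: "set (1 # ms) \<subseteq> {0..?p - 1}" using less.prems(1) p1 by auto
    note red = reduce_correct[OF p1 set1, of ds, folded F_def]
    have rs: "length rs = length cs" "set rs \<subseteq> {0..?p - 1}"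
      using red(2) by (auto simp: rs_def length_reduce ds)
    have lt: "length cs < length us" using vs(2) Cons by simp
    note IH = less.hyps[OF _ ds(2) rs(2), folded r_def, unfolded rs(1) ds(1), OF lt order_refl]
    have unit: "icong [:?p:] M (smult (c * c') X) X" for M X
      by (rule icong_0_coeffI) (metis c'(2) coeff_smult dvd_mult2 left_diff_distrib mult_1)
    \<comment> \<open>Division by the leading coefficient \<open>c\<close> changes \<open>us\<close>
      by a unit modulo \<open>p\<close>, so divisibility and roots stay the same.\<close>
    have eq: "icong [:?p:] M (lpoly us) (smult c (mpoly ds))" for M
    proof -
      have "icong [:?p:] M (smult c (mpoly ds)) (smult c (monom 1 (length cs) + smult c' (lpoly cs)))"
        using icong_mult[of "[:?p:]" M "[:c:]" "[:c:]", OF icong_refl icong_add[OF icong_refl lpoly_map_mult]]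
        by (simp add: mpoly_eq ds_def)
      also have "smult c (monom 1 (length cs) + smult c' (lpoly cs)) = monom c (length cs) + smult (c * c') (lpoly cs)"
        by (simp add: smult_add_right smult_monom)
      also have "icong [:?p:] M \<dots> (monom c (length cs) + lpoly cs)"
        by (rule icong_add[OF icong_refl unit])
      also have "\<dots> = lpoly us" using vs(1) Cons by (simp add: lpoly_Cons)
      finally show ?thesis by (rule icong_sym)
    qed
    have eq': "icong [:?p:] M (mpoly ds) (smult c' (lpoly us))" for M
    proof -
      have "icong [:?p:] M (smult c' (lpoly us)) (smult c' (smult c (mpoly ds)))"
        using icong_mult[of "[:?p:]" M "[:c':]" "[:c':]", OF icong_refl eq] by (simp add: mult.commute)
      also have "smult c' (smult c (mpoly ds)) = smult (c * c') (mpoly ds)" by (simp add: mult.commute)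
      also have "icong [:?p:] M \<dots> (mpoly ds)" by (rule unit)
      finally show ?thesis by (rule icong_sym)
    qed
    have gcd: "monic_gcd F ms us = (r, length us + (1 + (length cs +
        (snd (reduce F ds (1 # ms)) + snd (monic_gcd F ds rs)))))"
    proof -
      have "map_counted (\<lambda>u. tick (u \<otimes>\<^bsub>F\<^esub> c')) cs = (ds, length cs)"
        by (rule prod_eqI)
           (simp_all add: fst_map_counted snd_map_counted counted_simps F_def ds_def sum_list_triv)
      moreover have "\<one>\<^bsub>F\<^esub> = 1" by (simp add: F_def)
      ultimately show ?thesis
        by (subst monic_gcd.simps)
           (simp only: dw Cons bind_counted_def tick_def fst_conv snd_conv list.case
             c'_def[symmetric] rs_def[symmetric] r_def[symmetric])
    qed
    have 1: "icong [:?p:] (mpoly r) (lpoly us) 0"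
    proof -
      have "icong [:?p:] (mpoly r) (lpoly us) ([:c:] * mpoly ds)" using eq by simp
      also have "icong [:?p:] (mpoly r) \<dots> ([:c:] * 0)" using IH by (intro icong_mult icong_refl) simp
      finally show ?thesis by simp
    qed
    have 2: "icong [:?p:] (mpoly r) (mpoly ms) 0"
    proof -
      have "icong [:?p:] (mpoly r) (lpoly rs) (mpoly ms)"
        unfolding rs_def mpoly_def[of ms] by (rule icong_dvd[OF _ red(1)]) (use IH in blast)
      moreover have "icong [:?p:] (mpoly r) (lpoly rs) 0" using IH by blast
      ultimately show ?thesis by (rule icong_trans[OF icong_sym])
    qed
    have 3: "?p dvd poly (mpoly r) a" if "?p dvd poly (mpoly ms) a" "?p dvd poly (lpoly us) a" for a
    proof -
      have d: "?p dvd poly (mpoly ds) a"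
        using poly_icong_iff[OF eq'[of 0], of a] that(2) by simp
      have "?p dvd poly (lpoly rs) a"
        using poly_icong_iff[OF red(1) d] that(1) unfolding rs_def mpoly_def by simp
      with d IH show ?thesis by simp
    qed
    have "length us + (1 + (length cs + (snd (reduce F ds (1 # ms)) + snd (monic_gcd F ds rs))))
      \<le> 6 * (length ms + 1)\<^sup>2"
    proof -
      \<comment> \<open>For \<open>j < n\<close> the cost \<open>(n + 1 - j) * (2 * j + 1)\<close>
        of the division and the linear terms are covered by the difference of the quadratic bounds
        for \<open>n\<close> and for \<open>j\<close>; with \<open>n = j + 1 + i\<close> this is a
        comparison of coefficients.\<close>
      define j n where "j = length cs" "n = length ms"
      have jn: "j < n" using lt less.prems(3) by (simp add: j_n_def)
      then obtain i where i: "n = j + 1 + i" by (metis add.commute less_imp_add_positive Suc_eq_plus1 less_iff_Suc_add add_Suc_right)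
      have "length us + (1 + (length cs + (snd (reduce F ds (1 # ms)) + snd (monic_gcd F ds rs))))
        \<le> n + (1 + (j + ((n + 1 - j) * (2 * j + 1) + 6 * (j + 1)\<^sup>2)))"
        using red(3) IH less.prems(3) ds by (auto simp: j_n_def intro!: add_mono)
      also have "\<dots> \<le> 6 * (n + 1)\<^sup>2"
        unfolding i by (simp add: power2_eq_square algebra_simps)
      finally show ?thesis by (simp add: j_n_def)
    qed
    with 1 2 3 IH lt less.prems(3) show ?thesis unfolding gcd by auto
  qed
qed

section \<open>Cantor-Zassenhaus\<close>

lemma icong_power: "icong c d x y \<Longrightarrow> icong c d (x ^ n) (y ^ n)"
  by (induction n) (auto intro: icong_mult)

text \<open>If \<open>B\<close> had the larger degree, \<open>A\<close> would be a remainder of a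
  multiple of \<open>B\<close>; the multiplier and then \<open>A\<close> itself would vanish modulo
  \<open>m\<close>, against the leading coefficient 1.\<close>

lemma monic_divisor_degree_le:
  fixes m :: int
  assumes "m > 1" "lead_coeff B = 1" "lead_coeff A = 1" "icong [:m:] B A 0"
  shows "degree B \<le> degree A"
proof (rule ccontr)
  assume *: "\<not> degree B \<le> degree A"
  obtain S T where ST: "A - 0 = [:m:] * S + B * T" using assms(4) by (auto simp: icong_def)
  then have "B * T - A = [:m:] * (- S) + 0 * 0" by (simp add: algebra_simps)
  then have "icong [:m:] 0 (B * T) A" by (rule icongI)
  from monic_remainder_unique[OF _ assms(2) this] * assms(1) have "icong [:m:] 0 T 0" by simp
  from icong_mult[OF icong_refl this, of B] have "icong [:m:] 0 (B * T) 0" by simp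
  from icong_trans[OF icong_sym[OF \<open>icong [:m:] 0 (B * T) A\<close>] this] have "icong [:m:] 0 A 0" .
  from coeff_icong_0[OF this, of "degree A"] assms(1,3) show False by simp
qed

text \<open>Products of distinct linear factors over F_p, characterized by their number of roots, so
  that no factorization has to be carried along.\<close>

definition split_list :: "nat \<Rightarrow> int list \<Rightarrow> bool" where
  "split_list p ms \<longleftrightarrow> set ms \<subseteq> {0..int p - 1} \<and> card (roots_modulo p (mpoly ms)) = length ms"

lemma roots_modulo_divisor:
  assumes "icong [:int p:] B A 0"
  shows "roots_modulo p B \<subseteq> roots_modulo p A"
  using poly_icong_iff[OF assms] by (auto simp: roots_modulo_def)

text \<open>\<open>U\<close> is a polynomial of high degree, such as a power, which the algorithm
  knows only through its residue \<open>us\<close> modulo \<open>ms\<close>. Divisors of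
  \<open>ms\<close> see no difference between the two.\<close>

lemma monic_gcd_roots:
  assumes "prime p" "set ms \<subseteq> {0..int p - 1}" "set us \<subseteq> {0..int p - 1}" "length us \<le> length ms"
    and "icong [:int p:] (mpoly ms) (lpoly us) U"
  defines "g \<equiv> fst (monic_gcd (residue_ring (int p)) ms us)"
  shows "roots_modulo p (mpoly g) = {a \<in> roots_modulo p (mpoly ms). int p dvd poly U a}"
    and "icong [:int p:] (mpoly g) U 0"
proof -
  note g = monic_gcd_correct[OF assms(1-4), folded g_def]
  have "icong [:int p:] (mpoly g) (lpoly us) U"
    by (rule icong_dvd[OF _ assms(5)]) (use g in blast)
  with g show U: "icong [:int p:] (mpoly g) U 0" by (meson icong_sym icong_trans)
  show "roots_modulo p (mpoly g) = {a \<in> roots_modulo p (mpoly ms). int p dvd poly U a}"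
    using g poly_icong_iff[OF assms(5)] roots_modulo_divisor[of p "mpoly g" "mpoly ms"]
      roots_modulo_divisor[OF U]
    by (auto simp: roots_modulo_def)
qed

lemma split_monic_gcd:
  assumes "prime p" "split_list p ms" "set us \<subseteq> {0..int p - 1}" "length us \<le> length ms"
    and "icong [:int p:] (mpoly ms) (lpoly us) U"
  defines "g \<equiv> fst (monic_gcd (residue_ring (int p)) ms us)"
  shows "split_list p g" "roots_modulo p (mpoly g) = {a \<in> roots_modulo p (mpoly ms). int p dvd poly U a}"
proof -
  have ms: "set ms \<subseteq> {0..int p - 1}" using assms(2) by (simp add: split_list_def)
  note g = monic_gcd_correct[OF assms(1) ms assms(3,4), folded g_def]
  show "roots_modulo p (mpoly g) = {a \<in> roots_modulo p (mpoly ms). int p dvd poly U a}"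
    unfolding g_def by (rule monic_gcd_roots) (use assms ms in auto)
  have "card (roots_modulo p (mpoly g)) = degree (mpoly g)"
    by (rule split_factor[OF assms(1), of _ "mpoly ms"])
       (use g assms(2) in \<open>auto simp: split_list_def\<close>)
  with g show "split_list p g" by (simp add: split_list_def)
qed

section \<open>Splitting by quadratic characters\<close>

lemma fermat_int:
  fixes a :: int
  assumes "prime p"
  shows "int p dvd a ^ p - a"
proof (cases "int p dvd a")
  case True
  then have "int p dvd a ^ p"
    using prime_gt_0_nat[OF assms] by (meson dvd_power dvd_trans)
  with True show ?thesis by simp
next
  case False
  define n where "n = nat (a mod int p)"
  have n: "[int n = a] (mod int p)"
    using prime_gt_0_nat[OF assms] by (simp add: n_def cong_def)
  then have "\<not> p dvd n" using False by (metis cong_dvd_iff int_dvd_int_iff)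
  from fermat_theorem[OF assms this] have "[int n ^ (p - 1) = 1] (mod int p)"
    by (metis cong_int_iff of_nat_1 of_nat_power)
  with cong_pow[OF n, of "p - 1"] have "[a ^ (p - 1) = 1] (mod int p)"
    using cong_sym cong_trans by blast
  then have "int p dvd a * (a ^ (p - 1) - 1)" by (simp add: cong_iff_dvd_diff)
  also have "a * (a ^ (p - 1) - 1) = a ^ p - a"
    using prime_gt_0_nat[OF assms] by (simp add: right_diff_distrib power_Suc[symmetric] del: power_Suc)
  finally show ?thesis .
qed

text \<open>The splitting step for a given \<open>r\<close>, detached from the random choice so that
  it can be averaged by counting lists.\<close>

definition cz_split :: "nat \<Rightarrow> int list \<Rightarrow> int list \<Rightarrow> int list list counted" where
  "cz_split p ms r =
    (let F = residue_ring (int p) in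
      do { w \<leftarrow> power_mod F ms r ((p - 1) div 2);
           minus \<leftarrow> tick (last w \<ominus>\<^bsub>F\<^esub> \<one>\<^bsub>F\<^esub>);
           plus \<leftarrow> tick (last w \<oplus>\<^bsub>F\<^esub> \<one>\<^bsub>F\<^esub>);
           m0 \<leftarrow> monic_gcd F ms r;
           m1 \<leftarrow> monic_gcd F ms (butlast w @ [minus]);
           m2 \<leftarrow> monic_gcd F ms (butlast w @ [plus]);
           ret [m0, m1, m2] })"

text \<open>The quadratic character of the value of \<open>r\<close> at \<open>a\<close>, with -1
  represented by \<open>p - 1\<close>.\<close>

definition power_class :: "nat \<Rightarrow> int list \<Rightarrow> int \<Rightarrow> int" where
  "power_class p r a = (poly (lpoly r) a) ^ ((p - 1) div 2) mod int p"

text \<open>With \<open>y = x ^ ((p - 1) div 2)\<close> one has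
  \<open>x ^ p - x = x * (y - 1) * (y + 1)\<close>; by Fermat's theorem \<open>p\<close> divides one
  of the factors.\<close>

lemma half_power_mod:
  fixes x :: int
  assumes "prime p" "p \<noteq> 2"
  shows "x ^ ((p - 1) div 2) mod int p \<in> {0, 1, int p - 1}"
proof -
  let ?y = "x ^ ((p - 1) div 2)"
  have odd: "odd p" "p > 2" using assms prime_odd_nat prime_ge_2_nat[of p] by force+
  then have p: "p = Suc (2 * ((p - 1) div 2))" by simp
  have "x ^ p = x ^ Suc ((p - 1) div 2 * 2)" by (subst p) (simp only: mult.commute)
  also have "\<dots> = x * ?y\<^sup>2" by (simp only: power_Suc power_mult)
  finally have "x ^ p - x = x * ((?y - 1) * (?y + 1))" by (simp add: algebra_simps power2_eq_square)
  then have "int p dvd x * ((?y - 1) * (?y + 1))" using fermat_int[OF assms(1), of x] by simp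
  then have "int p dvd x \<or> int p dvd ?y - 1 \<or> int p dvd ?y + 1"
    using assms(1) by (simp add: prime_dvd_mult_iff)
  moreover have "int p dvd ?y" if "int p dvd x"
    using odd that by (intro dvd_power_le[of _ _ 1, simplified] dvd_power_le) auto
  moreover have "?y mod int p = 1" if "int p dvd ?y - 1"
    using that odd by (simp add: mod_eq_dvd_iff[symmetric])
  moreover have "?y mod int p = int p - 1" if "int p dvd ?y + 1"
  proof -
    have "int p dvd ?y - (int p - 1)" using that by (simp add: diff_diff_eq2)
    then have "?y mod int p = (int p - 1) mod int p" by (simp only: mod_eq_dvd_iff)
    also have "\<dots> = int p - 1" by (rule mod_pos_pos_trivial) (use odd in auto)
    finally show ?thesis .
  qed
  ultimately show ?thesis by auto
qed

text \<open>At every root of \<open>ms\<close> the computed \<open>w\<close> agrees modulo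
  \<open>p\<close> with the power of \<open>r\<close>, so the gcds with \<open>r\<close>,
  \<open>w - 1\<close> and \<open>w + 1\<close> collect the roots of each character. The bound adds
  up the power, two operations on the constant coefficient and three gcds.\<close>

lemma cz_split_correct:
  assumes p: "prime p" "p \<noteq> 2" and ms: "split_list p ms" "length ms > 0"
    and r: "length r = length ms" "set r \<subseteq> {0..int p - 1}"
    and k: "p < 2 ^ k"
  obtains m0 m1 m2 where
    "fst (cz_split p ms r) = [m0, m1, m2]" "split_list p m0" "split_list p m1" "split_list p m2"
    "roots_modulo p (mpoly m0) = {a \<in> roots_modulo p (mpoly ms). power_class p r a = 0}"
    "roots_modulo p (mpoly m1) = {a \<in> roots_modulo p (mpoly ms). power_class p r a = 1}"
    "roots_modulo p (mpoly m2) = {a \<in> roots_modulo p (mpoly ms). power_class p r a = int p - 1}"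
    "snd (cz_split p ms r) \<le> 3 + k * (2 * (length ms * (4 * length ms + 1))) + 18 * (length ms + 1)\<^sup>2"
proof -
  let ?F = "residue_ring (int p)" and ?e = "(p - 1) div 2"
  have p2: "p > 2" using p prime_ge_2_nat[of p] by force
  then have p1: "int p > 1" and e: "?e < 2 ^ k" "?e > 0" using k by auto
  define w where "w = fst (power_mod ?F ms r ?e)"
  note pm = power_mod_correct[OF p1 r(1) e(1), folded w_def]
  have "w \<noteq> []" using pm ms(2) by auto
  then have w: "w = butlast w @ [last w]" by simp
  then have lw: "lpoly w = pCons (last w) (lpoly (butlast w))" by (metis lpoly_snoc)
  have wset: "set (butlast w) \<subseteq> {0..int p - 1}" using pm by (auto dest: in_set_butlastD)
  define u1 where "u1 = butlast w @ [(last w - 1) mod int p]"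
  define u2 where "u2 = butlast w @ [(last w + 1) mod int p]"
  have len: "length u1 \<le> length ms" "length u2 \<le> length ms"
    using pm ms(2) by (auto simp: u1_def u2_def)
  have set: "set u1 \<subseteq> {0..int p - 1}" "set u2 \<subseteq> {0..int p - 1}"
    using wset p1 by (auto simp: u1_def u2_def)
  have c: "icong [:int p:] (mpoly ms) (lpoly (butlast w @ [(last w + x) mod int p])) (lpoly r ^ ?e + [:x:])" for x
  proof -
    have "icong [:int p:] (mpoly ms) (pCons ((last w + x) mod int p) (lpoly (butlast w))) (pCons (last w + x) (lpoly (butlast w)))"
      by (rule icong_0_coeffI) (simp add: coeff_pCons mod_eq_dvd_iff[symmetric] split: nat.split)
    also have "pCons (last w + x) (lpoly (butlast w)) = lpoly w + [:x:]" by (simp add: lw)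
    also have "icong [:int p:] (mpoly ms) \<dots> (lpoly r ^ ?e + [:x:])"
      using pm by (intro icong_add icong_refl) blast
    finally show ?thesis by simp
  qed
  define m0 where "m0 = fst (monic_gcd ?F ms r)"
  define m1 where "m1 = fst (monic_gcd ?F ms u1)"
  define m2 where "m2 = fst (monic_gcd ?F ms u2)"
  have c1: "icong [:int p:] (mpoly ms) (lpoly u1) (lpoly r ^ ?e - 1)"
    using c[of "- 1"] by (simp add: u1_def one_pCons diff_conv_add_uminus[of "_ ^ _"] del: add_uminus_conv_diff) (simp add: u1_def)
  have c2: "icong [:int p:] (mpoly ms) (lpoly u2) (lpoly r ^ ?e + 1)"
    using c[of 1] by (simp add: u2_def one_pCons)
  note s0 = split_monic_gcd[OF p(1) ms(1) r(2) _ icong_refl, folded m0_def]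
  note s1 = split_monic_gcd[OF p(1) ms(1) set(1) len(1) c1, folded m1_def]
  note s2 = split_monic_gcd[OF p(1) ms(1) set(2) len(2) c2, folded m2_def]
  have minus: "last w \<ominus>\<^bsub>?F\<^esub> 1 = (last w - 1) mod int p"
    using residue_ring_minus[OF p1, of 1] p1 by simp
  have set_ms: "set ms \<subseteq> {0..int p - 1}" using ms(1) by (simp add: split_list_def)
  have split: "cz_split p ms r = ([m0, m1, m2], snd (power_mod ?F ms r ?e) + (1 + (1 +
      (snd (monic_gcd ?F ms r) + (snd (monic_gcd ?F ms u1) + snd (monic_gcd ?F ms u2))))))"
    by (simp only: cz_split_def Let_def bind_counted_def tick_def ret_def fst_conv snd_conv
      residue_ring_simps w_def[symmetric] minus u1_def[symmetric] u2_def[symmetric]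
      m0_def[symmetric] m1_def[symmetric] m2_def[symmetric] add_0_right)
  show thesis
  proof
    show "fst (cz_split p ms r) = [m0, m1, m2]" by (simp add: split)
    show "split_list p m0" "split_list p m1" "split_list p m2" using s0 s1 s2 r(1) by auto
    have "int p dvd poly (lpoly r) a \<longleftrightarrow> power_class p r a = 0" for a
      using p(1) e(2) by (simp add: power_class_def dvd_eq_mod_eq_0[symmetric] prime_dvd_power_iff)
    then show "roots_modulo p (mpoly m0) = {a \<in> roots_modulo p (mpoly ms). power_class p r a = 0}"
      using s0(2) r(1) by simp
    have "int p dvd poly (lpoly r ^ ?e - 1) a \<longleftrightarrow> power_class p r a = 1" for a
      using p1 by (simp add: power_class_def mod_eq_dvd_iff[symmetric])
    then show "roots_modulo p (mpoly m1) = {a \<in> roots_modulo p (mpoly ms). power_class p r a = 1}"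
      using s1(2) by simp
    have "int p dvd poly (lpoly r ^ ?e + 1) a \<longleftrightarrow> power_class p r a = int p - 1" for a
    proof -
      have "poly (lpoly r ^ ?e + 1) a = poly (lpoly r) a ^ ?e - (int p - 1) + int p" by simp
      then have "int p dvd poly (lpoly r ^ ?e + 1) a \<longleftrightarrow> int p dvd poly (lpoly r) a ^ ?e - (int p - 1)"
        by (simp only: dvd_add_left_iff[OF dvd_refl])
      also have "\<dots> \<longleftrightarrow> power_class p r a = (int p - 1) mod int p"
        by (simp only: power_class_def mod_eq_dvd_iff)
      also have "(int p - 1) mod int p = int p - 1" by (rule mod_pos_pos_trivial) (use p1 in auto)
      finally show ?thesis .
    qed
    then show "roots_modulo p (mpoly m2) = {a \<in> roots_modulo p (mpoly ms). power_class p r a = int p - 1}"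
      using s2(2) by simp
    have "snd (monic_gcd ?F ms us) \<le> 6 * (length ms + 1)\<^sup>2"
      if "set us \<subseteq> {0..int p - 1}" "length us \<le> length ms" for us
      using monic_gcd_correct[OF p(1) set_ms that] by blast
    note this[OF r(2)] this[OF set(1) len(1)] this[OF set(2) len(2)]
    then show "snd (cz_split p ms r) \<le> 3 + k * (2 * (length ms * (4 * length ms + 1))) + 18 * (length ms + 1)\<^sup>2"
      using pm r(1) by (simp add: split)
  qed
qed

lemma card_power_class:
  assumes "prime p" "p \<noteq> 2" "v \<in> {1, int p - 1}"
  shows "card {y \<in> {0..<int p}. y ^ ((p - 1) div 2) mod int p = v} \<le> (p - 1) div 2"
proof -
  let ?e = "(p - 1) div 2"
  have p2: "p > 2" using assms prime_ge_2_nat[of p] by force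
  then have e: "?e > 0" by auto
  have v: "v mod int p = v" by (rule mod_pos_pos_trivial) (use assms(3) p2 in auto)
  let ?P = "monom 1 ?e - [:v:] :: int poly"
  have deg: "degree ?P = ?e" using e
    by (intro antisym degree_le le_degree) (auto simp: coeff_pCons split: nat.split)
  have "lead_coeff ?P = 1" unfolding deg using e by (simp add: coeff_pCons split: nat.split)
  from card_roots_modulo_le[OF assms(1) this] deg
  have "card (roots_modulo p ?P) \<le> ?e" by simp
  moreover have "int p dvd x - v \<longleftrightarrow> x mod int p = v" for x
    using mod_eq_dvd_iff[of x "int p" v] v by simp
  then have "roots_modulo p ?P = {y \<in> {0..<int p}. y ^ ?e mod int p = v}"
    by (simp add: roots_modulo_def poly_monom)
  ultimately show ?thesis by simp
qed

text \<open>At most one residue has character 0, and at most \<open>e = (p - 1) div 2\<close>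
  residues each have 1 and -1. So at most \<open>1 + 2 * e ^ 2\<close> pairs agree, which is no more
  than half of \<open>p ^ 2 = (2 * e + 1) ^ 2\<close>.\<close>

lemma card_same_power_class:
  assumes "prime p" "p \<noteq> 2"
  shows "2 * card {(y, z). y \<in> {0..<int p} \<and> z \<in> {0..<int p} \<and>
     y ^ ((p - 1) div 2) mod int p = z ^ ((p - 1) div 2) mod int p} \<le> p\<^sup>2"
proof -
  let ?e = "(p - 1) div 2"
  define Y where "Y v = {y \<in> {0..<int p}. y ^ ?e mod int p = v}" for v
  have p2: "p > 2" "odd p" using assms prime_odd_nat prime_ge_2_nat[of p] by force+
  have fin: "finite (Y v)" for v
    unfolding Y_def by (rule finite_subset[of _ "{0..<int p}"]) auto
  have Y0dvd: "int p dvd y" if "y \<in> Y 0" for y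
    using that assms(1) p2(1) by (auto simp: Y_def prime_dvd_power_iff dvd_eq_mod_eq_0[symmetric])
  have "y = 0" if "y \<in> Y 0" for y
  proof (rule ccontr)
    assume "y \<noteq> 0"
    moreover have "0 \<le> y" "y < int p" using that by (simp_all add: Y_def)
    ultimately show False using zdvd_not_zless[of y "int p"] Y0dvd[OF that] by simp
  qed
  then have "Y 0 \<subseteq> {0}" by blast
  from card_mono[OF _ this] have Y0: "card (Y 0) \<le> 1" by simp
  have Y12: "card (Y 1) \<le> ?e" "card (Y (int p - 1)) \<le> ?e"
    unfolding Y_def by (rule card_power_class; use assms in simp)+
  have "{(y, z). y \<in> {0..<int p} \<and> z \<in> {0..<int p} \<and> y ^ ?e mod int p = z ^ ?e mod int p}
    \<subseteq> Y 0 \<times> Y 0 \<union> (Y 1 \<times> Y 1 \<union> Y (int p - 1) \<times> Y (int p - 1))"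
    using half_power_mod[OF assms] by (force simp: Y_def)
  then have "card {(y, z). y \<in> {0..<int p} \<and> z \<in> {0..<int p} \<and> y ^ ?e mod int p = z ^ ?e mod int p}
    \<le> card (Y 0 \<times> Y 0 \<union> (Y 1 \<times> Y 1 \<union> Y (int p - 1) \<times> Y (int p - 1)))"
    by (intro card_mono) (auto simp: fin)
  also have "\<dots> \<le> card (Y 0 \<times> Y 0) + (card (Y 1 \<times> Y 1) + card (Y (int p - 1) \<times> Y (int p - 1)))"
    by (meson card_Un_le order.trans add_left_mono)
  also have "\<dots> \<le> 1 * 1 + (?e * ?e + ?e * ?e)"
    unfolding card_cartesian_product using Y0 Y12 by (intro add_mono mult_mono) auto
  also have "2 * \<dots> \<le> p\<^sup>2"
  proof -
    obtain i where i: "p = 2 * i + 1" using p2(2) by (rule oddE)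
    then show ?thesis using p2(1) by (simp add: power2_eq_square)
  qed
  finally show ?thesis by simp
qed

abbreviation residue_lists :: "nat \<Rightarrow> nat \<Rightarrow> int list set" where
  "residue_lists p n \<equiv> {r. length r = n \<and> set r \<subseteq> {0..int p - 1}}"

lemma residue_lists: "finite (residue_lists p n)" "card (residue_lists p n) = p ^ n"
  using finite_lists_length_eq[of "{0..int p - 1}" n] card_lists_length_eq[of "{0..int p - 1}" n]
  by (simp_all add: conj_commute)

text \<open>The values at two distinct residues determine the last two coefficients.\<close>

lemma card_power_class_eq:
  assumes "prime p" "p \<noteq> 2" "n \<ge> 2" and ab: "a \<in> {0..<int p}" "b \<in> {0..<int p}" "a \<noteq> b"
  shows "2 * card {r \<in> residue_lists p n. power_class p r a = power_class p r b} \<le> p ^ n"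
proof -
  let ?e = "(p - 1) div 2"
  define Q where "Q = {(y, z). y \<in> {0..<int p} \<and> z \<in> {0..<int p} \<and> y ^ ?e mod int p = z ^ ?e mod int p}"
  define f where "f r = (take (n - 2) r, poly (lpoly r) a mod int p, poly (lpoly r) b mod int p)" for r
  have p0: "int p > 0" using prime_gt_0_nat[OF assms(1)] by simp
  have finQ: "finite Q" unfolding Q_def
    by (rule finite_subset[of _ "{0..<int p} \<times> {0..<int p}"]) auto
  have "card {r \<in> residue_lists p n. power_class p r a = power_class p r b}
      \<le> card (residue_lists p (n - 2) \<times> Q)"
  proof (rule card_inj_on_le[of f])
    show "inj_on f {r \<in> residue_lists p n. power_class p r a = power_class p r b}"
    proof (rule inj_onI)
      fix r r' assume r: "r \<in> {r \<in> residue_lists p n. power_class p r a = power_class p r b}"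
        and r': "r' \<in> {r \<in> residue_lists p n. power_class p r a = power_class p r b}"
        and eq: "f r = f r'"
      have ex: "\<exists>u v. r = take (n - 2) r @ [u, v]" if "length r = n" for r :: "int list"
      proof -
        have *: "\<exists>u v. zs = [u, v]" if "length zs = Suc (Suc 0)" for zs :: "int list"
          using that by (auto simp: length_Suc_conv)
        have "length (drop (n - 2) r) = Suc (Suc 0)" using that assms(3) by simp
        from *[OF this] obtain u v where "drop (n - 2) r = [u, v]" by blast
        then show ?thesis by (metis append_take_drop_id)
      qed
      define l where "l = take (n - 2) r"
      from ex r obtain u v where uv: "r = l @ [u, v]" unfolding l_def by blast
      have "take (n - 2) r' = l" using eq by (simp add: f_def l_def)
      moreover have "length r' = n" using r' by simp
      ultimately obtain u' v' where uv': "r' = l @ [u', v']" using ex[of r'] by auto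
      have val: "poly (lpoly (l @ [u, v])) x = (poly (lpoly l) x * x + u) * x + v" for u v x
        using lpoly_snoc[of "l @ [u]" v] by (simp add: algebra_simps)
      have dvd: "int p dvd (u - u') * x + (v - v')" if "x \<in> {a, b}" for x
      proof -
        have "poly (lpoly r) x mod int p = poly (lpoly r') x mod int p" using eq that by (auto simp: f_def)
        then have "int p dvd poly (lpoly r) x - poly (lpoly r') x" by (simp only: mod_eq_dvd_iff)
        then show ?thesis unfolding uv uv' val by (simp add: algebra_simps)
      qed
      \<comment> \<open>The difference of the two congruences eliminates the constant
        coefficients.\<close>
      have "int p dvd (u - u') * (a - b)"
        using dvd_diff[OF dvd[of a] dvd[of b]] by (simp add: algebra_simps)
      moreover have "\<not> int p dvd a - b"
        using ab by (auto simp: mod_eq_dvd_iff[symmetric])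
      ultimately have "int p dvd u - u'" using assms(1) by (simp add: prime_dvd_mult_iff)
      then have u: "u = u'" using r r' by (auto simp: uv uv' mod_eq_dvd_iff[symmetric])
      with dvd[of a] have "int p dvd v - v'" by simp
      then have "v = v'" using r r' by (auto simp: uv uv' mod_eq_dvd_iff[symmetric])
      with u show "r = r'" by (simp add: uv uv')
    qed
    show "f ` {r \<in> residue_lists p n. power_class p r a = power_class p r b} \<subseteq> residue_lists p (n - 2) \<times> Q"
      using assms(3) p0 by (auto simp: f_def Q_def power_class_def mod_simps dest: in_set_takeD)
    show "finite (residue_lists p (n - 2) \<times> Q)"
      using finQ residue_lists by (intro finite_cartesian_product)
  qed
  also have "\<dots> = p ^ (n - 2) * card Q" by (simp only: card_cartesian_product residue_lists)
  also have "2 * \<dots> \<le> p ^ (n - 2) * p\<^sup>2"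
    using card_same_power_class[OF assms(1,2)] by (simp add: Q_def)
  also have "\<dots> = p ^ n" using assms(3) by (simp only: power_add[symmetric] le_add_diff_inverse2)
  finally show ?thesis by simp
qed

text \<open>\<open>T ^ p - T\<close> vanishes at all \<open>p\<close> residues and hence splits
  completely. So does each of its monic divisors, among them the gcd with \<open>ms\<close>, which
  keeps every root of \<open>ms\<close>.\<close>

lemma distinct_root_factor:
  assumes p: "prime p" and ms: "set ms \<subseteq> {0..int p - 1}"
    and us: "set us \<subseteq> {0..int p - 1}" "length us \<le> length ms"
    and U: "icong [:int p:] (mpoly ms) (lpoly us) (monom 1 p - monom 1 1)"
  defines "g \<equiv> fst (monic_gcd (residue_ring (int p)) ms us)"
  shows "split_list p g" "roots_modulo p (mpoly g) = roots_modulo p (mpoly ms)" "length g \<le> length ms"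
proof -
  let ?X = "monom 1 p - monom 1 1 :: int poly"
  have p1: "p > 1" by (rule prime_gt_1_nat) fact
  note g = monic_gcd_correct[OF p ms us, folded g_def]
  have X: "int p dvd poly ?X a" for a using fermat_int[OF p] by (simp add: poly_monom)
  show "roots_modulo p (mpoly g) = roots_modulo p (mpoly ms)"
    unfolding g_def using monic_gcd_roots(1)[OF p ms us U] X by simp
  have deg: "degree ?X = p"
    using p1 by (intro antisym degree_le le_degree) auto
  then have lead: "lead_coeff ?X = 1" using p1 by simp
  have "roots_modulo p ?X = {0..<int p}" using X by (auto simp: roots_modulo_def)
  then have "degree ?X \<le> card (roots_modulo p ?X)" unfolding deg by simp
  moreover have dvd: "icong [:int p:] (mpoly g) ?X 0"
    unfolding g_def using monic_gcd_roots(2)[OF p ms us U] .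
  moreover have "degree (mpoly g) \<le> degree ?X"
    by (rule monic_divisor_degree_le[OF _ _ lead dvd]) (use p1 in auto)
  ultimately have "card (roots_modulo p (mpoly g)) = degree (mpoly g)"
    by (intro split_factor[OF p _ lead]) auto
  with g show "split_list p g" by (simp add: split_list_def)
  show "length g \<le> length ms" using g by blast
qed

section \<open>Expected progress of a splitting step\<close>

lemma cantor_zassenhaus_step_Cons:
  assumes "prime p" "split_list p ms"
  shows "cantor_zassenhaus_step p (ms # st, roots, ops) =
    (if length ms = 0 then return_spmf (st, roots, ops)
     else if length ms = 1 then return_spmf (st, (- hd ms) mod int p # roots, ops + 1)
     else bind_spmf (spmf_of_set (residue_lists p (length ms)))
       (\<lambda>r. return_spmf (fst (cz_split p ms r) @ st, roots, ops + length ms + snd (cz_split p ms r))))"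
proof -
  have "a_inv (residue_ring (int p)) (hd ms) = (- hd ms) mod int p" if "length ms = 1"
  proof (rule residue_ring_uminus)
    show "1 < int p" using prime_gt_1_nat[OF assms(1)] by simp
    have "hd ms \<in> set ms" using that by (cases ms) auto
    then show "hd ms \<in> {0..int p - 1}" using assms(2) by (auto simp: split_list_def)
  qed
  then show ?thesis
    by (simp add: cantor_zassenhaus_step_def Let_def cz_split_def
        case_prod_beta cong: if_cong)
qed

text \<open>The length of a split list is its number of roots, so these are statements about the
  partition of \<open>A\<close> into classes. The sum of squares counts the ordered pairs of roots
  that stay together.\<close>

lemma cz_split_lengths:
  assumes p: "prime p" "p \<noteq> 2" and ms: "split_list p ms" "length ms > 0"
    and r: "r \<in> residue_lists p (length ms)"
  defines "A \<equiv> roots_modulo p (mpoly ms)"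
  shows "\<forall>m \<in> set (fst (cz_split p ms r)). split_list p m"
    and "(\<Sum>m\<leftarrow>fst (cz_split p ms r). of_bool (a \<in> roots_modulo p (mpoly m))) = (of_bool (a \<in> A) :: nat)"
    and "length (fst (cz_split p ms r)) = 3"
    and "(\<Sum>m\<leftarrow>fst (cz_split p ms r). length m) = length ms"
    and "(\<Sum>m\<leftarrow>fst (cz_split p ms r). (length m)\<^sup>2) =
      (\<Sum>a\<in>A. \<Sum>b\<in>A. of_bool (power_class p r a = power_class p r b))"
proof -
  obtain k where k: "p < 2 ^ k" using less_exp by blast
  from r have r': "length r = length ms" "set r \<subseteq> {0..int p - 1}" by auto
  obtain m0 m1 m2 where m': "fst (cz_split p ms r) = [m0, m1, m2]"
    "split_list p m0" "split_list p m1" "split_list p m2"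
    "roots_modulo p (mpoly m0) = {a \<in> roots_modulo p (mpoly ms). power_class p r a = 0}"
    "roots_modulo p (mpoly m1) = {a \<in> roots_modulo p (mpoly ms). power_class p r a = 1}"
    "roots_modulo p (mpoly m2) = {a \<in> roots_modulo p (mpoly ms). power_class p r a = int p - 1}"
    by (rule cz_split_correct[OF p ms r' k]) (rule that, assumption+)
  note m = m'[folded A_def]
  have p2: "p > 2" using p prime_ge_2_nat[of p] by force
  have cls: "power_class p r a \<in> {0, 1, int p - 1}" for a
    unfolding power_class_def by (rule half_power_mod) fact+
  show "\<forall>m \<in> set (fst (cz_split p ms r)). split_list p m"
    and "length (fst (cz_split p ms r)) = 3"
    using m by auto
  have part: "of_bool (power_class p r a = 0) + of_bool (power_class p r a = 1)
      + of_bool (power_class p r a = int p - 1) = (1::nat)" for a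
    using cls[of a] p2 by auto
  show *: "(\<Sum>m\<leftarrow>fst (cz_split p ms r). of_bool (a \<in> roots_modulo p (mpoly m))) = (of_bool (a \<in> A) :: nat)" for a
    using part[of a] m(1,5-7) by (cases "a \<in> A") auto
  have fin: "finite A" by (simp add: A_def)
  have len: "length m0 = (\<Sum>a\<in>A. of_bool (power_class p r a = 0))"
    "length m1 = (\<Sum>a\<in>A. of_bool (power_class p r a = 1))"
    "length m2 = (\<Sum>a\<in>A. of_bool (power_class p r a = int p - 1))"
    using m fin by (simp_all add: split_list_def sum_of_bool_eq Int_def conj_commute)
  have "length ms = card A" using ms by (simp add: split_list_def A_def)
  also have "\<dots> = (\<Sum>a\<in>A. of_bool (power_class p r a = 0) + of_bool (power_class p r a = 1)
      + of_bool (power_class p r a = int p - 1))"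
    unfolding part by simp
  finally show "(\<Sum>m\<leftarrow>fst (cz_split p ms r). length m) = length ms"
    unfolding m(1) using len by (simp add: sum.distrib)
  have "(\<Sum>m\<leftarrow>fst (cz_split p ms r). (length m)\<^sup>2) = (length m0)\<^sup>2 + (length m1)\<^sup>2 + (length m2)\<^sup>2"
    using m(1) by simp
  also have "\<dots> = (\<Sum>a\<in>A. \<Sum>b\<in>A.
      of_bool (power_class p r a = 0) * of_bool (power_class p r b = 0)
    + of_bool (power_class p r a = 1) * of_bool (power_class p r b = 1)
    + of_bool (power_class p r a = int p - 1) * of_bool (power_class p r b = int p - 1))"
    unfolding len power2_eq_square sum_product sum.distrib ..
  also have "\<dots> = (\<Sum>a\<in>A. \<Sum>b\<in>A. of_bool (power_class p r a = power_class p r b))"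
  proof (intro sum.cong refl)
    fix a b
    show "of_bool (power_class p r a = 0) * of_bool (power_class p r b = 0)
      + of_bool (power_class p r a = 1) * of_bool (power_class p r b = 1)
      + of_bool (power_class p r a = int p - 1) * of_bool (power_class p r b = int p - 1)
      = (of_bool (power_class p r a = power_class p r b) :: nat)"
      using cls[of a] cls[of b] p2 by auto
  qed
  finally show "(\<Sum>m\<leftarrow>fst (cz_split p ms r). (length m)\<^sup>2) =
      (\<Sum>a\<in>A. \<Sum>b\<in>A. of_bool (power_class p r a = power_class p r b))" .
qed

text \<open>A pair of distinct roots stays together for at most half of all \<open>r\<close>, a
  diagonal pair for all of them; this gives \<open>n * (n - 1) / 2 + n\<close> times the number of
  lists.\<close>

lemma sum_cz_split_squares:
  assumes p: "prime p" "p \<noteq> 2" and ms: "split_list p ms" "length ms \<ge> 2"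
  defines "n \<equiv> length ms"
  shows "2 * (\<Sum>r\<in>residue_lists p n. \<Sum>m\<leftarrow>fst (cz_split p ms r). (length m)\<^sup>2) \<le> (n\<^sup>2 + n) * p ^ n"
proof -
  define A where "A = roots_modulo p (mpoly ms)"
  have pos: "length ms > 0" using ms(2) by linarith
  have A: "finite A" "card A = n" using ms by (simp_all add: A_def split_list_def n_def)
  have "(\<Sum>r\<in>residue_lists p n. \<Sum>m\<leftarrow>fst (cz_split p ms r). (length m)\<^sup>2)
    = (\<Sum>r\<in>residue_lists p n. \<Sum>a\<in>A. \<Sum>b\<in>A. of_bool (power_class p r a = power_class p r b))"
    unfolding A_def n_def by (intro sum.cong refl cz_split_lengths(5) p ms(1) pos)
  also have "\<dots> = (\<Sum>a\<in>A. \<Sum>b\<in>A. \<Sum>r\<in>residue_lists p n. of_bool (power_class p r a = power_class p r b))"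
    by (subst sum.swap, intro sum.cong refl, rule sum.swap)
  also have "\<dots> = (\<Sum>a\<in>A. \<Sum>b\<in>A. card {r \<in> residue_lists p n. power_class p r a = power_class p r b})"
    using residue_lists(1)[of n p] by (simp add: sum_of_bool_eq Int_def)
  also have "2 * \<dots> \<le> (\<Sum>a\<in>A. \<Sum>b\<in>A. p ^ n + of_bool (a = b) * p ^ n)"
    unfolding sum_distrib_left
  proof (intro sum_mono)
    fix a b assume ab: "a \<in> A" "b \<in> A"
    show "2 * card {r \<in> residue_lists p n. power_class p r a = power_class p r b} \<le> p ^ n + of_bool (a = b) * p ^ n"
    proof (cases "a = b")
      case True
      have "card {r \<in> residue_lists p n. power_class p r a = power_class p r b} = p ^ n"
        using True residue_lists(2)[of n p] by simp
      then show ?thesis using True by simp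
    next
      case False
      then show ?thesis
        using card_power_class_eq[OF p, of n a b] ab ms(2) by (simp add: A_def n_def roots_modulo_def)
    qed
  qed
  also have "\<dots> = (n\<^sup>2 + n) * p ^ n"
    using A by (simp add: sum.distrib power2_eq_square algebra_simps flip: sum_distrib_right)
  finally show ?thesis .
qed

lemma cz_split_cost:
  assumes p: "prime p" "p \<noteq> 2" and ms: "split_list p ms" "length ms \<ge> 2"
    and r: "r \<in> residue_lists p (length ms)" and k: "p < 2 ^ k"
  shows "real (length ms + snd (cz_split p ms r)) \<le> 104 * real k * ((real (length ms))\<^sup>2 - real (length ms))"
proof -
  from r have r': "length r = length ms" "set r \<subseteq> {0..int p - 1}" by auto
  have "length ms > 0" using ms(2) by linarith
  from cz_split_correct[OF p ms(1) this r' k]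
  have "length ms + snd (cz_split p ms r)
     \<le> length ms + 3 + k * (2 * (length ms * (4 * length ms + 1))) + 18 * (length ms + 1)\<^sup>2"
    by (metis (no_types, lifting) add.assoc add_left_mono)
  also obtain i where i: "length ms = i + 2" using ms(2) by (metis le_add_diff_inverse2)
  obtain j where j: "k = Suc j" using k prime_gt_0_nat[OF p(1)] by (cases k) auto
  \<comment> \<open>The constant 104 is dictated by the case \<open>i = j = 0\<close>, where the two
    sides are 203 and 208; the other coefficients compare with room to spare.\<close>
  have "length ms + 3 + k * (2 * (length ms * (4 * length ms + 1))) + 18 * (length ms + 1)\<^sup>2
    \<le> 104 * k * ((i + 2) * (i + 1))"
    unfolding i j by (simp add: power2_eq_square algebra_simps)
  finally have "length ms + snd (cz_split p ms r) \<le> 104 * k * ((i + 2) * (i + 1))" .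
  then have "real (length ms + snd (cz_split p ms r)) \<le> real (104 * k * ((i + 2) * (i + 1)))"
    by (rule of_nat_mono)
  also have "\<dots> = 104 * real k * ((real (length ms))\<^sup>2 - real (length ms))"
    unfolding i by (simp add: power2_eq_square algebra_simps)
  finally show ?thesis .
qed

lemma nn_integral_spmf_of_set_le:
  assumes "finite A" "A \<noteq> {}" "\<And>x. x \<in> A \<Longrightarrow> 0 \<le> f x" "(\<Sum>x\<in>A. f x) \<le> c * real (card A)"
  shows "(\<integral>\<^sup>+ x. ennreal (f x) \<partial>measure_spmf (spmf_of_set A)) \<le> ennreal c"
proof -
  have c: "real (card A) > 0" using assms by (simp add: card_gt_0_iff)
  have "(\<integral>\<^sup>+ x. ennreal (f x) \<partial>measure_spmf (spmf_of_set A)) = ennreal ((\<Sum>x\<in>A. f x) / real (card A))"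
    using assms(3) c
    by (simp add: nn_integral_spmf_of_set sum_nonneg ennreal_of_nat_eq_real_of_nat divide_ennreal)
  also have "\<dots> \<le> ennreal c"
    using c assms(4) by (intro ennreal_leI) (simp add: field_simps)
  finally show ?thesis .
qed

text \<open>Every root of the original polynomial is either found or pending, exactly once. Counting
  occurrences makes the final list of roots free of repetitions.\<close>

definition cz_inv :: "nat \<Rightarrow> int set \<Rightarrow> int list list \<times> int list \<times> nat \<Rightarrow> bool" where
  "cz_inv p R = (\<lambda>(stack, roots, ops). (\<forall>ms \<in> set stack. split_list p ms) \<and>
     (\<forall>a. (\<Sum>ms\<leftarrow>stack. of_bool (a \<in> roots_modulo p (mpoly ms))) + count_list roots a = (of_bool (a \<in> R) :: nat)))"

text \<open>A splitting step halves \<open>n\<^sup>2 - n\<close>, summed over the stack, in expectation.\<close>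

definition cz_pairs :: "int list \<Rightarrow> real" where
  "cz_pairs ms = (real (length ms))\<^sup>2 - real (length ms)"

lemma cz_pairs_nonneg: "0 \<le> cz_pairs ms"
  unfolding cz_pairs_def power2_eq_square by (cases "length ms") auto

text \<open>The summand 1 pays for removing an entry without pairs. A split adds two entries and
  halves in expectation an amount \<open>8 * cz_pairs ms\<close> of at least 16, which leaves room
  for the required loss of 1.\<close>

definition cz_rank :: "int list list \<times> int list \<times> nat \<Rightarrow> ennreal" where
  "cz_rank = (\<lambda>(stack, roots, ops). ennreal (\<Sum>ms\<leftarrow>stack. 8 * cz_pairs ms + 1))"

text \<open>208 is twice the 104 of \<open>cz_split_cost\<close>: a split releases half of the
  potential of an entry and is paid by it. The summand \<open>length ms\<close>, preserved in total
  by splits, pays one operation per linear factor.\<close>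

definition cz_potential :: "nat \<Rightarrow> int list list \<times> int list \<times> nat \<Rightarrow> ennreal" where
  "cz_potential k = (\<lambda>(stack, roots, ops).
     ennreal (real ops + (\<Sum>ms\<leftarrow>stack. 208 * real k * cz_pairs ms + real (length ms))))"

lemma sum_cz_pairs:
  assumes p: "prime p" "p \<noteq> 2" and ms: "split_list p ms" "length ms \<ge> 2"
  shows "(\<Sum>r\<in>residue_lists p (length ms). \<Sum>m\<leftarrow>fst (cz_split p ms r). cz_pairs m)
    \<le> cz_pairs ms / 2 * real (card (residue_lists p (length ms)))"
proof -
  let ?L = "residue_lists p (length ms)" and ?n = "length ms"
  have pos: "length ms > 0" using ms(2) by linarith
  have 1: "(\<Sum>m\<leftarrow>fst (cz_split p ms r). cz_pairs m)
      = real (\<Sum>m\<leftarrow>fst (cz_split p ms r). (length m)\<^sup>2) - real ?n" if "r \<in> ?L" for r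
  proof -
    have "real (\<Sum>m\<leftarrow>xs. (length m)\<^sup>2) - real (\<Sum>m\<leftarrow>xs. length m) = (\<Sum>m\<leftarrow>xs. cz_pairs m)" for xs
      by (induction xs) (simp_all add: cz_pairs_def)
    from this[of "fst (cz_split p ms r)"] show ?thesis
      using cz_split_lengths(4)[OF p ms(1) pos that] by simp
  qed
  have "(\<Sum>r\<in>?L. \<Sum>m\<leftarrow>fst (cz_split p ms r). cz_pairs m)
    = real (\<Sum>r\<in>?L. \<Sum>m\<leftarrow>fst (cz_split p ms r). (length m)\<^sup>2) - real ?n * real (card ?L)"
    using 1 by (simp add: sum_subtractf)
  moreover have "2 * real (\<Sum>r\<in>?L. \<Sum>m\<leftarrow>fst (cz_split p ms r). (length m)\<^sup>2) \<le> ((real ?n)\<^sup>2 + real ?n) * real (card ?L)"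
    using of_nat_mono[OF sum_cz_split_squares[OF p ms], where 'a = real] residue_lists(2)[of ?n p] by simp
  ultimately show ?thesis by (simp add: cz_pairs_def algebra_simps)
qed

text \<open>Entries of length 0 or 1 are removed at once. For the others the total length and the
  number of new entries are fixed, so both claims reduce to the average of \<open>cz_pairs\<close>
  over the choices of \<open>r\<close>.\<close>

lemma cz_loop:
  assumes p: "prime p" "p \<noteq> 2" and k: "p < 2 ^ k"
  shows "terminating_loop (cz_inv p R) (\<lambda>(stack, _, _). stack \<noteq> []) (cantor_zassenhaus_step p) cz_rank"
    and "cz_inv p R s \<Longrightarrow> fst s \<noteq> [] \<Longrightarrow>
      (\<integral>\<^sup>+ t. cz_potential k t \<partial>measure_spmf (cantor_zassenhaus_step p s)) \<le> cz_potential k s"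
proof -
  have p2: "p > 2" using p prime_ge_2_nat[of p] by force
  have fin: "finite (residue_lists p n)" "residue_lists p n \<noteq> {}" for n
  proof -
    have "card (residue_lists p n) > 0" unfolding residue_lists(2) using p2 by simp
    then show "finite (residue_lists p n)" "residue_lists p n \<noteq> {}"
      using residue_lists(1)[of n p] by (auto simp only: card_gt_0_iff)
  qed
  show "(\<integral>\<^sup>+ t. cz_potential k t \<partial>measure_spmf (cantor_zassenhaus_step p s)) \<le> cz_potential k s"
    if inv: "cz_inv p R s" and ne: "fst s \<noteq> []" for s
  proof -
    obtain ms st roots ops where s: "s = (ms # st, roots, ops)"
      using ne by (cases s) (auto simp: neq_Nil_conv)
    have ms: "split_list p ms" using inv by (auto simp: s cz_inv_def)
    show ?thesis
    proof (cases "length ms \<ge> 2")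
      case False
      have nonneg: "208 * real k * cz_pairs ms \<ge> 0" using cz_pairs_nonneg by simp
      from False consider "length ms = 0" | "length ms = 1" by linarith
      then show ?thesis using nonneg unfolding s cantor_zassenhaus_step_Cons[OF p(1) ms]
        by cases (auto simp: nn_integral_return_spmf cz_potential_def intro!: ennreal_leI)
    next
      case True
      let ?n = "length ms" and ?L = "residue_lists p (length ms)"
      have pos: "length ms > 0" using True by linarith
      define rest where "rest = (\<Sum>ms\<leftarrow>st. 208 * real k * cz_pairs ms + real (length ms))"
      define f where "f r = real (ops + ?n + snd (cz_split p ms r)) +
        ((\<Sum>m\<leftarrow>fst (cz_split p ms r). 208 * real k * cz_pairs m + real (length m)) + rest)" for r
      have rest: "0 \<le> rest" unfolding rest_def
        by (intro sum_list_nonneg) (auto intro!: add_nonneg_nonneg mult_nonneg_nonneg cz_pairs_nonneg)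
      have "f r \<le> (real ops + 104 * real k * cz_pairs ms + real ?n + rest)
          + 208 * real k * (\<Sum>m\<leftarrow>fst (cz_split p ms r). cz_pairs m)" if "r \<in> ?L" for r
      proof -
        have "(\<Sum>m\<leftarrow>xs. 208 * real k * cz_pairs m + real (length m))
          = 208 * real k * (\<Sum>m\<leftarrow>xs. cz_pairs m) + real (\<Sum>m\<leftarrow>xs. length m)" for xs
          by (induction xs) (simp_all add: algebra_simps)
        from this[of "fst (cz_split p ms r)"] show ?thesis
          using cz_split_lengths(4)[OF p ms pos that] cz_split_cost[OF p ms True that k]
          by (simp add: f_def cz_pairs_def)
      qed
      then have "(\<Sum>r\<in>?L. f r) \<le> (\<Sum>r\<in>?L. (real ops + 104 * real k * cz_pairs ms + real ?n + rest)
          + 208 * real k * (\<Sum>m\<leftarrow>fst (cz_split p ms r). cz_pairs m))"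
        by (rule sum_mono)
      also have "\<dots> = (real ops + 104 * real k * cz_pairs ms + real ?n + rest) * real (card ?L)
          + 208 * real k * (\<Sum>r\<in>?L. \<Sum>m\<leftarrow>fst (cz_split p ms r). cz_pairs m)"
        by (simp add: sum.distrib sum_distrib_left)
      also have "\<dots> \<le> (real ops + 104 * real k * cz_pairs ms + real ?n + rest) * real (card ?L)
          + 208 * real k * (cz_pairs ms / 2 * real (card ?L))"
        by (intro add_left_mono mult_left_mono sum_cz_pairs p ms True) auto
      also have "\<dots> = (real ops + (208 * real k * cz_pairs ms + real ?n + rest)) * real (card ?L)"
        by (simp add: algebra_simps)
      finally have "(\<integral>\<^sup>+ r. ennreal (f r) \<partial>measure_spmf (spmf_of_set ?L))
          \<le> ennreal (real ops + (208 * real k * cz_pairs ms + real ?n + rest))"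
        by (intro nn_integral_spmf_of_set_le fin)
           (auto simp: f_def intro!: add_nonneg_nonneg sum_list_nonneg mult_nonneg_nonneg cz_pairs_nonneg rest)
      then show ?thesis
        using True unfolding s cantor_zassenhaus_step_Cons[OF p(1) ms]
        by (auto simp: nn_integral_bind_spmf nn_integral_return_spmf cz_potential_def f_def rest_def)
    qed
  qed
  show "terminating_loop (cz_inv p R) (\<lambda>(stack, _, _). stack \<noteq> []) (cantor_zassenhaus_step p) cz_rank"
  proof
    fix s t :: "int list list \<times> int list \<times> nat"
    assume inv: "cz_inv p R s" and ne: "case s of (stack, _, _) \<Rightarrow> stack \<noteq> []"
    obtain ms st roots ops where s: "s = (ms # st, roots, ops)"
      using ne by (cases s) (auto simp: neq_Nil_conv)
    have ms: "split_list p ms" using inv by (auto simp: s cz_inv_def)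
    show "lossless_spmf (cantor_zassenhaus_step p s)"
      using fin[of "length ms"] unfolding s cantor_zassenhaus_step_Cons[OF p(1) ms] by auto
    show "cz_inv p R t" if t: "t \<in> set_spmf (cantor_zassenhaus_step p s)"
    proof -
      consider "length ms = 0" | "length ms = 1" | "length ms \<ge> 2" by linarith
      then show ?thesis
      proof cases
        case 1
        then have "t = (st, roots, ops)" "mpoly ms = 1"
          using t unfolding s cantor_zassenhaus_step_Cons[OF p(1) ms] by (auto simp: mpoly_eq)
        moreover have "roots_modulo p 1 = {}" using p2 by (auto simp: roots_modulo_def)
        ultimately show ?thesis using inv by (simp add: s cz_inv_def)
      next
        case 2
        then obtain c where c: "ms = [c]" by (auto simp: length_Suc_conv)
        have t: "t = (st, (- c) mod int p # roots, ops + 1)"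
          using t 2 unfolding s cantor_zassenhaus_step_Cons[OF p(1) ms] by (auto simp: c)
        have "int p dvd a + c \<longleftrightarrow> a = (- c) mod int p" if "a \<in> {0..<int p}" for a
        proof -
          have "int p dvd a + c \<longleftrightarrow> a mod int p = (- c) mod int p" by (simp add: mod_eq_dvd_iff)
          then show ?thesis using that by simp
        qed
        moreover have "(- c) mod int p \<in> {0..<int p}" using p2 by simp
        moreover have "poly (mpoly ms) a = a + c" for a
          by (simp add: c mpoly_def lpoly_def)
        ultimately have "roots_modulo p (mpoly ms) = {(- c) mod int p}"
          by (auto simp: roots_modulo_def)
        moreover have "count_list (v # roots) a = of_bool (a = v) + count_list roots a" for v a
          by simp
        ultimately show ?thesis using inv
          by (simp add: s t cz_inv_def ac_simps del: count_list.simps)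
      next
        case 3
        then have ne: "length ms \<noteq> 0" "length ms \<noteq> 1" by linarith+
        have "t \<in> set_spmf (bind_spmf (spmf_of_set (residue_lists p (length ms)))
          (\<lambda>r. return_spmf (fst (cz_split p ms r) @ st, roots, ops + length ms + snd (cz_split p ms r))))"
          using t unfolding s cantor_zassenhaus_step_Cons[OF p(1) ms] by (simp only: ne if_False)
        then obtain r where r: "r \<in> residue_lists p (length ms)"
          "t = (fst (cz_split p ms r) @ st, roots, ops + length ms + snd (cz_split p ms r))"
          using fin(1)[of "length ms"] by (auto simp: set_bind_spmf)
        have "length ms > 0" using 3 by linarith
        note * = cz_split_lengths[OF p ms this r(1)]
        show ?thesis using inv *(1) unfolding s r(2) cz_inv_def
          by (auto simp: *(2))
      qed
    qed
    show "(\<integral>\<^sup>+ t. cz_rank t \<partial>measure_spmf (cantor_zassenhaus_step p s)) + 1 \<le> cz_rank s"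
    proof -
      define rest where "rest = (\<Sum>ms\<leftarrow>st. 8 * cz_pairs ms + 1)"
      have rest: "0 \<le> rest" unfolding rest_def
        by (intro sum_list_nonneg) (auto intro!: add_nonneg_nonneg mult_nonneg_nonneg cz_pairs_nonneg)
      have pairs: "0 \<le> cz_pairs ms" by (rule cz_pairs_nonneg)
      have "cz_rank s = ennreal ((8 * cz_pairs ms + rest) + 1)"
        by (simp add: s cz_rank_def rest_def add_ac)
      also have "\<dots> = ennreal (8 * cz_pairs ms + rest) + 1"
        by (subst ennreal_plus) (use pairs rest in auto)
      finally have rank_s: "cz_rank s = ennreal (8 * cz_pairs ms + rest) + 1" .
      show ?thesis
      proof (cases "length ms \<ge> 2")
        case False
        then consider "length ms = 0" | "length ms = 1" by linarith
        then have "(\<integral>\<^sup>+ t. cz_rank t \<partial>measure_spmf (cantor_zassenhaus_step p s)) = ennreal rest"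
          unfolding s cantor_zassenhaus_step_Cons[OF p(1) ms]
          by cases (auto simp: nn_integral_return_spmf cz_rank_def rest_def)
        then show ?thesis unfolding rank_s using pairs by (intro add_right_mono) (simp add: ennreal_leI)
      next
        case True
        let ?L = "residue_lists p (length ms)"
        have pos: "length ms > 0" using True by linarith
        have "cz_pairs ms \<ge> 2"
        proof -
          have "real (length ms) * 2 \<le> real (length ms) * real (length ms)"
            using True by (intro mult_left_mono) auto
          then show ?thesis using True by (simp add: cz_pairs_def power2_eq_square)
        qed
        define f where "f r = (\<Sum>m\<leftarrow>fst (cz_split p ms r). 8 * cz_pairs m + 1) + rest" for r
        have "f r = 3 + rest + 8 * (\<Sum>m\<leftarrow>fst (cz_split p ms r). cz_pairs m)" if "r \<in> ?L" for r
        proof -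
          have "(\<Sum>m\<leftarrow>xs. 8 * cz_pairs m + 1) = 8 * (\<Sum>m\<leftarrow>xs. cz_pairs m) + real (length xs)" for xs
            by (induction xs) simp_all
          from this[of "fst (cz_split p ms r)"] show ?thesis
            using cz_split_lengths(3)[OF p ms pos that] by (simp add: f_def)
        qed
        then have "(\<Sum>r\<in>?L. f r) = (3 + rest) * real (card ?L) + 8 * (\<Sum>r\<in>?L. \<Sum>m\<leftarrow>fst (cz_split p ms r). cz_pairs m)"
          by (simp add: sum.distrib sum_distrib_left)
        also have "\<dots> \<le> (3 + rest) * real (card ?L) + 8 * (cz_pairs ms / 2 * real (card ?L))"
          by (intro add_left_mono mult_left_mono sum_cz_pairs p ms True) auto
        also have "\<dots> = (3 + rest + 4 * cz_pairs ms) * real (card ?L)" by (simp add: algebra_simps)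
        also have "\<dots> \<le> (8 * cz_pairs ms + rest) * real (card ?L)"
          using \<open>cz_pairs ms \<ge> 2\<close> by (intro mult_right_mono) auto
        finally have "(\<integral>\<^sup>+ r. ennreal (f r) \<partial>measure_spmf (spmf_of_set ?L)) \<le> ennreal (8 * cz_pairs ms + rest)"
          by (intro nn_integral_spmf_of_set_le fin)
             (auto simp: f_def intro!: add_nonneg_nonneg sum_list_nonneg mult_nonneg_nonneg cz_pairs_nonneg rest)
        moreover have "(\<integral>\<^sup>+ t. cz_rank t \<partial>measure_spmf (cantor_zassenhaus_step p s))
            = (\<integral>\<^sup>+ r. ennreal (f r) \<partial>measure_spmf (spmf_of_set ?L))"
          using True unfolding s cantor_zassenhaus_step_Cons[OF p(1) ms]
          by (auto simp: nn_integral_bind_spmf nn_integral_return_spmf cz_rank_def f_def rest_def)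
        ultimately show ?thesis unfolding rank_s by (intro add_right_mono) simp
      qed
    qed
  qed
qed

text \<open>The gcd with \<open>T ^ p - T\<close>, for residues \<open>ms\<close> already extracted:
  from here on it does not matter from which ring they came.\<close>

definition cz_preprocess :: "nat \<Rightarrow> int list \<Rightarrow> int list counted" where
  "cz_preprocess p ms =
    (let F = residue_ring (int p) in
      do { t \<leftarrow> reduce F ms [1, 0];
           w \<leftarrow> power_mod F ms t p;
           w \<leftarrow> map_counted (\<lambda>(x, y). tick (x \<ominus>\<^bsub>F\<^esub> y)) (zip w t);
           monic_gcd F ms w })"

definition cz_roots :: "nat \<Rightarrow> int list \<Rightarrow> nat list counted spmf" where
  "cz_roots p ms =
    map_spmf (\<lambda>(_, roots, ops). (map nat roots, ops))
      (while_spmf (\<lambda>(stack, _, _). stack \<noteq> []) (cantor_zassenhaus_step p)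
        ([fst (cz_preprocess p ms)], [], length ms + snd (cz_preprocess p ms)))"

lemma cantor_zassenhaus_roots_eq:
  assumes "p \<noteq> 2"
  shows "cantor_zassenhaus_roots p R g = cz_roots p (map (residue p R) (tl (rev g)))"
proof -
  have "map_counted (\<lambda>c. tick (residue p R c)) xs = (map (residue p R) xs, length xs)" for xs
    by (rule prod_eqI) (simp_all add: fst_map_counted snd_map_counted counted_simps sum_list_triv)
  then show ?thesis using assms
    by (simp add: cantor_zassenhaus_roots_def cz_roots_def cz_preprocess_def Let_def split_def
      map_spmf_conv_bind_spmf bind_counted_def)
qed

lemma cz_preprocess_correct:
  assumes p: "prime p" "p \<noteq> 2" and ms: "set ms \<subseteq> {0..int p - 1}" and k: "p < 2 ^ k"
  shows "split_list p (fst (cz_preprocess p ms))"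
    "roots_modulo p (mpoly (fst (cz_preprocess p ms))) = roots_modulo p (mpoly ms)"
    "length (fst (cz_preprocess p ms)) \<le> length ms"
    "snd (cz_preprocess p ms) \<le> 4 + k * (2 * (length ms * (4 * length ms + 1))) + length ms + 6 * (length ms + 1)\<^sup>2"
proof -
  let ?F = "residue_ring (int p)" and ?M = "mpoly ms"
  have p1: "int p > 1" using prime_gt_1_nat[OF p(1)] by simp
  define t where "t = fst (reduce ?F ms [1, 0])"
  define w where "w = fst (power_mod ?F ms t p)"
  define v where "v = map (\<lambda>z. z mod int p) (map2 (\<lambda>x y. x + (- 1) * y) w t)"
  have set10: "set [1, 0] \<subseteq> {0..int p - 1}" using p1 by auto
  note red = reduce_correct[OF p1 set10, of ms, folded t_def]
  have tlen: "length t = length ms" by (simp add: t_def length_reduce)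
  note pm = power_mod_correct[OF p1 tlen k, folded w_def]
  have "map_counted (\<lambda>(x, y). tick (x \<ominus>\<^bsub>?F\<^esub> y)) (zip w t) = (v, length ms)"
  proof (rule prod_eqI)
    have "x \<ominus>\<^bsub>?F\<^esub> y = (x - y) mod int p" if "(x, y) \<in> set (zip w t)" for x y
      using residue_ring_minus[OF p1, of y x] red(2) set_zip_rightD[OF that] by auto
    then show "fst (map_counted (\<lambda>(x, y). tick (x \<ominus>\<^bsub>?F\<^esub> y)) (zip w t)) = fst (v, length ms)"
      by (auto simp: fst_map_counted counted_simps v_def)
    show "snd (map_counted (\<lambda>(x, y). tick (x \<ominus>\<^bsub>?F\<^esub> y)) (zip w t)) = snd (v, length ms)"
      using pm tlen by (simp add: snd_map_counted counted_simps case_prod_beta sum_list_triv)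
  qed
  then have eq: "cz_preprocess p ms = (fst (monic_gcd ?F ms v),
      snd (reduce ?F ms [1, 0]) + (snd (power_mod ?F ms t p) + (length ms + snd (monic_gcd ?F ms v))))"
    by (simp add: cz_preprocess_def Let_def bind_counted_def t_def[symmetric] w_def[symmetric] del: residue_ring_simps)
  have v: "set v \<subseteq> {0..int p - 1}" "length v \<le> length ms"
    using set_map_mod[of "int p" "map2 (\<lambda>x y. x + (- 1) * y) w t"] p1 pm tlen by (auto simp: v_def)
  have "icong [:int p:] ?M (lpoly v) (lpoly (map2 (\<lambda>x y. x + (- 1) * y) w t))"
    unfolding v_def by (rule lpoly_mod)
  also have "lpoly (map2 (\<lambda>x y. x + (- 1) * y) w t) = lpoly w - lpoly t"
    by (subst lpoly_map2) (use pm tlen in auto)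
  also have "icong [:int p:] ?M \<dots> (lpoly [1, 0] ^ p - lpoly [1, 0])"
    using pm red(1) icong_power[OF red(1)] by (intro icong_diff) (meson icong_trans)+
  also have "lpoly [1, 0] ^ p - lpoly [1, 0] = monom 1 p - monom 1 1"
    by (simp add: lpoly_Cons monom_power)
  finally have U: "icong [:int p:] ?M (lpoly v) (monom 1 p - monom 1 1)" .
  show "split_list p (fst (cz_preprocess p ms))"
    "roots_modulo p (mpoly (fst (cz_preprocess p ms))) = roots_modulo p (mpoly ms)"
    "length (fst (cz_preprocess p ms)) \<le> length ms"
    unfolding eq fst_conv by (rule distinct_root_factor[OF p(1) ms v U])+
  \<comment> \<open>Reducing \<open>T\<close> costs at most 2 for a constant modulus, at most 3 for
    a linear one and nothing otherwise.\<close>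
  have "snd (reduce ?F ms [1, 0]) \<le> (2 - length ms) * (2 * length ms + 1)"
    using red(3) by (simp add: numeral_2_eq_2)
  also have "\<dots> \<le> 3"
  proof -
    consider "length ms = 0" | "length ms = 1" | "length ms \<ge> 2" by linarith
    then show ?thesis by cases simp_all
  qed
  finally have r3: "snd (reduce ?F ms [1, 0]) \<le> 3" .
  have "snd (monic_gcd ?F ms v) \<le> 6 * (length ms + 1)\<^sup>2"
    using monic_gcd_correct[OF p(1) ms v] by blast
  with r3 pm show "snd (cz_preprocess p ms) \<le> 4 + k * (2 * (length ms * (4 * length ms + 1))) + length ms + 6 * (length ms + 1)\<^sup>2"
    by (simp add: eq)
qed

lemma cz_roots_correct:
  assumes p: "prime p" "p \<noteq> 2" and ms: "set ms \<subseteq> {0..int p - 1}" and k: "p < 2 ^ k"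
  shows "lossless_spmf (cz_roots p ms)"
    and "(as, i) \<in> set_spmf (cz_roots p ms) \<Longrightarrow> distinct as \<and> int ` set as = roots_modulo p (mpoly ms)"
    and "(\<integral>\<^sup>+ x. of_nat (snd x) \<partial>measure_spmf (cz_roots p ms)) \<le> ennreal (240 * real k * (real (length ms) + 1)\<^sup>2)"
proof -
  let ?R = "roots_modulo p (mpoly ms)"
  let ?s = "([fst (cz_preprocess p ms)], [], length ms + snd (cz_preprocess p ms)) :: int list list \<times> int list \<times> nat"
  let ?n = "length ms"
  note pre = cz_preprocess_correct[OF assms]
  interpret terminating_loop "cz_inv p ?R" "\<lambda>(stack, _, _). stack \<noteq> []" "cantor_zassenhaus_step p" cz_rank
    by (rule cz_loop[OF p k])
  have s: "cz_inv p ?R ?s" "cz_rank ?s < \<infinity>"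
    using pre by (simp_all add: cz_inv_def cz_rank_def)
  show "lossless_spmf (cz_roots p ms)"
    using lossless_while[OF s] by (simp add: cz_roots_def)
  show "distinct as \<and> int ` set as = ?R" if as: "(as, i) \<in> set_spmf (cz_roots p ms)"
  proof -
    from as obtain st roots where *: "as = map nat roots"
      "(st, roots, i) \<in> set_spmf (while_spmf (\<lambda>(stack, _, _). stack \<noteq> []) (cantor_zassenhaus_step p) ?s)"
      by (auto simp: cz_roots_def)
    from set_while[OF s *(2)] have count: "count_list roots a = of_bool (a \<in> ?R)" for a
      by (auto simp: cz_inv_def)
    have "set roots = ?R"
    proof (intro equalityI subsetI)
      fix a show "a \<in> ?R" if "a \<in> set roots"
        using that count[of a] count_list_0_iff[of roots a] by (cases "a \<in> ?R") auto
      show "a \<in> set roots" if "a \<in> ?R"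
        using that count[of a] count_list_0_iff[of roots a] by auto
    qed
    \<comment> \<open>The final state of the invariant gives every root the count 1; a repetition
      would give at least 2.\<close>
    moreover have "distinct roots"
    proof (rule ccontr)
      assume "\<not> distinct roots"
      then obtain xs ys zs a where "roots = xs @ [a] @ ys @ [a] @ zs" by (meson not_distinct_decomp)
      with count[of a] show False by (cases "a \<in> ?R") auto
    qed
    moreover have "0 \<le> a" if "a \<in> ?R" for a using that by (simp add: roots_modulo_def)
    moreover have "inj_on nat ?R"
      using \<open>\<And>a. a \<in> ?R \<Longrightarrow> 0 \<le> a\<close> by (intro inj_onI) (simp add: eq_nat_nat_iff)
    ultimately show ?thesis
      by (auto simp: *(1) distinct_map image_image image_iff)
  qed
  have "(\<integral>\<^sup>+ x. of_nat (snd x) \<partial>measure_spmf (cz_roots p ms)) =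
      (\<integral>\<^sup>+ x. of_nat (case x of (_, _, ops) \<Rightarrow> ops)
        \<partial>measure_spmf (while_spmf (\<lambda>(stack, _, _). stack \<noteq> []) (cantor_zassenhaus_step p) ?s))"
    by (simp add: cz_roots_def comp_def case_prod_beta)
  also have "\<dots> \<le> cz_potential k ?s"
  proof (rule nn_integral_while_le[OF _ _ s])
    fix s assume "cz_inv p ?R s" "case s of (stack, _, _) \<Rightarrow> stack \<noteq> []"
    then show "(\<integral>\<^sup>+ t. cz_potential k t \<partial>measure_spmf (cantor_zassenhaus_step p s)) \<le> cz_potential k s"
      by (intro cz_loop(2)[OF p k]) auto
  next
    fix s :: "int list list \<times> int list \<times> nat"
    assume "\<not> (case s of (stack, _, _) \<Rightarrow> stack \<noteq> [])"
    then show "of_nat (case s of (_, _, ops) \<Rightarrow> ops) \<le> cz_potential k s"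
      by (auto simp: cz_potential_def ennreal_of_nat_eq_real_of_nat)
  qed
  also have "cz_potential k ?s \<le> ennreal (240 * real k * (real ?n + 1)\<^sup>2)"
  proof -
    define m where "m = length (fst (cz_preprocess p ms))"
    have m: "m \<le> ?n" using pre(3) by (simp add: m_def)
    have k1: "real k \<ge> 1" using k prime_gt_1_nat[OF p(1)] by (cases k) auto
    have "real (snd (cz_preprocess p ms))
        \<le> real (4 + k * (2 * (?n * (4 * ?n + 1))) + ?n + 6 * (?n + 1)\<^sup>2)"
      using pre(4) by (rule of_nat_mono)
    also have "\<dots> = 4 + real k * (8 * (real ?n)\<^sup>2 + 2 * real ?n) + real ?n + 6 * (real ?n + 1)\<^sup>2"
      by (simp add: power2_eq_square algebra_simps)
    also have "\<dots> \<le> real k * (4 + (8 * (real ?n)\<^sup>2 + 2 * real ?n) + real ?n + 6 * (real ?n + 1)\<^sup>2)"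
    proof -
      have "4 + real ?n + 6 * (real ?n + 1)\<^sup>2 \<le> real k * (4 + real ?n + 6 * (real ?n + 1)\<^sup>2)"
        using mult_right_mono[OF k1, of "4 + real ?n + 6 * (real ?n + 1)\<^sup>2"] by simp
      then show ?thesis by (simp add: algebra_simps)
    qed
    finally have 1: "real (snd (cz_preprocess p ms)) \<le> \<dots>" .
    have "(real m)\<^sup>2 \<le> (real ?n)\<^sup>2"
      using m by (intro power_mono) auto
    then have "(real m)\<^sup>2 - real m \<le> (real ?n)\<^sup>2" by linarith
    from mult_left_mono[OF this, of "208 * real k"]
    have 2: "208 * real k * ((real m)\<^sup>2 - real m) \<le> real k * (208 * (real ?n)\<^sup>2)" by simp
    have 3: "real m + real ?n \<le> real k * (2 * real ?n)"
      using mult_right_mono[OF k1, of "2 * real ?n"] m by simp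
    have "real (?n + snd (cz_preprocess p ms)) + (208 * real k * ((real m)\<^sup>2 - real m) + real m)
      \<le> real k * (4 + (8 * (real ?n)\<^sup>2 + 2 * real ?n) + real ?n + 6 * (real ?n + 1)\<^sup>2)
        + real k * (208 * (real ?n)\<^sup>2) + real k * (2 * real ?n)"
      using 1 2 3 by simp
    \<comment> \<open>\<open>222 = 208 + 8 + 6\<close>, from the splits, the power and the
      gcd.\<close>
    also have "\<dots> = real k * (10 + 222 * (real ?n)\<^sup>2 + 17 * real ?n)"
      by (simp add: power2_eq_square algebra_simps)
    also have "\<dots> \<le> real k * (240 * (real ?n + 1)\<^sup>2)"
      by (intro mult_left_mono) (auto simp: power2_eq_square algebra_simps)
    finally show ?thesis
      by (auto simp: cz_potential_def cz_pairs_def m_def intro!: ennreal_leI)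
  qed
  finally show "(\<integral>\<^sup>+ x. of_nat (snd x) \<partial>measure_spmf (cz_roots p ms)) \<le> ennreal (240 * real k * (real ?n + 1)\<^sup>2)" .
qed

section \<open>Computing with \<open>b\<close> digits\<close>

lemma icong_pcompose:
  assumes "icong [:m:] 0 A B"
  shows "icong [:m:] 0 (pcompose A q) (pcompose B q)"
proof -
  obtain S T where "A - B = [:m:] * S + 0 * T" using assms by (auto simp: icong_def)
  then have "pcompose A q - pcompose B q = [:m:] * pcompose S q + 0 * 0"
    by (simp flip: pcompose_diff add: pcompose_smult)
  then show ?thesis by (rule icongI)
qed

lemma icong_pcompose_right: "icong [:m:] 0 q r \<Longrightarrow> icong [:m:] 0 (pcompose A q) (pcompose A r)"
  by (induction A) (auto simp: pcompose_pCons intro: icong_add icong_mult)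

lemma icong_pCons_cong:
  assumes "m dvd a - b" "icong [:m::int:] 0 A B"
  shows "icong [:m:] 0 (pCons a A) (pCons b B)"
proof (rule icong_0_coeffI)
  fix k show "m dvd coeff (pCons a A) k - coeff (pCons b B) k"
    using assms(1) coeff_icong_0[OF assms(2)] by (cases k) auto
qed

text \<open>In terms of divisibility, \<open>l\<close> is the Strassman count and \<open>p ^ - v\<close> the maximal absolute value.\<close>

definition last_minimal :: "nat \<Rightarrow> (nat \<Rightarrow> int) \<Rightarrow> nat \<Rightarrow> nat \<Rightarrow> nat \<Rightarrow> bool" where
  "last_minimal p c n l v \<longleftrightarrow> l \<le> n \<and> \<not> int p ^ Suc v dvd c l \<and> (\<forall>k\<le>n. int p ^ v dvd c k) \<and>
     (\<forall>k. l < k \<and> k \<le> n \<longrightarrow> int p ^ Suc v dvd c k)"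

lemma last_minimal_unique:
  assumes "last_minimal p c n l v" "last_minimal p c n l' v'"
  shows "l = l' \<and> v = v'"
proof -
  have "v \<le> v'" if "last_minimal p c n l v" "last_minimal p c n l' v'" for l v l' v'
  proof (rule ccontr)
    assume "\<not> v \<le> v'"
    then have "int p ^ Suc v' dvd int p ^ v" by (intro le_imp_power_dvd) simp
    then show False using that unfolding last_minimal_def by (meson dvd_trans)
  qed
  then have "v = v'" using assms by (meson order_antisym)
  then show ?thesis using assms unfolding last_minimal_def by (metis linorder_neqE_nat)
qed

text \<open>\<open>v\<close> is the least exponent for which \<open>p ^ Suc v\<close> fails to
  divide some coefficient, and \<open>l\<close> the last index where it fails. The given
  \<open>k\<close> witnesses that \<open>v\<close> is below \<open>b\<close>.\<close>

lemma last_minimal_exists: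
  assumes "\<not> int p ^ b dvd c k" "k \<le> n"
  obtains l v where "last_minimal p c n l v" "v < b"
proof -
  define P where "P v \<longleftrightarrow> (\<exists>k\<le>n. \<not> int p ^ Suc v dvd c k)" for v
  have "b \<noteq> 0" using assms(1) by (cases b) auto
  then have "P (b - 1)" using assms by (auto simp: P_def)
  define v where "v = (LEAST v. P v)"
  have v: "P v" unfolding v_def by (rule LeastI) fact
  have "v \<le> b - 1" unfolding v_def by (rule Least_le) fact
  with \<open>b \<noteq> 0\<close> have "v < b" by simp
  have all: "int p ^ v dvd c k" if "k \<le> n" for k
  proof (cases v)
    case (Suc w)
    then have "\<not> P w" unfolding v_def using not_less_Least[of w P] by simp
    then show ?thesis using that Suc by (auto simp: P_def)
  qed simp
  define K where "K = {k. k \<le> n \<and> \<not> int p ^ Suc v dvd c k}"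
  have K: "finite K" "K \<noteq> {}" using v by (auto simp: K_def P_def)
  have "Max K \<in> K" using K by (rule Max_in)
  then have m: "Max K \<le> n" "\<not> int p ^ Suc v dvd c (Max K)" unfolding K_def by blast+
  have gt: "int p ^ Suc v dvd c k" if "Max K < k" "k \<le> n" for k
  proof (rule ccontr)
    assume "\<not> int p ^ Suc v dvd c k"
    with that(2) have "k \<in> K" by (simp add: K_def)
    from Max_ge[OF K(1) this] that(1) show False by simp
  qed
  have "last_minimal p c n (Max K) v"
    unfolding last_minimal_def using m all gt by blast
  then show ?thesis using \<open>v < b\<close> by (rule that)
qed

text \<open>The definition tests divisibility by powers up to \<open>p ^ Suc v\<close>; as
  \<open>v < b\<close>, all of them are decided by the first \<open>b\<close> digits.\<close>

lemma last_minimal_cong: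
  assumes "last_minimal p c n l v" "v < b" "\<And>k. k \<le> n \<Longrightarrow> int p ^ b dvd c' k - c k"
  shows "last_minimal p c' n l v"
proof -
  have "int p ^ e dvd c' k \<longleftrightarrow> int p ^ e dvd c k" if "k \<le> n" "e \<le> Suc v" for k e
  proof -
    have "int p ^ e dvd int p ^ b" using that assms(2) by (intro le_imp_power_dvd) simp
    then have "int p ^ e dvd c' k - c k" using assms(3)[OF that(1)] by (rule dvd_trans)
    then show ?thesis by (metis diff_add_cancel dvd_add_right_iff)
  qed
  then show ?thesis using assms(1) by (auto simp: last_minimal_def simp del: power_Suc)
qed

lemma coeff_pcompose_affine: "coeff (pcompose (P :: int poly) [:x, q:]) k = q ^ k * coeff (pcompose P [:x, 1:]) k"
proof -
  have "pcompose P [:x, q:] = pcompose (pcompose P [:x, 1:]) [:0, q:]"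
    by (simp add: pcompose_assoc[symmetric] pcompose_pCons)
  then show ?thesis by (simp add: coeff_pcompose_linear)
qed

text \<open>The common features of \<open>\<int>\<^sub>p\<close> and \<open>\<int>/p ^ b\<close>, seen through the first \<open>b\<close> digits \<open>\<pi>\<close>, so that the algorithm is analyzed only once.\<close>

locale approx_ring =
  fixes p b :: nat and R :: "('a, 'm) ring_scheme" and \<pi> :: "'a \<Rightarrow> int" and \<iota> :: "int \<Rightarrow> 'a"
  assumes p: "prime p" and b: "b > 0"
    and zero_eq: "\<zero>\<^bsub>R\<^esub> = \<iota> 0" and one_eq: "\<one>\<^bsub>R\<^esub> = \<iota> 1"
    and nat_in_eq: "nat_in R n = \<iota> (int n)"
    and \<iota>_closed [simp]: "\<iota> i \<in> carrier R"
    and \<iota>_add: "\<iota> i \<oplus>\<^bsub>R\<^esub> \<iota> j = \<iota> (i + j)"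
    and \<iota>_mult: "\<iota> i \<otimes>\<^bsub>R\<^esub> \<iota> j = \<iota> (i * j)"
    and \<pi>_\<iota>: "\<pi> (\<iota> i) = i mod int p ^ b"
    and add_closed: "x \<in> carrier R \<Longrightarrow> y \<in> carrier R \<Longrightarrow> x \<oplus>\<^bsub>R\<^esub> y \<in> carrier R"
    and mult_closed: "x \<in> carrier R \<Longrightarrow> y \<in> carrier R \<Longrightarrow> x \<otimes>\<^bsub>R\<^esub> y \<in> carrier R"
    and minus_closed: "x \<in> carrier R \<Longrightarrow> y \<in> carrier R \<Longrightarrow> x \<ominus>\<^bsub>R\<^esub> y \<in> carrier R"
    and \<pi>_add: "x \<in> carrier R \<Longrightarrow> y \<in> carrier R \<Longrightarrow> \<pi> (x \<oplus>\<^bsub>R\<^esub> y) = (\<pi> x + \<pi> y) mod int p ^ b"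
    and \<pi>_mult: "x \<in> carrier R \<Longrightarrow> y \<in> carrier R \<Longrightarrow> \<pi> (x \<otimes>\<^bsub>R\<^esub> y) = (\<pi> x * \<pi> y) mod int p ^ b"
    and \<pi>_minus: "x \<in> carrier R \<Longrightarrow> y \<in> carrier R \<Longrightarrow> \<pi> (x \<ominus>\<^bsub>R\<^esub> y) = (\<pi> x - \<pi> y) mod int p ^ b"
    and abs_values: "x \<in> carrier R \<Longrightarrow> padic_abs p R x = 0 \<or> (\<exists>n. padic_abs p R x = 1 / real p ^ n)"
    and abs_le_iff: "x \<in> carrier R \<Longrightarrow> e \<le> b \<Longrightarrow> padic_abs p R x \<le> 1 / real p ^ e \<longleftrightarrow> int p ^ e dvd \<pi> x"
    and quotient_exists: "x \<in> carrier R \<Longrightarrow> y \<in> carrier R \<Longrightarrow> v < b \<Longrightarrow> int p ^ v dvd \<pi> y \<Longrightarrow>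
      \<not> int p ^ Suc v dvd \<pi> y \<Longrightarrow> int p ^ v dvd \<pi> x \<Longrightarrow> \<exists>z \<in> carrier R. z \<otimes>\<^bsub>R\<^esub> y = x"
begin

section \<open>Arithmetic seen through the first \<open>b\<close> digits\<close>

lemma p_gt_1: "p > 1" and real_p_gt_1: "real p > 1" and int_p_gt_1: "int p > 1"
  using prime_gt_1_nat[OF p] by simp_all

lemma inverse_power_le_iff: "1 / real p ^ n \<le> 1 / real p ^ m \<longleftrightarrow> m \<le> n"
  using real_p_gt_1 by (simp add: field_simps power_increasing_iff)

lemma \<pi>_zero: "\<pi> \<zero>\<^bsub>R\<^esub> = 0" by (simp add: zero_eq \<pi>_\<iota>)

lemma zero_closed: "\<zero>\<^bsub>R\<^esub> \<in> carrier R" by (simp add: zero_eq)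

lemma abs_less_1_iff: "x \<in> carrier R \<Longrightarrow> padic_abs p R x < 1 \<longleftrightarrow> int p dvd \<pi> x"
proof -
  assume x: "x \<in> carrier R"
  have "padic_abs p R x < 1 \<longleftrightarrow> padic_abs p R x \<le> 1 / real p ^ 1"
  proof (cases "padic_abs p R x = 0")
    case False
    then obtain n where n: "padic_abs p R x = 1 / real p ^ n" using abs_values[OF x] by auto
    have "1 / real p ^ n < 1 \<longleftrightarrow> \<not> 1 / real p ^ 0 \<le> 1 / real p ^ n" by (simp add: not_le)
    then have "1 / real p ^ n < 1 \<longleftrightarrow> 1 \<le> n"
      unfolding inverse_power_le_iff by auto
    then show ?thesis unfolding n inverse_power_le_iff by simp
  qed (use real_p_gt_1 in auto)
  also have "\<dots> \<longleftrightarrow> int p dvd \<pi> x" using abs_le_iff[OF x, of 1] b by simp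
  finally show ?thesis .
qed

lemma abs_eq:
  assumes "x \<in> carrier R" "v < b" "int p ^ v dvd \<pi> x" "\<not> int p ^ Suc v dvd \<pi> x"
  shows "padic_abs p R x = 1 / real p ^ v"
proof -
  have le: "padic_abs p R x \<le> 1 / real p ^ v" "\<not> padic_abs p R x \<le> 1 / real p ^ Suc v"
    using assms abs_le_iff[of x v] abs_le_iff[of x "Suc v"] by auto
  then have "padic_abs p R x \<noteq> 0" using real_p_gt_1 by auto
  then obtain n where n: "padic_abs p R x = 1 / real p ^ n" using abs_values[OF assms(1)] by auto
  from le have "n = v" unfolding n inverse_power_le_iff by simp
  then show ?thesis using n by simp
qed

lemma \<pi>_residue: "x \<in> carrier R \<Longrightarrow> residue p R x = \<pi> x mod int p"
proof -
  assume x: "x \<in> carrier R"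
  have dvd: "int p dvd int p ^ b" using b by simp
  have "padic_abs p R (x \<ominus>\<^bsub>R\<^esub> nat_in R a) < 1 \<longleftrightarrow> int a mod int p = \<pi> x mod int p" for a
  proof -
    have "padic_abs p R (x \<ominus>\<^bsub>R\<^esub> nat_in R a) < 1 \<longleftrightarrow> int p dvd (\<pi> x - int a mod int p ^ b) mod int p ^ b"
      by (simp add: nat_in_eq abs_less_1_iff minus_closed x \<pi>_minus \<pi>_\<iota>)
    also have "\<dots> \<longleftrightarrow> int p dvd \<pi> x - int a"
      using dvd by (simp add: dvd_mod_iff mod_simps)
    also have "\<dots> \<longleftrightarrow> int a mod int p = \<pi> x mod int p" by (metis mod_eq_dvd_iff)
    finally show ?thesis .
  qed
  moreover have "a < p \<and> int a mod int p = m \<longleftrightarrow> a = nat m" if "0 \<le> m" "m < int p" for a m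
  proof -
    have "a < p \<and> int a mod int p = m \<longleftrightarrow> a < p \<and> int a = m" by auto
    also have "\<dots> \<longleftrightarrow> a = nat m" using that by linarith
    finally show ?thesis .
  qed
  ultimately have "a < p \<and> padic_abs p R (x \<ominus>\<^bsub>R\<^esub> nat_in R a) < 1 \<longleftrightarrow> a = nat (\<pi> x mod int p)" for a
    using int_p_gt_1 by simp
  then have "(THE a. a < p \<and> padic_abs p R (x \<ominus>\<^bsub>R\<^esub> nat_in R a) < 1) = nat (\<pi> x mod int p)"
    by simp
  then show ?thesis using int_p_gt_1 by (simp add: residue_def)
qed

abbreviation Pi :: "'a list \<Rightarrow> int poly" where
  "Pi cs \<equiv> Poly (map \<pi> cs)"

abbreviation pb :: "int poly" where "pb \<equiv> [:int p ^ b:]"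

lemma mod_pb_dvd: "int p ^ b dvd x mod int p ^ b - x"
  by (simp add: mod_eq_dvd_iff[symmetric])

text \<open>The value is compared modulo \<open>p ^ b\<close> only, since \<open>\<pi>\<close> does
  not see the later digits of a p-adic integer.\<close>

lemma horner_correct:
  assumes "set cs \<subseteq> carrier R" "x \<in> carrier R"
  shows "fst (horner R cs x) \<in> carrier R \<and>
    int p ^ b dvd \<pi> (fst (horner R cs x)) - poly (Pi cs) (\<pi> x) \<and>
    snd (horner R cs x) = 2 * length cs"
  using assms
proof (induction cs)
  case Nil
  then show ?case by (simp add: counted_simps zero_closed \<pi>_zero)
next
  case (Cons c cs)
  let ?v = "fst (horner R cs x)"
  have IH: "?v \<in> carrier R" "int p ^ b dvd \<pi> ?v - poly (Pi cs) (\<pi> x)" "snd (horner R cs x) = 2 * length cs"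
    using Cons by auto
  have "\<pi> (c \<oplus>\<^bsub>R\<^esub> x \<otimes>\<^bsub>R\<^esub> ?v) = (\<pi> c + \<pi> x * \<pi> ?v) mod int p ^ b"
    using Cons.prems IH by (simp add: \<pi>_add \<pi>_mult mult_closed mod_simps)
  moreover have "int p ^ b dvd (\<pi> c + \<pi> x * \<pi> ?v) mod int p ^ b - (\<pi> c + \<pi> x * \<pi> ?v)"
    by (rule mod_pb_dvd)
  moreover have "int p ^ b dvd \<pi> x * (\<pi> ?v - poly (Pi cs) (\<pi> x))" using IH(2) by simp
  ultimately have "int p ^ b dvd (\<pi> (c \<oplus>\<^bsub>R\<^esub> x \<otimes>\<^bsub>R\<^esub> ?v) - (\<pi> c + \<pi> x * \<pi> ?v)) + \<pi> x * (\<pi> ?v - poly (Pi cs) (\<pi> x))"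
    by (metis dvd_add)
  then show ?case using IH Cons.prems
    by (simp add: counted_simps add_closed mult_closed algebra_simps)
qed

lemma synthetic_division_correct:
  assumes "set cs \<subseteq> carrier R" "x \<in> carrier R"
  shows "set (fst (fst (synthetic_division R cs x))) \<subseteq> carrier R
    \<and> length (fst (fst (synthetic_division R cs x))) = length cs
    \<and> snd (fst (synthetic_division R cs x)) \<in> carrier R
    \<and> icong pb 0 (Pi cs) ([:- \<pi> x, 1:] * Pi (fst (fst (synthetic_division R cs x)))
        + [:\<pi> (snd (fst (synthetic_division R cs x))):])
    \<and> snd (synthetic_division R cs x) = 2 * length cs"
  using assms
proof (induction cs)
  case Nil
  then show ?case by (simp add: counted_simps zero_closed \<pi>_zero)
next
  case (Cons c cs)
  obtain q r where qr: "fst (synthetic_division R cs x) = (q, r)" by (cases "fst (synthetic_division R cs x)")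
  have IH: "set q \<subseteq> carrier R" "length q = length cs" "r \<in> carrier R"
    "icong pb 0 (Pi cs) ([:- \<pi> x, 1:] * Pi q + [:\<pi> r:])" "snd (synthetic_division R cs x) = 2 * length cs"
    using Cons qr by auto
  let ?r = "c \<oplus>\<^bsub>R\<^esub> x \<otimes>\<^bsub>R\<^esub> r"
  have eq: "synthetic_division R (c # cs) x = ((r # q, ?r), 2 * length (c # cs))"
    using IH(5) by (simp add: counted_simps qr)
  have r: "?r \<in> carrier R" using Cons.prems IH by (simp add: add_closed mult_closed)
  have "\<pi> ?r = (\<pi> c + \<pi> x * \<pi> r) mod int p ^ b"
    using Cons.prems IH by (simp add: \<pi>_add \<pi>_mult mult_closed mod_simps)
  then have "int p ^ b dvd \<pi> ?r - (\<pi> c + \<pi> x * \<pi> r)" by (simp only: mod_pb_dvd)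
  then have 1: "icong pb 0 [:\<pi> c + \<pi> x * \<pi> r:] [:\<pi> ?r:]"
    by (intro icong_pCons_cong icong_refl) (simp add: dvd_diff_commute)
  have "Pi (c # cs) = pCons 0 (Pi cs) + [:\<pi> c:]" by simp
  also have "icong pb 0 \<dots> (pCons 0 ([:- \<pi> x, 1:] * Pi q + [:\<pi> r:]) + [:\<pi> c:])"
    by (intro icong_add icong_refl icong_pCons_cong IH) simp
  also have "\<dots> = [:- \<pi> x, 1:] * Pi (r # q) + [:\<pi> c + \<pi> x * \<pi> r:]"
    by (simp add: algebra_simps)
  also have "icong pb 0 \<dots> ([:- \<pi> x, 1:] * Pi (r # q) + [:\<pi> ?r:])"
    by (intro icong_add icong_refl 1)
  finally show ?case using IH r unfolding eq by simp
qed

text \<open>Substituting \<open>x + T\<close> turns the divisor \<open>T - x\<close> into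
  \<open>T\<close>, so one synthetic division splits off the constant Taylor coefficient.\<close>

lemma pcompose_synthetic_division:
  assumes "icong pb 0 P ([:- x, 1:] * Q + [:r:])"
  shows "icong pb 0 (pcompose P [:x, 1:]) (pCons r (pcompose Q [:x, 1:]))"
proof -
  have "pcompose ([:- x, 1:] * Q + [:r:]) [:x, 1:] = pCons r (pcompose Q [:x, 1:])"
    unfolding pcompose_add pcompose_mult by (simp add: pcompose_pCons)
  with icong_pcompose[OF assms, of "[:x, 1:]"] show ?thesis by simp
qed

text \<open>Quotients are padded to the length of \<open>cs\<close>, so each of the
  \<open>Suc n\<close> divisions costs the same.\<close>

lemma taylor_correct:
  assumes "set cs \<subseteq> carrier R" "x \<in> carrier R"
  shows "set (fst (taylor R cs x n)) \<subseteq> carrier R \<and> length (fst (taylor R cs x n)) = Suc n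
    \<and> (\<forall>k\<le>n. int p ^ b dvd \<pi> (fst (taylor R cs x n) ! k) - coeff (pcompose (Pi cs) [:\<pi> x, 1:]) k)
    \<and> snd (taylor R cs x n) = Suc n * (2 * length cs)"
  using assms
proof (induction n arbitrary: cs)
  case 0
  obtain q r where qr: "fst (synthetic_division R cs x) = (q, r)" by (cases "fst (synthetic_division R cs x)")
  note sd = synthetic_division_correct[OF 0, unfolded qr fst_conv snd_conv]
  have "int p ^ b dvd coeff (pcompose (Pi cs) [:\<pi> x, 1:]) 0 - coeff (pCons (\<pi> r) (pcompose (Pi q) [:\<pi> x, 1:])) 0"
    using sd by (intro coeff_icong_0 pcompose_synthetic_division) blast
  then show ?case using sd by (simp add: counted_simps qr dvd_diff_commute)
next
  case (Suc n)
  obtain q r where qr: "fst (synthetic_division R cs x) = (q, r)" by (cases "fst (synthetic_division R cs x)")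
  note sd = synthetic_division_correct[OF Suc.prems, unfolded qr fst_conv snd_conv]
  have c: "int p ^ b dvd coeff (pcompose (Pi cs) [:\<pi> x, 1:]) k - coeff (pCons (\<pi> r) (pcompose (Pi q) [:\<pi> x, 1:])) k" for k
    using sd by (intro coeff_icong_0 pcompose_synthetic_division) blast
  have "set q \<subseteq> carrier R" using sd by blast
  note IH = Suc.IH[OF this Suc.prems(2)]
  have "int p ^ b dvd \<pi> ((r # fst (taylor R q x n)) ! k) - coeff (pcompose (Pi cs) [:\<pi> x, 1:]) k" if "k \<le> Suc n" for k
  proof (cases k)
    case 0
    then show ?thesis using c[of 0] by (simp add: dvd_diff_commute)
  next
    case (Suc j)
    then have "[\<pi> (fst (taylor R q x n) ! j) = coeff (pcompose (Pi q) [:\<pi> x, 1:]) j] (mod int p ^ b)"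
      using IH that by (simp add: cong_iff_dvd_diff)
    moreover have "[coeff (pcompose (Pi cs) [:\<pi> x, 1:]) k = coeff (pcompose (Pi q) [:\<pi> x, 1:]) j] (mod int p ^ b)"
      using c[of k] Suc by (simp add: cong_iff_dvd_diff)
    ultimately have "[\<pi> (fst (taylor R q x n) ! j) = coeff (pcompose (Pi cs) [:\<pi> x, 1:]) k] (mod int p ^ b)"
      using cong_sym cong_trans by blast
    then show ?thesis using Suc by (simp add: cong_iff_dvd_diff)
  qed
  then show ?case using sd IH by (simp add: counted_simps qr)
qed

lemma scale_correct:
  assumes "set cs \<subseteq> carrier R" "q \<in> carrier R" "u \<in> carrier R"
  shows "set (fst (scale R cs q u)) \<subseteq> carrier R \<and> length (fst (scale R cs q u)) = length cs
    \<and> (\<forall>k<length cs. int p ^ b dvd \<pi> (fst (scale R cs q u) ! k) - \<pi> u * \<pi> q ^ k * \<pi> (cs ! k))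
    \<and> snd (scale R cs q u) = 2 * length cs"
  using assms
proof (induction cs arbitrary: u)
  case Nil
  then show ?case by (simp add: counted_simps)
next
  case (Cons c cs)
  let ?u = "u \<otimes>\<^bsub>R\<^esub> q" and ?v = "u \<otimes>\<^bsub>R\<^esub> c"
  have closed: "?u \<in> carrier R" "?v \<in> carrier R" using Cons.prems by (simp_all add: mult_closed)
  have IH: "set (fst (scale R cs q ?u)) \<subseteq> carrier R" "length (fst (scale R cs q ?u)) = length cs"
    "\<And>k. k < length cs \<Longrightarrow> int p ^ b dvd \<pi> (fst (scale R cs q ?u) ! k) - \<pi> ?u * \<pi> q ^ k * \<pi> (cs ! k)"
    "snd (scale R cs q ?u) = 2 * length cs"
    using Cons.IH[OF _ Cons.prems(2) closed(1)] Cons.prems by auto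
  have "int p ^ b dvd \<pi> ((?v # fst (scale R cs q ?u)) ! k) - \<pi> u * \<pi> q ^ k * \<pi> ((c # cs) ! k)"
    if "k < length (c # cs)" for k
  proof (cases k)
    case 0
    then show ?thesis using Cons.prems by (simp add: \<pi>_mult mod_pb_dvd)
  next
    case (Suc j)
    have "int p ^ b dvd \<pi> ?u - \<pi> u * \<pi> q" using Cons.prems by (simp add: \<pi>_mult mod_pb_dvd)
    then have "int p ^ b dvd (\<pi> ?u - \<pi> u * \<pi> q) * (\<pi> q ^ j * \<pi> (cs ! j))" by (rule dvd_mult2)
    moreover have "int p ^ b dvd \<pi> (fst (scale R cs q ?u) ! j) - \<pi> ?u * \<pi> q ^ j * \<pi> (cs ! j)"
      using IH(3)[of j] that Suc by simp
    ultimately have "int p ^ b dvd (\<pi> (fst (scale R cs q ?u) ! j) - \<pi> ?u * \<pi> q ^ j * \<pi> (cs ! j))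
      + (\<pi> ?u - \<pi> u * \<pi> q) * (\<pi> q ^ j * \<pi> (cs ! j))"
      by (simp only: dvd_add)
    then show ?thesis using Suc by (simp add: algebra_simps)
  qed
  then show ?case using IH closed by (simp add: counted_simps)
qed

lemma substitute_truncated_correct:
  fixes f x q n
  assumes "set f \<subseteq> carrier R"
  defines "h \<equiv> fst (substitute_truncated R f (\<iota> x) (\<iota> q) n)"
  shows "set h \<subseteq> carrier R" "length h = Suc n"
    and "\<forall>k\<le>n. int p ^ b dvd \<pi> (h ! k) - coeff (pcompose (Pi f) [:x, q:]) k"
    and "snd (substitute_truncated R f (\<iota> x) (\<iota> q) n) = Suc n * (2 * length f) + 2 * Suc n"
proof -
  let ?t = "fst (taylor R f (\<iota> x) n)"
  note t = taylor_correct[OF assms(1) \<iota>_closed[of x], of n]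
  have tc: "set ?t \<subseteq> carrier R" using t by blast
  note s = scale_correct[OF tc \<iota>_closed[of q] \<iota>_closed[of 1]]
  have eq: "substitute_truncated R f (\<iota> x) (\<iota> q) n =
     (fst (scale R ?t (\<iota> q) (\<iota> 1)), snd (taylor R f (\<iota> x) n) + snd (scale R ?t (\<iota> q) (\<iota> 1)))"
    by (simp add: substitute_truncated_def bind_counted_def one_eq)
  show "set h \<subseteq> carrier R" "length h = Suc n"
    and "snd (substitute_truncated R f (\<iota> x) (\<iota> q) n) = Suc n * (2 * length f) + 2 * Suc n"
    using s t by (auto simp: h_def eq)
  show "\<forall>k\<le>n. int p ^ b dvd \<pi> (h ! k) - coeff (pcompose (Pi f) [:x, q:]) k"
  proof (intro allI impI)
    fix k assume k: "k \<le> n"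
    let ?c = "coeff (pcompose (Pi f) [:x, 1:]) k"
    have "icong pb 0 (pcompose (Pi f) [:\<pi> (\<iota> x), 1:]) (pcompose (Pi f) [:x, 1:])"
      by (intro icong_pcompose_right icong_pCons_cong icong_refl) (simp add: \<pi>_\<iota> mod_pb_dvd)
    then have "int p ^ b dvd coeff (pcompose (Pi f) [:\<pi> (\<iota> x), 1:]) k - ?c" by (rule coeff_icong_0)
    moreover have "int p ^ b dvd \<pi> (?t ! k) - coeff (pcompose (Pi f) [:\<pi> (\<iota> x), 1:]) k" using t k by blast
    ultimately have 1: "[\<pi> (?t ! k) = ?c] (mod int p ^ b)"
      unfolding cong_iff_dvd_diff[symmetric] by (rule cong_trans[rotated])
    have "[\<pi> (h ! k) = \<pi> (\<iota> 1) * \<pi> (\<iota> q) ^ k * \<pi> (?t ! k)] (mod int p ^ b)"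
      using s t k by (simp add: cong_iff_dvd_diff h_def eq)
    also have "[\<pi> (\<iota> 1) * \<pi> (\<iota> q) ^ k * \<pi> (?t ! k) = 1 * q ^ k * ?c] (mod int p ^ b)"
      by (intro cong_mult cong_pow 1) (simp_all add: \<pi>_\<iota>)
    finally show "int p ^ b dvd \<pi> (h ! k) - coeff (pcompose (Pi f) [:x, q:]) k"
      by (simp add: cong_iff_dvd_diff coeff_pcompose_affine[of _ _ q])
  qed
qed

lemma strassman_count_eq:
  assumes "set h \<subseteq> carrier R" "length h = Suc n" "last_minimal p (\<lambda>k. \<pi> (h ! k)) n l v" "v < b"
  shows "strassman_count p R h = l"
proof -
  have c: "h ! k \<in> carrier R" if "k \<le> n" for k using that assms(1,2) by (auto simp: subset_iff)
  note lm = assms(3)[unfolded last_minimal_def]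
  have le: "padic_abs p R (h ! k) \<le> 1 / real p ^ v" if "k \<le> n" for k
    using lm that assms(4) abs_le_iff[OF c[OF that], of v] by auto
  have l: "padic_abs p R (h ! l) = 1 / real p ^ v"
    using lm assms(4) by (intro abs_eq c) auto
  have "padic_abs p R (h ! k) < 1 / real p ^ v" if "l < k" "k \<le> n" for k
  proof -
    have "padic_abs p R (h ! k) \<le> 1 / real p ^ Suc v"
      using lm that assms(4) abs_le_iff[OF c[OF that(2)], of "Suc v"] by auto
    also have "\<dots> < 1 / real p ^ v" using real_p_gt_1 by (simp add: field_simps)
    finally show ?thesis .
  qed
  then have gt: "k \<le> l" if "k \<le> n" "\<forall>j<k. padic_abs p R (h ! j) \<le> padic_abs p R (h ! k)" for k
    using that l by (metis not_le)
  show ?thesis unfolding strassman_count_def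
  proof (rule Max_eqI)
    show "finite {k. k < length h \<and> (\<forall>j<k. padic_abs p R (h ! j) \<le> padic_abs p R (h ! k))}" by simp
    show "l \<in> {k. k < length h \<and> (\<forall>j<k. padic_abs p R (h ! j) \<le> padic_abs p R (h ! k))}"
      using lm le l assms(2) by auto
    show "k \<le> l" if "k \<in> {k. k < length h \<and> (\<forall>j<k. padic_abs p R (h ! j) \<le> padic_abs p R (h ! k))}" for k
      using that gt assms(2) by auto
  qed
qed

text \<open>Modulo \<open>p ^ b\<close> a quotient by \<open>h ! l\<close> is determined only modulo
  \<open>p ^ (b - v)\<close>, so the defining equation is all that can be said about it.\<close>

lemma normalized_correct:
  assumes "set h \<subseteq> carrier R" "length h = Suc n" "last_minimal p (\<lambda>k. \<pi> (h ! k)) n l v" "v < b"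
  defines "g \<equiv> fst (normalized R h l)"
  shows "set g \<subseteq> carrier R" "length g = Suc l" "snd (normalized R h l) = Suc l"
    and "k \<le> l \<Longrightarrow> int p ^ b dvd \<pi> (g ! k) * \<pi> (h ! l) - \<pi> (h ! k)"
proof -
  have c: "h ! k \<in> carrier R" if "k \<le> n" for k using that assms(1,2) by (auto simp: subset_iff)
  note lm = assms(3)[unfolded last_minimal_def]
  have q: "quot R (h ! k) (h ! l) \<in> carrier R \<and> quot R (h ! k) (h ! l) \<otimes>\<^bsub>R\<^esub> (h ! l) = h ! k" if "k \<le> n" for k
  proof -
    have "\<exists>z \<in> carrier R. z \<otimes>\<^bsub>R\<^esub> (h ! l) = h ! k"
      using lm that by (intro quotient_exists[OF _ _ assms(4)] c) auto
    then show ?thesis unfolding quot_def by (intro someI_ex[where P = "\<lambda>z. z \<in> carrier R \<and> _ z"]) auto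
  qed
  have g: "g = map (\<lambda>c. quot R c (h ! l)) (take (Suc l) h)"
    by (simp add: g_def normalized_def fst_map_counted counted_simps)
  have gk: "g ! k = quot R (h ! k) (h ! l)" if "k \<le> l" for k
    using that lm assms(2) by (simp add: g)
  show len: "length g = Suc l" "snd (normalized R h l) = Suc l"
    using lm assms(2) by (simp_all add: g normalized_def snd_map_counted counted_simps sum_list_triv)
  show "set g \<subseteq> carrier R"
  proof
    fix z assume "z \<in> set g"
    then obtain k where "k \<le> l" "z = g ! k" using len(1) by (auto simp: in_set_conv_nth less_Suc_eq_le)
    then show "z \<in> carrier R" using gk q lm by auto
  qed
  show "int p ^ b dvd \<pi> (g ! k) * \<pi> (h ! l) - \<pi> (h ! k)" if "k \<le> l"
  proof -
    have kn: "k \<le> n" using that lm by simp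
    have "\<pi> (h ! k) = (\<pi> (g ! k) * \<pi> (h ! l)) mod int p ^ b"
      using q[OF kn] c[of l] lm gk[OF that] by (metis \<pi>_mult)
    then show ?thesis by (metis dvd_diff_commute mod_pb_dvd)
  qed
qed

text \<open>Repeated division by \<open>T - a\<close> reads off the Taylor coefficients at
  \<open>a\<close> until one is a unit modulo \<open>p\<close>. The division that finds the unit is
  charged as well, unless the cap \<open>n\<close> ends the search before.\<close>

lemma root_multiplicity_correct:
  fixes g n and a :: nat
  assumes "set g \<subseteq> carrier R"
  defines "c \<equiv> \<lambda>g k. coeff (pcompose (Pi g) [:int a, 1:]) k"
  shows "fst (root_multiplicity p R g a n) \<le> n
    \<and> (\<forall>k<fst (root_multiplicity p R g a n). int p dvd c g k)
    \<and> (fst (root_multiplicity p R g a n) < n \<longrightarrow> \<not> int p dvd c g (fst (root_multiplicity p R g a n)))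
    \<and> snd (root_multiplicity p R g a n) = (fst (root_multiplicity p R g a n)
        + (if fst (root_multiplicity p R g a n) < n then 1 else 0)) * (2 * length g + 1)"
  using assms(1)
proof (induction n arbitrary: g)
  case 0
  then show ?case by (simp add: counted_simps)
next
  case (Suc n)
  obtain q r where qr: "fst (synthetic_division R g (nat_in R a)) = (q, r)"
    by (cases "fst (synthetic_division R g (nat_in R a))")
  note sd = synthetic_division_correct[OF Suc.prems \<iota>_closed[of "int a"], folded nat_in_eq, unfolded qr fst_conv snd_conv]
  have pb: "int p dvd int p ^ b" using b by simp
  have "int p ^ b dvd \<pi> (nat_in R a) - int a" by (simp add: nat_in_eq \<pi>_\<iota> mod_pb_dvd)
  then have "int p ^ b dvd - \<pi> (nat_in R a) - (- int a)" by (simp add: dvd_diff_commute)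
  then have "icong pb 0 [:- \<pi> (nat_in R a), 1:] [:- int a, 1:]"
    by (rule icong_pCons_cong[OF _ icong_refl])
  then have "icong pb 0 ([:- \<pi> (nat_in R a), 1:] * Pi q + [:\<pi> r:]) ([:- int a, 1:] * Pi q + [:\<pi> r:])"
    by (intro icong_add icong_mult icong_refl)
  then have "icong pb 0 (Pi g) ([:- int a, 1:] * Pi q + [:\<pi> r:])"
    using sd icong_trans by blast
  from pcompose_synthetic_division[OF this]
  have "int p ^ b dvd c g k - coeff (pCons (\<pi> r) (pcompose (Pi q) [:int a, 1:])) k" for k
    unfolding c_def by (rule coeff_icong_0)
  then have "int p dvd c g k - coeff (pCons (\<pi> r) (pcompose (Pi q) [:int a, 1:])) k" for k
    using pb dvd_trans by blast
  then have ck: "int p dvd c g k \<longleftrightarrow> int p dvd coeff (pCons (\<pi> r) (pcompose (Pi q) [:int a, 1:])) k" for k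
    by (metis diff_add_cancel dvd_add_right_iff)
  have c0: "int p dvd c g 0 \<longleftrightarrow> int p dvd \<pi> r" and cS: "int p dvd c g (Suc k) \<longleftrightarrow> int p dvd c q k" for k
    using ck[of 0] ck[of "Suc k"] by (simp_all add: c_def)
  have r: "padic_abs p R r < 1 \<longleftrightarrow> int p dvd \<pi> r" using sd by (intro abs_less_1_iff) blast
  have "set q \<subseteq> carrier R" using sd by blast
  note IH = Suc.IH[OF this]
  show ?case
  proof (cases "int p dvd \<pi> r")
    case False
    then have "root_multiplicity p R g a (Suc n) = (0, snd (synthetic_division R g (nat_in R a)) + 1)"
      using r by (simp add: counted_simps qr)
    then show ?thesis using False c0 sd by simp
  next
    case True
    let ?k = "fst (root_multiplicity p R q a n)"
    have rm: "root_multiplicity p R g a (Suc n) =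
        (Suc ?k, snd (synthetic_division R g (nat_in R a)) + (1 + snd (root_multiplicity p R q a n)))"
      using r True by (simp add: counted_simps qr)
    have "int p dvd c g k" if "k < Suc ?k" for k
      using that True c0 cS IH by (cases k) auto
    then show ?thesis using IH cS sd unfolding rm by (simp add: algebra_simps)
  qed
qed

end

section \<open>The ring of p-adic integers\<close>

lemma padic_int_simps:
  "monoid.mult (padic_int p) x y = (\<lambda>n. (x n * y n) mod int p ^ n)"
  "ring.add (padic_int p) x y = (\<lambda>n. (x n + y n) mod int p ^ n)"
  "\<zero>\<^bsub>padic_int p\<^esub> = (\<lambda>n. 0)"
  "\<one>\<^bsub>padic_int p\<^esub> = (\<lambda>n. 1 mod int p ^ n)"
  by (simp_all add: padic_int_def)

lemma padic_carrier_iff: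
  "x \<in> carrier (padic_int p) \<longleftrightarrow> (\<forall>n. 0 \<le> x n \<and> x n < int p ^ n \<and> x (Suc n) mod int p ^ n = x n)"
  by (simp add: padic_int_def)

lemma padic_mod: "x \<in> carrier (padic_int p) \<Longrightarrow> n \<le> m \<Longrightarrow> x m mod int p ^ n = x n"
proof (induction m)
  case (Suc m)
  show ?case
  proof (cases "n = Suc m")
    case True
    show ?thesis unfolding True using Suc.prems
      by (intro mod_pos_pos_trivial) (auto simp: padic_carrier_iff simp del: power_Suc)
  next
    case False
    then have "n \<le> m" using Suc.prems by simp
    have "x (Suc m) mod int p ^ n = x (Suc m) mod int p ^ m mod int p ^ n"
      using \<open>n \<le> m\<close> by (simp add: mod_mod_cancel le_imp_power_dvd)
    also have "\<dots> = x m mod int p ^ n" using Suc.prems(1) by (simp add: padic_carrier_iff)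
    finally show ?thesis using Suc.IH Suc.prems \<open>n \<le> m\<close> by simp
  qed
next
  case 0
  then have "0 \<le> x 0" "x 0 < int p ^ 0" by (simp_all only: padic_carrier_iff)
  then show ?case using 0 by simp
qed

lemma padic_range: "x \<in> carrier (padic_int p) \<Longrightarrow> 0 \<le> x n \<and> x n < int p ^ n"
  by (simp add: padic_carrier_iff)

text \<open>Elements may be given by unreduced representatives; membership then is a divisibility of
  consecutive differences, which the ring operations preserve.\<close>

lemma padic_carrierI:
  assumes "p > 0" "\<And>n. int p ^ n dvd s (Suc n) - s n"
  shows "(\<lambda>n. s n mod int p ^ n) \<in> carrier (padic_int p)"
  unfolding padic_carrier_iff
proof (intro allI conjI)
  fix n
  show "0 \<le> s n mod int p ^ n" "s n mod int p ^ n < int p ^ n" using assms(1) by simp_all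
  have "s (Suc n) mod int p ^ Suc n mod int p ^ n = s (Suc n) mod int p ^ n"
    by (rule mod_mod_cancel) simp
  also have "\<dots> = s n mod int p ^ n" using assms(2)[of n] by (simp only: mod_eq_dvd_iff)
  finally show "s (Suc n) mod int p ^ Suc n mod int p ^ n = s n mod int p ^ n" .
qed

lemma padic_step_dvd: "x \<in> carrier (padic_int p) \<Longrightarrow> n \<le> m \<Longrightarrow> int p ^ n dvd x m - x n"
  using padic_mod[of x p n m] padic_mod[of x p n n] by (simp add: mod_eq_dvd_iff[symmetric])

lemma padic_of_int_closed: "p > 0 \<Longrightarrow> padic_of_int p i \<in> carrier (padic_int p)"
  unfolding padic_of_int_def by (rule padic_carrierI) auto

lemma padic_add_closed:
  assumes "p > 0" "x \<in> carrier (padic_int p)" "y \<in> carrier (padic_int p)"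
  shows "x \<oplus>\<^bsub>padic_int p\<^esub> y \<in> carrier (padic_int p)"
  unfolding padic_int_simps
proof (rule padic_carrierI[OF assms(1)])
  fix n
  have "int p ^ n dvd (x (Suc n) - x n) + (y (Suc n) - y n)"
    using assms by (intro dvd_add padic_step_dvd) auto
  then show "int p ^ n dvd x (Suc n) + y (Suc n) - (x n + y n)" by (simp add: algebra_simps)
qed

lemma padic_mult_closed:
  assumes "p > 0" "x \<in> carrier (padic_int p)" "y \<in> carrier (padic_int p)"
  shows "x \<otimes>\<^bsub>padic_int p\<^esub> y \<in> carrier (padic_int p)"
  unfolding padic_int_simps
proof (rule padic_carrierI[OF assms(1)])
  fix n
  have "int p ^ n dvd (x (Suc n) - x n) * y (Suc n) + x n * (y (Suc n) - y n)"
    using assms by (intro dvd_add dvd_mult2 dvd_mult padic_step_dvd) auto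
  then show "int p ^ n dvd x (Suc n) * y (Suc n) - x n * y n" by (simp add: algebra_simps)
qed

text \<open>The inverse is a definite description, so uniqueness is shown besides existence.\<close>

lemma padic_uminus:
  assumes "p > 0" "y \<in> carrier (padic_int p)"
  shows "a_inv (padic_int p) y = (\<lambda>n. (- y n) mod int p ^ n)"
proof -
  have closed: "(\<lambda>n. (- y n) mod int p ^ n) \<in> carrier (padic_int p)"
  proof (rule padic_carrierI[OF assms(1)])
    fix n show "int p ^ n dvd - y (Suc n) - - y n"
      using padic_step_dvd[OF assms(2), of n "Suc n"] by (simp add: dvd_diff_commute)
  qed
  show ?thesis
    unfolding a_inv_def m_inv_def
  proof (rule the_equality)
    show "(\<lambda>n. - y n mod int p ^ n) \<in> carrier (add_monoid (padic_int p)) \<and>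
      y \<otimes>\<^bsub>add_monoid (padic_int p)\<^esub> (\<lambda>n. - y n mod int p ^ n) = \<one>\<^bsub>add_monoid (padic_int p)\<^esub> \<and>
      (\<lambda>n. - y n mod int p ^ n) \<otimes>\<^bsub>add_monoid (padic_int p)\<^esub> y = \<one>\<^bsub>add_monoid (padic_int p)\<^esub>"
      using closed by (simp add: padic_int_simps mod_simps)
  next
    fix z
    assume z: "z \<in> carrier (add_monoid (padic_int p)) \<and>
      y \<otimes>\<^bsub>add_monoid (padic_int p)\<^esub> z = \<one>\<^bsub>add_monoid (padic_int p)\<^esub> \<and>
      z \<otimes>\<^bsub>add_monoid (padic_int p)\<^esub> y = \<one>\<^bsub>add_monoid (padic_int p)\<^esub>"
    show "z = (\<lambda>n. - y n mod int p ^ n)"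
    proof
      fix n
      have "(\<lambda>n. (z n + y n) mod int p ^ n) = (\<lambda>n. 0)" using z by (simp add: padic_int_simps)
      from fun_cong[OF this, of n] have "(z n + y n) mod int p ^ n = 0" .
      then have "int p ^ n dvd z n - (- y n)" by (simp add: dvd_eq_mod_eq_0)
      then have "z n mod int p ^ n = (- y n) mod int p ^ n" by (simp only: mod_eq_dvd_iff)
      then show "z n = (- y n) mod int p ^ n" using z padic_range[of z p n] by simp
    qed
  qed
qed

lemma padic_minus:
  assumes "p > 0" "y \<in> carrier (padic_int p)"
  shows "x \<ominus>\<^bsub>padic_int p\<^esub> y = (\<lambda>n. (x n - y n) mod int p ^ n)"
  unfolding a_minus_def padic_uminus[OF assms] padic_int_simps by (simp add: mod_add_right_eq)

lemma padic_minus_closed: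
  assumes "p > 0" "x \<in> carrier (padic_int p)" "y \<in> carrier (padic_int p)"
  shows "x \<ominus>\<^bsub>padic_int p\<^esub> y \<in> carrier (padic_int p)"
  unfolding padic_minus[OF assms(1,3)]
proof (rule padic_carrierI[OF assms(1)])
  fix n
  have "int p ^ n dvd (x (Suc n) - x n) - (y (Suc n) - y n)"
    using assms by (intro dvd_diff padic_step_dvd) auto
  then show "int p ^ n dvd x (Suc n) - y (Suc n) - (x n - y n)" by (simp add: algebra_simps)
qed

lemma nat_in_Suc: "nat_in R (Suc n) = nat_in R n \<oplus>\<^bsub>R\<^esub> \<one>\<^bsub>R\<^esub>" and nat_in_0: "nat_in R 0 = \<zero>\<^bsub>R\<^esub>"
  by (simp_all add: nat_in_def add_pow_def nat_pow_def)

lemma nat_in_padic: "nat_in (padic_int p) n = padic_of_int p (int n)"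
  by (induction n) (simp_all add: nat_in_0 nat_in_Suc padic_int_simps padic_of_int_def mod_simps add.commute)

lemma nat_in_residue_ring: "m > 0 \<Longrightarrow> nat_in (residue_ring m) n = int n mod m"
  by (induction n) (simp_all add: nat_in_0 nat_in_Suc mod_simps add.commute)

section \<open>Absolute values and division\<close>

lemma Greatest_downward:
  fixes D :: "nat \<Rightarrow> bool"
  assumes "D 0" "\<And>m n. D n \<Longrightarrow> m \<le> n \<Longrightarrow> D m" "\<not> D N"
  shows "D e \<longleftrightarrow> e \<le> (GREATEST n. D n)"
proof
  have bound: "y \<le> N" if "D y" for y using assms(2)[OF that, of N] assms(3) by (meson le_cases)
  show "e \<le> (GREATEST n. D n)" if "D e" using that bound by (rule Greatest_le_nat)
  show "D e" if "e \<le> (GREATEST n. D n)"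
    using assms(2)[OF GreatestI_nat[of D, OF assms(1) bound] that] .
qed

text \<open>\<open>D n\<close> is a concrete form of divisibility by \<open>p ^ n\<close>, different
  for each of the two rings; \<open>N\<close> bounds the exponents, so that a greatest one
  exists.\<close>

lemma padic_abs_le_iff_aux:
  assumes "p > 1" "x \<noteq> \<zero>\<^bsub>R\<^esub>" "\<And>n. nat_in R (p ^ n) divides\<^bsub>R\<^esub> x \<longleftrightarrow> D n"
    and "D 0" "\<And>m n. D n \<Longrightarrow> m \<le> n \<Longrightarrow> D m" "\<not> D N"
  shows "padic_abs p R x \<le> 1 / real p ^ e \<longleftrightarrow> D e"
proof -
  have "padic_abs p R x = 1 / real p ^ (GREATEST n. D n)"
    using assms(2,3) by (simp add: padic_abs_def)
  also have "\<dots> \<le> 1 / real p ^ e \<longleftrightarrow> e \<le> (GREATEST n. D n)"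
    using assms(1) by (simp add: field_simps power_increasing_iff)
  also have "\<dots> \<longleftrightarrow> D e" by (rule Greatest_downward[of D, OF assms(4-6), symmetric])
  finally show ?thesis .
qed

lemma padic_abs_values: "padic_abs p R x = 0 \<or> (\<exists>n. padic_abs p R x = 1 / real p ^ n)"
  by (auto simp: padic_abs_def)

lemma padic_divides_power:
  assumes "p > 0" "x \<in> carrier (padic_int p)"
  shows "nat_in (padic_int p) (p ^ e) divides\<^bsub>padic_int p\<^esub> x \<longleftrightarrow> x e = 0"
proof
  assume "nat_in (padic_int p) (p ^ e) divides\<^bsub>padic_int p\<^esub> x"
  then obtain c where "x = nat_in (padic_int p) (p ^ e) \<otimes>\<^bsub>padic_int p\<^esub> c" by (auto simp: factor_def)
  then show "x e = 0" by (simp add: nat_in_padic padic_int_simps padic_of_int_def)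
next
  assume x: "x e = 0"
  have dvd: "int p ^ e dvd x (n + e)" for n
    using padic_mod[OF assms(2), of e "n + e"] x by (simp add: dvd_eq_mod_eq_0)
  \<comment> \<open>Division by \<open>p ^ e\<close> consumes \<open>e\<close> digits, so the
    \<open>n\<close>-th residue of the quotient comes from \<open>x\<close> modulo
    \<open>p ^ (n + e)\<close>.\<close>
  define s where "s n = x (n + e) div int p ^ e" for n
  have s: "x (n + e) = int p ^ e * s n" for n unfolding s_def using dvd by simp
  have pe: "int p ^ e \<noteq> 0" using assms(1) by simp
  have "int p ^ n dvd s (Suc n) - s n" for n
  proof -
    have "int p ^ (n + e) dvd int p ^ e * (s (Suc n) - s n)"
      using padic_step_dvd[OF assms(2), of "n + e" "Suc n + e"] unfolding s by (simp add: right_diff_distrib)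
    then have "int p ^ e * int p ^ n dvd int p ^ e * (s (Suc n) - s n)" by (simp add: power_add mult.commute)
    then show ?thesis by (simp only: dvd_times_left_cancel_iff[OF pe])
  qed
  then have c: "(\<lambda>n. s n mod int p ^ n) \<in> carrier (padic_int p)" by (rule padic_carrierI[OF assms(1)])
  have "x = nat_in (padic_int p) (p ^ e) \<otimes>\<^bsub>padic_int p\<^esub> (\<lambda>n. s n mod int p ^ n)"
  proof
    fix n
    have "x n = int p ^ e * s n mod int p ^ n"
      using padic_mod[OF assms(2), of n "n + e"] s by simp
    then show "x n = (nat_in (padic_int p) (p ^ e) \<otimes>\<^bsub>padic_int p\<^esub> (\<lambda>n. s n mod int p ^ n)) n"
      by (simp add: nat_in_padic padic_int_simps padic_of_int_def mod_simps)
  qed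
  with c show "nat_in (padic_int p) (p ^ e) divides\<^bsub>padic_int p\<^esub> x" unfolding factor_def by blast
qed

lemma padic_abs_le_iff:
  assumes "p > 1" "x \<in> carrier (padic_int p)"
  shows "padic_abs p (padic_int p) x \<le> 1 / real p ^ e \<longleftrightarrow> x e = 0"
proof (cases "x = \<zero>\<^bsub>padic_int p\<^esub>")
  case True
  then show ?thesis using assms(1) by (simp add: padic_abs_def padic_int_simps)
next
  case False
  then obtain N where "x N \<noteq> 0" by (auto simp: padic_int_simps)
  moreover have "x 0 = 0" using padic_range[OF assms(2), of 0] by simp
  moreover have "x m = 0" if "x n = 0" "m \<le> n" for m n
    using padic_mod[OF assms(2) that(2)] that(1) by simp
  ultimately show ?thesis
    using assms False by (intro padic_abs_le_iff_aux padic_divides_power) auto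
qed

lemma int_prime_power_inverse:
  assumes "prime p" "\<not> int p dvd u"
  obtains i where "[u * i = 1] (mod int p ^ n)"
proof -
  have "coprime u (int p ^ n)"
    using assms by (simp add: prime_imp_coprime_int coprime_commute)
      (metis assms coprime_commute coprime_power_right_iff prime_imp_coprime prime_nat_int_transfer)
  then show ?thesis using that cong_solve_coprime_int by blast
qed

text \<open>Removing \<open>p ^ v\<close> from both elements leaves a unit \<open>u\<close> as
  denominator, which is invertible modulo each power of \<open>p\<close>. The last conclusion says
  that the quotient loses only \<open>v\<close> digits of divisibility; it controls the size of the
  Newton steps.\<close>

lemma padic_division:
  assumes p: "prime p" and x: "x \<in> carrier (padic_int p)" and y: "y \<in> carrier (padic_int p)"
    and v: "y v = 0" "y (Suc v) \<noteq> 0" "x v = 0"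
  obtains z where "z \<in> carrier (padic_int p)" "z \<otimes>\<^bsub>padic_int p\<^esub> y = x" "\<And>e. x (v + e) = 0 \<Longrightarrow> z e = 0"
proof -
  have p0: "p > 0" and p1: "int p > 1" using prime_gt_1_nat[OF p] by simp_all
  have pv: "int p ^ v \<noteq> 0" using p0 by simp
  have dvd: "int p ^ v dvd w (v + n)" if "w \<in> carrier (padic_int p)" "w v = 0" for w n
    using padic_mod[OF that(1), of v "v + n"] that(2) by (simp add: dvd_eq_mod_eq_0)
  define t where "t n = x (v + n) div int p ^ v" for n
  define u where "u n = y (v + n) div int p ^ v" for n
  have t: "x (v + n) = int p ^ v * t n" for n unfolding t_def using dvd[OF x v(3)] by simp
  have u: "y (v + n) = int p ^ v * u n" for n unfolding u_def using dvd[OF y v(1)] by simp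
  have cancel: "int p ^ n dvd A" if "int p ^ (v + n) dvd int p ^ v * A" for A n
    using that by (simp only: power_add dvd_times_left_cancel_iff[OF pv])
  have step: "int p ^ n dvd s (Suc n) - s n"
    if "w \<in> carrier (padic_int p)" "\<And>n. w (v + n) = int p ^ v * s n" for w s n
  proof (rule cancel)
    have "v + n \<le> v + Suc n" by simp
    from padic_step_dvd[OF that(1) this] show "int p ^ (v + n) dvd int p ^ v * (s (Suc n) - s n)"
      unfolding that(2) by (simp only: right_diff_distrib)
  qed
  have unit: "\<not> int p dvd u n" if "n > 0" for n
  proof
    assume "int p dvd u n"
    then have "int p ^ Suc v dvd y (v + n)" unfolding u by (simp add: mult.commute mult_dvd_mono)
    then show False using padic_mod[OF y, of "Suc v" "v + n"] that v(2) by simp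
  qed
  have "\<exists>z. [z * u n = t n] (mod int p ^ n)" for n
  proof (cases "n = 0")
    case False
    then obtain i where "[u n * i = 1] (mod int p ^ n)" using int_prime_power_inverse[OF p unit] by blast
    from cong_mult[OF cong_refl[of "t n"] this] show ?thesis
      by (intro exI[of _ "t n * i"]) (simp add: ac_simps)
  qed simp
  then obtain z where z: "\<And>n. [z n * u n = t n] (mod int p ^ n)" by metis
  \<comment> \<open>The \<open>z n\<close> are chosen independently of each other; cancelling the
    unit \<open>u n\<close> makes them compatible.\<close>
  have unique: "int p ^ n dvd A" if "int p ^ n dvd A * u n" for A n
  proof (cases "n = 0")
    case False
    then obtain i where "[u n * i = 1] (mod int p ^ n)" using int_prime_power_inverse[OF p unit] by blast
    from cong_mult[OF cong_refl[of A] this] have "[A * u n * i = A] (mod int p ^ n)" by (simp add: ac_simps)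
    then show ?thesis using that by (meson cong_dvd_iff dvd_mult2)
  qed simp
  have "int p ^ n dvd z (Suc n) - z n" for n
  proof (rule unique)
    have "int p ^ Suc n dvd z (Suc n) * u (Suc n) - t (Suc n)"
      using z[of "Suc n"] by (simp only: cong_iff_dvd_diff)
    then have d1: "int p ^ n dvd z (Suc n) * u (Suc n) - t (Suc n)"
      by (rule dvd_trans[rotated]) (simp add: le_imp_power_dvd)
    have d2: "int p ^ n dvd z (Suc n) * (u (Suc n) - u n)" using step[OF y u] by simp
    have d3: "int p ^ n dvd t (Suc n) - t n" by (rule step[OF x t])
    have d4: "int p ^ n dvd z n * u n - t n" using z[of n] by (simp add: cong_iff_dvd_diff)
    have "int p ^ n dvd (z (Suc n) * u (Suc n) - t (Suc n)) - z (Suc n) * (u (Suc n) - u n)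
      + (t (Suc n) - t n) - (z n * u n - t n)"
      by (rule dvd_diff[OF dvd_add[OF dvd_diff[OF d1 d2] d3] d4])
    then show "int p ^ n dvd (z (Suc n) - z n) * u n" by (simp add: algebra_simps)
  qed
  then have closed: "(\<lambda>n. z n mod int p ^ n) \<in> carrier (padic_int p)" by (rule padic_carrierI[OF p0])
  show ?thesis
  proof (rule that[OF closed])
    show "(\<lambda>n. z n mod int p ^ n) \<otimes>\<^bsub>padic_int p\<^esub> y = x"
    proof
      fix n
      have "int p ^ n dvd int p ^ v * (z n * u n - t n)" using z[of n] by (simp add: cong_iff_dvd_diff)
      then have d1: "int p ^ n dvd z n * y (v + n) - x (v + n)" unfolding t u by (simp add: algebra_simps)
      have d2: "int p ^ n dvd z n * (y (v + n) - y n)" using padic_step_dvd[OF y, of n "v + n"] by simp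
      have d3: "int p ^ n dvd x (v + n) - x n" using padic_step_dvd[OF x, of n "v + n"] by simp
      have "int p ^ n dvd (z n * y (v + n) - x (v + n)) - z n * (y (v + n) - y n) + (x (v + n) - x n)"
        by (rule dvd_add[OF dvd_diff[OF d1 d2] d3])
      then have "int p ^ n dvd z n * y n - x n" by (simp add: algebra_simps)
      then have "(z n * y n) mod int p ^ n = x n mod int p ^ n" by (simp only: mod_eq_dvd_iff)
      also have "\<dots> = x n" using padic_mod[OF x, of n n] by simp
      finally show "((\<lambda>n. z n mod int p ^ n) \<otimes>\<^bsub>padic_int p\<^esub> y) n = x n"
        by (simp add: padic_int_simps mod_simps)
    qed
    fix e assume "x (v + e) = 0"
    then have "t e = 0" using t[of e] pv by (metis mult_eq_0_iff)
    then have "[z e * u e = 0] (mod int p ^ e)" using z[of e] by simp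
    then have "int p ^ e dvd z e * u e" by (simp only: cong_0_iff)
    from unique[OF this] show "z e mod int p ^ e = 0" by (rule dvd_imp_mod_0)
  qed
qed

lemma approx_ring_padic:
  assumes "prime p" "b > 0"
  shows "approx_ring p b (padic_int p) (\<lambda>x. x b) (padic_of_int p)"
proof -
  have p1: "p > 1" and p0: "p > 0" using prime_gt_1_nat[OF assms(1)] by simp_all
  show ?thesis
  proof
    fix x y v
    assume x: "x \<in> carrier (padic_int p)" and y: "y \<in> carrier (padic_int p)" and v: "v < b"
      and dvd: "int p ^ v dvd y b" "\<not> int p ^ Suc v dvd y b" "int p ^ v dvd x b"
    have "y v = 0" "x v = 0" "y (Suc v) \<noteq> 0"
      using padic_mod[OF y, of v b] padic_mod[OF x, of v b] padic_mod[OF y, of "Suc v" b] v dvd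
      by (auto simp del: power_Suc)
    then show "\<exists>z\<in>carrier (padic_int p). z \<otimes>\<^bsub>padic_int p\<^esub> y = x"
      using padic_division[OF assms(1) x y] by blast
  next
    fix x e assume x: "x \<in> carrier (padic_int p)" and e: "e \<le> b"
    show "padic_abs p (padic_int p) x \<le> 1 / real p ^ e \<longleftrightarrow> int p ^ e dvd x b"
      using padic_abs_le_iff[OF p1 x] padic_mod[OF x e] by (simp add: dvd_eq_mod_eq_0)
  next
    fix x y assume xy: "x \<in> carrier (padic_int p)" "y \<in> carrier (padic_int p)"
    then show "x \<ominus>\<^bsub>padic_int p\<^esub> y \<in> carrier (padic_int p)"
      by (rule padic_minus_closed[OF p0])
    show "(x \<ominus>\<^bsub>padic_int p\<^esub> y) b = (x b - y b) mod int p ^ b"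
      by (simp add: padic_minus[OF p0 xy(2)])
  qed (use assms p0 in \<open>auto simp: nat_in_padic padic_of_int_closed padic_add_closed padic_mult_closed
      padic_abs_values\<close>,
      auto simp: padic_int_simps padic_of_int_def mod_simps)
qed

text \<open>For \<open>n > b\<close> both sides fail: \<open>p ^ n\<close> is zero in the ring, and
  a nonzero least residue is not a multiple of \<open>p ^ b\<close>.\<close>

lemma residue_ring_divides_power:
  assumes "p > 1" "x \<in> {0..int p ^ b - 1}" "x \<noteq> 0"
  shows "nat_in (residue_ring (int p ^ b)) (p ^ n) divides\<^bsub>residue_ring (int p ^ b)\<^esub> x \<longleftrightarrow> int p ^ n dvd x"
proof
  have p0: "int p ^ b > 0" using assms(1) by simp
  assume "nat_in (residue_ring (int p ^ b)) (p ^ n) divides\<^bsub>residue_ring (int p ^ b)\<^esub> x"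
  then obtain c where c: "x = (int p ^ n * c) mod int p ^ b"
    using p0 by (auto simp: factor_def nat_in_residue_ring mod_simps)
  have "n \<le> b"
  proof (rule ccontr)
    assume "\<not> n \<le> b"
    then have "int p ^ b dvd int p ^ n * c" by (simp add: le_imp_power_dvd)
    then show False using c assms(3) by simp
  qed
  then have "int p ^ n dvd int p ^ b" by (rule le_imp_power_dvd)
  then show "int p ^ n dvd x" unfolding c by (simp add: dvd_mod_iff)
next
  have p0: "int p ^ b > 0" using assms(1) by simp
  assume "int p ^ n dvd x"
  then obtain c where c: "x = int p ^ n * c" by (rule dvdE)
  have "0 < x" using assms by simp
  then have "0 < c" using assms(1) c by (simp add: zero_less_mult_iff)
  have "c \<le> x" "int p ^ n \<le> x"
    unfolding c using \<open>0 < c\<close> assms(1) by (simp_all add: mult_le_cancel_left1 mult_le_cancel_right1)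
  then have "int p ^ n < int p ^ b" "c \<in> {0..int p ^ b - 1}"
    using \<open>0 < c\<close> assms(2) by (auto simp del: power_strict_increasing_iff)
  then have "int p ^ n mod int p ^ b = int p ^ n" "c \<in> {0..int p ^ b - 1}"
    by (auto intro: mod_pos_pos_trivial)
  then show "nat_in (residue_ring (int p ^ b)) (p ^ n) divides\<^bsub>residue_ring (int p ^ b)\<^esub> x"
    using p0 c assms(2) by (auto simp: factor_def nat_in_residue_ring intro!: bexI[of _ c])
qed

lemma approx_ring_residue_ring:
  assumes "prime p" "b > 0"
  shows "approx_ring p b (residue_ring (int p ^ b)) (\<lambda>x. x) (\<lambda>i. i mod int p ^ b)"
proof -
  have p1: "p > 1" using prime_gt_1_nat[OF assms(1)] .
  have m1: "int p ^ b > 1" using p1 assms(2) by (simp add: one_less_power)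
  then have m0: "int p ^ b > 0" by linarith
  show ?thesis
  proof
    fix x e assume x: "x \<in> carrier (residue_ring (int p ^ b))" and e: "e \<le> b"
    show "padic_abs p (residue_ring (int p ^ b)) x \<le> 1 / real p ^ e \<longleftrightarrow> int p ^ e dvd x"
    proof (cases "x = 0")
      case True
      then show ?thesis by (simp add: padic_abs_def)
    next
      case False
      have x': "x \<in> {0..int p ^ b - 1}" using x by simp
      have "\<not> int p ^ b dvd x"
        using x' False zdvd_imp_le[of "int p ^ b" x] by auto
      moreover have "int p ^ m dvd x" if "int p ^ n dvd x" "m \<le> n" for m n
        using that by (meson dvd_trans le_imp_power_dvd)
      ultimately show ?thesis
        using False by (intro padic_abs_le_iff_aux[OF p1] residue_ring_divides_power[OF p1 x']) auto
    qed
  next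
    fix x y v
    assume x: "x \<in> carrier (residue_ring (int p ^ b))" and y: "y \<in> carrier (residue_ring (int p ^ b))"
      and v: "v < b" and dvd: "int p ^ v dvd y" "\<not> int p ^ Suc v dvd y" "int p ^ v dvd x"
    obtain u where u: "y = int p ^ v * u" using dvd(1) by (rule dvdE)
    obtain t where t: "x = int p ^ v * t" using dvd(3) by (rule dvdE)
    have "\<not> int p dvd u" using dvd(2) unfolding u by auto
    then obtain i where i: "[u * i = 1] (mod int p ^ b)" using int_prime_power_inverse[OF assms(1)] by blast
    have "[t * i * y = x] (mod int p ^ b)"
      using cong_mult[OF cong_refl[of x] i] by (simp add: t u ac_simps)
    then have "(t * i * y) mod int p ^ b = x" using x by (simp add: cong_def)
    then show "\<exists>z\<in>carrier (residue_ring (int p ^ b)). z \<otimes>\<^bsub>residue_ring (int p ^ b)\<^esub> y = x"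
      using m0 by (intro bexI[of _ "(t * i) mod int p ^ b"]) (auto simp: mod_simps)
  next
    fix x y assume "x \<in> carrier (residue_ring (int p ^ b))" "y \<in> carrier (residue_ring (int p ^ b))"
    then show "x \<ominus>\<^bsub>residue_ring (int p ^ b)\<^esub> y = (x - y) mod int p ^ b"
      by (intro residue_ring_minus m1) simp
    then show "x \<ominus>\<^bsub>residue_ring (int p ^ b)\<^esub> y \<in> carrier (residue_ring (int p ^ b))"
      using m0 by simp
  qed (use assms m0 m1 in \<open>auto simp: nat_in_residue_ring padic_abs_values mod_simps\<close>)
qed

section \<open>The tree of discs\<close>

lemma cong_poly:
  fixes x y m :: int
  assumes "[x = y] (mod m)"
  shows "[poly P x = poly P y] (mod m)"
proof (induction P)
  case (pCons a P)
  show ?case using cong_add[OF cong_refl cong_mult[OF assms pCons.IH], of a] by simp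
qed simp

lemma fermat_inverse:
  fixes u :: int
  assumes "prime p" "\<not> int p dvd u"
  shows "int p dvd u * u ^ (p - 2) - 1"
proof -
  have p: "p = Suc (Suc (p - 2))" using prime_ge_2_nat[OF assms(1)] by simp
  have "u ^ p - u = u * (u * u ^ (p - 2) - 1)"
    by (subst p) (simp add: algebra_simps)
  then have "int p dvd u * (u * u ^ (p - 2) - 1)" using fermat_int[OF assms(1), of u] by simp
  then show ?thesis using assms by (simp add: prime_dvd_mult_iff)
qed

text \<open>The quotients of \<open>c k\<close> by \<open>c l\<close> modulo \<open>p\<close>, where
  the unit \<open>c l div p ^ v\<close> is inverted by Fermat's theorem, as its power
  \<open>p - 2\<close>. A formula in integers serves both rings.\<close>

definition residue_coeffs :: "nat \<Rightarrow> (nat \<Rightarrow> int) \<Rightarrow> nat \<Rightarrow> nat \<Rightarrow> int list" where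
  "residue_coeffs p c l v = map (\<lambda>k. (c k div int p ^ v * (c l div int p ^ v) ^ (p - 2)) mod int p) [0..<Suc l]"

lemma length_residue_coeffs [simp]: "length (residue_coeffs p c l v) = Suc l"
  by (simp add: residue_coeffs_def)

lemma residue_coeffs_dvd:
  assumes "prime p" "last_minimal p c n l v" "k \<le> l"
  shows "int p ^ Suc v dvd residue_coeffs p c l v ! k * c l - c k"
proof -
  note lm = assms(2)[unfolded last_minimal_def]
  obtain h where h: "c l = int p ^ v * h" using lm by (meson dvdE order_refl)
  obtain h' where h': "c k = int p ^ v * h'" using lm assms(3) by (meson dvdE order_trans)
  have pv: "int p ^ v \<noteq> 0" using prime_gt_0_nat[OF assms(1)] by simp
  have h_unit: "\<not> int p dvd h"
  proof
    assume "int p dvd h"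
    then have "int p ^ Suc v dvd c l" unfolding h by (simp add: mult.commute mult_dvd_mono)
    then show False using lm by blast
  qed
  have r: "residue_coeffs p c l v ! k = (h' * h ^ (p - 2)) mod int p"
    using assms(3) pv by (simp add: residue_coeffs_def h h' nth_append del: upt_Suc)
  have "int p dvd (residue_coeffs p c l v ! k - h' * h ^ (p - 2)) * h"
    unfolding r by (intro dvd_mult2) (simp add: mod_eq_dvd_iff[symmetric])
  moreover have "int p dvd h' * (h * h ^ (p - 2) - 1)"
    using fermat_inverse[OF assms(1) h_unit] by simp
  ultimately have "int p dvd (residue_coeffs p c l v ! k - h' * h ^ (p - 2)) * h + h' * (h * h ^ (p - 2) - 1)"
    by (rule dvd_add)
  then have "int p dvd residue_coeffs p c l v ! k * h - h'" by (simp add: algebra_simps)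
  then have "int p ^ v * int p dvd int p ^ v * (residue_coeffs p c l v ! k * h - h')" by simp
  then show ?thesis unfolding h h' by (simp add: algebra_simps)
qed

text \<open>A quotient of \<open>c k\<close> by \<open>c l\<close> up to \<open>p ^ Suc v\<close> is
  unique modulo \<open>p\<close>, since \<open>c l\<close> has valuation exactly \<open>v\<close>.
  For this reason the arbitrary choice in \<open>quot\<close> has no influence on a run.\<close>

lemma residue_coeffs_unique:
  assumes "prime p" "last_minimal p c n l v" "k \<le> l" "int p ^ Suc v dvd z * c l - c k"
  shows "z mod int p = residue_coeffs p c l v ! k"
proof -
  note lm = assms(2)[unfolded last_minimal_def]
  have pv: "int p ^ v \<noteq> 0" using prime_gt_0_nat[OF assms(1)] by simp
  let ?g = "residue_coeffs p c l v ! k"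
  obtain h where h: "c l = int p ^ v * h" using lm by (meson dvdE order_refl)
  have h_unit: "\<not> int p dvd h"
  proof
    assume "int p dvd h"
    then have "int p ^ Suc v dvd c l" unfolding h by (simp add: mult.commute mult_dvd_mono)
    then show False using lm by blast
  qed
  have "int p ^ Suc v dvd (z * c l - c k) - (?g * c l - c k)"
    using assms(4) residue_coeffs_dvd[OF assms(1-3)] by (rule dvd_diff)
  also have "(z * c l - c k) - (?g * c l - c k) = int p ^ v * ((z - ?g) * h)"
    by (simp add: h algebra_simps)
  finally have "int p ^ v * int p dvd int p ^ v * ((z - ?g) * h)" by (simp add: mult.commute)
  then have "int p dvd (z - ?g) * h" by (simp only: dvd_times_left_cancel_iff[OF pv])
  then have "int p dvd z - ?g" using h_unit assms(1) by (simp add: prime_dvd_mult_iff)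
  then have "z mod int p = ?g mod int p" by (simp only: mod_eq_dvd_iff)
  also have "\<dots> = ?g" using assms(3) by (simp add: residue_coeffs_def del: upt_Suc)
  finally show ?thesis .
qed

lemma set_residue_coeffs:
  assumes "p > 0"
  shows "set (residue_coeffs p c l v) \<subseteq> {0..int p - 1}"
proof -
  have "x mod int p \<in> {0..int p - 1}" for x using assms by simp
  then show ?thesis unfolding residue_coeffs_def set_map by blast
qed

lemma residue_coeffs_last:
  assumes "prime p" "last_minimal p c n l v"
  shows "residue_coeffs p c l v ! l = 1"
proof -
  have "1 mod int p = residue_coeffs p c l v ! l"
    by (rule residue_coeffs_unique[OF assms]) simp_all
  then show ?thesis using prime_gt_1_nat[OF assms(1)] by simp
qed

lemma monic_Poly_residue_coeffs:
  assumes "prime p" "last_minimal p c n l v"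
  shows "degree (Poly (residue_coeffs p c l v)) = l" "lead_coeff (Poly (residue_coeffs p c l v)) = 1"
proof -
  have c: "coeff (Poly (residue_coeffs p c l v)) l = 1"
    using residue_coeffs_last[OF assms] by (simp add: nth_default_def)
  then show "degree (Poly (residue_coeffs p c l v)) = l"
    by (intro antisym degree_le le_degree) (auto simp: nth_default_def)
  with c show "lead_coeff (Poly (residue_coeffs p c l v)) = 1" by simp
qed

definition node_poly :: "nat \<Rightarrow> int poly \<Rightarrow> nat \<Rightarrow> nat \<Rightarrow> int poly" where
  "node_poly p P s x = pcompose P [:int x, int p ^ s:]"

abbreviation taylor_coeff :: "int poly \<Rightarrow> nat \<Rightarrow> nat \<Rightarrow> int" where
  "taylor_coeff P x k \<equiv> coeff (pcompose P [:int x, 1:]) k"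

lemma coeff_node_poly: "coeff (node_poly p P s x) k = int p ^ (s * k) * taylor_coeff P x k"
  unfolding node_poly_def by (subst coeff_pcompose_affine) (simp add: power_mult)

lemma coeff_child: "coeff (node_poly p P (Suc s) (x + a * p ^ s)) k = int p ^ k * taylor_coeff (node_poly p P s x) a k"
proof -
  have "node_poly p P (Suc s) (x + a * p ^ s) = pcompose (node_poly p P s x) [:int a, int p:]"
    by (simp add: node_poly_def pcompose_assoc[symmetric] pcompose_pCons algebra_simps)
  then show ?thesis using coeff_pcompose_affine[of "node_poly p P s x" "int a" "int p" k] by simp
qed

section \<open>Counts, residues and multiplicities on one disc\<close>

context
  fixes p d :: nat and P :: "int poly"
begin

text \<open>The count together with the minimal valuation; on regular nodes the pair exists and is
  unique, elsewhere it is arbitrary.\<close>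

definition node_min :: "nat \<Rightarrow> nat \<Rightarrow> nat \<times> nat" where
  "node_min s x = (SOME (l, v). last_minimal p (coeff (node_poly p P s x)) d l v)"

definition node_count :: "nat \<Rightarrow> nat \<Rightarrow> nat" where
  "node_count s x = fst (node_min s x)"

definition node_residues :: "nat \<Rightarrow> nat \<Rightarrow> int list" where
  "node_residues s x = residue_coeffs p (coeff (node_poly p P s x)) (node_count s x) (snd (node_min s x))"

definition node_roots :: "nat \<Rightarrow> nat \<Rightarrow> nat set" where
  "node_roots s x = {a. a < p \<and> int p dvd poly (Poly (node_residues s x)) (int a)}"

text \<open>The multiplicity of \<open>a\<close> as a root of the residue polynomial, read off from
  the Taylor expansion; derivatives would not detect multiplicities of \<open>p\<close> and
  more.\<close>

definition node_mult :: "nat \<Rightarrow> nat \<Rightarrow> nat \<Rightarrow> nat" where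
  "node_mult s x a = (LEAST k. \<not> int p dvd taylor_coeff (Poly (node_residues s x)) a k)"

text \<open>The summands are 3 for the new center and power, the search for the multiplicity, the
  substitution, the pass for the count, and the normalization if the new disc is kept for
  refinement.\<close>

definition refine_cost :: "truncation \<Rightarrow> nat \<Rightarrow> nat \<Rightarrow> nat \<Rightarrow> nat" where
  "refine_cost tr s x a =
    (let l = node_count s x; m = node_mult s x a; l' = node_count (Suc s) (x + a * p ^ s);
         n = (case tr of At_Count \<Rightarrow> l | At_Multiplicity \<Rightarrow> m) in
     3 + (case tr of At_Count \<Rightarrow> 0 | At_Multiplicity \<Rightarrow> (m + (if m < l then 1 else 0)) * (2 * Suc l + 1))
     + (Suc n * (2 * Suc d) + 2 * Suc n) + Suc n + (if l' > 1 then Suc l' else 0))"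

definition regular_node :: "nat \<Rightarrow> nat \<Rightarrow> nat \<Rightarrow> bool" where
  "regular_node b s x \<longleftrightarrow> (\<exists>l v. last_minimal p (coeff (node_poly p P s x)) d l v \<and> v < b)"

lemma regular_nodeD:
  assumes "regular_node b s x"
  shows "last_minimal p (coeff (node_poly p P s x)) d (node_count s x) (snd (node_min s x))"
    "snd (node_min s x) < b"
proof -
  obtain l v where lv: "last_minimal p (coeff (node_poly p P s x)) d l v" "v < b"
    using assms by (auto simp: regular_node_def)
  obtain l' v' where eq: "node_min s x = (l', v')" by fastforce
  have "case node_min s x of (l, v) \<Rightarrow> last_minimal p (coeff (node_poly p P s x)) d l v"
    unfolding node_min_def by (rule someI[of _ "(l, v)"]) (use lv(1) in simp)
  then have 1: "last_minimal p (coeff (node_poly p P s x)) d l' v'" by (simp add: eq)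
  then show "last_minimal p (coeff (node_poly p P s x)) d (node_count s x) (snd (node_min s x))"
    by (simp add: node_count_def eq)
  from last_minimal_unique[OF 1 lv(1)] lv(2) show "snd (node_min s x) < b" by (simp add: eq)
qed

lemma node_count_le:
  assumes "regular_node b s x"
  shows "node_count s x \<le> d"
  using regular_nodeD(1)[OF assms] by (simp add: last_minimal_def)

text \<open>The coefficient at the count \<open>l\<close> is not divisible by
  \<open>p ^ Suc v\<close>, but on a disc of radius \<open>p ^ - s\<close> it carries the factor
  \<open>p ^ (s * l)\<close>.\<close>

lemma node_count_le_valuation:
  assumes "prime p" "regular_node b s x"
  shows "s * node_count s x \<le> snd (node_min s x)"
proof (rule ccontr)
  let ?v = "snd (node_min s x)"
  note lm = regular_nodeD(1)[OF assms(2), unfolded last_minimal_def coeff_node_poly]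
  assume "\<not> s * node_count s x \<le> ?v"
  then have "int p ^ Suc ?v dvd int p ^ (s * node_count s x)" by (intro le_imp_power_dvd) simp
  then show False using lm by (meson dvd_mult2)
qed

text \<open>As the minimal valuation is at least \<open>s * j\<close>, \<open>p ^ (s * j)\<close>
  divides every coefficient of the disc polynomial; the \<open>k\<close>-th one carries
  \<open>p ^ (s * k)\<close>, and cancellation leaves the exponent
  \<open>s * (j - k)\<close>.\<close>

lemma node_count_geD:
  assumes "prime p" "regular_node b s x" "j \<le> node_count s x" "k < j"
  shows "int p ^ (s * (j - k)) dvd taylor_coeff P x k"
proof -
  define l v where "l = node_count s x" and "v = snd (node_min s x)"
  note lm = regular_nodeD(1)[OF assms(2), folded l_def v_def, unfolded last_minimal_def coeff_node_poly]
  have p0: "int p \<noteq> 0" using prime_gt_0_nat[OF assms(1)] by simp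
  have "s * l \<le> v" using node_count_le_valuation[OF assms(1,2)] by (simp add: l_def v_def)
  moreover have "s * j \<le> s * l" using assms(3) by (simp add: l_def)
  ultimately have "s * j \<le> v" by (rule order_trans[rotated])
  then have "int p ^ (s * j) dvd int p ^ v" by (rule le_imp_power_dvd)
  moreover have "int p ^ v dvd int p ^ (s * k) * taylor_coeff P x k"
    using lm assms(3,4) by (simp add: l_def)
  ultimately have "int p ^ (s * j) dvd int p ^ (s * k) * taylor_coeff P x k" by (rule dvd_trans)
  moreover have "s * j = s * k + s * (j - k)" using assms(4) by (simp add: diff_mult_distrib2)
  ultimately have "int p ^ (s * k) * int p ^ (s * (j - k)) dvd int p ^ (s * k) * taylor_coeff P x k"
    by (simp only: power_add)
  moreover have "int p ^ (s * k) \<noteq> 0" using p0 by simp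
  ultimately show ?thesis using dvd_times_left_cancel_iff by blast
qed

text \<open>The disc polynomial and its coefficient at the count times the residue polynomial agree
  modulo \<open>p ^ Suc v\<close>, and translation by \<open>a\<close> respects this.\<close>

lemma taylor_coeff_node_residues:
  assumes "prime p" "degree P \<le> d" "regular_node b s x"
  defines "v \<equiv> snd (node_min s x)"
  shows "int p ^ Suc v dvd taylor_coeff (node_poly p P s x) a k
    - coeff (node_poly p P s x) (node_count s x) * taylor_coeff (Poly (node_residues s x)) a k"
proof -
  let ?D = "node_poly p P s x" and ?l = "node_count s x" and ?g = "Poly (node_residues s x)"
  note lm = regular_nodeD(1)[OF assms(3), folded v_def]
  have "degree ?D \<le> degree P * degree [:int x, int p ^ s:]"
    unfolding node_poly_def by (rule degree_pcompose_le)
  also have "\<dots> \<le> degree P * 1" by (intro mult_left_mono) auto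
  finally have D: "degree ?D \<le> d" using assms(2) by simp
  have "int p ^ Suc v dvd coeff ?D k - coeff (smult (coeff ?D ?l) ?g) k" for k
  proof (cases "k \<le> ?l")
    case True
    then have "coeff ?g k = residue_coeffs p (coeff ?D) ?l v ! k"
      by (simp add: nth_default_def node_residues_def v_def)
    then show ?thesis
      using residue_coeffs_dvd[OF assms(1) lm True] by (simp add: mult.commute dvd_diff_commute)
  next
    case False
    then have "coeff ?g k = 0" by (simp add: nth_default_def node_residues_def)
    moreover have "int p ^ Suc v dvd coeff ?D k"
      using False lm D by (cases "k \<le> d") (auto simp: last_minimal_def coeff_eq_0 simp del: power_Suc)
    ultimately show ?thesis by simp
  qed
  then have "icong [:int p ^ Suc v:] 0 ?D (smult (coeff ?D ?l) ?g)" by (rule icong_0_coeffI)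
  from coeff_icong_0[OF icong_pcompose[OF this, of "[:int a, 1:]"], of k]
  show ?thesis by (simp add: pcompose_smult)
qed

lemma node_mult_props:
  assumes "prime p" "regular_node b s x"
  shows "node_mult s x a \<le> node_count s x"
    "\<not> int p dvd taylor_coeff (Poly (node_residues s x)) a (node_mult s x a)"
    "k < node_mult s x a \<Longrightarrow> int p dvd taylor_coeff (Poly (node_residues s x)) a k"
    "a \<in> node_roots s x \<Longrightarrow> node_mult s x a \<ge> 1"
proof -
  let ?g = "Poly (node_residues s x)"
  note m = monic_Poly_residue_coeffs[OF assms(1) regular_nodeD(1)[OF assms(2)], folded node_residues_def]
  have "taylor_coeff ?g a (node_count s x) = lead_coeff (pcompose ?g [:int a, 1:])"
    using m by (simp add: degree_pcompose)
  also have "\<dots> = 1" using m by (simp add: lead_coeff_comp)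
  finally have l: "\<not> int p dvd taylor_coeff ?g a (node_count s x)"
    using prime_gt_1_nat[OF assms(1)] by simp
  then show "node_mult s x a \<le> node_count s x" unfolding node_mult_def by (rule Least_le)
  show nm: "\<not> int p dvd taylor_coeff ?g a (node_mult s x a)"
    unfolding node_mult_def using l by (rule LeastI)
  show "int p dvd taylor_coeff ?g a k" if "k < node_mult s x a"
    using not_less_Least[OF that[unfolded node_mult_def]] by simp
  show "node_mult s x a \<ge> 1" if "a \<in> node_roots s x"
    using nm that by (cases "node_mult s x a") (auto simp: node_roots_def)
qed

text \<open>With \<open>m\<close> the multiplicity, the coefficient of degree \<open>m\<close> on
  the smaller disc is not divisible by \<open>p ^ Suc (m + v)\<close>, whereas those of degree
  \<open>k > m\<close> are divisible by \<open>p ^ (k + v)\<close>. So the count is at most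
  \<open>m\<close>, and truncation at any degree from \<open>m\<close> on leaves it unchanged, which
  justifies both kinds of truncation.\<close>

lemma child_last_minimal:
  assumes p: "prime p" and P: "degree P \<le> d" and reg: "regular_node b s x" "regular_node b' (Suc s) (x + a * p ^ s)"
    and n: "node_mult s x a \<le> n" "n \<le> d"
  shows "last_minimal p (coeff (node_poly p P (Suc s) (x + a * p ^ s))) n
      (node_count (Suc s) (x + a * p ^ s)) (snd (node_min (Suc s) (x + a * p ^ s)))"
    and "node_count (Suc s) (x + a * p ^ s) \<le> node_mult s x a"
proof -
  let ?D = "node_poly p P s x" and ?E = "node_poly p P (Suc s) (x + a * p ^ s)"
  define m where "m = node_mult s x a"
  define v where "v = snd (node_min s x)"
  define l' where "l' = node_count (Suc s) (x + a * p ^ s)"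
  define v' where "v' = snd (node_min (Suc s) (x + a * p ^ s))"
  note lm = regular_nodeD(1)[OF reg(1), folded v_def]
  note lm' = regular_nodeD(1)[OF reg(2), folded l'_def v'_def]
  note t = taylor_coeff_node_residues[OF p P reg(1), folded v_def]
  note nm = node_mult_props[OF p reg(1), where a = a, folded m_def]
  have p0: "int p \<noteq> 0" using prime_gt_0_nat[OF p] by simp
  obtain h where h: "coeff ?D (node_count s x) = int p ^ v * h" using lm by (meson last_minimal_def dvdE)
  have h_unit: "\<not> int p dvd h"
  proof
    assume "int p dvd h"
    then have "int p ^ Suc v dvd coeff ?D (node_count s x)" unfolding h by (simp add: mult.commute mult_dvd_mono)
    then show False using lm by (simp only: last_minimal_def) blast
  qed
  have "\<not> int p ^ Suc v dvd taylor_coeff ?D a m"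
  proof
    assume "int p ^ Suc v dvd taylor_coeff ?D a m"
    from dvd_diff[OF this t[of a m]] have "int p ^ v * int p dvd int p ^ v * (h * taylor_coeff (Poly (node_residues s x)) a m)"
      by (simp add: h mult.commute mult.left_commute)
    moreover have "int p ^ v \<noteq> 0" using p0 by simp
    ultimately have "int p dvd h * taylor_coeff (Poly (node_residues s x)) a m"
      using dvd_times_left_cancel_iff by blast
    then show False using h_unit nm(2) p by (simp add: prime_dvd_mult_iff)
  qed
  then have "\<not> int p ^ m * int p ^ Suc v dvd int p ^ m * taylor_coeff ?D a m"
    using p0 by (subst dvd_times_left_cancel_iff) simp_all
  then have not_dvd: "\<not> int p ^ Suc (m + v) dvd coeff ?E m"
    unfolding coeff_child by (simp add: power_add mult.commute mult.left_commute)
  have "v' \<le> m + v"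
  proof (rule ccontr)
    assume "\<not> v' \<le> m + v"
    then have "int p ^ Suc (m + v) dvd int p ^ v'" by (intro le_imp_power_dvd) simp
    moreover have "int p ^ v' dvd coeff ?E m" using lm' n by (simp add: last_minimal_def m_def)
    ultimately show False using not_dvd dvd_trans by blast
  qed
  have pv: "int p ^ v dvd taylor_coeff ?D a k" for k
  proof -
    have "int p ^ v dvd coeff ?D (node_count s x) * taylor_coeff (Poly (node_residues s x)) a k" by (simp add: h)
    moreover have "int p ^ v dvd taylor_coeff ?D a k - coeff ?D (node_count s x) * taylor_coeff (Poly (node_residues s x)) a k"
      by (rule dvd_trans[OF _ t]) simp
    ultimately show ?thesis by (metis diff_add_cancel dvd_add)
  qed
  have above: "int p ^ Suc v' dvd coeff ?E k" if "m < k" for k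
  proof -
    have "int p ^ (k + v) dvd coeff ?E k" unfolding coeff_child power_add by (intro mult_dvd_mono pv) simp
    moreover have "int p ^ Suc v' dvd int p ^ (k + v)"
      using that \<open>v' \<le> m + v\<close> by (intro le_imp_power_dvd) simp
    ultimately show ?thesis using dvd_trans by blast
  qed
  show l': "l' \<le> m" unfolding l'_def[symmetric] m_def[symmetric]
    using above[of l'] lm' by (meson last_minimal_def not_le)
  show "last_minimal p (coeff ?E) n l' v'"
    using lm' l' n by (simp add: last_minimal_def m_def)
qed

end

lemma node_poly_0 [simp]: "node_poly p P 0 0 = P"
  by (simp add: node_poly_def)

text \<open>Root finding as a function of the residues alone, which is what both rings have in
  common.\<close>

definition reduced_roots :: "root_finder \<Rightarrow> nat \<Rightarrow> int list \<Rightarrow> nat list counted spmf" where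
  "reduced_roots rf p g =
    (if rf = Cantor_Zassenhaus \<and> p \<noteq> 2 then cz_roots p (tl (rev g))
     else return_spmf (filter (\<lambda>a. int p dvd poly (Poly g) (int a)) [0..<p], p * (2 * length g + 1)))"

lemma filter_map_conv: "map fst (filter snd (map (\<lambda>a. (a, P a)) xs)) = filter P xs"
  by (induction xs) auto

lemma reduced_roots_correct:
  assumes "prime p" "p < 2 ^ k" and g: "g = residue_coeffs p c l v" "last_minimal p c n l v"
  shows "lossless_spmf (reduced_roots rf p g)"
    and "(as, i) \<in> set_spmf (reduced_roots rf p g) \<Longrightarrow> distinct as \<and> set as = {a. a < p \<and> int p dvd poly (Poly g) (int a)}"
    and "(\<integral>\<^sup>+ x. of_nat (snd x) \<partial>measure_spmf (reduced_roots Cantor_Zassenhaus p g)) \<le> ennreal (240 * real k * (real l + 1)\<^sup>2)"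
    and "(\<integral>\<^sup>+ x. of_nat (snd x) \<partial>measure_spmf (reduced_roots Exhaustive_Search p g)) = ennreal (real p * (2 * real l + 3))"
proof -
  have len: "length g = Suc l" by (simp add: g(1))
  then have "rev g \<noteq> []" "hd (rev g) = last g" by (auto simp: hd_rev)
  moreover have "last g = 1"
    using residue_coeffs_last[OF assms(1) g(2)] len g(1)
    by (metis diff_Suc_1 last_conv_nth list.size(3) nat.simps(3))
  \<comment> \<open>The lists of the Cantor-Zassenhaus part start with the highest coefficient and
    suppress it, as it is 1.\<close>
  ultimately have "rev g = 1 # tl (rev g)" by (metis list.collapse)
  then have poly: "mpoly (tl (rev g)) = Poly g" by (metis lpoly_def mpoly_def rev_rev_ident)
  have "set g \<subseteq> {0..int p - 1}"
    unfolding g(1) by (rule set_residue_coeffs) (rule prime_gt_0_nat[OF assms(1)])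
  moreover have "set (tl (rev g)) \<subseteq> set g" using list.set_sel(2)[of "rev g"] \<open>rev g \<noteq> []\<close> by auto
  ultimately have set: "set (tl (rev g)) \<subseteq> {0..int p - 1}" by blast
  have len': "length (tl (rev g)) = l" using len by simp
  note cz = cz_roots_correct[OF assms(1) _ set assms(2), unfolded poly len']
  show "lossless_spmf (reduced_roots rf p g)" using cz(1) by (simp add: reduced_roots_def)
  show "distinct as \<and> set as = {a. a < p \<and> int p dvd poly (Poly g) (int a)}"
    if as: "(as, i) \<in> set_spmf (reduced_roots rf p g)"
  proof (cases "rf = Cantor_Zassenhaus \<and> p \<noteq> 2")
    case True
    then have *: "distinct as" "int ` set as = roots_modulo p (Poly g)"
      using cz(2)[of as i] as by (auto simp: reduced_roots_def)
    have "a \<in> set as \<longleftrightarrow> int a \<in> int ` set as" for a by auto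
    then have "a \<in> set as \<longleftrightarrow> a < p \<and> int p dvd poly (Poly g) (int a)" for a
      unfolding *(2) by (simp add: roots_modulo_def)
    then show ?thesis using *(1) by blast
  next
    case False
    then show ?thesis using as by (auto simp: reduced_roots_def)
  qed
  have k: "real k \<ge> 1" using assms(2) prime_gt_1_nat[OF assms(1)] by (cases k) auto
  show "(\<integral>\<^sup>+ x. of_nat (snd x) \<partial>measure_spmf (reduced_roots Exhaustive_Search p g)) = ennreal (real p * (2 * real l + 3))"
    by (simp add: reduced_roots_def nn_integral_return_spmf len ennreal_of_nat_eq_real_of_nat algebra_simps
      del: of_nat_mult of_nat_add of_nat_Suc) (simp add: algebra_simps)
  show "(\<integral>\<^sup>+ x. of_nat (snd x) \<partial>measure_spmf (reduced_roots Cantor_Zassenhaus p g)) \<le> ennreal (240 * real k * (real l + 1)\<^sup>2)"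
  proof (cases "p = 2")
    case True
    have "real (p * (2 * length g + 1)) = 4 * real l + 6" by (simp add: True len)
    also have "\<dots> \<le> 240 * (real l + 1)\<^sup>2" by (simp add: power2_eq_square algebra_simps)
    also have "\<dots> \<le> 240 * real k * (real l + 1)\<^sup>2"
      using mult_right_mono[OF k, of "240 * (real l + 1)\<^sup>2"] by simp
    finally have "ennreal (real (p * (2 * length g + 1))) \<le> ennreal (240 * real k * (real l + 1)\<^sup>2)"
      by (rule ennreal_leI)
    then show ?thesis using True
      by (simp only: reduced_roots_def simp_thms if_False nn_integral_return_spmf snd_conv ennreal_of_nat_eq_real_of_nat)
  next
    case False
    then show ?thesis using cz(3) by (simp add: reduced_roots_def)
  qed
qed

context approx_ring
begin

lemma Poly_mod_cong:
  "map (\<lambda>c. \<pi> c mod int p) g = g' \<Longrightarrow> icong [:int p:] 0 (Pi g) (Poly g')"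
proof (rule icong_0_coeffI)
  fix k assume g: "map (\<lambda>c. \<pi> c mod int p) g = g'"
  have "int p dvd x - x mod int p" for x by (simp add: minus_mod_eq_mult_div)
  then show "int p dvd coeff (Pi g) k - coeff (Poly g') k"
    unfolding g[symmetric] by (simp add: nth_default_def)
qed

lemma roots_mod_eq:
  assumes g: "set g \<subseteq> carrier R" and g': "map (\<lambda>c. \<pi> c mod int p) g = g'"
  shows "roots_mod rf p R g = reduced_roots rf p g'"
proof -
  have ex: "exhaustive_roots p R g = (filter (\<lambda>a. int p dvd poly (Poly g') (int a)) [0..<p], p * (2 * length g' + 1))"
  proof -
    have h: "snd (horner R g (nat_in R a)) = 2 * length g"
      "padic_abs p R (fst (horner R g (nat_in R a))) < 1 \<longleftrightarrow> int p dvd poly (Poly g') (int a)" for a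
    proof -
      note h = horner_correct[OF g \<iota>_closed[of "int a"], folded nat_in_eq]
      show "snd (horner R g (nat_in R a)) = 2 * length g" using h by blast
      have pb: "int p dvd int p ^ b" using b by simp
      have "[\<pi> (fst (horner R g (nat_in R a))) = poly (Pi g) (\<pi> (nat_in R a))] (mod int p ^ b)"
        using h by (simp add: cong_iff_dvd_diff)
      then have "[\<pi> (fst (horner R g (nat_in R a))) = poly (Pi g) (\<pi> (nat_in R a))] (mod int p)"
        using pb by (rule cong_dvd_modulus)
      also have "[poly (Pi g) (\<pi> (nat_in R a)) = poly (Poly g') (\<pi> (nat_in R a))] (mod int p)"
        using poly_icong[OF Poly_mod_cong[OF g'], of "\<pi> (nat_in R a)"] by (simp add: cong_iff_dvd_diff)
      also have "[poly (Poly g') (\<pi> (nat_in R a)) = poly (Poly g') (int a)] (mod int p)"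
      proof (rule cong_poly)
        have "[\<pi> (nat_in R a) = int a] (mod int p ^ b)" by (simp add: nat_in_eq \<pi>_\<iota>)
        then show "[\<pi> (nat_in R a) = int a] (mod int p)" using pb by (rule cong_dvd_modulus)
      qed
      finally show "padic_abs p R (fst (horner R g (nat_in R a))) < 1 \<longleftrightarrow> int p dvd poly (Poly g') (int a)"
        using h by (simp add: abs_less_1_iff cong_dvd_iff)
    qed
    have "length g = length g'" using g' by auto
    moreover have "map_counted (\<lambda>a. do { v \<leftarrow> horner R g (nat_in R a); t \<leftarrow> tick (padic_abs p R v < 1); ret (a, t) }) xs
      = (map (\<lambda>a. (a, int p dvd poly (Poly g') (int a))) xs, length xs * (2 * length g + 1))" for xs
      using h(2) by (intro prod_eqI) (simp_all add: fst_map_counted snd_map_counted counted_simps h(1) sum_list_triv)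
    ultimately show ?thesis
      unfolding exhaustive_roots_def by (simp add: bind_counted_def ret_def filter_map_conv)
  qed
  show ?thesis
  proof (cases "rf = Cantor_Zassenhaus \<and> p \<noteq> 2")
    case True
    have "set (tl (rev g)) \<subseteq> carrier R" using g list.set_sel(2)[of "rev g"] by (cases "rev g") auto
    then have "map (residue p R) (tl (rev g)) = map (\<lambda>c. \<pi> c mod int p) (tl (rev g))"
      by (auto simp: \<pi>_residue)
    also have "\<dots> = tl (rev g')" by (simp add: g'[symmetric] map_tl rev_map)
    finally show ?thesis using True cantor_zassenhaus_roots_eq[of p R g]
      by (simp add: roots_mod_def reduced_roots_def)
  next
    case False
    then show ?thesis using ex
      by (cases rf) (auto simp: roots_mod_def reduced_roots_def cantor_zassenhaus_roots_def)
  qed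
qed

end

text \<open>No disc of radius \<open>p ^ - t\<close> is refined, and each disc considered before has a coefficient that is
  visible with \<open>b\<close> digits.\<close>

definition resolved :: "nat \<Rightarrow> nat \<Rightarrow> nat \<Rightarrow> int poly \<Rightarrow> bool" where
  "resolved p b t P \<longleftrightarrow> 2 * t \<le> b \<and>
     (\<forall>x<p ^ t. \<not> (int p ^ (2 * t) dvd taylor_coeff P x 0 \<and> int p ^ t dvd taylor_coeff P x 1)) \<and>
     (\<forall>s\<le>t. \<forall>x<p ^ s. \<not> (int p ^ b dvd taylor_coeff P x 0 \<and> int p ^ (b - s) dvd taylor_coeff P x 1))"

lemma resolved_pos:
  assumes "resolved p b t P"
  shows "t > 0" "b > 0"
proof -
  have "t \<noteq> 0"
  proof
    \<comment> \<open>At depth 0 the second condition would deny that \<open>p ^ 0 = 1\<close> is a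
      divisor.\<close>
    assume "t = 0"
    with assms show False by (auto simp: resolved_def dest!: spec[of _ 0])
  qed
  with assms show "t > 0" "b > 0" by (auto simp: resolved_def)
qed

text \<open>One of the coefficients of degree 0 and 1 is visible. The latter carries
  \<open>p ^ s\<close> on the disc, which explains the exponent \<open>b - s\<close> in
  \<open>resolved\<close>; it is among the coefficients considered because
  \<open>d \<ge> 1\<close>.\<close>

lemma resolved_regular:
  assumes p: "prime p" and d: "d \<ge> 1" and res: "resolved p b t P" and s: "s \<le> t" "x < p ^ s"
  shows "regular_node p d P b s x"
proof -
  have sb: "s \<le> b" using res s(1) by (simp add: resolved_def)
  have "\<not> int p ^ b dvd taylor_coeff P x 0 \<or> \<not> int p ^ (b - s) dvd taylor_coeff P x 1"
    using res s by (auto simp: resolved_def)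
  then obtain k where k: "k \<le> d" "\<not> int p ^ b dvd coeff (node_poly p P s x) k"
  proof
    assume "\<not> int p ^ b dvd taylor_coeff P x 0"
    then show ?thesis using that[of 0] by (simp add: coeff_node_poly)
  next
    assume *: "\<not> int p ^ (b - s) dvd taylor_coeff P x 1"
    have "\<not> int p ^ b dvd int p ^ s * taylor_coeff P x 1"
    proof
      assume "int p ^ b dvd int p ^ s * taylor_coeff P x 1"
      moreover have "int p ^ b = int p ^ s * int p ^ (b - s)" using sb by (simp flip: power_add)
      moreover have "int p ^ s \<noteq> 0" using prime_gt_0_nat[OF p] by simp
      ultimately show False using * dvd_times_left_cancel_iff by metis
    qed
    then show ?thesis using that[of 1] d by (simp add: coeff_node_poly)
  qed
  from last_minimal_exists[of p b "coeff (node_poly p P s x)" k d, OF k(2,1)] show ?thesis unfolding regular_node_def by metis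
qed

text \<open>A count of 2 would force \<open>p ^ (2 * t)\<close> and \<open>p ^ t\<close> into the
  first two Taylor coefficients, which is the combination excluded at level
  \<open>t\<close>.\<close>

lemma resolved_leaf:
  assumes p: "prime p" and d: "d \<ge> 1" and res: "resolved p b t P" and x: "x < p ^ t"
  shows "node_count p d P t x \<le> 1"
proof (rule ccontr)
  assume "\<not> node_count p d P t x \<le> 1"
  then have "2 \<le> node_count p d P t x" by simp
  note * = node_count_geD[OF p resolved_regular[OF p d res order_refl x] this]
  have "int p ^ (2 * t) dvd taylor_coeff P x 0" "int p ^ t dvd taylor_coeff P x 1"
    using *[of 0] *[of 1] by (simp_all add: mult.commute)
  then show False using res x by (auto simp: resolved_def)
qed

lemma child_less:
  fixes x s a p :: nat
  shows "x < p ^ s \<Longrightarrow> a < p \<Longrightarrow> x + a * p ^ s < p ^ Suc s"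
proof -
  assume "x < p ^ s" "a < p"
  then have "x + a * p ^ s < p ^ s + a * p ^ s" by (simp only: add_less_cancel_right)
  also have "\<dots> = (a + 1) * p ^ s" by simp
  also have "\<dots> \<le> p * p ^ s" using \<open>a < p\<close> by (intro mult_right_mono) auto
  finally show ?thesis by simp
qed

text \<open>\<open>n\<close> is the number of levels left before the depth at which all counts are
  at most 1. The size counts the iterations of the loop and serves as induction measure.\<close>

fun tree_size :: "nat \<Rightarrow> nat \<Rightarrow> int poly \<Rightarrow> nat \<Rightarrow> nat \<Rightarrow> nat \<Rightarrow> nat" where
  "tree_size p d P 0 s x = 0"
| "tree_size p d P (Suc n) s x = Suc (\<Sum>a\<in>node_roots p d P s x.
     if node_count p d P (Suc s) (x + a * p ^ s) > 1 then tree_size p d P n (Suc s) (x + a * p ^ s) else 0)"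

fun tree_output :: "nat \<Rightarrow> nat \<Rightarrow> int poly \<Rightarrow> nat \<Rightarrow> nat \<Rightarrow> nat \<Rightarrow> (nat \<times> nat) set" where
  "tree_output p d P 0 s x = {}"
| "tree_output p d P (Suc n) s x = (\<Union>a\<in>node_roots p d P s x.
     if node_count p d P (Suc s) (x + a * p ^ s) > 1 then tree_output p d P n (Suc s) (x + a * p ^ s)
     else if node_count p d P (Suc s) (x + a * p ^ s) = 1 then {(x + a * p ^ s, Suc s)} else {})"

text \<open>Only the search for roots is random; the set of roots, and with it the cost of the
  refinements, is not.\<close>

definition node_cost :: "root_finder \<Rightarrow> truncation \<Rightarrow> nat \<Rightarrow> nat \<Rightarrow> int poly \<Rightarrow> nat \<Rightarrow> nat \<Rightarrow> ennreal" where
  "node_cost rf tr p d P s x =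
     (\<integral>\<^sup>+ y. of_nat (snd y) \<partial>measure_spmf (reduced_roots rf p (node_residues p d P s x))) +
     of_nat (\<Sum>a\<in>node_roots p d P s x. refine_cost p d P tr s x a)"

fun tree_cost :: "root_finder \<Rightarrow> truncation \<Rightarrow> nat \<Rightarrow> nat \<Rightarrow> int poly \<Rightarrow> nat \<Rightarrow> nat \<Rightarrow> nat \<Rightarrow> ennreal" where
  "tree_cost rf tr p d P 0 s x = 0"
| "tree_cost rf tr p d P (Suc n) s x = node_cost rf tr p d P s x + (\<Sum>a\<in>node_roots p d P s x.
     if node_count p d P (Suc s) (x + a * p ^ s) > 1 then tree_cost rf tr p d P n (Suc s) (x + a * p ^ s) else 0)"

lemma nn_integral_add_of_nat:
  assumes "lossless_spmf M"
  shows "(\<integral>\<^sup>+ y. of_nat (f y) + c \<partial>measure_spmf M) = (\<integral>\<^sup>+ y. of_nat (f y) \<partial>measure_spmf M) + c"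
proof -
  have "(\<integral>\<^sup>+ y. of_nat (f y) + c \<partial>measure_spmf M) = (\<integral>\<^sup>+ y. of_nat (f y) \<partial>measure_spmf M) + (\<integral>\<^sup>+ y. c \<partial>measure_spmf M)"
    by (rule nn_integral_add) auto
  then show ?thesis by (simp only: nn_integral_const_spmf_lossless[OF assms])
qed

section \<open>Simulation of a run by the tree\<close>

context approx_ring
begin

text \<open>Center and power are images of exact integers, whereas \<open>g\<close> is pinned down
  modulo \<open>p\<close> only; this is what can be maintained in both rings.\<close>

definition valid_item :: "nat \<Rightarrow> int poly \<Rightarrow> 'a item \<Rightarrow> nat \<times> nat \<Rightarrow> bool" where
  "valid_item d P it n \<longleftrightarrow> (case n of (s, x) \<Rightarrow> \<exists>g.
     it = (g, \<iota> (int x), s, \<iota> (int p ^ s), node_count p d P s x) \<and> set g \<subseteq> carrier R \<and>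
     map (\<lambda>c. \<pi> c mod int p) g = node_residues p d P s x)"

lemma normalized_residues:
  assumes h: "set h \<subseteq> carrier R" "length h = Suc n"
    and lm: "last_minimal p c n l v" "v < b" and c: "\<And>k. k \<le> n \<Longrightarrow> int p ^ b dvd \<pi> (h ! k) - c k"
  shows "strassman_count p R h = l"
    and "set (fst (normalized R h l)) \<subseteq> carrier R" "snd (normalized R h l) = Suc l"
    and "map (\<lambda>c. \<pi> c mod int p) (fst (normalized R h l)) = residue_coeffs p c l v"
proof -
  have lm': "last_minimal p (\<lambda>k. \<pi> (h ! k)) n l v" by (rule last_minimal_cong[OF lm c])
  show "strassman_count p R h = l" by (rule strassman_count_eq[OF h lm' lm(2)])
  note g = normalized_correct[OF h lm' lm(2)]
  show "set (fst (normalized R h l)) \<subseteq> carrier R" "snd (normalized R h l) = Suc l"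
    using g by simp_all
  have l: "l \<le> n" using lm(1) by (simp add: last_minimal_def)
  show "map (\<lambda>c. \<pi> c mod int p) (fst (normalized R h l)) = residue_coeffs p c l v"
  proof (rule nth_equalityI)
    fix k assume "k < length (map (\<lambda>c. \<pi> c mod int p) (fst (normalized R h l)))"
    then have k: "k \<le> l" using g(2) by simp
    let ?z = "\<pi> (fst (normalized R h l) ! k)"
    have "[?z * c l = ?z * \<pi> (h ! l)] (mod int p ^ b)"
      using c[OF l] by (intro cong_mult cong_refl) (simp add: cong_iff_dvd_diff dvd_diff_commute)
    also have "[?z * \<pi> (h ! l) = \<pi> (h ! k)] (mod int p ^ b)"
      using g(4)[OF k] by (simp add: cong_iff_dvd_diff)
    also have "[\<pi> (h ! k) = c k] (mod int p ^ b)"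
      using c[of k] k l by (simp add: cong_iff_dvd_diff)
    finally have "int p ^ b dvd ?z * c l - c k" by (simp add: cong_iff_dvd_diff)
    moreover have "int p ^ Suc v dvd int p ^ b" using lm(2) by (intro le_imp_power_dvd) simp
    ultimately have "int p ^ Suc v dvd ?z * c l - c k" by (rule dvd_trans[rotated])
    from residue_coeffs_unique[OF p lm(1) k this] k g(2)
    show "map (\<lambda>c. \<pi> c mod int p) (fst (normalized R h l)) ! k = residue_coeffs p c l v ! k" by simp
  qed (use g(2) in simp)
qed

lemma root_multiplicity_eq:
  fixes a :: nat
  assumes g: "set g \<subseteq> carrier R" "map (\<lambda>c. \<pi> c mod int p) g = node_residues p d P s x"
    and reg: "regular_node p d P b s x"
  defines "m \<equiv> node_mult p d P s x a" and "l \<equiv> node_count p d P s x"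
  shows "root_multiplicity p R g a l = (m, (m + (if m < l then 1 else 0)) * (2 * Suc l + 1))"
proof -
  let ?r = "root_multiplicity p R g a l"
  note rm = root_multiplicity_correct[OF g(1), of a l]
  note nm = node_mult_props[OF p reg, where a = a, folded m_def l_def]
  have "icong [:int p:] 0 (pcompose (Pi g) [:int a, 1:]) (pcompose (Poly (node_residues p d P s x)) [:int a, 1:])"
    by (rule icong_pcompose[OF Poly_mod_cong[OF g(2)]])
  from coeff_icong_0[OF this] have iff: "int p dvd taylor_coeff (Pi g) a k \<longleftrightarrow> int p dvd taylor_coeff (Poly (node_residues p d P s x)) a k" for k
    by (metis diff_add_cancel dvd_add_right_iff)
  have "\<not> m < fst ?r" using rm nm(2) iff by blast
  moreover have "\<not> fst ?r < m" using rm nm(1,3) iff by (meson order_less_le_trans)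
  ultimately have "fst ?r = m" by simp
  moreover have "length g = Suc l"
    using arg_cong[OF g(2), of length] by (simp add: node_residues_def l_def)
  ultimately show ?thesis using rm by (simp add: prod_eq_iff)
qed

text \<open>All arithmetic on centers and powers goes through \<open>\<iota>\<close>, so these stay
  exact, while the computed \<open>h\<close> agrees with the disc polynomial modulo
  \<open>p ^ b\<close>; regularity of the smaller disc makes this enough for its count and
  residues.\<close>

lemma refine_eq:
  assumes f: "set f \<subseteq> carrier R" "length f = Suc d"
    and it: "valid_item d (Pi f) it (s, x)" and a: "a \<in> node_roots p d (Pi f) s x"
    and reg: "regular_node p d (Pi f) b s x" "regular_node p d (Pi f) b (Suc s) (x + a * p ^ s)"
  shows "snd (refine tr p R f it a) = refine_cost p d (Pi f) tr s x a"
    and "list_all2 (valid_item d (Pi f)) (fst (fst (refine tr p R f it a)))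
      (if node_count p d (Pi f) (Suc s) (x + a * p ^ s) > 1 then [(Suc s, x + a * p ^ s)] else [])"
    and "snd (fst (refine tr p R f it a)) =
      (if node_count p d (Pi f) (Suc s) (x + a * p ^ s) = 1 then [(\<iota> (int (x + a * p ^ s)), Suc s)] else [])"
proof -
  let ?P = "Pi f" and ?y = "x + a * p ^ s"
  define l where "l = node_count p d ?P s x"
  define l' where "l' = node_count p d ?P (Suc s) ?y"
  define m where "m = node_mult p d ?P s x a"
  define n where "n = (case tr of At_Count \<Rightarrow> l | At_Multiplicity \<Rightarrow> m)"
  define mc where "mc = (case tr of At_Count \<Rightarrow> 0 | At_Multiplicity \<Rightarrow> (m + (if m < l then 1 else 0)) * (2 * Suc l + 1))"
  obtain g where g: "it = (g, \<iota> (int x), s, \<iota> (int p ^ s), l)" "set g \<subseteq> carrier R"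
    "map (\<lambda>c. \<pi> c mod int p) g = node_residues p d ?P s x"
    using it by (auto simp: valid_item_def l_def)
  have deg: "degree ?P \<le> d"
    using f(2) by (intro degree_le) (simp add: nth_default_def)
  note nm = node_mult_props[OF p reg(1), where a = a, folded m_def l_def]
  have nd: "m \<le> n" "n \<le> d"
    using nm(1) node_count_le[OF reg(1)] by (auto simp: n_def l_def split: truncation.split)
  note child = child_last_minimal[OF p deg reg nd[unfolded m_def], folded l'_def]
  define h where "h = fst (substitute_truncated R f (\<iota> (int ?y)) (\<iota> (int p ^ Suc s)) n)"
  note st = substitute_truncated_correct[OF f(1), where x = "int ?y" and q = "int p ^ Suc s" and n = n, folded h_def]
  have c: "int p ^ b dvd \<pi> (h ! k) - coeff (node_poly p ?P (Suc s) ?y) k" if "k \<le> n" for k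
    using st(3) that by (simp add: node_poly_def)
  note nr = normalized_residues[OF st(1,2) child(1) regular_nodeD(2)[OF reg(2)] c, folded l'_def]
  have x': "\<iota> (int x) \<oplus>\<^bsub>R\<^esub> (nat_in R a \<otimes>\<^bsub>R\<^esub> \<iota> (int p ^ s)) = \<iota> (int ?y)"
    by (simp add: nat_in_eq \<iota>_mult \<iota>_add)
  have q': "nat_in R p \<otimes>\<^bsub>R\<^esub> \<iota> (int p ^ s) = \<iota> (int p ^ Suc s)"
    by (simp add: nat_in_eq \<iota>_mult)
  have trunc: "(case tr of At_Count \<Rightarrow> ret l | At_Multiplicity \<Rightarrow> root_multiplicity p R g a l) = (n, mc)"
    using root_multiplicity_eq[OF g(2,3) reg(1), of a]
    by (simp add: n_def mc_def m_def l_def ret_def split: truncation.split)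
  have eq: "refine tr p R f it a = (
      ((if l' > 1 then [(fst (normalized R h l'), \<iota> (int ?y), Suc s, \<iota> (int p ^ Suc s), l')] else []),
       (if l' = 1 then [(\<iota> (int ?y), Suc s)] else [])),
      3 + mc + snd (substitute_truncated R f (\<iota> (int ?y)) (\<iota> (int p ^ Suc s)) n) + Suc n + (if l' > 1 then Suc l' else 0))"
    unfolding refine_def g(1) Let_def prod.case bind_counted_def tick_def fst_conv snd_conv x' q' trunc
      h_def[symmetric] count_op_def
    by (simp add: ret_def nr(1,3) st(2))
  show "snd (refine tr p R f it a) = refine_cost p d ?P tr s x a"
    unfolding eq snd_conv st(4) f(2) refine_cost_def Let_def
    by (cases tr) (simp_all add: l_def[symmetric] m_def[symmetric] l'_def[symmetric] n_def mc_def)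
  show "snd (fst (refine tr p R f it a)) = (if l' = 1 then [(\<iota> (int ?y), Suc s)] else [])"
    unfolding eq by simp
  show "list_all2 (valid_item d ?P) (fst (fst (refine tr p R f it a))) (if l' > 1 then [(Suc s, ?y)] else [])"
    unfolding eq using nr(2,4) by (auto simp: valid_item_def node_residues_def l'_def)
qed

definition level_size :: "nat \<Rightarrow> int poly \<Rightarrow> nat \<Rightarrow> (nat \<times> nat) list \<Rightarrow> nat" where
  "level_size d P t ns = (\<Sum>(s, x)\<leftarrow>ns. tree_size p d P (t - s) s x)"

lemma finite_node_roots: "finite (node_roots p d P s x)"
  unfolding node_roots_def by simp

text \<open>The tree is finite, so an induction on the number of pending nodes follows the loop
  exactly: output and expected cost are equalities, and termination comes along. The stack may mix
  items of different levels, each with its own number \<open>t - s\<close> of levels left.\<close>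

lemma strassman_loop:
  fixes rf tr
  assumes f: "set f \<subseteq> carrier R" "length f = Suc d" "d \<ge> 1" and res: "resolved p b t (Pi f)"
    and S: "list_all2 (valid_item d (Pi f)) S ns" "\<forall>(s, x) \<in> set ns. s < t \<and> x < p ^ s"
  defines "W \<equiv> while_spmf (\<lambda>(S, Z, ops). S \<noteq> []) (strassman_step rf tr p R f)"
  shows "lossless_spmf (W (S, Z, ops)) \<and>
    (\<forall>(S', Z', ops') \<in> set_spmf (W (S, Z, ops)). set Z' = set Z \<union>
       (\<lambda>(y, k). (\<iota> (int y), k)) ` (\<Union>(s, x) \<in> set ns. tree_output p d (Pi f) (t - s) s x)) \<and>
    (\<integral>\<^sup>+ (S', Z', ops'). of_nat ops' \<partial>measure_spmf (W (S, Z, ops))) =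
      of_nat ops + (\<Sum>(s, x)\<leftarrow>ns. tree_cost rf tr p d (Pi f) (t - s) s x)"
  using S
proof (induction "level_size d (Pi f) t ns" arbitrary: S ns Z ops rule: less_induct)
  case less
  let ?P = "Pi f"
  show ?case
  proof (cases ns)
    case Nil
    then have "S = []" using less.prems by simp
    then have "W (S, Z, ops) = return_spmf (S, Z, ops)" unfolding W_def by (subst while_spmf.simps) simp
    then show ?thesis using Nil by (simp add: nn_integral_return_spmf)
  next
    case (Cons n ns')
    obtain s x where n: "n = (s, x)" by fastforce
    obtain it S' where S: "S = it # S'" "valid_item d ?P it (s, x)" "list_all2 (valid_item d ?P) S' ns'"
      using less.prems(1) unfolding Cons n by (auto simp: list_all2_Cons2)
    have sx: "s < t" "x < p ^ s" using less.prems(2) by (auto simp: Cons n)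
    define u where "u = t - Suc s"
    have u: "t - s = Suc u" using sx by (simp add: u_def)
    define A where "A = node_roots p d ?P s x"
    have finA: "finite A" by (simp add: A_def finite_node_roots)
    define y where "y a = x + a * p ^ s" for a
    define L where "L a = node_count p d ?P (Suc s) (y a)" for a
    have reg: "regular_node p d ?P b s x" by (rule resolved_regular[OF p f(3) res]) (use sx in auto)
    have y: "y a < p ^ Suc s" if "a \<in> A" for a
      unfolding y_def using that sx(2) by (intro child_less) (auto simp: A_def node_roots_def)
    have reg': "regular_node p d ?P b (Suc s) (y a)" if "a \<in> A" for a
      by (rule resolved_regular[OF p f(3) res _ y[OF that]]) (use sx in auto)
    \<comment> \<open>At level \<open>t\<close> no count exceeds 1, so a disc that is kept for
      refinement lies strictly above it.\<close>
    have deeper: "Suc s < t" if "a \<in> A" "L a > 1" for a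
    proof (rule ccontr)
      assume "\<not> Suc s < t"
      then have "t = Suc s" using sx by simp
      with resolved_leaf[OF p f(3) res, of "y a"] y[OF that(1)] that(2) show False by (simp add: L_def)
    qed
    define kids where "kids as = concat (map (\<lambda>a. if L a > 1 then [(Suc s, y a)] else []) as)" for as
    define items where "items as = concat (map (\<lambda>a. fst (fst (refine tr p R f it a))) as)" for as
    define found where "found as = concat (map (\<lambda>a. snd (fst (refine tr p R f it a))) as)" for as
    define cost where "cost = (\<Sum>a\<in>A. refine_cost p d ?P tr s x a)"
    define M where "M = reduced_roots rf p (node_residues p d ?P s x)"
    note ref = refine_eq[OF f(1,2) S(2) _ reg, folded A_def, folded y_def, folded L_def, OF _ reg']
    obtain k where k: "p < 2 ^ k" using less_exp by blast
    note rr = reduced_roots_correct[OF p k node_residues_def regular_nodeD(1)[OF reg],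
        folded M_def, folded node_roots_def, folded A_def]
    obtain g where g: "it = (g, \<iota> (int x), s, \<iota> (int p ^ s), node_count p d ?P s x)" "set g \<subseteq> carrier R"
      "map (\<lambda>c. \<pi> c mod int p) g = node_residues p d ?P s x"
      using S(2) by (auto simp: valid_item_def)
    have rm: "roots_mod rf p R (fst it) = M"
      using roots_mod_eq[OF g(2,3)] by (simp add: M_def g(1))
    define next_state where "next_state = (\<lambda>(as, i). (items as @ S', found as @ Z, ops + i + cost))"
    have W: "W (S, Z, ops) = bind_spmf M (\<lambda>r. W (next_state r))"
    proof -
      have "W (S, Z, ops) = bind_spmf (strassman_step rf tr p R f (S, Z, ops)) W"
        unfolding W_def by (subst while_spmf.simps) (simp add: S(1))
      also have "strassman_step rf tr p R f (S, Z, ops) = bind_spmf M (\<lambda>(as, i). return_spmf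
          (items as @ S', found as @ Z, ops + i + (\<Sum>a\<leftarrow>as. snd (refine tr p R f it a))))"
        by (simp add: strassman_step_def S(1) rm case_prod_beta fst_map_counted snd_map_counted items_def found_def comp_def)
      \<comment> \<open>The roots may come in any order, but the sum of the costs over all of them
        is fixed.\<close>
      also have "\<dots> = bind_spmf M (\<lambda>r. return_spmf (next_state r))"
      proof (rule bind_spmf_cong[OF refl])
        fix r assume r: "r \<in> set_spmf M"
        obtain as i where as: "r = (as, i)" by fastforce
        from rr(2)[of as i rf] r have "distinct as" "set as = A" unfolding as M_def by blast+
        then have "(\<Sum>a\<leftarrow>as. snd (refine tr p R f it a)) = cost"
          by (simp add: sum_list_distinct_conv_sum_set cost_def ref(1))
        then show "(case r of (as, i) \<Rightarrow> return_spmf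
          (items as @ S', found as @ Z, ops + i + (\<Sum>a\<leftarrow>as. snd (refine tr p R f it a)))) = return_spmf (next_state r)"
          by (simp add: as next_state_def)
      qed
      finally show ?thesis by simp
    qed
    have sum_kids: "(\<Sum>(s, x)\<leftarrow>kids as. F s x) = (\<Sum>a\<in>A. if L a > 1 then F (Suc s) (y a) else 0)"
      if "distinct as" "set as = A" for as and F :: "nat \<Rightarrow> nat \<Rightarrow> 'z :: comm_monoid_add"
    proof -
      have "(\<Sum>(s, x)\<leftarrow>kids as. F s x) = (\<Sum>a\<leftarrow>as. if L a > 1 then F (Suc s) (y a) else 0)"
        unfolding kids_def by (induction as) auto
      then show ?thesis using that by (simp add: sum_list_distinct_conv_sum_set)
    qed
    have *: "lossless_spmf (W (next_state r)) \<and>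
      (\<forall>(S', Z', ops') \<in> set_spmf (W (next_state r)). set Z' = set Z \<union>
       (\<lambda>(y, k). (\<iota> (int y), k)) ` (\<Union>(s, x) \<in> set ns. tree_output p d ?P (t - s) s x)) \<and>
      (\<integral>\<^sup>+ (S', Z', ops'). of_nat ops' \<partial>measure_spmf (W (next_state r))) =
      of_nat (snd r) + (of_nat (ops + cost) + ((\<Sum>a\<in>A. if L a > 1 then tree_cost rf tr p d ?P u (Suc s) (y a) else 0)
        + (\<Sum>(s, x)\<leftarrow>ns'. tree_cost rf tr p d ?P (t - s) s x)))"
      if r: "r \<in> set_spmf M" for r
    proof -
      obtain as i where as: "r = (as, i)" by fastforce
      from rr(2)[of as i rf] r have d: "distinct as" "set as = A" unfolding as M_def by blast+
      have valid: "list_all2 (valid_item d ?P) (items as @ S') (kids as @ ns')"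
      proof (rule list_all2_appendI[OF _ S(3)])
        have "\<forall>a\<in>set as. a \<in> A" using d by simp
        then show "list_all2 (valid_item d ?P) (items as) (kids as)"
          unfolding items_def kids_def
        proof (induction as)
          case (Cons a as)
          have "list_all2 (valid_item d ?P) (fst (fst (refine tr p R f it a))) (if L a > 1 then [(Suc s, y a)] else [])"
            by (rule ref(2)) (use Cons.prems in simp_all)
          moreover have "list_all2 (valid_item d ?P) (concat (map (\<lambda>a. fst (fst (refine tr p R f it a))) as))
            (concat (map (\<lambda>a. if L a > 1 then [(Suc s, y a)] else []) as))"
            by (rule Cons.IH) (use Cons.prems in simp)
          ultimately show ?case unfolding list.map concat.simps by (rule list_all2_appendI)
        qed simp
      qed
      have in_range: "\<forall>(s, x) \<in> set (kids as @ ns'). s < t \<and> x < p ^ s"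
        using less.prems(2) deeper y d(2) by (auto simp: Cons kids_def split: if_splits)
      have "level_size d ?P t (kids as @ ns') < level_size d ?P t ns"
      proof -
        have "level_size d ?P t (kids as @ ns')
          = (\<Sum>a\<in>A. if L a > 1 then tree_size p d ?P u (Suc s) (y a) else 0) + level_size d ?P t ns'"
          using sum_kids[OF d, of "\<lambda>s x. tree_size p d ?P (t - s) s x"]
          by (simp add: level_size_def u_def cong: if_cong)
        also have "\<dots> < tree_size p d ?P (Suc u) s x + level_size d ?P t ns'"
          unfolding A_def L_def y_def tree_size.simps by simp
        finally show ?thesis by (simp add: level_size_def Cons n u)
      qed
      note IH = less.hyps[OF this valid in_range, of "found as @ Z" "ops + i + cost"]
      have found: "set (found as) = (\<lambda>(y, k). (\<iota> (int y), k)) ` (\<Union>a\<in>A. if L a = 1 then {(y a, Suc s)} else {})"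
        unfolding found_def using d(2) ref(3) by (auto split: if_splits)
      have kids: "(\<Union>(s, x) \<in> set (kids as). tree_output p d ?P (t - s) s x)
        = (\<Union>a\<in>A. if L a > 1 then tree_output p d ?P u (Suc s) (y a) else {})"
        unfolding kids_def using d(2) by (auto simp: u_def split: if_splits)
      have "tree_output p d ?P (t - s) s x = (\<Union>a\<in>A. if L a = 1 then {(y a, Suc s)} else {})
        \<union> (\<Union>a\<in>A. if L a > 1 then tree_output p d ?P u (Suc s) (y a) else {})"
        unfolding u tree_output.simps A_def[symmetric] L_def y_def by (auto split: if_splits)
      then have out: "set (found as @ Z) \<union> (\<lambda>(y, k). (\<iota> (int y), k)) ` (\<Union>(s, x) \<in> set (kids as @ ns'). tree_output p d ?P (t - s) s x)
        = set Z \<union> (\<lambda>(y, k). (\<iota> (int y), k)) ` (\<Union>(s, x) \<in> set ns. tree_output p d ?P (t - s) s x)"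
        unfolding set_append UN_Un kids found Cons n by (simp add: image_Un Un_ac)
      have cost: "(\<Sum>(s, x)\<leftarrow>kids as @ ns'. tree_cost rf tr p d ?P (t - s) s x)
        = (\<Sum>a\<in>A. if L a > 1 then tree_cost rf tr p d ?P u (Suc s) (y a) else 0)
          + (\<Sum>(s, x)\<leftarrow>ns'. tree_cost rf tr p d ?P (t - s) s x)"
        using sum_kids[OF d, of "\<lambda>s x. tree_cost rf tr p d ?P (t - s) s x"]
        by (simp add: u_def cong: if_cong)
      show ?thesis using IH unfolding out cost by (simp add: as next_state_def ac_simps)
    qed
    have "lossless_spmf M" unfolding M_def by (rule rr(1))
    show ?thesis
    proof (intro conjI)
      show "lossless_spmf (W (S, Z, ops))"
        using \<open>lossless_spmf M\<close> * by (simp add: W)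
      show "\<forall>(S', Z', ops') \<in> set_spmf (W (S, Z, ops)). set Z' = set Z \<union>
        (\<lambda>(y, k). (\<iota> (int y), k)) ` (\<Union>(s, x) \<in> set ns. tree_output p d ?P (t - s) s x)"
        using * unfolding W set_bind_spmf by (auto simp: bind_UNION)
      have "(\<integral>\<^sup>+ (S', Z', ops'). of_nat ops' \<partial>measure_spmf (W (S, Z, ops))) =
        (\<integral>\<^sup>+ r. of_nat (snd r) + (of_nat (ops + cost) + ((\<Sum>a\<in>A. if L a > 1 then tree_cost rf tr p d ?P u (Suc s) (y a) else 0)
        + (\<Sum>(s, x)\<leftarrow>ns'. tree_cost rf tr p d ?P (t - s) s x))) \<partial>measure_spmf M)"
        unfolding W nn_integral_bind_spmf using * by (intro nn_integral_spmf_cong) blast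
      also have "\<dots> = (\<integral>\<^sup>+ r. of_nat (snd r) \<partial>measure_spmf M) + (of_nat (ops + cost) +
        ((\<Sum>a\<in>A. if L a > 1 then tree_cost rf tr p d ?P u (Suc s) (y a) else 0)
        + (\<Sum>(s, x)\<leftarrow>ns'. tree_cost rf tr p d ?P (t - s) s x)))"
        by (rule nn_integral_add_of_nat) fact
      also have "\<dots> = of_nat ops + (\<Sum>(s, x)\<leftarrow>ns. tree_cost rf tr p d ?P (t - s) s x)"
        unfolding Cons n M_def cost_def A_def L_def y_def
        by (simp add: u node_cost_def ac_simps cong: if_cong)
      finally show "(\<integral>\<^sup>+ (S', Z', ops'). of_nat ops' \<partial>measure_spmf (W (S, Z, ops))) =
        of_nat ops + (\<Sum>(s, x)\<leftarrow>ns. tree_cost rf tr p d ?P (t - s) s x)" .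
    qed
  qed
qed

text \<open>The operations before the loop are \<open>Suc d\<close> for the initial count and one
  more than the count for the normalization.\<close>

lemma strassman_run:
  assumes f: "set f \<subseteq> carrier R" "length f = Suc d" "d \<ge> 1" and res: "resolved p b t (Pi f)"
  shows "lossless_spmf (strassman rf tr p R f)"
    and "(Z, ops) \<in> set_spmf (strassman rf tr p R f) \<Longrightarrow>
      Z = (\<lambda>(y, k). (\<iota> (int y), k)) ` tree_output p d (Pi f) t 0 0"
    and "(\<integral>\<^sup>+ (Z, ops). of_nat ops \<partial>measure_spmf (strassman rf tr p R f)) =
      of_nat (Suc d + Suc (node_count p d (Pi f) 0 0)) + tree_cost rf tr p d (Pi f) t 0 0"
proof -
  let ?l = "node_count p d (Pi f) 0 0"
  have reg: "regular_node p d (Pi f) b 0 0" by (rule resolved_regular[OF p f(3) res]) auto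
  note lm = regular_nodeD[OF reg, unfolded node_poly_0]
  have "int p ^ b dvd \<pi> (f ! k) - coeff (Pi f) k" if "k \<le> d" for k
    using that f(2) by (simp add: nth_default_def)
  note nr = normalized_residues[OF f(1,2) lm this]
  define g where "g = fst (normalized R f ?l)"
  define it where "it = (g, \<zero>\<^bsub>R\<^esub>, 0 :: nat, \<one>\<^bsub>R\<^esub>, ?l)"
  have "valid_item d (Pi f) it (0, 0)"
    using nr(2,4) by (simp add: valid_item_def it_def zero_eq one_eq g_def node_residues_def)
  then have items: "list_all2 (valid_item d (Pi f)) [it] [(0, 0)]" by simp
  have range: "\<forall>(s, x) \<in> set [(0, 0)]. s < t \<and> x < p ^ s" using resolved_pos[OF res] by simp
  note loop = strassman_loop[OF f res items range, of rf tr "[]" "Suc d + Suc ?l"]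
  have eq: "strassman rf tr p R f = map_spmf (\<lambda>(S, Z, ops). (set Z, ops))
      (while_spmf (\<lambda>(S, Z, ops). S \<noteq> []) (strassman_step rf tr p R f) ([it], [], Suc d + Suc ?l))"
    by (simp add: strassman_def bind_counted_def ret_def count_op_def nr(1,3) g_def[symmetric] it_def f(2))
  show "lossless_spmf (strassman rf tr p R f)" using loop unfolding eq by simp
  show "Z = (\<lambda>(y, k). (\<iota> (int y), k)) ` tree_output p d (Pi f) t 0 0"
    if "(Z, ops) \<in> set_spmf (strassman rf tr p R f)"
  proof -
    from that obtain S' Z' where *: "(S', Z', ops) \<in> set_spmf
        (while_spmf (\<lambda>(S, Z, ops). S \<noteq> []) (strassman_step rf tr p R f) ([it], [], Suc d + Suc ?l))" "Z = set Z'"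
      unfolding eq by auto
    from loop[THEN conjunct2, THEN conjunct1] *(1)
    have "set Z' = (\<lambda>(y, k). (\<iota> (int y), k)) ` tree_output p d (Pi f) t 0 0" by fastforce
    then show ?thesis using *(2) by simp
  qed
  show "(\<integral>\<^sup>+ (Z, ops). of_nat ops \<partial>measure_spmf (strassman rf tr p R f)) =
      of_nat (Suc d + Suc ?l) + tree_cost rf tr p d (Pi f) t 0 0"
    using loop unfolding eq nn_integral_map_spmf by (simp add: comp_def split_def)
qed

end

section \<open>Discs with Strassman count 1\<close>

abbreviation approx_poly :: "nat \<Rightarrow> (nat \<Rightarrow> int) list \<Rightarrow> int poly" where
  "approx_poly N f \<equiv> Poly (map (\<lambda>c. c N) f)"

lemma peval_padic:
  assumes "p > 0" "set f \<subseteq> carrier (padic_int p)" "z \<in> carrier (padic_int p)"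
  shows "peval (padic_int p) f z \<in> carrier (padic_int p)"
    and "peval (padic_int p) f z N = poly (approx_poly N f) (z N) mod int p ^ N"
proof -
  have "peval (padic_int p) f z \<in> carrier (padic_int p) \<and>
    (\<forall>N. peval (padic_int p) f z N = poly (approx_poly N f) (z N) mod int p ^ N)"
    using assms(2)
  proof (induction f)
    case Nil
    then show ?case using assms(1) by (simp add: padic_int_simps padic_carrier_iff)
  next
    case (Cons c f)
    then have c: "c \<in> carrier (padic_int p)" and IH: "peval (padic_int p) f z \<in> carrier (padic_int p)"
      "\<And>N. peval (padic_int p) f z N = poly (approx_poly N f) (z N) mod int p ^ N" by auto
    have "peval (padic_int p) (c # f) z \<in> carrier (padic_int p)"
      using padic_add_closed[OF assms(1) c padic_mult_closed[OF assms(1,3) IH(1)]] by simp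
    moreover have "peval (padic_int p) (c # f) z N = poly (approx_poly N (c # f)) (z N) mod int p ^ N" for N
      using IH(2) by (simp add: padic_int_simps(1,2) mod_simps)
    ultimately show ?case by blast
  qed
  then show "peval (padic_int p) f z \<in> carrier (padic_int p)"
    and "peval (padic_int p) f z N = poly (approx_poly N f) (z N) mod int p ^ N" by blast+
qed

lemma pderivative_padic:
  assumes "p > 0" "set f \<subseteq> carrier (padic_int p)"
  shows "set (pderivative (padic_int p) f) \<subseteq> carrier (padic_int p)"
    and "icong [:int p ^ N:] 0 (approx_poly N (pderivative (padic_int p) f)) (pderiv (approx_poly N f))"
proof -
  show "set (pderivative (padic_int p) f) \<subseteq> carrier (padic_int p)"
    using assms by (auto simp: pderivative_def nat_in_padic intro!: padic_mult_closed padic_of_int_closed)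
  show "icong [:int p ^ N:] 0 (approx_poly N (pderivative (padic_int p) f)) (pderiv (approx_poly N f))"
  proof (rule icong_0_coeffI)
    fix k
    show "int p ^ N dvd coeff (approx_poly N (pderivative (padic_int p) f)) k - coeff (pderiv (approx_poly N f)) k"
    proof (cases "Suc k < length f")
      case True
      have "int p ^ N dvd x mod int p ^ N - x" for x by (simp add: mod_eq_dvd_iff[symmetric])
      then show ?thesis using True
        by (simp add: nth_default_def pderivative_def coeff_pderiv padic_int_simps nat_in_padic
          padic_of_int_def mod_simps del: of_nat_Suc)
    next
      case False
      then have "\<not> k < length f - 1" by linarith
      with False show ?thesis by (simp add: nth_default_def pderivative_def coeff_pderiv)
    qed
  qed
qed

lemma peval_pderivative:
  assumes "p > 0" "set f \<subseteq> carrier (padic_int p)" "z \<in> carrier (padic_int p)"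
  shows "peval (padic_int p) (pderivative (padic_int p) f) z \<in> carrier (padic_int p)"
    and "peval (padic_int p) (pderivative (padic_int p) f) z N = poly (pderiv (approx_poly N f)) (z N) mod int p ^ N"
proof -
  note d = pderivative_padic[OF assms(1,2)]
  show "peval (padic_int p) (pderivative (padic_int p) f) z \<in> carrier (padic_int p)"
    by (rule peval_padic[OF assms(1) d(1) assms(3)])
  have "int p ^ N dvd poly (approx_poly N (pderivative (padic_int p) f)) (z N) - poly (pderiv (approx_poly N f)) (z N)"
    by (rule poly_icong[OF d(2)]) simp
  then show "peval (padic_int p) (pderivative (padic_int p) f) z N = poly (pderiv (approx_poly N f)) (z N) mod int p ^ N"
    unfolding peval_padic(2)[OF assms(1) d(1) assms(3)] by (simp only: mod_eq_dvd_iff)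
qed

lemma approx_poly_cong:
  assumes "set f \<subseteq> carrier (padic_int p)" "n \<le> N"
  shows "icong [:int p ^ n:] 0 (approx_poly N f) (approx_poly n f)"
proof (rule icong_0_coeffI)
  fix k
  have "int p ^ n dvd (f ! k) N - (f ! k) n" if "k < length f"
    using assms that by (intro padic_step_dvd) auto
  then show "int p ^ n dvd coeff (approx_poly N f) k - coeff (approx_poly n f) k"
    by (simp add: nth_default_def)
qed

lemma degree_approx_poly: "length f = Suc d \<Longrightarrow> degree (approx_poly N f) \<le> d"
  by (rule degree_le) (simp add: nth_default_def)

section \<open>Taylor expansion on a disc\<close>

lemma poly_taylor2:
  fixes D :: "int poly"
  shows "\<exists>E. poly D y = poly D x + poly (pderiv D) x * (y - x) + (y - x)\<^sup>2 * E"
proof (induction D)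
  case (pCons a D)
  then obtain E where E: "poly D y = poly D x + poly (pderiv D) x * (y - x) + (y - x)\<^sup>2 * E" by blast
  have "poly (pCons a D) y = poly (pCons a D) x + poly (pderiv (pCons a D)) x * (y - x)
      + (y - x)\<^sup>2 * (poly (pderiv D) x + y * E)"
    by (simp add: E pderiv_pCons algebra_simps power2_eq_square)
  then show ?case ..
qed simp

text \<open>The linear part of \<open>D\<close> has no second-order remainder, and the rest is
  \<open>m\<close> times a polynomial.\<close>

lemma poly_taylor2_dvd:
  fixes D :: "int poly"
  assumes "\<And>k. k \<ge> 2 \<Longrightarrow> m dvd coeff D k"
  shows "m * (y - x)\<^sup>2 dvd poly D y - poly D x - poly (pderiv D) x * (y - x)"
proof -
  have "[:m:] dvd D - [:coeff D 0, coeff D 1:]"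
    unfolding const_poly_dvd_iff using assms by (auto simp: coeff_pCons split: nat.split)
  then obtain Q where "D - [:coeff D 0, coeff D 1:] = [:m:] * Q" by (rule dvdE)
  then have D: "D = [:coeff D 0, coeff D 1:] + smult m Q" by (simp add: algebra_simps)
  obtain E where E: "poly Q y = poly Q x + poly (pderiv Q) x * (y - x) + (y - x)\<^sup>2 * E"
    using poly_taylor2 by blast
  have val: "poly D z = coeff D 0 + z * coeff D 1 + m * poly Q z" for z
    by (subst D) simp
  have der: "poly (pderiv D) z = coeff D 1 + m * poly (pderiv Q) z" for z
    by (subst D) (simp add: pderiv_add pderiv_smult pderiv_pCons)
  have "poly D y - poly D x - poly (pderiv D) x * (y - x) = m * (y - x)\<^sup>2 * E"
    unfolding val der E by (simp add: algebra_simps)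
  then show ?thesis by simp
qed

text \<open>The value differs from the constant coefficient by a combination of the other ones. Thus
  a constant coefficient of strictly smallest valuation excludes zeros.\<close>

lemma dvd_coeff_0:
  fixes E :: "int poly"
  assumes "\<And>k. k \<ge> 1 \<Longrightarrow> m dvd coeff E k" "m dvd poly E x"
  shows "m dvd coeff E 0"
proof (cases E)
  case (pCons c Q)
  have "[:m:] dvd Q" unfolding const_poly_dvd_iff using assms(1)[of "Suc _"] by (simp add: pCons)
  then obtain S where "Q = [:m:] * S" by (rule dvdE)
  then have "poly E x = c + m * (x * poly S x)" by (simp add: pCons)
  then have "c = poly E x - m * (x * poly S x)" by simp
  also have "m dvd \<dots>" using assms(2) by (intro dvd_diff) simp_all
  finally show ?thesis by (simp add: pCons)
qed

lemma padic_zero_mono: "x \<in> carrier (padic_int p) \<Longrightarrow> n \<le> m \<Longrightarrow> x m = 0 \<Longrightarrow> x n = 0"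
  by (metis mod_0 padic_mod)

lemma padic_zero_iff_dvd:
  assumes "x \<in> carrier (padic_int p)" "n \<le> N"
  shows "x n = 0 \<longleftrightarrow> int p ^ n dvd x N"
  unfolding dvd_eq_mod_eq_0 padic_mod[OF assms] ..

text \<open>A disc on which \<open>f\<close> has Strassman count 1, seen with any precision \<open>N \<ge> b\<close>.\<close>

locale simple_disc =
  fixes p d b s v y :: nat and f :: "(nat \<Rightarrow> int) list"
  assumes p: "prime p" and f: "set f \<subseteq> carrier (padic_int p)" "length f = Suc d"
    and v: "v < b" and min: "\<And>N. N \<ge> b \<Longrightarrow> last_minimal p (coeff (node_poly p (approx_poly N f) s y)) d 1 v"
begin

abbreviation "R \<equiv> padic_int p"
abbreviation "fval u \<equiv> peval R f u"
abbreviation "dval u \<equiv> peval R (pderivative R f) u"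
abbreviation "D N \<equiv> node_poly p (approx_poly N f) s y"

definition in_disc :: "(nat \<Rightarrow> int) \<Rightarrow> bool" where
  "in_disc u \<longleftrightarrow> u \<in> carrier R \<and> u s = int y mod int p ^ s"

lemma p0: "p > 0" using prime_gt_0_nat[OF p] .
lemma pn0: "int p ^ n \<noteq> 0" using p0 by simp

lemma coeff_D: 
  assumes "N \<ge> b"
  shows "int p ^ v dvd coeff (D N) k" "\<not> int p ^ Suc v dvd coeff (D N) 1"
    "k \<ge> 2 \<Longrightarrow> int p ^ Suc v dvd coeff (D N) k"
proof -
  note m = min[OF assms, unfolded last_minimal_def]
  have "degree (D N) \<le> degree (approx_poly N f) * degree [:int y, int p ^ s:]"
    unfolding node_poly_def by (rule degree_pcompose_le)
  also have "\<dots> \<le> degree (approx_poly N f) * 1" by (intro mult_left_mono) auto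
  also have "\<dots> \<le> d" using degree_approx_poly[OF f(2)] by simp
  finally have deg: "coeff (D N) k = 0" if "\<not> k \<le> d" for k using that by (intro coeff_eq_0) simp
  show "int p ^ v dvd coeff (D N) k" using m deg by (cases "k \<le> d") auto
  show "\<not> int p ^ Suc v dvd coeff (D N) 1" using m by blast
  show "int p ^ Suc v dvd coeff (D N) k" if "k \<ge> 2" using m deg that by (cases "k \<le> d") (auto simp del: power_Suc)
qed

lemma s_le_v: "s \<le> v"
proof (rule ccontr)
  assume "\<not> s \<le> v"
  then have "int p ^ Suc v dvd int p ^ s" by (intro le_imp_power_dvd) simp
  moreover have "int p ^ s dvd coeff (D b) 1" by (simp add: coeff_node_poly)
  ultimately show False using coeff_D(2)[of b] dvd_trans by blast
qed

lemma disc_coordinate: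
  assumes "in_disc u" "N \<ge> s"
  obtains \<tau> where "u N = int y + int p ^ s * \<tau>"
proof -
  have "u N mod int p ^ s = int y mod int p ^ s"
    using padic_mod[of u p s N] assms by (simp add: in_disc_def)
  then have "int p ^ s dvd u N - int y" by (simp only: mod_eq_dvd_iff)
  then obtain \<tau> where "u N - int y = int p ^ s * \<tau>" by (rule dvdE)
  then show ?thesis by (intro that[of \<tau>]) simp
qed

lemma fval_D: "u \<in> carrier R \<Longrightarrow> u N = int y + int p ^ s * \<tau> \<Longrightarrow> int p ^ N dvd fval u N - poly (D N) \<tau>"
  unfolding peval_padic(2)[OF p0 f(1)]
  by (simp add: node_poly_def poly_pcompose mod_eq_dvd_iff[symmetric] mult.commute)

lemma pderiv_D: "poly (pderiv (D N)) \<tau> = int p ^ s * poly (pderiv (approx_poly N f)) (int y + int p ^ s * \<tau>)"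
  by (simp add: node_poly_def pderiv_pcompose poly_pcompose pderiv_pCons mult.commute)

lemma dval_D: "u \<in> carrier R \<Longrightarrow> int p ^ N dvd dval u N - poly (pderiv (approx_poly N f)) (u N)"
  unfolding peval_pderivative(2)[OF p0 f(1)] by (simp add: mod_eq_dvd_iff[symmetric])

lemma fval_v: "in_disc u \<Longrightarrow> fval u v = 0"
proof -
  assume u: "in_disc u"
  then have uc: "u \<in> carrier R" by (simp add: in_disc_def)
  have "s \<le> b" using s_le_v v by simp
  then obtain \<tau> where t: "u b = int y + int p ^ s * \<tau>" using disc_coordinate[OF u] by blast
  have "[:int p ^ v:] dvd D b" unfolding const_poly_dvd_iff using coeff_D(1)[of b] by simp
  then obtain H where "D b = [:int p ^ v:] * H" by (rule dvdE)
  then have "int p ^ v dvd poly (D b) \<tau>" by simp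
  moreover have "int p ^ v dvd fval u b - poly (D b) \<tau>"
    by (rule dvd_trans[OF _ fval_D[OF uc t]]) (use v in \<open>simp add: le_imp_power_dvd\<close>)
  ultimately have "int p ^ v dvd fval u b" by (metis diff_add_cancel dvd_add)
  then show ?thesis using padic_zero_iff_dvd[OF peval_padic(1)[OF p0 f(1) uc], of v b] v by simp
qed

text \<open>Modulo \<open>p ^ Suc v\<close> the derivative is the constant
  \<open>coeff (D N) 1\<close>, because the coefficients from degree 2 on vanish there. So it has
  valuation \<open>v\<close> on the whole disc.\<close>

lemma pderiv_D_exact:
  assumes "N \<ge> b"
  shows "int p ^ v dvd poly (pderiv (D N)) \<tau>" "\<not> int p ^ Suc v dvd poly (pderiv (D N)) \<tau>"
proof -
  have dvd1: "int p ^ Suc v dvd coeff (pderiv (D N) - [:coeff (D N) 1:]) k" for k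
  proof (cases k)
    case (Suc j)
    then show ?thesis using coeff_D(3)[OF assms, of "Suc k"]
      by (simp add: coeff_pderiv del: power_Suc of_nat_Suc)
  qed (simp add: coeff_pderiv)
  then have "[:int p ^ Suc v:] dvd pderiv (D N) - [:coeff (D N) 1:]" unfolding const_poly_dvd_iff by blast
  then obtain H where "pderiv (D N) - [:coeff (D N) 1:] = [:int p ^ Suc v:] * H" by (rule dvdE)
  then have "pderiv (D N) = [:coeff (D N) 1:] + [:int p ^ Suc v:] * H" by (simp add: algebra_simps)
  then have *: "poly (pderiv (D N)) \<tau> = coeff (D N) 1 + int p ^ Suc v * poly H \<tau>" by simp
  show "int p ^ v dvd poly (pderiv (D N)) \<tau>"
    unfolding * using coeff_D(1)[OF assms, of 1] by (intro dvd_add) simp_all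
  show "\<not> int p ^ Suc v dvd poly (pderiv (D N)) \<tau>"
    unfolding * using coeff_D(2)[OF assms] dvd_add_left_iff[of "int p ^ Suc v" "int p ^ Suc v * poly H \<tau>"]
    by (simp del: power_Suc)
qed

text \<open>In the coordinate of the disc the derivative gains a factor \<open>p ^ s\<close> by the
  chain rule, hence the difference \<open>v - s\<close>.\<close>

lemma dval_exact:
  assumes u: "in_disc u"
  shows "dval u (v - s) = 0" "dval u (Suc (v - s)) \<noteq> 0"
proof -
  have uc: "u \<in> carrier R" using u by (simp add: in_disc_def)
  have sb: "s \<le> b" using s_le_v v by simp
  then obtain \<tau> where t: "u b = int y + int p ^ s * \<tau>" using disc_coordinate[OF u] by blast
  let ?d = "poly (pderiv (approx_poly b f)) (u b)"
  have e: "poly (pderiv (D b)) \<tau> = int p ^ s * ?d" using pderiv_D[of b \<tau>] t by simp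
  have pow: "int p ^ s * int p ^ (v - s) = int p ^ v" "int p ^ s * int p ^ Suc (v - s) = int p ^ Suc v"
    using s_le_v by (simp_all flip: power_add power_Suc)
  have "int p ^ s * int p ^ (v - s) dvd int p ^ s * ?d"
    unfolding pow e[symmetric] by (rule pderiv_D_exact) simp
  then have 1: "int p ^ (v - s) dvd ?d" by (simp only: dvd_times_left_cancel_iff[OF pn0])
  have "\<not> int p ^ s * int p ^ Suc (v - s) dvd int p ^ s * ?d"
    unfolding pow e[symmetric] by (rule pderiv_D_exact) simp
  then have 2: "\<not> int p ^ Suc (v - s) dvd ?d" by (simp only: dvd_times_left_cancel_iff[OF pn0] simp_thms)
  have iff: "dval u n = 0 \<longleftrightarrow> int p ^ n dvd ?d" if "n \<le> b" for n
  proof -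
    have "int p ^ n dvd dval u b - ?d"
      by (rule dvd_trans[OF _ dval_D[OF uc]]) (use that in \<open>simp add: le_imp_power_dvd\<close>)
    then have "int p ^ n dvd dval u b \<longleftrightarrow> int p ^ n dvd ?d" by (metis diff_add_cancel dvd_add_right_iff)
    then show ?thesis using padic_zero_iff_dvd[OF peval_pderivative(1)[OF p0 f(1) uc] that] by simp
  qed
  show "dval u (v - s) = 0" "dval u (Suc (v - s)) \<noteq> 0"
    using iff[of "v - s"] iff[of "Suc (v - s)"] 1 2 v by simp_all
qed

lemma dval_nonzero: "in_disc u \<Longrightarrow> dval u \<noteq> \<zero>\<^bsub>R\<^esub>"
  by (metis dval_exact(2) padic_int_simps(3))

text \<open>The last conjunct is quantitative: where the value has valuation at least
  \<open>v + m\<close>, the point moves by valuation at least \<open>s + m\<close>, as the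
  derivative has valuation \<open>v - s\<close>.\<close>

definition newton_step :: "(nat \<Rightarrow> int) \<Rightarrow> (nat \<Rightarrow> int) \<Rightarrow> bool" where
  "newton_step u u' \<longleftrightarrow> in_disc u' \<and> (u \<ominus>\<^bsub>R\<^esub> u') \<otimes>\<^bsub>R\<^esub> dval u = fval u \<and>
     (\<forall>m. fval u (v + m) = 0 \<longrightarrow> (u \<ominus>\<^bsub>R\<^esub> u') (s + m) = 0)"

lemma newton_step_exists:
  assumes u: "in_disc u"
  shows "\<exists>u'. newton_step u u'"
proof -
  have uc: "u \<in> carrier R" using u by (simp add: in_disc_def)
  note X = peval_padic(1)[OF p0 f(1) uc] and Y = peval_pderivative(1)[OF p0 f(1) uc]
  have "fval u (v - s) = 0" using padic_mod[OF X, of "v - s" v] fval_v[OF u] by simp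
  from padic_division[OF p X Y dval_exact[OF u] this] obtain z where
    z: "z \<in> carrier R" "z \<otimes>\<^bsub>R\<^esub> dval u = fval u" "\<And>e. fval u (v - s + e) = 0 \<Longrightarrow> z e = 0" by blast
  have zm: "z (s + m) = 0" if "fval u (v + m) = 0" for m
    using z(3)[of "s + m"] that s_le_v by simp
  define u' where "u' = u \<ominus>\<^bsub>R\<^esub> z"
  have u'c: "u' \<in> carrier R" unfolding u'_def by (rule padic_minus_closed[OF p0 uc z(1)])
  have diff: "u \<ominus>\<^bsub>R\<^esub> u' = z"
  proof
    fix n
    have "(u n - (u n - z n)) mod int p ^ n = z n mod int p ^ n" by simp
    also have "\<dots> = z n" using padic_mod[OF z(1), of n n] by simp
    finally show "(u \<ominus>\<^bsub>R\<^esub> u') n = z n"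
      unfolding padic_minus[OF p0 u'c] by (simp add: u'_def padic_minus[OF p0 z(1)] mod_simps)
  qed
  \<comment> \<open>The value is divisible by \<open>p ^ v\<close> everywhere on the disc, so the
    step does not leave the disc.\<close>
  have "z s = 0" using zm[of 0] fval_v[OF u] by simp
  then have "u' s = u s" using padic_mod[OF uc, of s s] by (simp add: u'_def padic_minus[OF p0 z(1)])
  then have "in_disc u'" using u u'c by (simp add: in_disc_def)
  then show ?thesis unfolding newton_step_def
    by (intro exI[of _ u'] conjI allI impI) (simp_all only: diff z(2) zm)
qed

text \<open>Both kinds of convergence follow from Taylor's formula on the disc.\<close>

lemma newton_step_taylor:
  assumes u: "in_disc u" and step: "newton_step u u'" and w: "in_disc w" and N: "N \<ge> b"
    and near: "int p ^ (s + m) dvd u N - w N" and mN: "v + 1 + 2 * m \<le> N"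
  shows "int p ^ (v + 1 + 2 * m) dvd (u' N - w N) * poly (pderiv (approx_poly N f)) (u N) + fval w N"
proof -
  let ?d = "poly (pderiv (approx_poly N f)) (u N)"
  have uc: "u \<in> carrier R" "u' \<in> carrier R" "w \<in> carrier R"
    using u w step by (simp_all add: in_disc_def newton_step_def)
  have sN: "s \<le> N" using s_le_v v N by simp
  obtain \<tau> where t: "u N = int y + int p ^ s * \<tau>" using disc_coordinate[OF u sN] by blast
  obtain \<sigma> where \<sigma>: "w N = int y + int p ^ s * \<sigma>" using disc_coordinate[OF w sN] by blast
  have "int p ^ s * int p ^ m dvd int p ^ s * (\<tau> - \<sigma>)" using near by (simp add: t \<sigma> power_add algebra_simps)
  then have "int p ^ m dvd \<tau> - \<sigma>" by (simp only: dvd_times_left_cancel_iff[OF pn0])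
  then have "int p ^ m dvd \<sigma> - \<tau>" by (simp add: dvd_diff_commute)
  then have "(int p ^ m)\<^sup>2 dvd (\<sigma> - \<tau>)\<^sup>2" by (rule dvd_power_same)
  \<comment> \<open>The coefficients of degree at least 2 are divisible by \<open>p ^ Suc v\<close>
    instead of \<open>p ^ v\<close>. This additional digit makes the method converge already from
    the center, where \<open>m = 0\<close>.\<close>
  then have "int p ^ Suc v * (int p ^ m)\<^sup>2 dvd int p ^ Suc v * (\<sigma> - \<tau>)\<^sup>2" by (rule mult_dvd_mono[OF dvd_refl])
  also have "int p ^ Suc v * (\<sigma> - \<tau>)\<^sup>2 dvd poly (D N) \<sigma> - poly (D N) \<tau> - poly (pderiv (D N)) \<tau> * (\<sigma> - \<tau>)"
    by (rule poly_taylor2_dvd) (rule coeff_D(3)[OF N])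
  also have "int p ^ Suc v * (int p ^ m)\<^sup>2 = int p ^ (v + 1 + 2 * m)"
    by (simp add: power_add power_mult power2_eq_square flip: power_mult_distrib)
  finally have 1: "int p ^ (v + 1 + 2 * m) dvd poly (D N) \<sigma> - poly (D N) \<tau> - poly (pderiv (D N)) \<tau> * (\<sigma> - \<tau>)" .
  have pN: "int p ^ (v + 1 + 2 * m) dvd int p ^ N" by (rule le_imp_power_dvd) fact
  have 2: "int p ^ (v + 1 + 2 * m) dvd fval w N - poly (D N) \<sigma>" by (rule dvd_trans[OF pN fval_D[OF uc(3) \<sigma>]])
  have 3: "int p ^ (v + 1 + 2 * m) dvd fval u N - poly (D N) \<tau>" by (rule dvd_trans[OF pN fval_D[OF uc(1) t]])
  have "((u \<ominus>\<^bsub>R\<^esub> u') \<otimes>\<^bsub>R\<^esub> dval u) N = fval u N"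
    using step by (simp only: newton_step_def)
  then have "((u N - u' N) * dval u N) mod int p ^ N = fval u N"
    unfolding padic_int_simps(1) padic_minus[OF p0 uc(2)] by (simp only: mod_mult_left_eq)
  then have "int p ^ N dvd (u N - u' N) * dval u N - fval u N" by (metis mod_eq_dvd_iff mod_mod_trivial)
  moreover have "int p ^ N dvd (u N - u' N) * (dval u N - ?d)" using dval_D[OF uc(1)] by simp
  ultimately have "int p ^ N dvd ((u N - u' N) * dval u N - fval u N) - (u N - u' N) * (dval u N - ?d)"
    by (rule dvd_diff)
  then have "int p ^ N dvd (u N - u' N) * ?d - fval u N" by (simp add: algebra_simps)
  then have 4: "int p ^ (v + 1 + 2 * m) dvd (u N - u' N) * ?d - fval u N" by (rule dvd_trans[OF pN])
  have 5: "poly (pderiv (D N)) \<tau> * (\<sigma> - \<tau>) = (w N - u N) * ?d"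
    using pderiv_D[of N \<tau>] by (simp add: t \<sigma> algebra_simps)
  have "int p ^ (v + 1 + 2 * m) dvd (poly (D N) \<sigma> - poly (D N) \<tau> - poly (pderiv (D N)) \<tau> * (\<sigma> - \<tau>))
      + (fval w N - poly (D N) \<sigma>) - (fval u N - poly (D N) \<tau>) - ((u N - u' N) * ?d - fval u N)"
    by (rule dvd_diff[OF dvd_diff[OF dvd_add[OF 1 2] 3] 4])
  then show ?thesis unfolding 5 by (simp add: algebra_simps)
qed

text \<open>Taylor's formula with \<open>w = u'\<close>, for which the linear term vanishes.\<close>

lemma newton_step_residual:
  assumes u: "in_disc u" and step: "newton_step u u'" and m: "fval u (v + m) = 0"
  shows "fval u' (v + (1 + 2 * m)) = 0"
proof -
  define N where "N = b + v + 1 + 2 * m + s"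
  have u': "in_disc u'" using step by (simp add: newton_step_def)
  then have uc: "u' \<in> carrier R" "u \<in> carrier R" using u by (simp_all add: in_disc_def)
  have "(u \<ominus>\<^bsub>R\<^esub> u') (s + m) = 0" using step m by (simp add: newton_step_def)
  then have "int p ^ (s + m) dvd (u \<ominus>\<^bsub>R\<^esub> u') N"
    using padic_zero_iff_dvd[OF padic_minus_closed[OF p0 uc(2,1)], of "s + m" N] by (simp add: N_def)
  then have near: "int p ^ (s + m) dvd u N - u' N"
    by (simp add: padic_minus[OF p0 uc(1)] dvd_mod_iff le_imp_power_dvd N_def)
  have "int p ^ (v + 1 + 2 * m) dvd fval u' N"
    using newton_step_taylor[OF u step u' _ near] by (simp add: N_def)
  then show ?thesis
    using padic_zero_iff_dvd[OF peval_padic(1)[OF p0 f(1) uc(1)], of "v + 1 + 2 * m" N] by (simp add: N_def)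
qed

text \<open>At a root \<open>w\<close> the value drops out of Taylor's formula, and division by the
  derivative turns the exponent \<open>v + 1 + 2 * m\<close> into
  \<open>s + 1 + 2 * m\<close>.\<close>

lemma newton_step_error:
  assumes u: "in_disc u" and step: "newton_step u u'" and w: "in_disc w" "fval w = \<zero>\<^bsub>R\<^esub>"
    and m: "(u \<ominus>\<^bsub>R\<^esub> w) (s + m) = 0"
  shows "(u' \<ominus>\<^bsub>R\<^esub> w) (s + (1 + 2 * m)) = 0"
proof -
  define N where "N = b + v + 1 + 2 * m + s"
  let ?d = "poly (pderiv (approx_poly N f)) (u N)"
  have u': "in_disc u'" using step by (simp add: newton_step_def)
  then have uc: "u' \<in> carrier R" "u \<in> carrier R" "w \<in> carrier R" using u w by (simp_all add: in_disc_def)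
  have "int p ^ (s + m) dvd (u \<ominus>\<^bsub>R\<^esub> w) N"
    using m padic_zero_iff_dvd[OF padic_minus_closed[OF p0 uc(2,3)], of "s + m" N] by (simp add: N_def)
  then have near: "int p ^ (s + m) dvd u N - w N"
    by (simp add: padic_minus[OF p0 uc(3)] dvd_mod_iff le_imp_power_dvd N_def)
  have "int p ^ (v + 1 + 2 * m) dvd (u' N - w N) * ?d"
    using newton_step_taylor[OF u step w(1) _ near] w(2) by (simp add: N_def padic_int_simps)
  moreover obtain \<tau> where t: "u N = int y + int p ^ s * \<tau>" using disc_coordinate[OF u, of N] by (auto simp: N_def)
  have Nb: "N \<ge> b" by (simp add: N_def)
  obtain h where h: "poly (pderiv (D N)) \<tau> = int p ^ v * h" using pderiv_D_exact(1)[OF Nb] by (meson dvdE)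
  have hp: "\<not> int p dvd h"
  proof
    assume "int p dvd h"
    then have "int p ^ Suc v dvd poly (pderiv (D N)) \<tau>" unfolding h by (simp add: mult.commute mult_dvd_mono)
    then show False using pderiv_D_exact(2)[OF Nb] by blast
  qed
  have "int p ^ s * ?d = int p ^ v * h" using pderiv_D[of N \<tau>] h t by simp
  then have "int p ^ s * ((u' N - w N) * ?d) = int p ^ v * ((u' N - w N) * h)" by (simp add: algebra_simps)
  moreover have "int p ^ s * int p ^ (v + 1 + 2 * m) = int p ^ v * int p ^ (s + 1 + 2 * m)"
    by (simp flip: power_add add: ac_simps)
  ultimately have "int p ^ v * int p ^ (s + 1 + 2 * m) dvd int p ^ v * ((u' N - w N) * h)"
    by (metis dvd_refl mult_dvd_mono)
  then have "int p ^ (s + 1 + 2 * m) dvd (u' N - w N) * h" by (simp only: dvd_times_left_cancel_iff[OF pn0])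
  moreover have "coprime (int p ^ (s + 1 + 2 * m)) h"
    using hp p by (intro coprime_power_left_iff[THEN iffD2] disjI1 prime_imp_coprime) simp_all
  ultimately have "int p ^ (s + 1 + 2 * m) dvd u' N - w N" by (simp add: coprime_dvd_mult_left_iff)
  then have "int p ^ (s + 1 + 2 * m) dvd (u' \<ominus>\<^bsub>R\<^esub> w) N"
    by (simp add: padic_minus[OF p0 uc(3)] dvd_mod_iff le_imp_power_dvd N_def)
  then show ?thesis
    using padic_zero_iff_dvd[OF padic_minus_closed[OF p0 uc(1,3)], of "s + 1 + 2 * m" N] by (simp add: N_def)
qed

lemma center_in_disc: "in_disc (padic_of_int p (int y))"
  unfolding in_disc_def using padic_of_int_closed[OF p0] by (simp add: padic_of_int_def)

lemma newton_sequence: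
  "\<exists>u. u 0 = padic_of_int p (int y) \<and> (\<forall>n. in_disc (u n) \<and> newton_step (u n) (u (Suc n)))"
proof -
  have "\<exists>u. \<forall>n. (in_disc (u n) \<and> (n = 0 \<longrightarrow> u n = padic_of_int p (int y))) \<and> newton_step (u n) (u (Suc n))"
  proof (rule dependent_nat_choice)
    show "\<exists>x. in_disc x \<and> (0 = (0::nat) \<longrightarrow> x = padic_of_int p (int y))" using center_in_disc by blast
    fix x and n :: nat assume "in_disc x \<and> (n = 0 \<longrightarrow> x = padic_of_int p (int y))"
    then show "\<exists>x'. (in_disc x' \<and> (Suc n = 0 \<longrightarrow> x' = padic_of_int p (int y))) \<and> newton_step x x'"
      using newton_step_exists[of x] by (auto simp: newton_step_def)
  qed
  then obtain u where "\<forall>n. (in_disc (u n) \<and> (n = 0 \<longrightarrow> u n = padic_of_int p (int y))) \<and> newton_step (u n) (u (Suc n))"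
    by (rule exE)
  then show ?thesis by (intro exI[of _ u]) simp
qed

text \<open>The first \<open>n\<close> digits are stable from \<open>u n\<close> on, so the diagonal
  is the limit of the Newton sequence. Its value vanishes modulo \<open>p ^ n\<close> because that
  of \<open>u n\<close> does.\<close>

lemma root_exists: "\<exists>w. in_disc w \<and> fval w = \<zero>\<^bsub>R\<^esub>"
proof -
  obtain u where "\<forall>n. in_disc (u n) \<and> newton_step (u n) (u (Suc n))" using newton_sequence by blast
  then have u: "in_disc (u n)" "newton_step (u n) (u (Suc n))" for n by simp_all
  have uc: "u n \<in> carrier R" for n using u(1)[of n] by (simp add: in_disc_def)
  have X: "fval (u n) \<in> carrier R" for n by (rule peval_padic(1)[OF p0 f(1) uc])
  have res: "fval (u n) (v + n) = 0" for n
  proof (induction n)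
    case 0
    then show ?case using fval_v[OF u(1)] by simp
  next
    case (Suc n)
    show ?case
      by (rule padic_zero_mono[OF X _ newton_step_residual[OF u(1) u(2) Suc]]) simp
  qed
  have step: "u (Suc n) k = u n k" if "k \<le> n" for n k
  proof -
    have "(u n \<ominus>\<^bsub>R\<^esub> u (Suc n)) (s + n) = 0" using u(2)[of n] res[of n] by (simp add: newton_step_def)
    then have "(u n \<ominus>\<^bsub>R\<^esub> u (Suc n)) k = 0"
      by (rule padic_zero_mono[OF padic_minus_closed[OF p0 uc uc], rotated]) (use that in simp)
    then have "int p ^ k dvd u n k - u (Suc n) k" by (simp add: padic_minus[OF p0 uc] dvd_eq_mod_eq_0)
    then have "u n k mod int p ^ k = u (Suc n) k mod int p ^ k" by (simp only: mod_eq_dvd_iff)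
    then show ?thesis using padic_mod[OF uc, of k k] by simp
  qed
  have stable: "u (k + j) k = u k k" for k j
    by (induction j) (simp_all add: step)
  define w where "w n = u n n" for n
  have wc: "w \<in> carrier R"
    unfolding padic_carrier_iff
  proof (intro allI conjI)
    fix n show "0 \<le> w n" "w n < int p ^ n" using padic_range[OF uc] by (simp_all add: w_def)
    show "w (Suc n) mod int p ^ n = w n"
      using padic_mod[OF uc, of n "Suc n"] step[of n n] by (simp add: w_def)
  qed
  have "in_disc w" using wc u(1)[of s] by (simp add: in_disc_def w_def)
  moreover have "fval w = \<zero>\<^bsub>R\<^esub>"
  proof
    fix n
    have "fval w n = poly (approx_poly n f) (u (n + 0) n) mod int p ^ n"
      unfolding peval_padic(2)[OF p0 f(1) wc] by (simp add: w_def)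
    also have "\<dots> = fval (u n) n" by (simp add: peval_padic(2)[OF p0 f(1) uc])
    also have "\<dots> = 0" by (rule padic_zero_mono[OF X _ res[of n]]) simp
    finally show "fval w n = \<zero>\<^bsub>R\<^esub> n" by (simp add: padic_int_simps)
  qed
  ultimately show ?thesis by blast
qed

lemma newton_converges:
  assumes w: "in_disc w" "fval w = \<zero>\<^bsub>R\<^esub>"
  shows "newton_converges_quadratically p f (padic_of_int p (int y)) w"
proof -
  obtain u where u0: "u 0 = padic_of_int p (int y)" and "\<forall>n. in_disc (u n) \<and> newton_step (u n) (u (Suc n))"
    using newton_sequence by blast
  then have u: "in_disc (u n)" "newton_step (u n) (u (Suc n))" for n by simp_all
  have uc: "u n \<in> carrier R" and wc: "w \<in> carrier R" for n using u(1)[of n] w by (simp_all add: in_disc_def)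
  have p1: "p > 1" using prime_gt_1_nat[OF p] .
  then have rp: "real p > 1" by simp
  define err where "err x = padic_abs p R (x \<ominus>\<^bsub>R\<^esub> w)" for x
  have ec: "x \<ominus>\<^bsub>R\<^esub> w \<in> carrier R" if "x \<in> carrier R" for x using padic_minus_closed[OF p0 that wc] .
  have err_le: "err x \<le> 1 / real p ^ e \<longleftrightarrow> (x \<ominus>\<^bsub>R\<^esub> w) e = 0" if "x \<in> carrier R" for x e
    unfolding err_def by (rule padic_abs_le_iff[OF p1 ec[OF that]])
  have err_nonneg: "0 \<le> err x" for x by (simp add: err_def padic_abs_def)
  have start: "(u n \<ominus>\<^bsub>R\<^esub> w) s = 0" for n
    using u(1)[of n] w(1) by (simp add: in_disc_def padic_minus[OF p0 wc])
  have conv: "(u n \<ominus>\<^bsub>R\<^esub> w) (s + n) = 0" for n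
  proof (induction n)
    case 0
    then show ?case using start by simp
  next
    case (Suc n)
    show ?case
      by (rule padic_zero_mono[OF ec[OF uc] _ newton_step_error[OF u(1) u(2) w Suc]]) simp
  qed
  have "(\<lambda>n. err (u n)) \<longlonglongrightarrow> 0"
  proof (rule tendsto_sandwich[OF _ _ tendsto_const])
    show "\<forall>\<^sub>F n in sequentially. 0 \<le> err (u n)" using err_nonneg by simp
    have "err (u n) \<le> (1 / real p) ^ n" for n
    proof -
      have "err (u n) \<le> 1 / real p ^ (s + n)" using conv err_le[OF uc] by simp
      also have "\<dots> \<le> 1 / real p ^ n" using rp by (intro divide_left_mono power_increasing) auto
      finally show ?thesis by (simp add: power_one_over)
    qed
    then show "\<forall>\<^sub>F n in sequentially. err (u n) \<le> (1 / real p) ^ n" by simp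
    show "(\<lambda>n. (1 / real p) ^ n) \<longlonglongrightarrow> 0" using rp by (intro LIMSEQ_power_zero) simp
  qed
  \<comment> \<open>An error of at most \<open>p ^ - (s + m)\<close> is followed by one of at most
    \<open>p ^ - (s + 1 + 2 * m)\<close>; comparison with the square
    \<open>p ^ - (2 * s + 2 * m)\<close> leaves the factor \<open>p ^ s\<close>.\<close>
  moreover have "err (u (Suc n)) \<le> real p ^ s * (err (u n))\<^sup>2" for n
  proof (cases "err (u n) = 0")
    \<comment> \<open>After an exact hit the estimate holds with every \<open>m\<close>, so the next
      error is 0 as well.\<close>
    case True
    have "err (u (Suc n)) \<le> (1 / real p) ^ m" for m
    proof -
      have "(u n \<ominus>\<^bsub>R\<^esub> w) (s + m) = 0" using True err_le[OF uc, of n "s + m"] rp by simp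
      from newton_step_error[OF u(1) u(2) w this] err_le[OF uc, of "Suc n" "s + (1 + 2 * m)"]
      have "err (u (Suc n)) \<le> 1 / real p ^ (s + (1 + 2 * m))" by simp
      also have "\<dots> \<le> 1 / real p ^ m" using rp by (intro divide_left_mono power_increasing) auto
      finally show ?thesis by (simp add: power_one_over)
    qed
    moreover have "(\<lambda>m. (1 / real p) ^ m) \<longlonglongrightarrow> 0" using rp by (intro LIMSEQ_power_zero) simp
    ultimately have "err (u (Suc n)) \<le> 0" by (intro LIMSEQ_le_const) auto
    then show ?thesis using True by simp
  next
    case False
    then obtain g where g: "err (u n) = 1 / real p ^ g" using padic_abs_values[of p R "u n \<ominus>\<^bsub>R\<^esub> w"] by (auto simp: err_def)
    have "1 / real p ^ g \<le> 1 / real p ^ s" using err_le[OF uc, of n s] start g by simp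
    then have "s \<le> g" using rp by (simp add: field_simps)
    then obtain m where m: "g = s + m" using le_Suc_ex by blast
    have "(u n \<ominus>\<^bsub>R\<^esub> w) (s + m) = 0" using err_le[OF uc, of n "s + m"] g m by simp
    from newton_step_error[OF u(1) u(2) w this] err_le[OF uc, of "Suc n" "s + (1 + 2 * m)"]
    have "err (u (Suc n)) \<le> 1 / real p ^ (s + (1 + 2 * m))" by simp
    also have "\<dots> \<le> 1 / real p ^ (s + 2 * m)" using rp by (intro divide_left_mono power_increasing) auto
    also have "\<dots> = real p ^ s * (err (u n))\<^sup>2"
    proof -
      have "(real p ^ (s + m))\<^sup>2 = real p ^ (s + (s + 2 * m))"
        by (simp only: power_mult[symmetric]) (simp add: algebra_simps)
      then have "(real p ^ (s + m))\<^sup>2 = real p ^ s * real p ^ (s + 2 * m)" by (simp only: power_add)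
      then show ?thesis using rp by (simp add: g m power_divide)
    qed
    finally show ?thesis .
  qed
  ultimately show ?thesis
    unfolding newton_converges_quadratically_def Let_def err_def[symmetric]
    using u0 uc dval_nonzero[OF u(1)] u(2) by (intro exI[of _ u]) (auto simp: newton_step_def)
qed

end

section \<open>Correctness\<close>

lemma tree_output_node:
  assumes "prime p" "d \<ge> 1" "resolved p b t P" "(y, k) \<in> tree_output p d P n s x" "n + s \<le> t" "x < p ^ s"
  shows "k \<le> t \<and> y < p ^ k \<and> node_count p d P k y = 1"
  using assms(4-6)
proof (induction n arbitrary: s x)
  case (Suc n)
  then obtain a where a: "a \<in> node_roots p d P s x"
    and or: "(node_count p d P (Suc s) (x + a * p ^ s) > 1 \<and> (y, k) \<in> tree_output p d P n (Suc s) (x + a * p ^ s)) \<or>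
      (node_count p d P (Suc s) (x + a * p ^ s) = 1 \<and> (y, k) = (x + a * p ^ s, Suc s))"
    by (auto split: if_splits)
  have lt: "x + a * p ^ s < p ^ Suc s"
    using a Suc.prems(3) by (intro child_less) (auto simp: node_roots_def)
  from or show ?case
  proof
    assume "node_count p d P (Suc s) (x + a * p ^ s) > 1 \<and> (y, k) \<in> tree_output p d P n (Suc s) (x + a * p ^ s)"
    then show ?thesis using Suc.IH[OF _ _ lt] Suc.prems(2) by simp
  next
    assume "node_count p d P (Suc s) (x + a * p ^ s) = 1 \<and> (y, k) = (x + a * p ^ s, Suc s)"
    then show ?thesis using lt Suc.prems(2) by simp
  qed
qed simp

context
  fixes p d b t :: nat and f :: "(nat \<Rightarrow> int) list"
  assumes p: "prime p" and f: "set f \<subseteq> carrier (padic_int p)" "length f = Suc d" and d: "d \<ge> 1"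
    and res: "resolved p b t (approx_poly b f)"
begin

lemma depth_le_precision: "t \<le> b" using res by (simp add: resolved_def)

text \<open>The minimal valuation is below \<open>b\<close>, so the same data describe the disc at
  every higher precision, as the infinitely many Newton steps require.\<close>

lemma simple_disc_output:
  assumes "(y, k) \<in> tree_output p d (approx_poly b f) t 0 0"
  obtains v where "simple_disc p d b k v y f"
proof -
  note node = tree_output_node[OF p d res assms]
  have reg: "regular_node p d (approx_poly b f) b k y"
    by (rule resolved_regular[OF p d res]) (use node in auto)
  note lm = regular_nodeD[OF reg]
  let ?v = "snd (node_min p d (approx_poly b f) k y)"
  have "simple_disc p d b k ?v y f"
  proof
    fix N assume N: "N \<ge> b"
    show "last_minimal p (coeff (node_poly p (approx_poly N f) k y)) d 1 ?v"
    proof (rule last_minimal_cong[OF _ lm(2)])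
      show "last_minimal p (coeff (node_poly p (approx_poly b f) k y)) d 1 ?v" using lm(1) node by simp
      show "int p ^ b dvd coeff (node_poly p (approx_poly N f) k y) j - coeff (node_poly p (approx_poly b f) k y) j" for j
        unfolding node_poly_def by (rule coeff_icong_0[OF icong_pcompose[OF approx_poly_cong[OF f(1) N]]])
    qed
  qed (use p f lm in auto)
  then show ?thesis by (rule that)
qed

text \<open>A root is followed down the tree by its digits. The next digit is a root of the residue
  polynomial, and the count of the next disc is not 0, since otherwise the constant coefficient
  would dominate the value at the root.\<close>

lemma root_in_output:
  assumes z: "z \<in> carrier (padic_int p)" "peval (padic_int p) f z = \<zero>\<^bsub>padic_int p\<^esub>"
    and "n + s = t" "x < p ^ s" "s < t" "z s = int x"
  shows "\<exists>(y, k) \<in> tree_output p d (approx_poly b f) n s x. z k = int y"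
  using assms(3-6)
proof (induction n arbitrary: s x)
  case (Suc n)
  have p0: "p > 0" using prime_gt_0_nat[OF p] .
  have ps: "int p ^ s > 0" using p0 by simp
  have reg: "regular_node p d (approx_poly b f) b s x" by (rule resolved_regular[OF p d res]) (use Suc.prems in auto)
  define a where "a = nat (z (Suc s) div int p ^ s)"
  have range: "0 \<le> z (Suc s)" "z (Suc s) < int p ^ Suc s" using padic_range[OF z(1), of "Suc s"] by blast+
  have zdiv: "0 \<le> z (Suc s) div int p ^ s" using range(1) ps by (simp add: pos_imp_zdiv_nonneg_iff)
  have "z (Suc s) div int p ^ s * int p ^ s \<le> z (Suc s)" 
    using div_mult_mod_eq[of "z (Suc s)" "int p ^ s"] pos_mod_sign[OF ps, of "z (Suc s)"] by linarith
  with range(2) have "z (Suc s) div int p ^ s * int p ^ s < int p * int p ^ s" by simp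
  then have "z (Suc s) div int p ^ s < int p" using ps by (simp only: mult_less_cancel_right)
  then have a: "a < p" using zdiv by (simp add: a_def)
  define y where "y = x + a * p ^ s"
  have "z (Suc s) = z (Suc s) mod int p ^ s + z (Suc s) div int p ^ s * int p ^ s"
    using div_mult_mod_eq[of "z (Suc s)" "int p ^ s"] by linarith
  also have "z (Suc s) mod int p ^ s = int x" using padic_mod[OF z(1), of s "Suc s"] Suc.prems(4) by simp
  finally have zy: "z (Suc s) = int y" using zdiv by (simp add: y_def a_def)
  have y: "y < p ^ Suc s" unfolding y_def by (rule child_less[OF Suc.prems(2) a])
  have reg': "regular_node p d (approx_poly b f) b (Suc s) y" by (rule resolved_regular[OF p d res _ y]) (use Suc.prems in auto)
  let ?D = "node_poly p (approx_poly b f) s x" and ?E = "node_poly p (approx_poly b f) (Suc s) y"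
  have "Suc s \<le> b" using Suc.prems depth_le_precision by simp
  \<comment> \<open>Inside the smaller disc the root has an integer coordinate
    \<open>\<tau>\<close>, at which the disc polynomial vanishes modulo
    \<open>p ^ b\<close>.\<close>
  from padic_step_dvd[OF z(1) this] obtain \<tau> where "z b - z (Suc s) = int p ^ Suc s * \<tau>" by (rule dvdE)
  then have "z b = int y + int p ^ Suc s * \<tau>" using zy by simp
  then have "poly ?E \<tau> = poly (approx_poly b f) (z b)" by (simp add: node_poly_def poly_pcompose mult.commute)
  moreover have "poly (approx_poly b f) (z b) mod int p ^ b = 0"
    using peval_padic(2)[OF p0 f(1) z(1), of b] z(2) by (simp add: padic_int_simps)
  ultimately have zero: "int p ^ b dvd poly ?E \<tau>" by (simp add: dvd_eq_mod_eq_0)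
  have Ek: "coeff ?E k = int p ^ k * taylor_coeff ?D a k" for k unfolding y_def by (rule coeff_child)
  have degP: "degree (approx_poly b f) \<le> d" by (rule degree_approx_poly) (rule f(2))
  have root: "a \<in> node_roots p d (approx_poly b f) s x"
  proof -
    define l where "l = node_count p d (approx_poly b f) s x"
    define v where "v = snd (node_min p d (approx_poly b f) s x)"
    note lm = regular_nodeD[OF reg, folded l_def v_def]
    note lm1 = lm(1)[unfolded last_minimal_def]
    obtain h where h: "coeff ?D l = int p ^ v * h" using lm1 by (meson dvdE)
    have hp: "\<not> int p dvd h"
    proof
      assume "int p dvd h"
      then have "int p ^ Suc v dvd coeff ?D l" unfolding h by (simp add: mult.commute mult_dvd_mono)
      then show False using lm1 by blast
    qed
    have pv: "int p ^ v dvd taylor_coeff ?D a k" for k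
    proof -
      have "int p ^ v dvd taylor_coeff ?D a k - coeff ?D l * taylor_coeff (Poly (node_residues p d (approx_poly b f) s x)) a k"
        by (rule dvd_trans[OF _ taylor_coeff_node_residues[OF p degP reg, folded l_def v_def]]) simp
      then show ?thesis unfolding h by (metis diff_add_cancel dvd_add dvd_triv_left mult.assoc)
    qed
    \<comment> \<open>Refinement multiplies the \<open>k\<close>-th coefficient by
      \<open>p ^ k\<close>, so all coefficients beyond degree 0 gain a digit over \<open>v\<close>;
      the vanishing value passes this on to the constant one.\<close>
    have "int p ^ Suc v dvd coeff ?E 0"
    proof (rule dvd_coeff_0)
      show "int p ^ Suc v dvd coeff ?E k" if "k \<ge> 1" for k
        using mult_dvd_mono[OF le_imp_power_dvd[OF that, of "int p"] pv[of k]] by (simp add: Ek)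
      show "int p ^ Suc v dvd poly ?E \<tau>"
        by (rule dvd_trans[OF _ zero]) (use lm(2) in \<open>simp add: le_imp_power_dvd del: power_Suc\<close>)
    qed
    then have "int p ^ Suc v dvd taylor_coeff ?D a 0" by (simp add: Ek del: power_Suc)
    from dvd_diff[OF this taylor_coeff_node_residues[OF p degP reg, of a 0, folded l_def v_def]]
    have "int p ^ v * int p dvd int p ^ v * (h * poly (Poly (node_residues p d (approx_poly b f) s x)) (int a))"
      by (simp add: h mult.commute mult.left_commute)
    moreover have "int p ^ v \<noteq> 0" using p0 by simp
    ultimately have "int p dvd h * poly (Poly (node_residues p d (approx_poly b f) s x)) (int a)"
      using dvd_times_left_cancel_iff by blast
    then show ?thesis using hp p a by (simp add: node_roots_def prime_dvd_mult_iff)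
  qed
  have count: "node_count p d (approx_poly b f) (Suc s) y \<noteq> 0"
  proof
    assume c0: "node_count p d (approx_poly b f) (Suc s) y = 0"
    define v where "v = snd (node_min p d (approx_poly b f) (Suc s) y)"
    note lm = regular_nodeD[OF reg', unfolded c0, folded v_def]
    have "degree ?E \<le> degree (approx_poly b f) * degree [:int y, int p ^ Suc s:]"
      unfolding node_poly_def by (rule degree_pcompose_le)
    also have "\<dots> \<le> degree (approx_poly b f) * 1" by (intro mult_left_mono) auto
    finally have deg: "degree ?E \<le> d" using degP by simp
    have "int p ^ Suc v dvd coeff ?E 0"
    proof (rule dvd_coeff_0)
      show "int p ^ Suc v dvd coeff ?E k" if "k \<ge> 1" for k
      proof (cases "k \<le> d")
        case True
        then show ?thesis using lm(1) that by (simp add: last_minimal_def del: power_Suc)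
      next
        case False
        then show ?thesis using deg by (simp add: coeff_eq_0 del: power_Suc)
      qed
      show "int p ^ Suc v dvd poly ?E \<tau>"
        by (rule dvd_trans[OF _ zero]) (use lm(2) in \<open>simp add: le_imp_power_dvd del: power_Suc\<close>)
    qed
    then show False using lm(1) by (simp add: last_minimal_def del: power_Suc)
  qed
  show ?case
  proof (cases "node_count p d (approx_poly b f) (Suc s) y = 1")
    case True
    have "(y, Suc s) \<in> tree_output p d (approx_poly b f) (Suc n) s x"
      unfolding tree_output.simps using root True by (auto simp: y_def intro!: bexI[of _ a])
    then show ?thesis using zy by blast
  next
    case False
    with count have gt: "node_count p d (approx_poly b f) (Suc s) y > 1" by simp
    have "Suc s < t"
    proof (rule ccontr)
      assume "\<not> Suc s < t"
      then have "t = Suc s" using Suc.prems by simp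
      with resolved_leaf[OF p d res, of y] y gt show False by simp
    qed
    from Suc.IH[OF _ y this zy] Suc.prems(1) obtain y' k where
      *: "(y', k) \<in> tree_output p d (approx_poly b f) n (Suc s) y" "z k = int y'" by auto
    have "(y', k) \<in> tree_output p d (approx_poly b f) (Suc n) s x"
      unfolding tree_output.simps using root gt *(1) by (auto simp: y_def intro!: bexI[of _ a])
    then show ?thesis using *(2) by blast
  qed
qed simp

lemma root_output:
  assumes z: "z \<in> padic_roots p f"
  obtains y k where "(y, k) \<in> tree_output p d (approx_poly b f) t 0 0" "z k = int y"
proof -
  have zc: "z \<in> carrier (padic_int p)" "peval (padic_int p) f z = \<zero>\<^bsub>padic_int p\<^esub>"
    using z by (simp_all add: padic_roots_def)
  have "z 0 = int 0" using padic_range[OF zc(1), of 0] by simp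
  from root_in_output[OF zc, of t 0 0] resolved_pos[OF res] this show ?thesis using that by fastforce
qed

lemma in_disc_root:
  assumes "simple_disc p d b k v y f" "z \<in> carrier (padic_int p)" "z k = int y"
  shows "simple_disc.in_disc p k y z"
proof -
  have "z k = int y mod int p ^ k" using padic_range[OF assms(2), of k] assms(3) by simp
  then show ?thesis using assms(2) by (simp add: simple_disc.in_disc_def[OF assms(1)])
qed

lemma approximates_output:
  "approximates_all_roots p f ((\<lambda>(y, k). (padic_of_int p (int y), k)) ` tree_output p d (approx_poly b f) t 0 0)"
  unfolding approximates_all_roots_def
proof (intro conjI)
  show "(\<lambda>(y, k). (padic_of_int p (int y), k)) ` tree_output p d (approx_poly b f) t 0 0 \<subseteq> carrier (padic_int p) \<times> UNIV"
    using padic_of_int_closed[OF prime_gt_0_nat[OF p]] by auto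
  show "\<forall>(x, s)\<in>(\<lambda>(y, k). (padic_of_int p (int y), k)) ` tree_output p d (approx_poly b f) t 0 0.
      \<exists>z\<in>padic_roots p f. newton_converges_quadratically p f x z"
  proof clarify
    fix y k assume "(y, k) \<in> tree_output p d (approx_poly b f) t 0 0"
    then obtain v where sd: "simple_disc p d b k v y f" by (rule simple_disc_output)
    from simple_disc.root_exists[OF sd] obtain w where
      w: "simple_disc.in_disc p k y w" "peval (padic_int p) f w = \<zero>\<^bsub>padic_int p\<^esub>" by blast
    then have "w \<in> padic_roots p f" by (simp add: padic_roots_def simple_disc.in_disc_def[OF sd])
    with simple_disc.newton_converges[OF sd w]
    show "\<exists>z\<in>padic_roots p f. newton_converges_quadratically p f (padic_of_int p (int y)) z" by blast
  qed
  show "\<forall>z\<in>padic_roots p f. \<exists>(x, s)\<in>(\<lambda>(y, k). (padic_of_int p (int y), k)) ` tree_output p d (approx_poly b f) t 0 0.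
      newton_converges_quadratically p f x z"
  proof
    fix z assume z: "z \<in> padic_roots p f"
    then have zc: "z \<in> carrier (padic_int p)" "peval (padic_int p) f z = \<zero>\<^bsub>padic_int p\<^esub>"
      by (simp_all add: padic_roots_def)
    from z obtain y k where yk: "(y, k) \<in> tree_output p d (approx_poly b f) t 0 0" "z k = int y" by (rule root_output)
    from yk(1) obtain v where sd: "simple_disc p d b k v y f" by (rule simple_disc_output)
    from simple_disc.newton_converges[OF sd in_disc_root[OF sd zc(1) yk(2)] zc(2)] yk(1)
    show "\<exists>(x, s)\<in>(\<lambda>(y, k). (padic_of_int p (int y), k)) ` tree_output p d (approx_poly b f) t 0 0.
      newton_converges_quadratically p f x z" by force
  qed
qed

text \<open>Every root lies in a disc of the output, and the derivative has no zero there.\<close>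

lemma resolved_no_singular_roots: "no_singular_roots p f"
proof -
  have False if z: "z \<in> padic_roots p f" "z \<in> padic_roots p (pderivative (padic_int p) f)" for z
  proof -
    from z(1) have zc: "z \<in> carrier (padic_int p)" by (simp add: padic_roots_def)
    from z(1) obtain y k where yk: "(y, k) \<in> tree_output p d (approx_poly b f) t 0 0" "z k = int y" by (rule root_output)
    from yk(1) obtain v where sd: "simple_disc p d b k v y f" by (rule simple_disc_output)
    from simple_disc.dval_nonzero[OF sd in_disc_root[OF sd zc yk(2)]] z(2)
    show False by (simp add: padic_roots_def)
  qed
  then show ?thesis by (auto simp: no_singular_roots_def)
qed

lemma run_correct_exact: "run_correct p f (strassman rf tr p (padic_int p) f)"
proof -
  have b0: "b > 0" using resolved_pos[OF res] by simp
  interpret approx_ring p b "padic_int p" "\<lambda>x. x b" "padic_of_int p" by (rule approx_ring_padic[OF p b0])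
  note run = strassman_run[OF f d res]
  show ?thesis unfolding run_correct_def using run(1,2) approximates_output by auto
qed

lemma expected_operations_exact:
  "expected_operations (strassman rf tr p (padic_int p) f) =
    of_nat (Suc d + Suc (node_count p d (approx_poly b f) 0 0)) + tree_cost rf tr p d (approx_poly b f) t 0 0"
proof -
  have b0: "b > 0" using resolved_pos[OF res] by simp
  interpret approx_ring p b "padic_int p" "\<lambda>x. x b" "padic_of_int p" by (rule approx_ring_padic[OF p b0])
  note run = strassman_run[OF f d res]
  show ?thesis unfolding expected_operations_def using run(1,3) by simp
qed

lemma run_correct_truncated: "run_correct p f (truncated_run rf tr p b (map (\<lambda>c. c b) f))"
proof -
  have b0: "b > 0" using resolved_pos[OF res] by simp
  have p0: "int p ^ b > 0" using prime_gt_0_nat[OF p] by simp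
  interpret approx_ring p b "residue_ring (int p ^ b)" "\<lambda>x. x" "\<lambda>i. i mod int p ^ b"
    by (rule approx_ring_residue_ring[OF p b0])
  have c: "set (map (\<lambda>c. c b) f) \<subseteq> carrier (residue_ring (int p ^ b))"
  proof
    fix x assume "x \<in> set (map (\<lambda>c. c b) f)"
    then obtain c where "c \<in> set f" "x = c b" by auto
    then show "x \<in> carrier (residue_ring (int p ^ b))" using padic_range[of c p b] f(1) by auto
  qed
  have poly: "Poly (map (\<lambda>x. x) (map (\<lambda>c. c b) f)) = (approx_poly b f)" by simp
  note run = strassman_run[OF c _ d, unfolded poly length_map, OF f(2) res]
  have "(\<lambda>(x, s). (padic_of_int p x, s)) ` (\<lambda>(y, k). (int y mod int p ^ b, k)) ` tree_output p d (approx_poly b f) t 0 0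
    = (\<lambda>(y, k). (padic_of_int p (int y), k)) ` tree_output p d (approx_poly b f) t 0 0"
    unfolding image_image
  proof (rule image_cong[OF refl])
    fix yk assume yk: "yk \<in> tree_output p d (approx_poly b f) t 0 0"
    obtain y k where [simp]: "yk = (y, k)" by fastforce
    \<comment> \<open>Centers lie below \<open>p ^ t\<close>, hence below \<open>p ^ b\<close>, so
      that they survive reduction modulo \<open>p ^ b\<close> unchanged.\<close>
    from tree_output_node[OF p d res, of y k t 0 0] yk have "y < p ^ k" "k \<le> t" by auto
    moreover have "p ^ k \<le> p ^ b" using \<open>k \<le> t\<close> depth_le_precision prime_gt_0_nat[OF p] by (intro power_increasing) auto
    ultimately have "int y < int (p ^ b)" by linarith
    then show "(case case yk of (y, k) \<Rightarrow> (int y mod int p ^ b, k) of (x, s) \<Rightarrow> (padic_of_int p x, s))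
      = (case yk of (y, k) \<Rightarrow> (padic_of_int p (int y), k))" by simp
  qed
  then show ?thesis
    unfolding run_correct_def truncated_run_def using run(1,2) approximates_output by auto
qed

end

section \<open>Random polynomials\<close>

definition digit_sum :: "nat \<Rightarrow> (nat \<Rightarrow> nat) \<Rightarrow> nat \<Rightarrow> int" where
  "digit_sum p x n = (\<Sum>i<n. int (x i) * int p ^ i)"

lemma digit_sum_Suc: "digit_sum p x (Suc n) = digit_sum p x n + int (x n) * int p ^ n"
  by (simp add: digit_sum_def)

lemma digit_sum_bounds:
  assumes "\<And>i. x i < p"
  shows "0 \<le> digit_sum p x n \<and> digit_sum p x n < int p ^ n"
proof (induction n)
  case (Suc n)
  have "int (x n) + 1 \<le> int p" using assms[of n] by simp
  then have "(int (x n) + 1) * int p ^ n \<le> int p * int p ^ n" by (intro mult_right_mono) auto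
  with Suc show ?case by (simp add: digit_sum_Suc algebra_simps)
qed (simp add: digit_sum_def)

lemma digit_sum_carrier:
  assumes "\<And>i. x i < p"
  shows "digit_sum p x \<in> carrier (padic_int p)"
  unfolding padic_carrier_iff
proof (intro allI conjI)
  fix n
  show "0 \<le> digit_sum p x n" "digit_sum p x n < int p ^ n" using digit_sum_bounds[OF assms] by auto
  then show "digit_sum p x (Suc n) mod int p ^ n = digit_sum p x n"
    by (simp add: digit_sum_Suc)
qed

lemma digit_sum_inj:
  assumes x: "\<And>i. x i < p" and y: "\<And>i. y i < p" and eq: "digit_sum p x n = digit_sum p y n" and i: "i < n"
  shows "x i = y i"
proof -
  have "p > 0" using x[of 0] by simp
  have *: "digit_sum p x m = digit_sum p y m" if "m \<le> n" for m
    using padic_mod[OF digit_sum_carrier[of x p, OF x] that] padic_mod[OF digit_sum_carrier[of y p, OF y] that] eq by metis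
  have "int (x i) * int p ^ i = int (y i) * int p ^ i"
    using *[of i] *[of "Suc i"] i by (simp add: digit_sum_Suc)
  then show ?thesis using \<open>p > 0\<close> by simp
qed

abbreviation digit_space :: "nat \<Rightarrow> (nat \<Rightarrow> nat) measure" where
  "digit_space p \<equiv> \<Pi>\<^sub>M i\<in>UNIV. uniform_count_measure {..<p}"

lemma padic_haar_eq:
  "padic_haar p = distr (digit_space p)
     (restrict_space (\<Pi>\<^sub>M n\<in>UNIV. count_space UNIV) (carrier (padic_int p))) (digit_sum p)"
  by (simp add: padic_haar_def digit_sum_def[abs_def])

lemma space_digit_space: "x \<in> space (digit_space p) \<Longrightarrow> x i < p"
  by (auto simp: space_PiM PiE_iff space_uniform_count_measure)

lemma measurable_count_space_add:
  fixes g h :: "'a \<Rightarrow> int"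
  assumes "g \<in> M \<rightarrow>\<^sub>M count_space UNIV" "h \<in> M \<rightarrow>\<^sub>M count_space UNIV"
  shows "(\<lambda>x. g x + h x) \<in> M \<rightarrow>\<^sub>M count_space UNIV"
  by (rule measurable_compose_countable[OF _ assms(1)])
     (rule measurable_compose[OF assms(2)], simp)

lemma measurable_digit_sum_component:
  "(\<lambda>x. digit_sum p x n) \<in> digit_space p \<rightarrow>\<^sub>M count_space UNIV"
proof (induction n)
  case (Suc n)
  have "(\<lambda>x. x n) \<in> digit_space p \<rightarrow>\<^sub>M uniform_count_measure {..<p}"
    by (rule measurable_component_singleton) simp
  moreover have "(\<lambda>k. int k * int p ^ n) \<in> uniform_count_measure {..<p} \<rightarrow>\<^sub>M count_space UNIV"
    by (rule measurableI) (auto simp: sets_uniform_count_measure space_uniform_count_measure)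
  ultimately have "(\<lambda>x. int (x n) * int p ^ n) \<in> digit_space p \<rightarrow>\<^sub>M count_space UNIV"
    by (rule measurable_compose)
  from measurable_count_space_add[OF Suc this] show ?case by (simp add: digit_sum_Suc)
qed (simp add: digit_sum_def)

lemma measurable_digit_sum:
  "digit_sum p \<in> digit_space p \<rightarrow>\<^sub>M restrict_space (\<Pi>\<^sub>M n\<in>UNIV. count_space UNIV) (carrier (padic_int p))"
proof (rule measurable_restrict_space2)
  show "digit_sum p \<in> space (digit_space p) \<rightarrow> carrier (padic_int p)"
    using space_digit_space digit_sum_carrier by blast
  show "digit_sum p \<in> digit_space p \<rightarrow>\<^sub>M (\<Pi>\<^sub>M n\<in>UNIV. count_space UNIV)"
    by (rule measurable_PiM_single') (use measurable_digit_sum_component in \<open>auto simp: space_PiM\<close>)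
qed

lemma prob_space_padic_haar:
  assumes "p > 0"
  shows "prob_space (padic_haar p)"
proof -
  have "prob_space (uniform_count_measure {..<p} :: nat measure)"
    using assms by (intro prob_space_uniform_count_measure) auto
  then have "prob_space (digit_space p)" by (intro prob_space_PiM)
  then show ?thesis unfolding padic_haar_eq by (rule prob_space.prob_space_distr[OF _ measurable_digit_sum])
qed

lemma space_padic_haar: "space (padic_haar p) = carrier (padic_int p)"
  by (auto simp: padic_haar_eq space_restrict_space space_PiM)

lemma measurable_padic_component: "(\<lambda>x. x n) \<in> padic_haar p \<rightarrow>\<^sub>M count_space UNIV"
proof -
  have "(\<lambda>x. x n) \<in> restrict_space (\<Pi>\<^sub>M n\<in>UNIV. count_space UNIV) (carrier (padic_int p)) \<rightarrow>\<^sub>M (count_space UNIV :: int measure)"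
    by (intro measurable_restrict_space1 measurable_component_singleton) simp
  then show ?thesis unfolding padic_haar_eq measurable_distr_eq1 .
qed

lemma sets_padic_component: "{x \<in> space (padic_haar p). x n = g} \<in> sets (padic_haar p)"
  using measurable_sets[OF measurable_padic_component, of "{g}" n p]
  by (simp add: vimage_def Int_def conj_commute)

text \<open>A residue modulo \<open>p ^ n\<close> fixes the first \<open>n\<close> digits, so the
  class lies in a cylinder over \<open>n\<close> independent uniform digits.\<close>

lemma emeasure_padic_component:
  assumes "p > 0"
  shows "emeasure (padic_haar p) {x \<in> space (padic_haar p). x n = g} \<le> ennreal (1 / real p ^ n)"
proof -
  have prob: "prob_space (uniform_count_measure {..<p} :: nat measure)"
    using assms by (intro prob_space_uniform_count_measure) auto
  let ?A = "{x \<in> space (digit_space p). digit_sum p x n = g}"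
  have "emeasure (padic_haar p) {x \<in> space (padic_haar p). x n = g}
      = emeasure (digit_space p) (digit_sum p -` {x \<in> space (padic_haar p). x n = g} \<inter> space (digit_space p))"
    using sets_padic_component[of p n g] unfolding padic_haar_eq
    by (subst emeasure_distr[OF measurable_digit_sum]) (simp_all del: vimage_Collect_eq)
  also have "digit_sum p -` {x \<in> space (padic_haar p). x n = g} \<inter> space (digit_space p) = ?A"
    unfolding space_padic_haar using digit_sum_carrier[of _ p] space_digit_space[of _ p] by blast
  also have "emeasure (digit_space p) ?A \<le> ennreal (1 / real p ^ n)"
  proof (cases "?A = {}")
    case True
    then show ?thesis by (simp only: emeasure_empty zero_le)
  next
    case False
    then obtain z where z: "z \<in> space (digit_space p)" "digit_sum p z n = g" by blast
    let ?B = "prod_emb UNIV (\<lambda>i. uniform_count_measure {..<p}) {..<n} (\<Pi>\<^sub>E i\<in>{..<n}. {z i})"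
    have zp: "z i < p" for i by (rule space_digit_space[OF z(1)])
    have sets: "{z i} \<in> sets (uniform_count_measure {..<p})" for i
      using zp[of i] by (simp add: sets_uniform_count_measure)
    have "?A \<subseteq> ?B"
    proof
      fix x assume x: "x \<in> ?A"
      have "x i = z i" if "i < n" for i
        by (rule digit_sum_inj[of x p z n]) (use x z that space_digit_space[of x p] zp in auto)
      then show "x \<in> ?B" using x by (auto simp: prod_emb_def space_PiM)
    qed
    moreover have "?B \<in> sets (digit_space p)"
      by (intro sets_PiM_I) (use sets in auto)
    ultimately have "emeasure (digit_space p) ?A \<le> emeasure (digit_space p) ?B" by (rule emeasure_mono)
    also have "\<dots> = (\<Prod>i\<in>{..<n}. emeasure (uniform_count_measure {..<p}) {z i})"
      by (rule emeasure_PiM_emb) (use sets prob in auto)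
    also have "\<dots> = (\<Prod>i\<in>{..<n}. ennreal (1 / real p))"
      using zp by (intro prod.cong refl) (simp add: emeasure_uniform_count_measure)
    also have "\<dots> = ennreal (1 / real p ^ n)"
      by (simp add: ennreal_power power_one_over)
    finally show ?thesis .
  qed
  finally show ?thesis .
qed

section \<open>Events in finitely many digits of the coefficients\<close>

definition approx_coeffs :: "nat \<Rightarrow> nat \<Rightarrow> (nat \<Rightarrow> nat \<Rightarrow> int) \<Rightarrow> int list" where
  "approx_coeffs d b F = map (\<lambda>k. F k b) [0..<Suc d]"

lemma map_poly_of: "map (\<lambda>c. c b) (poly_of d F) = approx_coeffs d b F"
  by (simp add: poly_of_def approx_coeffs_def)

lemma length_approx_coeffs: "length (approx_coeffs d b F) = Suc d"
  by (simp add: approx_coeffs_def)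

lemma space_random_coeffs: "F \<in> space (random_coeffs p d) \<Longrightarrow> k \<le> d \<Longrightarrow> F k \<in> carrier (padic_int p)"
  by (auto simp: random_coeffs_def space_PiM space_padic_haar)

lemma poly_of_carrier:
  "F \<in> space (random_coeffs p d) \<Longrightarrow> set (poly_of d F) \<subseteq> carrier (padic_int p)"
  using space_random_coeffs[of F p d] by (auto simp: poly_of_def simp del: upt_Suc)

lemma prob_space_random_coeffs: "p > 0 \<Longrightarrow> prob_space (random_coeffs p d)"
  unfolding random_coeffs_def by (intro prob_space_PiM prob_space_padic_haar)

lemma measurable_map_count_space:
  fixes f :: "'b \<Rightarrow> 'a \<Rightarrow> 'c :: countable"
  assumes "\<And>k. k \<in> set ks \<Longrightarrow> f k \<in> M \<rightarrow>\<^sub>M count_space UNIV"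
  shows "(\<lambda>x. map (\<lambda>k. f k x) ks) \<in> M \<rightarrow>\<^sub>M count_space UNIV"
  using assms
proof (induction ks)
  case (Cons k ks)
  have "(\<lambda>x. f k x # map (\<lambda>k. f k x) ks) \<in> M \<rightarrow>\<^sub>M count_space UNIV"
  proof (rule measurable_compose_countable[where g = "f k"])
    show "f k \<in> M \<rightarrow>\<^sub>M count_space UNIV" using Cons.prems by simp
    show "(\<lambda>x. i # map (\<lambda>k. f k x) ks) \<in> M \<rightarrow>\<^sub>M count_space UNIV" for i
      by (rule measurable_compose[OF Cons.IH]) (use Cons.prems in auto)
  qed
  then show ?case by simp
qed simp

lemma measurable_approx_coeffs: "approx_coeffs d b \<in> random_coeffs p d \<rightarrow>\<^sub>M count_space UNIV"
  unfolding approx_coeffs_def[abs_def]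
proof (rule measurable_map_count_space)
  fix k assume "k \<in> set [0..<Suc d]"
  then have "k \<in> {..d}" by auto
  from measurable_compose[OF measurable_component_singleton[OF this] measurable_padic_component]
  show "(\<lambda>F. F k b) \<in> random_coeffs p d \<rightarrow>\<^sub>M count_space UNIV" unfolding random_coeffs_def .
qed

text \<open>The approximate coefficients take values in a countable discrete space, so any predicate
  \<open>Q\<close> on them defines an event, however complicated.\<close>

lemma sets_approx_coeffs: "{F \<in> space (random_coeffs p d). Q (approx_coeffs d b F)} \<in> sets (random_coeffs p d)"
  using measurable_sets[OF measurable_approx_coeffs, of "Collect Q" d b p]
  by (simp add: vimage_def Int_def conj_commute)

lemma emeasure_approx_coeffs_eq:
  assumes "p > 0"
  shows "emeasure (random_coeffs p d) {F \<in> space (random_coeffs p d). approx_coeffs d b F = cs}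
    \<le> ennreal (1 / real p ^ (b * Suc d))"
proof (cases "length cs = Suc d")
  case False
  then have "{F \<in> space (random_coeffs p d). approx_coeffs d b F = cs} = {}"
    by (auto simp: length_approx_coeffs)
  then show ?thesis by (simp only: emeasure_empty zero_le)
next
  case True
  have prob: "prob_space (padic_haar p)" by (rule prob_space_padic_haar) fact
  have sf: "product_sigma_finite (\<lambda>_ :: nat. padic_haar p)"
    by (intro product_sigma_finite.intro prob_space_imp_sigma_finite prob)
  have "{F \<in> space (random_coeffs p d). approx_coeffs d b F = cs}
    \<subseteq> (\<Pi>\<^sub>E k\<in>{..d}. {x \<in> space (padic_haar p). x b = cs ! k})"
  proof
    fix F assume F: "F \<in> {F \<in> space (random_coeffs p d). approx_coeffs d b F = cs}"
    have "F k b = cs ! k" if "k \<le> d" for k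
    proof -
      have "approx_coeffs d b F ! k = F k b" using that by (simp add: approx_coeffs_def del: upt_Suc)
      then show ?thesis using F by simp
    qed
    then show "F \<in> (\<Pi>\<^sub>E k\<in>{..d}. {x \<in> space (padic_haar p). x b = cs ! k})"
      using F by (auto simp: random_coeffs_def space_PiM)
  qed
  then have "emeasure (random_coeffs p d) {F \<in> space (random_coeffs p d). approx_coeffs d b F = cs}
    \<le> emeasure (random_coeffs p d) (\<Pi>\<^sub>E k\<in>{..d}. {x \<in> space (padic_haar p). x b = cs ! k})"
    unfolding random_coeffs_def by (intro emeasure_mono sets_PiM_I_finite) (auto simp: sets_padic_component)
  also have "\<dots> = (\<Prod>k\<in>{..d}. emeasure (padic_haar p) {x \<in> space (padic_haar p). x b = cs ! k})"
    unfolding random_coeffs_def by (rule product_sigma_finite.emeasure_PiM[OF sf]) (auto simp: sets_padic_component)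
  also have "\<dots> \<le> (\<Prod>k\<in>{..d}. ennreal (1 / real p ^ b))"
    by (intro prod_mono_ennreal emeasure_padic_component assms)
  also have "\<dots> = ennreal (1 / real p ^ (b * Suc d))"
    by (simp add: ennreal_power power_one_over power_mult del: power_Suc mult_Suc_right)
  finally show ?thesis .
qed

definition residue_vectors :: "nat \<Rightarrow> nat \<Rightarrow> nat \<Rightarrow> int list set" where
  "residue_vectors p d b = {cs. set cs \<subseteq> {0..<int p ^ b} \<and> length cs = Suc d}"

lemma finite_residue_vectors: "finite (residue_vectors p d b)"
  unfolding residue_vectors_def by (rule finite_lists_length_eq) simp

lemma approx_coeffs_residue_vectors:
  assumes "F \<in> space (random_coeffs p d)"
  shows "approx_coeffs d b F \<in> residue_vectors p d b"
proof -
  have "F k b \<in> {0..<int p ^ b}" if "k \<le> d" for k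
    using padic_range[OF space_random_coeffs[OF assms that], of b] by simp
  then show ?thesis by (auto simp: residue_vectors_def approx_coeffs_def simp del: upt_Suc)
qed

text \<open>No residue vector has more than its equal share of the measure, so such events are
  bounded by counting.\<close>

lemma emeasure_approx_coeffs_le:
  assumes "p > 0"
  shows "emeasure (random_coeffs p d) {F \<in> space (random_coeffs p d). Q (approx_coeffs d b F)}
    \<le> ennreal (real (card {cs \<in> residue_vectors p d b. Q cs}) / real p ^ (b * Suc d))"
proof -
  let ?V = "{cs \<in> residue_vectors p d b. Q cs}"
  have fin: "finite ?V" using finite_residue_vectors by simp
  have "{F \<in> space (random_coeffs p d). Q (approx_coeffs d b F)}
    \<subseteq> (\<Union>cs\<in>?V. {F \<in> space (random_coeffs p d). approx_coeffs d b F = cs})"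
    using approx_coeffs_residue_vectors by blast
  then have "emeasure (random_coeffs p d) {F \<in> space (random_coeffs p d). Q (approx_coeffs d b F)}
    \<le> emeasure (random_coeffs p d) (\<Union>cs\<in>?V. {F \<in> space (random_coeffs p d). approx_coeffs d b F = cs})"
    by (intro emeasure_mono sets.finite_UN fin sets_approx_coeffs)
  also have "\<dots> \<le> (\<Sum>cs\<in>?V. emeasure (random_coeffs p d) {F \<in> space (random_coeffs p d). approx_coeffs d b F = cs})"
    by (intro emeasure_subadditive_finite fin) (auto intro: sets_approx_coeffs)
  also have "\<dots> \<le> (\<Sum>cs\<in>?V. ennreal (1 / real p ^ (b * Suc d)))"
    by (intro sum_mono emeasure_approx_coeffs_eq assms)
  also have "\<dots> = ennreal (real (card ?V) / real p ^ (b * Suc d))"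
    by (simp add: ennreal_of_nat_eq_real_of_nat flip: ennreal_mult)
  finally show ?thesis .
qed

lemma coeff_pcompose_shift_top:
  fixes D :: "int poly"
  assumes "degree D \<le> k"
  shows "coeff (pcompose D [:x, 1:]) k = coeff D k"
proof (cases "degree D = k")
  case True
  then have "coeff (pcompose D [:x, 1:]) k = lead_coeff (pcompose D [:x, 1:])" by (simp add: degree_pcompose)
  also have "\<dots> = lead_coeff D" by (simp add: lead_coeff_comp)
  finally show ?thesis using True by simp
next
  case False
  then show ?thesis using assms by (simp add: coeff_eq_0 degree_pcompose)
qed

text \<open>The Taylor coefficients depend on the coefficients in a unitriangular way, so that prescribing the
  former modulo powers of \<open>p\<close> prescribes the latter one after the other.\<close>

lemma card_taylor_dvd:
  fixes x :: nat
  assumes p: "p > 0" and j: "j \<le> Suc d" and e: "\<And>k. k < j \<Longrightarrow> e k \<le> b"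
  shows "card {cs \<in> residue_vectors p d b. \<forall>k<j. int p ^ e k dvd taylor_coeff (Poly cs) x k} * p ^ (\<Sum>k<j. e k)
    \<le> p ^ (b * Suc d)"
proof -
  let ?V = "{cs \<in> residue_vectors p d b. \<forall>k<j. int p ^ e k dvd taylor_coeff (Poly cs) x k}"
  define E where "E k = (if k < j then e k else 0)" for k
  have Eb: "E k \<le> b" for k using e by (simp add: E_def)
  have dvd: "int p ^ E k dvd taylor_coeff (Poly cs) x k" if "cs \<in> ?V" for cs k
    using that by (simp add: E_def)
  \<comment> \<open>The divisibilities determine the \<open>k\<close>-th coefficient modulo
    \<open>p ^ E k\<close> once the higher ones are known; \<open>g\<close> retains the remaining
    freedom.\<close>
  define g where "g cs = (\<lambda>k\<in>{..d}. cs ! k div int p ^ E k)" for cs :: "int list"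
  have pp: "int p ^ n > 0" for n using p by simp
  have "card ?V \<le> card (\<Pi>\<^sub>E k\<in>{..d}. {0..<int p ^ (b - E k)})"
  proof (rule card_inj_on_le[of g])
    show "finite (\<Pi>\<^sub>E k\<in>{..d}. {0..<int p ^ (b - E k)})" by (intro finite_PiE) auto
    show "g ` ?V \<subseteq> (\<Pi>\<^sub>E k\<in>{..d}. {0..<int p ^ (b - E k)})"
    proof (rule image_subsetI)
      fix cs assume "cs \<in> ?V"
      then have cs: "0 \<le> cs ! k" "cs ! k < int p ^ b" if "k \<le> d" for k
        using that nth_mem[of k cs] by (auto simp: residue_vectors_def subset_iff)
      have "cs ! k div int p ^ E k < int p ^ (b - E k)" if "k \<le> d" for k
      proof -
        have "cs ! k div int p ^ E k * int p ^ E k \<le> cs ! k"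
          using div_mult_mod_eq[of "cs ! k" "int p ^ E k"] pos_mod_sign[OF pp, of "cs ! k" "E k"] by linarith
        also have "\<dots> < int p ^ (b - E k) * int p ^ E k" using cs(2)[OF that] Eb[of k] by (simp flip: power_add)
        finally show ?thesis using pp by (simp only: mult_less_cancel_right_pos)
      qed
      then show "g cs \<in> (\<Pi>\<^sub>E k\<in>{..d}. {0..<int p ^ (b - E k)})"
        using cs(1) pp by (auto simp: g_def pos_imp_zdiv_nonneg_iff)
    qed
    show "inj_on g ?V"
    proof (rule inj_onI)
      fix cs ds assume cs: "cs \<in> ?V" and ds: "ds \<in> ?V" and eq: "g cs = g ds"
      have len: "length cs = Suc d" "length ds = Suc d" using cs ds by (auto simp: residue_vectors_def)
      have "cs ! k = ds ! k" if "k \<le> d" for k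
        using that
      \<comment> \<open>Descending in \<open>k\<close>: if the higher coefficients agree, the
        \<open>k\<close>-th Taylor coefficients differ exactly as the \<open>k\<close>-th
        coefficients do.\<close>
      proof (induction "d - k" arbitrary: k rule: less_induct)
        case less
        let ?D = "Poly cs - Poly ds"
        have "coeff ?D i = 0" if "i > k" for i
        proof (cases "i \<le> d")
          case True
          then have "cs ! i = ds ! i" using less that by simp
          then show ?thesis using len True by (simp add: nth_default_def)
        qed (simp add: nth_default_def len)
        then have "degree ?D \<le> k" by (intro degree_le) simp
        from coeff_pcompose_shift_top[OF this, of "int x"]
        have "taylor_coeff (Poly cs) x k - taylor_coeff (Poly ds) x k = cs ! k - ds ! k"
          using len less.prems by (simp add: pcompose_diff nth_default_def)
        moreover have "int p ^ E k dvd taylor_coeff (Poly cs) x k - taylor_coeff (Poly ds) x k"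
          by (rule dvd_diff[OF dvd[OF cs] dvd[OF ds]])
        ultimately have "cs ! k mod int p ^ E k = ds ! k mod int p ^ E k" by (simp only: mod_eq_dvd_iff)
        moreover have "cs ! k div int p ^ E k = ds ! k div int p ^ E k"
          using fun_cong[OF eq, of k] less.prems by (simp add: g_def)
        ultimately show ?case by (metis div_mult_mod_eq)
      qed
      then show "cs = ds" using len by (intro nth_equalityI) auto
    qed
  qed
  also have "\<dots> = (\<Prod>k\<le>d. p ^ (b - E k))" by (simp add: card_PiE nat_power_eq)
  finally have "card ?V * (\<Prod>k\<le>d. p ^ E k) \<le> (\<Prod>k\<le>d. p ^ (b - E k)) * (\<Prod>k\<le>d. p ^ E k)"
    by (rule mult_right_mono) simp
  also have "\<dots> = (\<Prod>k\<le>d. p ^ b)" using Eb by (simp flip: prod.distrib power_add)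
  also have "\<dots> = p ^ (b * Suc d)" by (simp only: prod_constant card_atMost power_mult)
  also have "(\<Prod>k\<le>d. p ^ E k) = p ^ (\<Sum>k\<le>d. E k)" by (simp add: power_sum)
  also have "(\<Sum>k\<le>d. E k) = (\<Sum>k<j. e k)"
  proof -
    have "(\<Sum>k\<le>d. E k) = (\<Sum>k\<in>{..d} \<inter> {k. k < j}. e k)" unfolding E_def by (subst sum.If_cases) auto
    also have "{..d} \<inter> {k. k < j} = {..<j}" using j by auto
    finally show ?thesis .
  qed
  finally show ?thesis .
qed

lemma emeasure_taylor_dvd:
  fixes x :: nat
  assumes "p > 0" "j \<le> Suc d" "\<And>k. k < j \<Longrightarrow> e k \<le> b"
  shows "emeasure (random_coeffs p d) {F \<in> space (random_coeffs p d).
      \<forall>k<j. int p ^ e k dvd taylor_coeff (Poly (approx_coeffs d b F)) x k} \<le> ennreal (1 / real p ^ (\<Sum>k<j. e k))"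
proof -
  let ?c = "card {cs \<in> residue_vectors p d b. \<forall>k<j. int p ^ e k dvd taylor_coeff (Poly cs) x k}"
  have "real ?c * real p ^ (\<Sum>k<j. e k) \<le> real p ^ (b * Suc d)"
    using of_nat_mono[OF card_taylor_dvd[OF assms, where x = x], where 'a = real] by simp
  then have "real ?c / real p ^ (b * Suc d) \<le> 1 / real p ^ (\<Sum>k<j. e k)"
    using assms(1) by (simp add: field_simps del: power_Suc)
  with emeasure_approx_coeffs_le[OF assms(1), of d "\<lambda>cs. \<forall>k<j. int p ^ e k dvd taylor_coeff (Poly cs) x k" b]
  show ?thesis by (meson ennreal_leI order_trans)
qed

abbreviation coeffs_poly :: "nat \<Rightarrow> nat \<Rightarrow> (nat \<Rightarrow> nat \<Rightarrow> int) \<Rightarrow> int poly" where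
  "coeffs_poly d b F \<equiv> Poly (approx_coeffs d b F)"

lemma length_poly_of: "length (poly_of d F) = Suc d"
  by (simp add: poly_of_def)

lemma degree_coeffs_poly: "degree (coeffs_poly d b F) \<le> d"
  using degree_approx_poly[OF length_poly_of[of d F], of b] by (simp only: map_poly_of)

lemma taylor_dvd_transfer_le:
  assumes "F \<in> space (random_coeffs p d)" "e \<le> b" "b \<le> b'"
  shows "int p ^ e dvd taylor_coeff (coeffs_poly d b' F) x k \<longleftrightarrow> int p ^ e dvd taylor_coeff (coeffs_poly d b F) x k"
proof -
  have "icong [:int p ^ b:] 0 (coeffs_poly d b' F) (coeffs_poly d b F)"
    using approx_poly_cong[OF poly_of_carrier[OF assms(1)] assms(3)] by (simp only: map_poly_of)
  from coeff_icong_0[OF icong_pcompose[OF this, of "[:int x, 1:]"], of k]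
  have "int p ^ e dvd taylor_coeff (coeffs_poly d b' F) x k - taylor_coeff (coeffs_poly d b F) x k"
    by (rule dvd_trans[OF le_imp_power_dvd[OF assms(2)]])
  from dvd_add_right_iff[OF this, of "taylor_coeff (coeffs_poly d b F) x k"] show ?thesis by simp
qed

lemma taylor_dvd_transfer:
  assumes "F \<in> space (random_coeffs p d)" "e \<le> b" "e \<le> b'"
  shows "int p ^ e dvd taylor_coeff (coeffs_poly d b' F) x k \<longleftrightarrow> int p ^ e dvd taylor_coeff (coeffs_poly d b F) x k"
proof (cases "b \<le> b'")
  case True
  then show ?thesis using taylor_dvd_transfer_le[OF assms(1,2)] by blast
next
  case False
  then show ?thesis using taylor_dvd_transfer_le[OF assms(1,3), of b] by simp
qed

text \<open>The depth \<open>t\<close> is kept; what is excluded at precision \<open>b\<close> stays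
  excluded at \<open>b'\<close>, where the exponents are at least as large. The definition of the
  needed precision asks for all larger precisions at once.\<close>

lemma resolved_mono:
  assumes F: "F \<in> space (random_coeffs p d)" and res: "resolved p b t (coeffs_poly d b F)" and b: "b \<le> b'"
  shows "resolved p b' t (coeffs_poly d b' F)"
proof -
  note r = res[unfolded resolved_def]
  note tr = taylor_dvd_transfer_le[OF F _ b]
  show ?thesis
    unfolding resolved_def
  proof (intro conjI allI impI notI)
    show "2 * t \<le> b'" using r b by simp
    fix x assume "x < p ^ t"
      "int p ^ (2 * t) dvd taylor_coeff (coeffs_poly d b' F) x 0 \<and> int p ^ t dvd taylor_coeff (coeffs_poly d b' F) x 1"
    then show False using r tr[of "2 * t" x 0] tr[of t x 1] by simp
  next
    fix s x assume s: "s \<le> t" "x < p ^ s" and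
      *: "int p ^ b' dvd taylor_coeff (coeffs_poly d b' F) x 0 \<and> int p ^ (b' - s) dvd taylor_coeff (coeffs_poly d b' F) x 1"
    have "int p ^ b dvd taylor_coeff (coeffs_poly d b' F) x 0"
      using * dvd_trans[OF le_imp_power_dvd[OF b]] by blast
    moreover have "int p ^ (b - s) dvd taylor_coeff (coeffs_poly d b' F) x 1"
      using * dvd_trans[OF le_imp_power_dvd[OF diff_le_mono[OF b]]] by blast
    ultimately show False using r s tr[of b x 0] tr[of "b - s" x 1] by simp
  qed
qed

definition unresolved :: "nat \<Rightarrow> nat \<Rightarrow> nat \<Rightarrow> (nat \<Rightarrow> nat \<Rightarrow> int) set" where
  "unresolved p d b = {F \<in> space (random_coeffs p d). \<not> (\<exists>t. resolved p b t (coeffs_poly d b F))}"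

lemma sets_unresolved: "unresolved p d b \<in> sets (random_coeffs p d)"
  unfolding unresolved_def by (rule sets_approx_coeffs)

lemma sum_power_le:
  fixes q :: real
  assumes "q \<ge> 2"
  shows "(\<Sum>s\<le>t. q ^ s) \<le> 2 * q ^ t"
proof (induction t)
  case (Suc t)
  have "2 * q ^ t \<le> q * q ^ t" using assms by (intro mult_right_mono) auto
  with Suc show ?case by simp
qed simp

text \<open>Take \<open>t = b div 2\<close>. The first condition fails on one of
  \<open>p ^ t\<close> discs with probability at most \<open>p ^ - (3 * t)\<close> each, in total
  \<open>p ^ - (2 * t)\<close>. The second one involves \<open>p ^ s\<close> discs with probability
  at most \<open>p ^ - (2 * b - s)\<close> each, and the sum over \<open>s\<close> is geometric with
  dominant term \<open>s = t\<close>. Either part is at most \<open>2 / 2 ^ b\<close>.\<close>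

lemma emeasure_unresolved:
  assumes p: "prime p" and d: "d \<ge> 1"
  shows "emeasure (random_coeffs p d) (unresolved p d b) \<le> ennreal (4 / 2 ^ b)"
proof -
  let ?M = "random_coeffs p d"
  have p2: "real p \<ge> 2" using prime_ge_2_nat[OF p] by simp
  have p0: "p > 0" "real p > 0" using p2 by auto
  define t where "t = b div 2"
  have t: "2 * t \<le> b" "b \<le> 2 * t + 1" by (simp_all add: t_def)
  define A where "A e x = {F \<in> space ?M. \<forall>k<2. int p ^ e k dvd taylor_coeff (coeffs_poly d b F) x k}"
    for e :: "nat \<Rightarrow> nat" and x :: nat
  have A_sets: "A e x \<in> sets ?M" for e x unfolding A_def by (rule sets_approx_coeffs)
  have A_le: "emeasure ?M (A e x) \<le> ennreal (1 / real p ^ (e 0 + e 1))" if "e 0 \<le> b" "e 1 \<le> b" for e x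
  proof -
    have "e k \<le> b" if "k < 2" for k using that \<open>e 0 \<le> b\<close> \<open>e 1 \<le> b\<close> by (cases k) (auto simp: less_Suc_eq)
    from emeasure_taylor_dvd[OF p0(1) _ this, where j = 2 and d = d and x = x] d show ?thesis by (simp add: A_def numeral_2_eq_2)
  qed
  have UN_le: "emeasure ?M (\<Union>x<n. A e x) \<le> ennreal (real n / real p ^ (e 0 + e 1))" if "e 0 \<le> b" "e 1 \<le> b" for e n
  proof -
    have "emeasure ?M (\<Union>x<n. A e x) \<le> (\<Sum>x<n. emeasure ?M (A e x))"
      by (intro emeasure_subadditive_finite) (use A_sets in auto)
    also have "\<dots> \<le> (\<Sum>x<n. ennreal (1 / real p ^ (e 0 + e 1)))" by (intro sum_mono A_le that)
    also have "\<dots> = ennreal (real n / real p ^ (e 0 + e 1))"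
      by (simp add: ennreal_of_nat_eq_real_of_nat flip: ennreal_mult)
    finally show ?thesis .
  qed
  define e1 where "e1 k = (if k = 0 then 2 * t else t)" for k :: nat
  define e2 where "e2 s k = (if k = 0 then b else b - s)" for s k :: nat
  let ?B1 = "\<Union>x<p ^ t. A e1 x" and ?B2 = "\<Union>s\<le>t. \<Union>x<p ^ s. A (e2 s) x"
  have sub: "unresolved p d b \<subseteq> ?B1 \<union> ?B2"
  proof
    fix F assume F: "F \<in> unresolved p d b"
    then have sp: "F \<in> space ?M" and "\<not> resolved p b t (coeffs_poly d b F)" by (auto simp: unresolved_def)
    then consider x where "x < p ^ t" "int p ^ (2 * t) dvd taylor_coeff (coeffs_poly d b F) x 0"
        "int p ^ t dvd taylor_coeff (coeffs_poly d b F) x 1"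
      | s x where "s \<le> t" "x < p ^ s" "int p ^ b dvd taylor_coeff (coeffs_poly d b F) x 0"
        "int p ^ (b - s) dvd taylor_coeff (coeffs_poly d b F) x 1"
      unfolding resolved_def using t(1) by blast
    then show "F \<in> ?B1 \<union> ?B2"
    proof cases
      case 1
      then have "F \<in> A e1 x" using sp by (auto simp: A_def e1_def less_2_cases_iff)
      then show ?thesis using 1 by blast
    next
      case 2
      then have "F \<in> A (e2 s) x" using sp by (auto simp: A_def e2_def less_2_cases_iff)
      then show ?thesis using 2 by blast
    qed
  qed
  have B_sets: "?B1 \<in> sets ?M" "(\<Union>x<p ^ s. A (e2 s) x) \<in> sets ?M" "?B2 \<in> sets ?M" for s
    using A_sets by auto
  have "emeasure ?M ?B1 \<le> ennreal (real (p ^ t) / real p ^ (2 * t + t))"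
    using UN_le[of e1 "p ^ t"] t by (simp add: e1_def)
  also have "real (p ^ t) / real p ^ (2 * t + t) = 1 / real p ^ (2 * t)"
    using p0 by (simp only: power_add of_nat_power) simp
  also have "\<dots> \<le> 1 / 2 ^ (2 * t)"
    using p2 by (intro divide_left_mono power_mono) auto
  also have "\<dots> \<le> 2 / 2 ^ b"
  proof -
    have "(2 :: real) ^ b \<le> 2 ^ Suc (2 * t)" by (rule power_increasing) (use t in auto)
    then show ?thesis by (simp add: field_simps)
  qed
  finally have B1: "emeasure ?M ?B1 \<le> ennreal (2 / 2 ^ b)" by (simp add: ennreal_leI)
  have "emeasure ?M ?B2 \<le> (\<Sum>s\<le>t. emeasure ?M (\<Union>x<p ^ s. A (e2 s) x))"
    by (intro emeasure_subadditive_finite) (use B_sets in auto)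
  also have "\<dots> \<le> (\<Sum>s\<le>t. ennreal (real p ^ (2 * s) / real p ^ (2 * b)))"
  proof (rule sum_mono)
    fix s assume "s \<in> {..t}"
    then have s: "s \<le> b" using t by simp
    have "emeasure ?M (\<Union>x<p ^ s. A (e2 s) x) \<le> ennreal (real (p ^ s) / real p ^ (b + (b - s)))"
      using UN_le[of "e2 s" "p ^ s"] by (simp add: e2_def)
    also have "real (p ^ s) / real p ^ (b + (b - s)) = real p ^ (2 * s) / real p ^ (2 * b)"
    proof -
      have "2 * b = b + (b - s) + s" using s by simp
      then have "real p ^ (2 * b) = real p ^ (b + (b - s)) * real p ^ s" by (simp only: power_add)
      moreover have "real p ^ (2 * s) = real p ^ s * real p ^ s" by (simp only: mult_2 power_add)
      ultimately show ?thesis using p0 by (simp only: of_nat_power) simp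
    qed
    finally show "emeasure ?M (\<Union>x<p ^ s. A (e2 s) x) \<le> ennreal (real p ^ (2 * s) / real p ^ (2 * b))" .
  qed
  also have "\<dots> = ennreal ((\<Sum>s\<le>t. (real p ^ 2) ^ s) / real p ^ (2 * b))"
    by (simp add: sum_ennreal sum_divide_distrib power_mult)
  also have "(\<Sum>s\<le>t. (real p ^ 2) ^ s) / real p ^ (2 * b) \<le> 2 * (real p ^ 2) ^ t / real p ^ (2 * b)"
    using p2 mult_mono[OF p2 p2] by (intro divide_right_mono sum_power_le) (auto simp: power2_eq_square)
  also have "\<dots> \<le> 2 * real p ^ b / real p ^ (2 * b)"
  proof -
    have "(real p ^ 2) ^ t \<le> real p ^ b"
      unfolding power_mult[symmetric] by (rule power_increasing) (use t p2 in auto)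
    then show ?thesis by (intro divide_right_mono) auto
  qed
  also have "\<dots> = 2 / real p ^ b"
  proof -
    have "real p ^ (2 * b) = real p ^ b * real p ^ b" by (simp only: mult_2 power_add)
    then show ?thesis using p0 by simp
  qed
  also have "\<dots> \<le> 2 / 2 ^ b" using p2 by (intro divide_left_mono power_mono) auto
  finally have B2: "emeasure ?M ?B2 \<le> ennreal (2 / 2 ^ b)" by (simp add: ennreal_leI)
  have "emeasure ?M (unresolved p d b) \<le> emeasure ?M (?B1 \<union> ?B2)"
    by (intro emeasure_mono sub sets.Un B_sets)
  also have "\<dots> \<le> emeasure ?M ?B1 + emeasure ?M ?B2"
    by (intro emeasure_subadditive B_sets)
  also have "\<dots> \<le> ennreal (2 / 2 ^ b) + ennreal (2 / 2 ^ b)" by (intro add_mono B1 B2)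
  also have "\<dots> = ennreal (4 / 2 ^ b)" by (simp flip: ennreal_plus)
  finally show ?thesis .
qed

text \<open>A polynomial that is never resolved belongs to the exceptional set of every
  \<open>b\<close>, and these have measures tending to 0.\<close>

lemma AE_resolved:
  assumes "prime p" "d \<ge> 1"
  shows "AE F in random_coeffs p d. \<exists>b t. resolved p b t (coeffs_poly d b F)"
proof (rule AE_I)
  let ?M = "random_coeffs p d"
  show "{F \<in> space ?M. \<not> (\<exists>b t. resolved p b t (coeffs_poly d b F))} \<subseteq> (\<Inter>b. unresolved p d b)"
    by (auto simp: unresolved_def)
  show "(\<Inter>b. unresolved p d b) \<in> sets ?M" using sets_unresolved by blast
  have "emeasure ?M (\<Inter>b. unresolved p d b) \<le> ennreal (4 / 2 ^ b)" for b
    by (rule order_trans[OF emeasure_mono emeasure_unresolved[OF assms]]) (auto intro: sets_unresolved)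
  moreover have "(\<lambda>b. ennreal (4 / 2 ^ b)) \<longlonglongrightarrow> ennreal 0"
    by (intro tendsto_ennrealI LIMSEQ_divide_realpow_zero) simp
  ultimately have "emeasure ?M (\<Inter>b. unresolved p d b) \<le> ennreal 0"
    by (intro LIMSEQ_le_const[of "\<lambda>b. ennreal (4 / 2 ^ b)"]) auto
  then show "emeasure ?M (\<Inter>b. unresolved p d b) = 0" by simp
qed

lemma AE_correct:
  assumes "prime p" "d \<ge> 1"
  shows "AE F in random_coeffs p d. no_singular_roots p (poly_of d F) \<and>
    run_correct p (poly_of d F) (strassman rf tr p (padic_int p) (poly_of d F))"
  using AE_resolved[OF assms] AE_space
proof eventually_elim
  case (elim F)
  then obtain b t where res: "resolved p b t (approx_poly b (poly_of d F))" by (auto simp: map_poly_of)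
  note * = assms(1) poly_of_carrier[OF elim(2)] length_poly_of assms(2) res
  show ?case using resolved_no_singular_roots[OF *] run_correct_exact[OF *] by blast
qed

text \<open>The behaviour of \<open>X\<close> on a null set is unknown; agreement almost everywhere
  with a measurable function settles measurability with respect to the completion.\<close>

lemma average_at_mostI:
  assumes X': "X' \<in> borel_measurable M" and AE: "AE x in M. X x = X' x" and le: "(\<integral>\<^sup>+ x. X' x \<partial>M) \<le> ennreal c"
  shows "average_at_most M X c"
proof -
  have "X \<in> borel_measurable (completion M)"
  proof (rule measurableI)
    fix S :: "ennreal set" assume S: "S \<in> sets borel"
    show "X -` S \<inter> space (completion M) \<in> sets (completion M)"
    proof (rule completion.in_sets_AE)
      show "X' -` S \<inter> space (completion M) \<in> sets (completion M)"
        by (rule measurable_sets[OF measurable_completion[OF X'] S])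
      show "AE x in completion M. (x \<in> X' -` S \<inter> space (completion M)) \<longleftrightarrow> (x \<in> X -` S \<inter> space (completion M))"
        using AE_completion[OF AE] by eventually_elim simp
    qed simp
  qed simp
  moreover have "(\<integral>\<^sup>+ x. X x \<partial>M) = (\<integral>\<^sup>+ x. X' x \<partial>M)" by (rule nn_integral_cong_AE) (rule AE)
  ultimately show ?thesis using le by (simp add: average_at_most_def nn_integral_completion)
qed

text \<open>Being resolved depends on the first \<open>b\<close> digits only, so it holds for every
  \<open>f'\<close> with these digits, and correctness follows for \<open>f'\<close> itself.\<close>

lemma precision_suffices_resolved:
  assumes p: "prime p" and d: "d \<ge> 1" and res: "resolved p b t (coeffs_poly d b F)"
  shows "precision_suffices rf tr p (poly_of d F) b"
  unfolding precision_suffices_def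
proof (intro allI impI)
  fix f' assume f': "set f' \<subseteq> carrier (padic_int p) \<and> map (\<lambda>c. c b) f' = map (\<lambda>c. c b) (poly_of d F)"
  then have len: "length f' = Suc d" using length_poly_of[of d F] by (metis length_map)
  have "resolved p b t (approx_poly b f')" using f' res by (simp add: map_poly_of)
  from run_correct_truncated[OF p _ len d this] f'
  show "run_correct p f' (truncated_run rf tr p b (map (\<lambda>c. c b) (poly_of d F)))" by simp
qed

text \<open>The infimum now runs over all \<open>b\<close>, with the value infinity at inadmissible
  ones; in this form measurability in the polynomial is immediate.\<close>

lemma precision_needed_eq:
  "precision_needed rf tr p f = (INF b. if \<forall>b'. b \<le> b' \<longrightarrow> precision_suffices rf tr p f b' then of_nat b else \<infinity>)"
  (is "_ = (INF b. ?g b)")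
  unfolding precision_needed_def
proof (rule antisym)
  show "(INF b\<in>{b. \<forall>b'\<ge>b. precision_suffices rf tr p f b'}. of_nat b) \<le> (INF b. ?g b)"
    by (rule INF_greatest) (auto intro: INF_lower)
  show "(INF b. ?g b) \<le> (INF b\<in>{b. \<forall>b'\<ge>b. precision_suffices rf tr p f b'}. of_nat b)"
  proof (rule INF_greatest)
    fix b assume b: "b \<in> {b. \<forall>b'\<ge>b. precision_suffices rf tr p f b'}"
    have "(INF b. ?g b) \<le> ?g b" by (rule INF_lower) (rule UNIV_I)
    then show "(INF b. ?g b) \<le> of_nat b" using b by simp
  qed
qed

text \<open>The least resolved precision \<open>B\<close> is the number of all \<open>b < B\<close>,
  each of which is unresolved. So its expectation is at most the sum of the tail bounds
  \<open>4 / 2 ^ b\<close>, which is 8.\<close>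

lemma average_precision:
  assumes p: "prime p" and d: "d \<ge> 1"
  shows "average_at_most (random_coeffs p d) (\<lambda>F. precision_needed rf tr p (poly_of d F)) 8"
proof (rule average_at_mostI)
  let ?M = "random_coeffs p d" and ?X = "\<lambda>F. precision_needed rf tr p (poly_of d F)"
  define Q where "Q b cs \<longleftrightarrow> (\<forall>f'. set f' \<subseteq> carrier (padic_int p) \<and> map (\<lambda>c. c b) f' = cs \<longrightarrow>
    run_correct p f' (truncated_run rf tr p b cs))" for b cs
  have [measurable]: "Measurable.pred ?M (\<lambda>F. Q b (approx_coeffs d b F))" for b
    unfolding pred_def by (rule sets_approx_coeffs)
  have "(\<lambda>F. INF b. if \<forall>b'. b \<le> b' \<longrightarrow> Q b' (approx_coeffs d b' F) then of_nat b else \<infinity> :: ennreal)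
    \<in> borel_measurable ?M" by measurable
  then show "?X \<in> borel_measurable ?M"
    by (simp add: precision_needed_eq precision_suffices_def map_poly_of Q_def)
  show "AE F in ?M. ?X F = ?X F" by simp
  have le: "AE F in ?M. ?X F \<le> (\<Sum>b. indicator (unresolved p d b) F)"
    using AE_resolved[OF p d] AE_space
  proof eventually_elim
    case (elim F)
    then obtain b where b: "F \<notin> unresolved p d b" by (auto simp: unresolved_def)
    define B where "B = (LEAST b. F \<notin> unresolved p d b)"
    have "F \<notin> unresolved p d B" unfolding B_def using b by (rule LeastI)
    then obtain t where t: "resolved p B t (coeffs_poly d B F)" using elim by (auto simp: unresolved_def)
    have "\<forall>b'\<ge>B. precision_suffices rf tr p (poly_of d F) b'"
      using precision_suffices_resolved[OF p d resolved_mono[OF elim(2) t]] by blast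
    then have "?X F \<le> of_nat B" unfolding precision_needed_def by (intro INF_lower) simp
    also have "\<dots> = (\<Sum>b<B. indicator (unresolved p d b) F)"
    proof -
      have "F \<in> unresolved p d b" if "b < B" for b using not_less_Least[OF that[unfolded B_def]] by simp
      then show ?thesis by simp
    qed
    also have "\<dots> \<le> (\<Sum>b. indicator (unresolved p d b) F)" by (rule sum_le_suminf) auto
    finally show ?case .
  qed
  have "(\<lambda>b. (1 / 2 :: real) ^ b) sums 2" using geometric_sums[of "1 / 2 :: real"] by simp
  from sums_mult[OF this, of 4] have sums: "(\<lambda>b. 4 / 2 ^ b :: real) sums 8" by (simp add: power_one_over)
  have "(\<integral>\<^sup>+ F. ?X F \<partial>?M) \<le> (\<integral>\<^sup>+ F. (\<Sum>b. indicator (unresolved p d b) F) \<partial>?M)"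
    by (rule nn_integral_mono_AE) (rule le)
  also have "\<dots> = (\<Sum>b. \<integral>\<^sup>+ F. indicator (unresolved p d b) F \<partial>?M)"
    by (rule nn_integral_suminf) (use sets_unresolved in auto)
  also have "\<dots> = (\<Sum>b. emeasure ?M (unresolved p d b))" by (simp add: sets_unresolved)
  also have "\<dots> \<le> (\<Sum>b. ennreal (4 / 2 ^ b))"
    by (intro suminf_le emeasure_unresolved p d) auto
  also have "\<dots> = ennreal 8" by (rule suminf_ennreal_eq[OF _ sums]) simp
  finally show "(\<integral>\<^sup>+ F. ?X F \<partial>?M) \<le> ennreal 8" .
qed

section \<open>From the tree to sums of indicators\<close>

lemma sum_nat_group':
  fixes f :: "nat \<Rightarrow> 'a :: comm_monoid_add"
  shows "(\<Sum>a<k. \<Sum>y<m. f (a + y * k)) = (\<Sum>z<m * k. f z)"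
proof -
  have "(\<Sum>a<k. \<Sum>y<m. f (a + y * k)) = (\<Sum>y<m. \<Sum>a<k. f (a + y * k))" by (rule sum.swap)
  also have "\<dots> = (\<Sum>y<m. sum f {y * k..<y * k + k})"
  proof (rule sum.cong[OF refl])
    fix y
    show "(\<Sum>a<k. f (a + y * k)) = sum f {y * k..<y * k + k}"
      by (subst sum.atLeastLessThan_shift_0) (simp add: atLeast0LessThan add.commute)
  qed
  also have "\<dots> = (\<Sum>z<m * k. f z)" by (rule sum.nat_group)
  finally show ?thesis .
qed

text \<open>Below the starting disc only discs with a count above 1 are entered, so \<open>h\<close>
  may be 0 on the others. Summing over all discs of a level, reached or not, removes the dependence
  on the ancestors.\<close>

lemma tree_cost_le:
  fixes h :: "nat \<Rightarrow> nat \<Rightarrow> ennreal"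
  assumes h: "\<And>i y. node_count p d P i y > 1 \<Longrightarrow> h i y = node_cost rf tr p d P i y"
  shows "tree_cost rf tr p d P n s x \<le> node_cost rf tr p d P s x + (\<Sum>i<n. \<Sum>y<p ^ Suc i. h (s + Suc i) (x + y * p ^ s))"
proof (induction n arbitrary: s x)
  case (Suc n)
  let ?c = "\<lambda>a. x + a * p ^ s"
  let ?H = "\<lambda>i. \<Sum>z<p ^ Suc i. h (s + Suc i) (x + z * p ^ s)"
  have "(\<Sum>a\<in>node_roots p d P s x. if node_count p d P (Suc s) (?c a) > 1 then tree_cost rf tr p d P n (Suc s) (?c a) else 0)
    \<le> (\<Sum>a\<in>node_roots p d P s x. h (Suc s) (?c a) + (\<Sum>i<n. \<Sum>y<p ^ Suc i. h (Suc s + Suc i) (?c a + y * p ^ Suc s)))"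
  proof (rule sum_mono)
    fix a assume "a \<in> node_roots p d P s x"
    show "(if node_count p d P (Suc s) (?c a) > 1 then tree_cost rf tr p d P n (Suc s) (?c a) else 0)
      \<le> h (Suc s) (?c a) + (\<Sum>i<n. \<Sum>y<p ^ Suc i. h (Suc s + Suc i) (?c a + y * p ^ Suc s))"
    proof (cases "node_count p d P (Suc s) (?c a) > 1")
      case True
      then show ?thesis using Suc.IH[of "Suc s" "?c a"] h[OF True] by simp
    next
      case False
      then show ?thesis by (simp only: if_False zero_le)
    qed
  qed
  also have "\<dots> \<le> (\<Sum>a<p. h (Suc s) (?c a) + (\<Sum>i<n. \<Sum>y<p ^ Suc i. h (Suc s + Suc i) (?c a + y * p ^ Suc s)))"
    by (rule sum_mono2) (auto simp: node_roots_def)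
  also have "\<dots> = (\<Sum>a<p. h (Suc s) (?c a)) + (\<Sum>i<n. \<Sum>a<p. \<Sum>y<p ^ Suc i. h (Suc s + Suc i) (?c a + y * p ^ Suc s))"
    by (subst sum.distrib, subst (2) sum.swap) (rule refl)
  also have "(\<Sum>i<n. \<Sum>a<p. \<Sum>y<p ^ Suc i. h (Suc s + Suc i) (?c a + y * p ^ Suc s)) = (\<Sum>i<n. ?H (Suc i))"
  proof (rule sum.cong[OF refl])
    fix i
    have "(\<Sum>a<p. \<Sum>y<p ^ Suc i. h (Suc s + Suc i) (?c a + y * p ^ Suc s))
      = (\<Sum>a<p. \<Sum>y<p ^ Suc i. h (Suc s + Suc i) (x + (a + y * p) * p ^ s))"
      by (simp add: algebra_simps)
    \<comment> \<open>The next digit \<open>a\<close> and the later digits \<open>y\<close> are the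
      parts of \<open>z = a + y * p\<close>.\<close>
    also have "\<dots> = (\<Sum>z<p ^ Suc i * p. h (Suc s + Suc i) (x + z * p ^ s))"
      by (rule sum_nat_group')
    also have "\<dots> = ?H (Suc i)" by (simp add: mult.commute)
    finally show "(\<Sum>a<p. \<Sum>y<p ^ Suc i. h (Suc s + Suc i) (?c a + y * p ^ Suc s)) = ?H (Suc i)" .
  qed
  also have "(\<Sum>a<p. h (Suc s) (?c a)) + (\<Sum>i<n. ?H (Suc i)) = (\<Sum>i<Suc n. ?H i)"
    by (simp only: sum.lessThan_Suc_shift) simp
  finally show ?case by (simp only: tree_cost.simps add_left_mono)
qed simp

text \<open>The event that the disc of radius \<open>p ^ - i\<close> around \<open>y\<close> has Strassman count at least \<open>j\<close> is
  contained in \<open>count_event p d i y j\<close>.\<close>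

definition count_event :: "nat \<Rightarrow> nat \<Rightarrow> nat \<Rightarrow> nat \<Rightarrow> nat \<Rightarrow> (nat \<Rightarrow> nat \<Rightarrow> int) set" where
  "count_event p d i y j = {F \<in> space (random_coeffs p d).
     \<forall>k<j. int p ^ (i * (j - k)) dvd taylor_coeff (coeffs_poly d (i * j) F) y k}"

definition mult_event :: "nat \<Rightarrow> nat \<Rightarrow> nat \<Rightarrow> nat \<Rightarrow> (nat \<Rightarrow> nat \<Rightarrow> int) set" where
  "mult_event p d a j = {F \<in> space (random_coeffs p d).
     \<forall>k<j. int p ^ 1 dvd taylor_coeff (coeffs_poly d 1 F) a k}"

lemma sets_count_event: "count_event p d i y j \<in> sets (random_coeffs p d)"
  unfolding count_event_def by (rule sets_approx_coeffs)

lemma sets_mult_event: "mult_event p d a j \<in> sets (random_coeffs p d)"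
  unfolding mult_event_def by (rule sets_approx_coeffs)

text \<open>The exponents add up to \<open>i * j * (j + 1) / 2\<close>. The weaker
  \<open>i * (j + 1)\<close>, which is the same for \<open>j = 2\<close>, is linear in
  \<open>j\<close> and already makes all sums geometric.\<close>

lemma emeasure_count_event:
  assumes "p > 0" "2 \<le> j" "j \<le> d"
  shows "emeasure (random_coeffs p d) (count_event p d i y j) \<le> ennreal (1 / real p ^ (i * Suc j))"
proof -
  have "(\<Sum>k<j. i * (j - k)) = i * (\<Sum>k<j. j - k)" by (simp add: sum_distrib_left)
  also have "(\<Sum>k<j. j - k) = (\<Sum>k<j. Suc k)" by (rule sum.reindex_bij_witness[of _ "\<lambda>k. j - Suc k" "\<lambda>k. j - Suc k"]) auto
  finally have eq: "(\<Sum>k<j. i * (j - k)) = i * (\<Sum>k<j. Suc k)" .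
  have "Suc j \<le> (\<Sum>k<j. Suc k)" using assms(2)
  proof (induction j rule: dec_induct)
    case base
    then show ?case by (simp add: numeral_2_eq_2)
  next
    case (step j)
    then show ?case by simp
  qed
  then have ge: "i * Suc j \<le> (\<Sum>k<j. i * (j - k))" unfolding eq by (rule mult_le_mono2)
  have "emeasure (random_coeffs p d) (count_event p d i y j) \<le> ennreal (1 / real p ^ (\<Sum>k<j. i * (j - k)))"
    unfolding count_event_def by (rule emeasure_taylor_dvd) (use assms in auto)
  also have "\<dots> \<le> ennreal (1 / real p ^ (i * Suc j))"
    using assms(1) by (intro ennreal_leI divide_left_mono power_increasing ge mult_pos_pos zero_less_power) auto
  finally show ?thesis .
qed

lemma emeasure_mult_event:
  assumes "p > 0" "j \<le> d"
  shows "emeasure (random_coeffs p d) (mult_event p d a j) \<le> ennreal (1 / real p ^ j)"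
proof -
  have "emeasure (random_coeffs p d) (mult_event p d a j) \<le> ennreal (1 / real p ^ (\<Sum>k<j. 1))"
    unfolding mult_event_def by (rule emeasure_taylor_dvd) (use assms in auto)
  then show ?thesis by simp
qed

text \<open>The event is formulated with the precision \<open>i * j\<close>, so that it is
  independent of the \<open>b\<close> at which the polynomial happens to be resolved; the exponents
  exceed neither.\<close>

lemma count_event_if:
  assumes p: "prime p" and F: "F \<in> space (random_coeffs p d)"
    and reg: "regular_node p d (coeffs_poly d b F) b i y" and j: "j \<le> node_count p d (coeffs_poly d b F) i y"
  shows "F \<in> count_event p d i y j"
  unfolding count_event_def mem_Collect_eq
proof (intro conjI allI impI F)
  fix k assume k: "k < j"
  let ?l = "node_count p d (coeffs_poly d b F) i y"
  have "i * ?l \<le> snd (node_min p d (coeffs_poly d b F) i y)"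
    by (rule node_count_le_valuation[OF p reg])
  then have "i * ?l < b" using regular_nodeD(2)[OF reg] by (rule le_less_trans)
  moreover have "i * (j - k) \<le> i * ?l" using j by (intro mult_le_mono2) simp
  ultimately have "i * (j - k) \<le> b" by linarith
  moreover have "i * (j - k) \<le> i * j" by simp
  ultimately show "int p ^ (i * (j - k)) dvd taylor_coeff (coeffs_poly d (i * j) F) y k"
    using node_count_geD[OF p reg j k] taylor_dvd_transfer[OF F] by blast
qed

text \<open>Modulo \<open>p ^ Suc v\<close> the polynomial is a multiple of its residue polynomial
  by a factor divisible by \<open>p ^ v\<close>, so Taylor coefficients of the latter that vanish
  modulo \<open>p\<close> do so for the former.\<close>

lemma mult_event_if:
  assumes p: "prime p" and F: "F \<in> space (random_coeffs p d)" and b: "b > 0"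
    and reg: "regular_node p d (coeffs_poly d b F) b 0 0" and j: "j \<le> node_mult p d (coeffs_poly d b F) 0 0 a"
  shows "F \<in> mult_event p d a j"
  unfolding mult_event_def mem_Collect_eq
proof (intro conjI allI impI F)
  fix k assume k: "k < j"
  let ?P = "coeffs_poly d b F"
  let ?v = "snd (node_min p d ?P 0 0)" and ?g = "Poly (node_residues p d ?P 0 0)" and ?l = "node_count p d ?P 0 0"
  have P0: "node_poly p ?P 0 0 = ?P" by (rule node_poly_0)
  have "int p ^ Suc ?v dvd taylor_coeff ?P a k - coeff ?P ?l * taylor_coeff ?g a k"
    using taylor_coeff_node_residues[OF p degree_coeffs_poly reg] unfolding P0 .
  moreover have "int p ^ Suc ?v dvd coeff ?P ?l * taylor_coeff ?g a k"
  proof -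
    have 1: "int p ^ ?v dvd coeff ?P ?l"
      using regular_nodeD(1)[OF reg] unfolding P0 by (simp add: last_minimal_def)
    have "int p dvd taylor_coeff ?g a k" by (rule node_mult_props(3)[OF p reg]) (use k j in simp)
    from mult_dvd_mono[OF this 1] show ?thesis by (simp only: power_Suc mult.commute[of _ "taylor_coeff ?g a k"])
  qed
  ultimately have "int p ^ Suc ?v dvd (taylor_coeff ?P a k - coeff ?P ?l * taylor_coeff ?g a k) + coeff ?P ?l * taylor_coeff ?g a k"
    by (rule dvd_add)
  then have "int p ^ Suc ?v dvd taylor_coeff ?P a k" by (simp only: diff_add_cancel)
  moreover have "int p ^ 1 dvd int p ^ Suc ?v" by (rule le_imp_power_dvd) simp
  ultimately have "int p ^ 1 dvd taylor_coeff ?P a k" by (rule dvd_trans[rotated])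
  moreover have "1 \<le> b" using b by simp
  ultimately show "int p ^ 1 dvd taylor_coeff (coeffs_poly d 1 F) a k"
    using taylor_dvd_transfer[OF F, of 1 b 1] by blast
qed

lemma of_nat_le_sum_indicator:
  assumes "\<And>j. 1 \<le> j \<Longrightarrow> j \<le> n \<Longrightarrow> x \<in> A j" "n \<le> d"
  shows "ennreal (real n) \<le> (\<Sum>j=1..d. indicator (A j) x)"
proof -
  have "ennreal (real n) = (\<Sum>j=1..n. indicator (A j) x)"
    using assms(1) by (simp add: ennreal_of_nat_eq_real_of_nat)
  also have "\<dots> \<le> (\<Sum>j=1..d. indicator (A j) x)" by (rule sum_mono2) (use assms(2) in auto)
  finally show ?thesis .
qed

text \<open>The events start at \<open>j = 2\<close>, as the bound for \<open>j = 1\<close> does not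
  decay fast enough to be summed over all discs. The factor 2 comes from
  \<open>n \<le> 2 * (n - 1)\<close>.\<close>

lemma of_nat_le_double_sum_indicator:
  assumes "\<And>j. 2 \<le> j \<Longrightarrow> j \<le> n \<Longrightarrow> x \<in> A j" "2 \<le> n" "n \<le> d"
  shows "ennreal (real n) \<le> 2 * (\<Sum>j=2..d. indicator (A j) x)"
proof -
  have "ennreal (real n) \<le> ennreal (real (2 * (n - 1)))" using assms(2) by (intro ennreal_leI) simp
  also have "\<dots> = of_nat (2 * (n - 1))" by (simp only: ennreal_of_nat_eq_real_of_nat)
  also have "\<dots> = 2 * of_nat (n - 1)" by (simp only: of_nat_mult of_nat_numeral)
  also have "of_nat (n - 1) = (\<Sum>j=2..n. indicator (A j) x :: ennreal)"
    using assms(1,2) by simp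
  also have "(2 :: ennreal) * \<dots> \<le> 2 * (\<Sum>j=2..d. indicator (A j) x)"
    by (intro mult_left_mono sum_mono2) (use assms(3) in auto)
  finally show ?thesis .
qed

lemma suminf_ennreal_power_le:
  assumes "real p \<ge> 2"
  shows "(\<Sum>i. ennreal (1 / real p ^ (c + i))) \<le> ennreal (2 / real p ^ c)"
proof -
  have "(\<lambda>b. (1 / 2 :: real) ^ b) sums 2" using geometric_sums[of "1 / 2 :: real"] by simp
  from sums_mult[OF this, of "1 / real p ^ c"]
  have sums: "(\<lambda>i. 1 / real p ^ c * (1 / 2) ^ i) sums (2 / real p ^ c)" by simp
  have "(\<Sum>i. ennreal (1 / real p ^ (c + i))) \<le> (\<Sum>i. ennreal (1 / real p ^ c * (1 / 2) ^ i))"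
  proof (intro suminf_le ennreal_leI)
    fix i
    have "1 / real p ^ i \<le> 1 / 2 ^ i" using assms by (intro divide_left_mono power_mono) auto
    then have "1 / real p ^ c * (1 / real p ^ i) \<le> 1 / real p ^ c * (1 / 2 ^ i)" by (intro mult_left_mono) auto
    then show "1 / real p ^ (c + i) \<le> 1 / real p ^ c * (1 / 2) ^ i" by (simp add: power_add power_one_over)
  qed auto
  also have "\<dots> = ennreal (2 / real p ^ c)" by (rule suminf_ennreal_eq[OF _ sums]) simp
  finally show ?thesis .
qed

definition root_bound :: "nat \<Rightarrow> nat \<Rightarrow> (nat \<Rightarrow> nat \<Rightarrow> int) \<Rightarrow> ennreal" where
  "root_bound p d F = (\<Sum>a<p. \<Sum>j=1..d. indicator (mult_event p d a j) F)"

definition inner_bound :: "nat \<Rightarrow> nat \<Rightarrow> (nat \<Rightarrow> nat \<Rightarrow> int) \<Rightarrow> ennreal" where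
  "inner_bound p d F = (\<Sum>i. \<Sum>y<p ^ Suc i. \<Sum>j=2..d. indicator (count_event p d (Suc i) y j) F)"

lemma measurable_bounds [measurable]:
  "root_bound p d \<in> borel_measurable (random_coeffs p d)"
  "inner_bound p d \<in> borel_measurable (random_coeffs p d)"
proof -
  note [measurable] = sets_mult_event sets_count_event
  show "root_bound p d \<in> borel_measurable (random_coeffs p d)" unfolding root_bound_def[abs_def] by measurable
  show "inner_bound p d \<in> borel_measurable (random_coeffs p d)" unfolding inner_bound_def[abs_def] by measurable
qed

lemma sum_inverse_power_le:
  assumes "real p \<ge> 2"
  shows "(\<Sum>j=m..d. ennreal (1 / real p ^ (c + j))) \<le> ennreal (2 / real p ^ (c + m))"
proof -
  have "(\<Sum>j=m..d. ennreal (1 / real p ^ (c + j))) = (\<Sum>j<Suc d - m. ennreal (1 / real p ^ (c + m + j)))"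
    by (rule sum.reindex_bij_witness[of _ "\<lambda>j. m + j" "\<lambda>j. j - m"]) auto
  also have "\<dots> \<le> (\<Sum>j. ennreal (1 / real p ^ (c + m + j)))" by (rule sum_le_suminf) auto
  also have "\<dots> \<le> ennreal (2 / real p ^ (c + m))" by (rule suminf_ennreal_power_le) fact
  finally show ?thesis .
qed

text \<open>For each of the \<open>p\<close> residues the probabilities \<open>p ^ - j\<close> sum
  up to at most \<open>2 / p\<close>.\<close>

lemma nn_integral_root_bound:
  assumes "prime p"
  shows "(\<integral>\<^sup>+ F. root_bound p d F \<partial>random_coeffs p d) \<le> ennreal 2"
proof -
  have p: "real p \<ge> 2" using prime_ge_2_nat[OF assms] by simp
  have "(\<integral>\<^sup>+ F. root_bound p d F \<partial>random_coeffs p d) = (\<Sum>a<p. \<Sum>j=1..d. emeasure (random_coeffs p d) (mult_event p d a j))"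
    unfolding root_bound_def
    by (subst nn_integral_sum; (subst nn_integral_sum)?) (auto simp: sets_mult_event intro!: borel_measurable_sum borel_measurable_indicator)
  also have "\<dots> \<le> (\<Sum>a<p. \<Sum>j=1..d. ennreal (1 / real p ^ (0 + j)))"
    unfolding add_0 by (intro sum_mono emeasure_mult_event) (use p in auto)
  also have "\<dots> \<le> (\<Sum>a<p. ennreal (2 / real p ^ (0 + 1)))"
    by (intro sum_mono sum_inverse_power_le p)
  also have "\<dots> = ennreal 2" using p by (simp add: ennreal_of_nat_eq_real_of_nat flip: ennreal_mult)
  finally show ?thesis .
qed

text \<open>On level \<open>i + 1\<close> the \<open>p ^ (i + 1)\<close> discs together contribute
  at most \<open>2 / p ^ (i + 2)\<close>. The factor \<open>1 / p\<close> in the result compensates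
  the factor \<open>p\<close> in the cost of a disc.\<close>

lemma nn_integral_inner_bound:
  assumes "prime p"
  shows "(\<integral>\<^sup>+ F. inner_bound p d F \<partial>random_coeffs p d) \<le> ennreal (4 / real p)"
proof -
  let ?M = "random_coeffs p d"
  have p: "real p \<ge> 2" using prime_ge_2_nat[OF assms] by simp
  have "(\<integral>\<^sup>+ F. inner_bound p d F \<partial>?M)
      = (\<Sum>i. \<integral>\<^sup>+ F. (\<Sum>y<p ^ Suc i. \<Sum>j=2..d. indicator (count_event p d (Suc i) y j) F) \<partial>?M)"
    unfolding inner_bound_def
    by (rule nn_integral_suminf) (auto simp: sets_count_event intro!: borel_measurable_sum borel_measurable_indicator)
  also have "\<dots> \<le> (\<Sum>i. ennreal (2 / real p ^ (2 + i)))"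
  proof (rule suminf_le)
    fix i
    have "(\<integral>\<^sup>+ F. (\<Sum>y<p ^ Suc i. \<Sum>j=2..d. indicator (count_event p d (Suc i) y j) F) \<partial>?M)
      = (\<Sum>y<p ^ Suc i. \<Sum>j=2..d. emeasure ?M (count_event p d (Suc i) y j))"
      by (subst nn_integral_sum; (subst nn_integral_sum)?) (auto simp: sets_count_event intro!: borel_measurable_sum borel_measurable_indicator)
    also have "\<dots> \<le> (\<Sum>y<p ^ Suc i. \<Sum>j=2..d. ennreal (1 / real p ^ (Suc i + i + j)))"
    proof (intro sum_mono)
      fix y j assume j: "j \<in> {2..d}"
      have "emeasure ?M (count_event p d (Suc i) y j) \<le> ennreal (1 / real p ^ (Suc i * Suc j))"
        by (rule emeasure_count_event) (use j p in auto)
      also have "\<dots> \<le> ennreal (1 / real p ^ (Suc i + i + j))"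
      proof (intro ennreal_leI divide_left_mono power_increasing mult_pos_pos zero_less_power)
        have "i * 1 \<le> i * j" using j by (intro mult_le_mono2) simp
        then show "Suc i + i + j \<le> Suc i * Suc j" by simp
      qed (use p in auto)
      finally show "emeasure ?M (count_event p d (Suc i) y j) \<le> ennreal (1 / real p ^ (Suc i + i + j))" .
    qed
    also have "\<dots> \<le> (\<Sum>y<p ^ Suc i. ennreal (2 / real p ^ (Suc i + i + 2)))"
      by (intro sum_mono sum_inverse_power_le p)
    also have "\<dots> = ennreal (real p ^ Suc i * (2 / real p ^ (Suc i + i + 2)))"
      by (simp add: ennreal_of_nat_eq_real_of_nat flip: ennreal_mult)
    also have "real p ^ Suc i * (2 / real p ^ (Suc i + i + 2)) = 2 / real p ^ (2 + i)"
      using p by (simp add: power_add)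
    finally show "(\<integral>\<^sup>+ F. (\<Sum>y<p ^ Suc i. \<Sum>j=2..d. indicator (count_event p d (Suc i) y j) F) \<partial>?M)
      \<le> ennreal (2 / real p ^ (2 + i))" .
  qed auto
  also have "\<dots> = (\<Sum>i. 2 * ennreal (1 / real p ^ (2 + i)))"
    by (rule suminf_cong) (simp flip: ennreal_numeral ennreal_mult)
  also have "\<dots> = 2 * (\<Sum>i. ennreal (1 / real p ^ (2 + i)))" by (rule ennreal_suminf_cmult)
  also have "\<dots> \<le> 2 * ennreal (2 / real p ^ 2)" by (intro mult_left_mono suminf_ennreal_power_le p) auto
  also have "\<dots> = ennreal (4 / real p ^ 2)" by (simp flip: ennreal_numeral ennreal_mult)
  also have "\<dots> \<le> ennreal (4 / real p)"
  proof (rule ennreal_leI)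
    have "real p * 1 \<le> real p * real p" using p by (intro mult_left_mono) auto
    then show "4 / real p ^ 2 \<le> 4 / real p" using p by (intro divide_left_mono) (auto simp: power2_eq_square)
  qed
  finally show ?thesis .
qed

section \<open>Average cost\<close>

text \<open>The root is visited with certainty and has its own bound with \<alpha> and \<beta>; all
  other discs are charged \<gamma> per unit of the count. The factor 2 of \<beta> bounds the
  expected sum of multiplicities, the 8 of \<gamma> is the factor 2 from the indicators times the 4
  of the inner discs, and \<open>2 * d + 2\<close> covers the operations before the loop.\<close>

lemma average_operations:
  assumes p: "prime p" and d: "d \<ge> 1" and nonneg: "0 \<le> \<alpha>" "0 \<le> \<beta>" "0 \<le> \<gamma>"
    and root: "\<And>P b t. resolved p b t P \<Longrightarrow> degree P \<le> d \<Longrightarrow>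
      node_cost rf tr p d P 0 0 \<le> ennreal (\<alpha> + \<beta> * (\<Sum>a\<in>node_roots p d P 0 0. real (node_mult p d P 0 0 a)))"
    and inner: "\<And>P b t s x. resolved p b t P \<Longrightarrow> degree P \<le> d \<Longrightarrow> s < t \<Longrightarrow> x < p ^ s \<Longrightarrow> 2 \<le> node_count p d P s x \<Longrightarrow>
      node_cost rf tr p d P s x \<le> ennreal (\<gamma> * real (node_count p d P s x))"
  shows "average_at_most (random_coeffs p d)
    (\<lambda>F. expected_operations (strassman rf tr p (padic_int p) (poly_of d F)))
    (real (2 * d + 2) + \<alpha> + 2 * \<beta> + 8 * \<gamma> / real p)"
proof -
  let ?M = "random_coeffs p d"
  define X where "X F = expected_operations (strassman rf tr p (padic_int p) (poly_of d F))" for F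
  \<comment> \<open>For each \<open>b\<close> this depends on finitely many digits, hence measurably
    on the polynomial. All resolved precisions give the same value, and the default 0 hides the
    unresolved ones from the supremum over \<open>b\<close>.\<close>
  define cost :: "nat \<Rightarrow> int list \<Rightarrow> ennreal" where "cost b cs = (if \<exists>t. resolved p b t (Poly cs)
    then of_nat (Suc d + Suc (node_count p d (Poly cs) 0 0)) + tree_cost rf tr p d (Poly cs) (SOME t. resolved p b t (Poly cs)) 0 0
    else 0)" for b cs
  define X' where "X' F = (SUP b. cost b (approx_coeffs d b F))" for F
  define Y where "Y F = (ennreal (real (2 * d + 2)) + ennreal \<alpha>) + (ennreal \<beta> * root_bound p d F + ennreal (2 * \<gamma>) * inner_bound p d F)" for F
  have "(\<lambda>F. cost b (approx_coeffs d b F)) \<in> borel_measurable ?M" for b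
    by (rule measurable_compose[OF measurable_approx_coeffs]) simp
  then have X'_meas: "X' \<in> borel_measurable ?M" unfolding X'_def[abs_def] by (intro borel_measurable_SUP) auto
  have exact: "X F = of_nat (Suc d + Suc (node_count p d (coeffs_poly d b F) 0 0)) + tree_cost rf tr p d (coeffs_poly d b F) t 0 0"
    if "F \<in> space ?M" "resolved p b t (coeffs_poly d b F)" for F b t
    using expected_operations_exact[OF p poly_of_carrier[OF that(1)] length_poly_of d, of b t rf tr] that(2)
    by (simp only: map_poly_of X_def)
  have cost: "cost b (approx_coeffs d b F) = X F" if "F \<in> space ?M" "resolved p b t (coeffs_poly d b F)" for F b t
  proof -
    have "resolved p b (SOME t. resolved p b t (coeffs_poly d b F)) (coeffs_poly d b F)"
      by (rule someI[of "\<lambda>t. resolved p b t (coeffs_poly d b F)"]) (rule that(2))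
    from exact[OF that(1) this] show ?thesis using that(2) unfolding cost_def by auto
  qed
  have AE_eq: "AE F in ?M. X F = X' F"
    using AE_resolved[OF p d] AE_space
  proof eventually_elim
    case (elim F)
    then obtain b t where t: "resolved p b t (coeffs_poly d b F)" by blast
    show ?case unfolding X'_def
    proof (rule antisym)
      show "X F \<le> (SUP b. cost b (approx_coeffs d b F))"
        unfolding cost[OF elim(2) t, symmetric] by (rule SUP_upper) (rule UNIV_I)
      show "(SUP b. cost b (approx_coeffs d b F)) \<le> X F"
      proof (rule SUP_least)
        fix b
        show "cost b (approx_coeffs d b F) \<le> X F"
        proof (cases "\<exists>t. resolved p b t (coeffs_poly d b F)")
          case True
          then show ?thesis using cost[OF elim(2)] by auto
        next
          case False
          then show ?thesis by (simp add: cost_def)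
        qed
      qed
    qed
  qed
  have AE_le: "AE F in ?M. X F \<le> Y F"
    using AE_resolved[OF p d] AE_space
  proof eventually_elim
    case (elim F)
    then obtain b t where res: "resolved p b t (coeffs_poly d b F)" by blast
    define P where "P = coeffs_poly d b F"
    note res = res[folded P_def]
    have deg: "degree P \<le> d" unfolding P_def by (rule degree_coeffs_poly)
    have reg: "regular_node p d P b s x" if "s \<le> t" "x < p ^ s" for s x
      by (rule resolved_regular[OF p d res that])
    have reg0: "regular_node p d P b 0 0" by (rule reg) auto
    define h where "h i y = (if node_count p d P i y > 1 then node_cost rf tr p d P i y else 0)" for i y
    let ?E = "\<lambda>i y. \<Sum>j=2..d. indicator (count_event p d i y j) F :: ennreal"
    have h_le: "h i y \<le> ennreal (2 * \<gamma>) * ?E i y" if i: "i \<le> t" "y < p ^ i" for i y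
    proof (cases "node_count p d P i y > 1")
      case True
      then have n2: "2 \<le> node_count p d P i y" by simp
      have "i \<noteq> t" using resolved_leaf[OF p d res] i True by fastforce
      then have "i < t" using i by simp
      have "h i y = node_cost rf tr p d P i y" using True by (simp add: h_def)
      also have "\<dots> \<le> ennreal (\<gamma> * real (node_count p d P i y))" by (rule inner[OF res deg \<open>i < t\<close> i(2) n2])
      also have "\<dots> = ennreal \<gamma> * ennreal (real (node_count p d P i y))" by (rule ennreal_mult) (use nonneg in auto)
      also have "\<dots> \<le> ennreal \<gamma> * (2 * ?E i y)"
      proof (intro mult_left_mono of_nat_le_double_sum_indicator n2 node_count_le[OF reg[OF i]])
        show "F \<in> count_event p d i y j" if "j \<le> node_count p d P i y" for j
          using count_event_if[OF p elim(2) reg[OF i, unfolded P_def] that[unfolded P_def]] .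
      qed simp_all
      also have "\<dots> = ennreal (2 * \<gamma>) * ?E i y"
        using nonneg by (simp add: ennreal_mult mult_ac)
      finally show ?thesis .
    qed (simp add: h_def)
    have "(\<Sum>i<t. \<Sum>y<p ^ Suc i. h (0 + Suc i) (0 + y * p ^ 0)) \<le> (\<Sum>i<t. \<Sum>y<p ^ Suc i. ennreal (2 * \<gamma>) * ?E (Suc i) y)"
      by (intro sum_mono) (use h_le in simp)
    also have "\<dots> = ennreal (2 * \<gamma>) * (\<Sum>i<t. \<Sum>y<p ^ Suc i. ?E (Suc i) y)"
      by (simp only: sum_distrib_left)
    also have "\<dots> \<le> ennreal (2 * \<gamma>) * inner_bound p d F"
      unfolding inner_bound_def by (intro mult_left_mono sum_le_suminf) auto
    finally have inner_le: "(\<Sum>i<t. \<Sum>y<p ^ Suc i. h (0 + Suc i) (0 + y * p ^ 0)) \<le> ennreal (2 * \<gamma>) * inner_bound p d F" .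
    have b: "b > 0" using resolved_pos[OF res] by simp
    let ?r = "node_roots p d P 0 0" and ?m = "node_mult p d P 0 0"
    have "ennreal (\<Sum>a\<in>?r. real (?m a)) = (\<Sum>a\<in>?r. ennreal (real (?m a)))" by (simp add: sum_ennreal)
    also have "\<dots> \<le> (\<Sum>a\<in>?r. \<Sum>j=1..d. indicator (mult_event p d a j) F)"
    proof (intro sum_mono of_nat_le_sum_indicator)
      fix a
      show "?m a \<le> d" by (rule order_trans[OF node_mult_props(1)[OF p reg0] node_count_le[OF reg0]])
      show "F \<in> mult_event p d a j" if "j \<le> ?m a" for j
        by (rule mult_event_if[OF p elim(2) b reg0[unfolded P_def] that[unfolded P_def]])
    qed
    also have "\<dots> \<le> root_bound p d F"
      unfolding root_bound_def by (rule sum_mono2) (auto simp: node_roots_def)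
    finally have mult_le: "ennreal (\<Sum>a\<in>?r. real (?m a)) \<le> root_bound p d F" .
    have "node_cost rf tr p d P 0 0 \<le> ennreal (\<alpha> + \<beta> * (\<Sum>a\<in>?r. real (?m a)))" by (rule root[OF res deg])
    also have "\<dots> = ennreal \<alpha> + ennreal \<beta> * ennreal (\<Sum>a\<in>?r. real (?m a))"
      using nonneg by (simp add: ennreal_plus ennreal_mult sum_nonneg)
    also have "\<dots> \<le> ennreal \<alpha> + ennreal \<beta> * root_bound p d F"
      by (intro add_left_mono mult_left_mono mult_le) simp
    finally have root_le: "node_cost rf tr p d P 0 0 \<le> ennreal \<alpha> + ennreal \<beta> * root_bound p d F" .
    have "tree_cost rf tr p d P t 0 0 \<le> node_cost rf tr p d P 0 0 + (\<Sum>i<t. \<Sum>y<p ^ Suc i. h (0 + Suc i) (0 + y * p ^ 0))"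
      by (rule tree_cost_le) (simp add: h_def)
    also have "\<dots> \<le> (ennreal \<alpha> + ennreal \<beta> * root_bound p d F) + ennreal (2 * \<gamma>) * inner_bound p d F"
      by (intro add_mono root_le inner_le)
    finally have tree_le: "tree_cost rf tr p d P t 0 0 \<le> (ennreal \<alpha> + ennreal \<beta> * root_bound p d F) + ennreal (2 * \<gamma>) * inner_bound p d F" .
    have "(of_nat (Suc d + Suc (node_count p d P 0 0)) :: ennreal) = ennreal (real (Suc d + Suc (node_count p d P 0 0)))"
      by (simp only: ennreal_of_nat_eq_real_of_nat)
    also have "\<dots> \<le> ennreal (real (2 * d + 2))"
      using node_count_le[OF reg0] by (intro ennreal_leI of_nat_mono) simp
    finally have "of_nat (Suc d + Suc (node_count p d P 0 0)) \<le> ennreal (real (2 * d + 2))" .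
    from add_mono[OF this tree_le] show ?case
      unfolding exact[OF elim(2) res[unfolded P_def], folded P_def] Y_def by (simp only: add.assoc)
  qed
  interpret prob_space ?M by (rule prob_space_random_coeffs) (rule prime_gt_0_nat[OF p])
  have "(\<integral>\<^sup>+ F. X' F \<partial>?M) = (\<integral>\<^sup>+ F. X F \<partial>?M)"
    by (rule nn_integral_cong_AE) (use AE_eq in eventually_elim, simp)
  also have "\<dots> \<le> (\<integral>\<^sup>+ F. Y F \<partial>?M)" by (rule nn_integral_mono_AE) (rule AE_le)
  also have "\<dots> = (ennreal (real (2 * d + 2)) + ennreal \<alpha>) +
      (ennreal \<beta> * (\<integral>\<^sup>+ F. root_bound p d F \<partial>?M) + ennreal (2 * \<gamma>) * (\<integral>\<^sup>+ F. inner_bound p d F \<partial>?M))"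
    unfolding Y_def by (simp add: nn_integral_add nn_integral_cmult emeasure_space_1)
  also have "\<dots> \<le> (ennreal (real (2 * d + 2)) + ennreal \<alpha>) + (ennreal \<beta> * ennreal 2 + ennreal (2 * \<gamma>) * ennreal (4 / real p))"
    by (intro add_left_mono add_mono mult_left_mono nn_integral_root_bound nn_integral_inner_bound p) auto
  also have "\<dots> = ennreal (real (2 * d + 2) + \<alpha> + (\<beta> * 2 + 2 * \<gamma> * (4 / real p)))"
  proof -
    have 1: "ennreal \<beta> * ennreal 2 = ennreal (\<beta> * 2)" by (rule ennreal_mult[symmetric]) (use nonneg in auto)
    have 2: "ennreal (2 * \<gamma>) * ennreal (4 / real p) = ennreal (2 * \<gamma> * (4 / real p))"
      by (rule ennreal_mult[symmetric]) (use nonneg in auto)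
    show ?thesis unfolding 1 2 using nonneg by (simp add: algebra_simps flip: ennreal_plus)
  qed
  also have "real (2 * d + 2) + \<alpha> + (\<beta> * 2 + 2 * \<gamma> * (4 / real p)) = real (2 * d + 2) + \<alpha> + 2 * \<beta> + 8 * \<gamma> / real p"
    by (simp add: algebra_simps)
  finally show ?thesis
    using average_at_mostI[OF X'_meas AE_eq] by (simp add: X_def[abs_def])
qed

text \<open>With the multiplicity as truncation degree every summand is linear in \<open>m\<close>,
  including the search for it, and the new count is at most \<open>m\<close>. As
  \<open>m \<ge> 1\<close>, constants are absorbed.\<close>

lemma refine_cost_multiplicity:
  assumes p: "prime p" and P: "degree P \<le> d" and d: "d \<ge> 1"
    and reg: "regular_node p d P b s x" "regular_node p d P b (Suc s) (x + a * p ^ s)" and a: "a \<in> node_roots p d P s x"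
  shows "refine_cost p d P At_Multiplicity s x a \<le> 32 * d * node_mult p d P s x a"
proof -
  define m l l' where defs: "m = node_mult p d P s x a" "l = node_count p d P s x" "l' = node_count p d P (Suc s) (x + a * p ^ s)"
  have l: "l \<le> d" using node_count_le[OF reg(1)] by (simp add: defs)
  have m: "m \<le> l" "1 \<le> m" using node_mult_props(1,4)[OF p reg(1)] a by (simp_all add: defs)
  have l': "l' \<le> m" using child_last_minimal(2)[OF p P reg order_refl] m l by (simp add: defs)
  define A B D E where bounds: "A = (m + (if m < l then 1 else 0)) * (2 * Suc l + 1)" "B = Suc m * (2 * Suc d)" "D = d * m"
    "E = (if l' > 1 then Suc l' else 0)"
  have "A \<le> (2 * m) * (5 * d)"
    unfolding bounds by (rule mult_le_mono) (use m l d in auto)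
  also have "\<dots> = 10 * D" by (simp add: bounds)
  finally have "A \<le> 10 * D" .
  moreover have "B \<le> 8 * D"
  proof -
    have "B \<le> (2 * m) * (4 * d)" unfolding bounds by (rule mult_le_mono) (use m d in auto)
    also have "\<dots> = 8 * D" by (simp add: bounds)
    finally show ?thesis .
  qed
  moreover have "m \<le> D" using mult_le_mono1[OF d, of m] by (simp add: bounds)
  moreover have "E \<le> 2 * m" using l' m by (simp add: bounds)
  ultimately have "3 + A + (B + 2 * Suc m) + Suc m + E \<le> 3 * m + 10 * D + (8 * D + 2 * (2 * m)) + 2 * m + 2 * m"
    using m(2) by (intro add_mono mult_le_mono2) auto
  also have "\<dots> = 18 * D + 11 * m" by simp
  also have "\<dots> \<le> 18 * D + 11 * D" by (intro add_left_mono mult_le_mono2) fact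
  also have "\<dots> \<le> 32 * D" by simp
  also have "3 + A + (B + 2 * Suc m) + Suc m + E = refine_cost p d P At_Multiplicity s x a"
    by (simp only: refine_cost_def bounds defs Let_def truncation.case)
  finally show ?thesis by (simp add: bounds defs mult.assoc)
qed

lemma refine_cost_count:
  assumes p: "prime p" and P: "degree P \<le> d" and d: "d \<ge> 1"
    and reg: "regular_node p d P b s x" "regular_node p d P b (Suc s) (x + a * p ^ s)"
  shows "refine_cost p d P At_Count s x a \<le> 11 * d * Suc (node_count p d P s x)"
proof -
  define l l' where defs: "l = node_count p d P s x" "l' = node_count p d P (Suc s) (x + a * p ^ s)"
  have l: "l \<le> d" using node_count_le[OF reg(1)] by (simp add: defs)
  have m: "node_mult p d P s x a \<le> l" using node_mult_props(1)[OF p reg(1)] by (simp add: defs)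
  have l': "l' \<le> l" using child_last_minimal(2)[OF p P reg order_refl] m l by (simp add: defs)
  define B D E where bounds: "B = Suc l * (2 * Suc d)" "D = d * Suc l"
    "E = (if l' > 1 then Suc l' else 0)"
  have "B \<le> Suc l * (4 * d)"
    unfolding bounds by (rule mult_le_mono2) (use d in auto)
  then have "B \<le> 4 * D" by (simp only: bounds mult_ac)
  moreover have "Suc l \<le> D" using mult_le_mono1[OF d, of "Suc l"] by (simp add: bounds)
  moreover have "E \<le> Suc l" using l' by (simp add: bounds)
  ultimately have "3 + (B + 2 * Suc l) + Suc l + E \<le> 3 * Suc l + (4 * D + 2 * Suc l) + Suc l + Suc l"
    by (intro add_mono mult_le_mono2) auto
  also have "\<dots> = 4 * D + 7 * Suc l" by simp
  also have "\<dots> \<le> 4 * D + 7 * D" by (intro add_left_mono mult_le_mono2) fact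
  also have "\<dots> = 11 * D" by simp
  also have "3 + (B + 2 * Suc l) + Suc l + E = refine_cost p d P At_Count s x a"
    by (simp only: refine_cost_def bounds defs Let_def truncation.case add_0_right)
  finally show ?thesis by (simp add: bounds defs mult.assoc)
qed

lemma node_cost_exhaustive:
  assumes p: "prime p" and P: "degree P \<le> d" and d: "d \<ge> 1" and res: "resolved p b t P" and s: "s < t" "x < p ^ s"
  shows "node_cost Exhaustive_Search At_Multiplicity p d P s x
    \<le> ennreal (real p * (2 * real (node_count p d P s x) + 3)
      + 32 * real d * (\<Sum>a\<in>node_roots p d P s x. real (node_mult p d P s x a)))"
proof -
  let ?l = "node_count p d P s x" and ?r = "node_roots p d P s x" and ?m = "node_mult p d P s x"
  have reg: "regular_node p d P b s x" by (rule resolved_regular[OF p d res]) (use s in auto)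
  have pk: "p < 2 ^ p" by (rule less_exp)
  have "(\<Sum>a\<in>?r. refine_cost p d P At_Multiplicity s x a) \<le> (\<Sum>a\<in>?r. 32 * d * ?m a)"
  proof (rule sum_mono)
    fix a assume a: "a \<in> ?r"
    have "regular_node p d P b (Suc s) (x + a * p ^ s)"
      by (rule resolved_regular[OF p d res _ child_less[OF s(2)]]) (use s a in \<open>auto simp: node_roots_def\<close>)
    from refine_cost_multiplicity[OF p P d reg this a] show "refine_cost p d P At_Multiplicity s x a \<le> 32 * d * ?m a" .
  qed
  also have "\<dots> = 32 * d * (\<Sum>a\<in>?r. ?m a)" by (simp only: sum_distrib_left)
  finally have "real (\<Sum>a\<in>?r. refine_cost p d P At_Multiplicity s x a) \<le> real (32 * d * (\<Sum>a\<in>?r. ?m a))"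
    by (rule of_nat_mono)
  also have "\<dots> = 32 * real d * (\<Sum>a\<in>?r. real (?m a))" by simp
  finally have le: "real (\<Sum>a\<in>?r. refine_cost p d P At_Multiplicity s x a) \<le> 32 * real d * (\<Sum>a\<in>?r. real (?m a))" .
  have "node_cost Exhaustive_Search At_Multiplicity p d P s x
    = ennreal (real p * (2 * real ?l + 3)) + ennreal (real (\<Sum>a\<in>?r. refine_cost p d P At_Multiplicity s x a))"
    unfolding node_cost_def reduced_roots_correct(4)[OF p pk node_residues_def regular_nodeD(1)[OF reg]]
    by (simp only: ennreal_of_nat_eq_real_of_nat)
  also have "\<dots> = ennreal (real p * (2 * real ?l + 3) + real (\<Sum>a\<in>?r. refine_cost p d P At_Multiplicity s x a))"
    by (intro ennreal_plus[symmetric] of_nat_0_le_iff) auto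
  also have "\<dots> \<le> ennreal (real p * (2 * real ?l + 3) + 32 * real d * (\<Sum>a\<in>?r. real (?m a)))"
    by (intro ennreal_leI add_left_mono le)
  finally show ?thesis .
qed

text \<open>With truncation at the count the same bound holds for every root, so the number of roots
  appears in place of the sum of multiplicities.\<close>

lemma node_cost_cantor_zassenhaus:
  assumes p: "prime p" and P: "degree P \<le> d" and d: "d \<ge> 1" and res: "resolved p b t P" and s: "s < t" "x < p ^ s"
    and k: "p < 2 ^ k"
  shows "node_cost Cantor_Zassenhaus At_Count p d P s x
    \<le> ennreal (240 * real k * (real (node_count p d P s x) + 1)\<^sup>2
      + 11 * real d * (real (node_count p d P s x) + 1) * real (card (node_roots p d P s x)))"
proof -
  let ?l = "node_count p d P s x" and ?r = "node_roots p d P s x"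
  have reg: "regular_node p d P b s x" by (rule resolved_regular[OF p d res]) (use s in auto)
  have "(\<Sum>a\<in>?r. refine_cost p d P At_Count s x a) \<le> (\<Sum>a\<in>?r. 11 * d * Suc ?l)"
  proof (rule sum_mono)
    fix a assume a: "a \<in> ?r"
    have "regular_node p d P b (Suc s) (x + a * p ^ s)"
      by (rule resolved_regular[OF p d res _ child_less[OF s(2)]]) (use s a in \<open>auto simp: node_roots_def\<close>)
    from refine_cost_count[OF p P d reg this] show "refine_cost p d P At_Count s x a \<le> 11 * d * Suc ?l" .
  qed
  then have "real (\<Sum>a\<in>?r. refine_cost p d P At_Count s x a) \<le> real (\<Sum>a\<in>?r. 11 * d * Suc ?l)"
    by (rule of_nat_mono)
  also have "\<dots> = 11 * real d * (real ?l + 1) * real (card ?r)" by (simp add: algebra_simps)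
  finally have le: "real (\<Sum>a\<in>?r. refine_cost p d P At_Count s x a) \<le> 11 * real d * (real ?l + 1) * real (card ?r)" .
  have "node_cost Cantor_Zassenhaus At_Count p d P s x
    \<le> ennreal (240 * real k * (real ?l + 1)\<^sup>2) + ennreal (real (\<Sum>a\<in>?r. refine_cost p d P At_Count s x a))"
    unfolding node_cost_def ennreal_of_nat_eq_real_of_nat[symmetric]
    by (intro add_right_mono reduced_roots_correct(3)[OF p k node_residues_def regular_nodeD(1)[OF reg]])
  also have "\<dots> = ennreal (240 * real k * (real ?l + 1)\<^sup>2 + real (\<Sum>a\<in>?r. refine_cost p d P At_Count s x a))"
    by (intro ennreal_plus[symmetric] of_nat_0_le_iff) auto
  also have "\<dots> \<le> ennreal (240 * real k * (real ?l + 1)\<^sup>2 + 11 * real d * (real ?l + 1) * real (card ?r))"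
    by (intro ennreal_leI add_left_mono le)
  finally show ?thesis .
qed

lemma card_node_roots_le: "card (node_roots p d P s x) \<le> p"
proof -
  have "card (node_roots p d P s x) \<le> card {..<p}" by (rule card_mono) (auto simp: node_roots_def)
  then show ?thesis by simp
qed

lemma average_at_most_mono: "average_at_most M X c \<Longrightarrow> c \<le> c' \<Longrightarrow> average_at_most M X c'"
  unfolding average_at_most_def by (meson ennreal_leI order_trans)

lemma average_operations_exhaustive:
  assumes p: "prime p" and d: "d \<ge> 1"
  shows "average_at_most (random_coeffs p d)
    (\<lambda>F. expected_operations (strassman Exhaustive_Search At_Multiplicity p (padic_int p) (poly_of d F)))
    (400 * (real d * real p))"
proof -
  have p2: "real p \<ge> 2" using prime_ge_2_nat[OF p] by simp
  have d1: "real d \<ge> 1" using d by simp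
  \<comment> \<open>\<open>2 * l + 3 \<le> 5 * d\<close> gives the 5, the refinements give 32, and
    \<open>36 = 32 + 4\<close> adds the exhaustive search on inner discs. There at most
    \<open>p\<close> roots have multiplicity at most \<open>l\<close>, hence the factor
    \<open>p\<close> in \<gamma>.\<close>
  let ?\<alpha> = "5 * real d * real p" and ?\<beta> = "32 * real d" and ?\<gamma> = "36 * real d * real p"
  show ?thesis
  proof (rule average_at_most_mono[OF average_operations[OF p d, of ?\<alpha> ?\<beta> ?\<gamma>]])
    fix P b t assume res: "resolved p b t P" and P: "degree P \<le> d"
    have reg: "regular_node p d P b 0 0" by (rule resolved_regular[OF p d res]) auto
    have "real p * (2 * real (node_count p d P 0 0) + 3) \<le> real p * (5 * real d)"
      using node_count_le[OF reg] d1 by (intro mult_left_mono) auto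
    then show "node_cost Exhaustive_Search At_Multiplicity p d P 0 0
      \<le> ennreal (?\<alpha> + ?\<beta> * (\<Sum>a\<in>node_roots p d P 0 0. real (node_mult p d P 0 0 a)))"
      using resolved_pos[OF res]
      by (intro order_trans[OF node_cost_exhaustive[OF p P d res]] ennreal_leI) (auto simp: mult_ac)
  next
    fix P b t s x assume res: "resolved p b t P" and P: "degree P \<le> d" and s: "s < t" "x < p ^ s"
      and l: "2 \<le> node_count p d P s x"
    let ?l = "node_count p d P s x" and ?r = "node_roots p d P s x"
    have reg: "regular_node p d P b s x" by (rule resolved_regular[OF p d res]) (use s in auto)
    have "(\<Sum>a\<in>?r. real (node_mult p d P s x a)) \<le> real (card ?r) * real ?l"
      by (rule sum_bounded_above) (simp add: node_mult_props(1)[OF p reg])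
    also have "\<dots> \<le> real p * real ?l" by (intro mult_right_mono) (auto simp: card_node_roots_le)
    finally have "32 * real d * (\<Sum>a\<in>?r. real (node_mult p d P s x a)) \<le> 32 * real d * (real p * real ?l)"
      by (intro mult_left_mono) auto
    moreover have "real p * (2 * real ?l + 3) \<le> real p * (4 * real d * real ?l)"
    proof (intro mult_left_mono)
      have "2 * real ?l + 3 \<le> 1 * (4 * real ?l)" using l by simp
      also have "\<dots> \<le> real d * (4 * real ?l)" by (rule mult_right_mono) (use d1 in auto)
      finally show "2 * real ?l + 3 \<le> 4 * real d * real ?l" by (simp only: mult_ac)
    qed simp
    ultimately have "real p * (2 * real ?l + 3) + 32 * real d * (\<Sum>a\<in>?r. real (node_mult p d P s x a)) \<le> ?\<gamma> * real ?l"
      by (simp add: algebra_simps)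
    then show "node_cost Exhaustive_Search At_Multiplicity p d P s x \<le> ennreal (?\<gamma> * real ?l)"
      by (intro order_trans[OF node_cost_exhaustive[OF p P d res s]] ennreal_leI)
  next
    have eq: "real (2 * d + 2) = 2 * real d + 2" "?\<alpha> = 5 * (real p * real d)" "400 * (real d * real p) = 400 * (real p * real d)"
      by simp_all
    have "8 * ?\<gamma> / real p = 288 * real d" using p2 by simp
    moreover have "2 * real d \<le> real p * real d" by (rule mult_right_mono) (use p2 in auto)
    ultimately show "real (2 * d + 2) + ?\<alpha> + 2 * ?\<beta> + 8 * ?\<gamma> / real p \<le> 400 * (real d * real p)"
      using d1 eq by linarith
  qed simp_all
qed

lemma average_operations_cantor_zassenhaus:
  assumes p: "prime p" and d: "d \<ge> 1" and k: "p < 2 ^ k" "k \<le> p"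
  shows "average_at_most (random_coeffs p d)
    (\<lambda>F. expected_operations (strassman Cantor_Zassenhaus At_Count p (padic_int p) (poly_of d F)))
    (9000 * real k * real d ^ 2)"
proof -
  have p2: "real p \<ge> 2" using prime_ge_2_nat[OF p] by simp
  have d1: "real d \<ge> 1" using d by simp
  have k1: "real k \<ge> 1" using k p2 by (cases k) auto
  have dd: "real d \<le> real d ^ 2" using d1 by (rule self_le_power) simp
  \<comment> \<open>\<open>960 = 240 * 4\<close> and \<open>22 = 11 * 2\<close> come from
    \<open>l + 1 \<le> 2 * d\<close>, and \<open>982 = 960 + 22\<close>. On inner discs
    \<open>k \<le> p\<close> replaces \<open>k\<close> by \<open>p\<close>, which the probability
    cancels, so that \<open>k\<close> remains only in the contribution of the root.\<close>
  let ?\<alpha> = "960 * real k * real d ^ 2" and ?\<beta> = "22 * real d ^ 2" and ?\<gamma> = "982 * real d * real p"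
  show ?thesis
  proof (rule average_at_most_mono[OF average_operations[OF p d, of ?\<alpha> ?\<beta> ?\<gamma>]])
    fix P b t assume res: "resolved p b t P" and P: "degree P \<le> d"
    let ?l = "node_count p d P 0 0" and ?r = "node_roots p d P 0 0"
    have reg: "regular_node p d P b 0 0" by (rule resolved_regular[OF p d res]) auto
    have l: "real ?l + 1 \<le> 2 * real d" using node_count_le[OF reg] d1 by simp
    have "(real ?l + 1)\<^sup>2 \<le> (2 * real d)\<^sup>2" by (rule power_mono[OF l]) simp
    then have "240 * real k * (real ?l + 1)\<^sup>2 \<le> 240 * real k * (2 * real d)\<^sup>2" by (rule mult_left_mono) simp
    also have "\<dots> = ?\<alpha>" by (simp add: power_mult_distrib)
    finally have 1: "240 * real k * (real ?l + 1)\<^sup>2 \<le> ?\<alpha>" .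
    have "real (card ?r) = (\<Sum>a\<in>?r. 1)" by simp
    also have "\<dots> \<le> (\<Sum>a\<in>?r. real (node_mult p d P 0 0 a))"
      by (rule sum_mono) (use node_mult_props(4)[OF p reg] in \<open>simp add: Suc_le_eq\<close>)
    finally have "11 * real d * (real ?l + 1) * real (card ?r) \<le> (11 * real d * (2 * real d)) * (\<Sum>a\<in>?r. real (node_mult p d P 0 0 a))"
      by (intro mult_mono l) auto
    also have "\<dots> = ?\<beta> * (\<Sum>a\<in>?r. real (node_mult p d P 0 0 a))" by (simp add: power2_eq_square)
    finally have 2: "11 * real d * (real ?l + 1) * real (card ?r) \<le> ?\<beta> * (\<Sum>a\<in>?r. real (node_mult p d P 0 0 a))" .
    have "0 < t" by (rule resolved_pos[OF res])
    have "node_cost Cantor_Zassenhaus At_Count p d P 0 0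
      \<le> ennreal (240 * real k * (real ?l + 1)\<^sup>2 + 11 * real d * (real ?l + 1) * real (card ?r))"
      by (rule node_cost_cantor_zassenhaus[OF p P d res \<open>0 < t\<close> _ k(1)]) simp
    also have "\<dots> \<le> ennreal (?\<alpha> + ?\<beta> * (\<Sum>a\<in>?r. real (node_mult p d P 0 0 a)))"
      by (rule ennreal_leI[OF add_mono[OF 1 2]])
    finally show "node_cost Cantor_Zassenhaus At_Count p d P 0 0
      \<le> ennreal (?\<alpha> + ?\<beta> * (\<Sum>a\<in>?r. real (node_mult p d P 0 0 a)))" .
  next
    fix P b t s x assume res: "resolved p b t P" and P: "degree P \<le> d" and s: "s < t" "x < p ^ s"
      and l: "2 \<le> node_count p d P s x"
    let ?l = "node_count p d P s x" and ?r = "node_roots p d P s x"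
    have reg: "regular_node p d P b s x" by (rule resolved_regular[OF p d res]) (use s in auto)
    have ld: "real ?l \<le> real d" using node_count_le[OF reg] by simp
    have "(real ?l + 1)\<^sup>2 \<le> (2 * real ?l)\<^sup>2" by (rule power_mono) (use l in auto)
    also have "\<dots> = 4 * (real ?l * real ?l)" by (simp add: power2_eq_square)
    also have "\<dots> \<le> 4 * (real d * real ?l)" by (intro mult_left_mono mult_right_mono ld) auto
    finally have "240 * real k * (real ?l + 1)\<^sup>2 \<le> 240 * real p * (4 * (real d * real ?l))"
      by (intro mult_mono) (use k in auto)
    moreover have "11 * real d * (real ?l + 1) * real (card ?r) \<le> 11 * real d * (2 * real ?l) * real p"
      by (intro mult_mono) (use l card_node_roots_le in auto)
    ultimately have "240 * real k * (real ?l + 1)\<^sup>2 + 11 * real d * (real ?l + 1) * real (card ?r) \<le> ?\<gamma> * real ?l"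
      by (simp add: algebra_simps)
    then show "node_cost Cantor_Zassenhaus At_Count p d P s x \<le> ennreal (?\<gamma> * real ?l)"
      by (intro order_trans[OF node_cost_cantor_zassenhaus[OF p P d res s k(1)]] ennreal_leI)
  next
    have eq: "?\<alpha> = 960 * (real k * real d ^ 2)" "9000 * real k * real d ^ 2 = 9000 * (real k * real d ^ 2)" by simp_all
    have "real (2 * d + 2) = 2 * real d + 2" by simp
    have "8 * ?\<gamma> / real p = 7856 * real d" using p2 by simp
    moreover have "1 * real d ^ 2 \<le> real k * real d ^ 2" by (rule mult_right_mono[OF k1]) simp
    ultimately show "real (2 * d + 2) + ?\<alpha> + 2 * ?\<beta> + 8 * ?\<gamma> / real p \<le> 9000 * real k * real d ^ 2"
      using d1 dd \<open>real (2 * d + 2) = 2 * real d + 2\<close> eq by linarith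
  qed simp_all
qed

lemma ln_ge_two_thirds: "x \<ge> 2 \<Longrightarrow> 2 / 3 \<le> ln (x :: real)"
  by (rule order_trans[OF ln2_ge_two_thirds]) (subst ln_le_cancel_iff, auto)

text \<open>The least \<open>k\<close> satisfies \<open>2 ^ (k - 1) \<le> p\<close>. Since
  \<open>ln 2\<close> and \<open>ln p\<close> are at least \<open>2 / 3\<close>, both
  \<open>k - 1\<close> and 1 are at most \<open>3 / 2 * ln p\<close>.\<close>

lemma binary_length:
  assumes "p \<ge> 2"
  obtains k where "p < 2 ^ k" "k \<le> p" "real k \<le> 3 * ln (real p)"
proof -
  define k where "k = (LEAST k. p < 2 ^ k)"
  have 1: "p < 2 ^ k" unfolding k_def by (rule LeastI[of _ p]) (rule less_exp)
  have "k \<le> p" unfolding k_def by (rule Least_le) (rule less_exp)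
  obtain j where j: "k = Suc j" using 1 assms by (cases k) auto
  have "\<not> p < 2 ^ j" using not_less_Least[of j "\<lambda>k. p < 2 ^ k"] j unfolding k_def by simp
  then have "2 ^ j \<le> real p" by (metis not_less of_nat_le_iff of_nat_numeral of_nat_power)
  then have "ln (2 ^ j) \<le> ln (real p)" using assms by (subst ln_le_cancel_iff) auto
  then have "real j * ln 2 \<le> ln (real p)" by (simp add: ln_realpow)
  moreover have "real j * (2 / 3) \<le> real j * ln 2" by (intro mult_left_mono ln_ge_two_thirds) auto
  moreover have "2 / 3 \<le> ln (real p)" by (rule ln_ge_two_thirds) (use assms in simp)
  ultimately have "real k \<le> 3 * ln (real p)" using j by simp
  with 1 \<open>k \<le> p\<close> show ?thesis by (rule that)
qed

text \<open>Inserting \<open>k \<le> 3 * ln p\<close> into \<open>9000 * k\<close> gives 27000. For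
  \<open>d \<ge> 2\<close> the factor \<open>ln d ^ 3\<close> is at least \<open>8 / 27\<close>, and
  \<open>100000 * 8 / 27\<close> exceeds 27000.\<close>

lemma average_operations_log:
  assumes p: "prime p" and d: "d \<ge> 2"
  shows "average_at_most (random_coeffs p d)
    (\<lambda>F. expected_operations (strassman Cantor_Zassenhaus At_Count p (padic_int p) (poly_of d F)))
    (100000 * real d ^ 2 * ln (real d) ^ 3 * ln (real p))"
proof -
  obtain k where k: "p < 2 ^ k" "k \<le> p" "real k \<le> 3 * ln (real p)"
    using binary_length[OF prime_ge_2_nat[OF p]] by blast
  have "(2 / 3) ^ 3 \<le> ln (real d) ^ 3" by (intro power_mono ln_ge_two_thirds) (use d in auto)
  then have "27000 \<le> 100000 * ln (real d) ^ 3" by (simp add: power3_eq_cube)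
  then have "27000 * (real d ^ 2 * ln (real p)) \<le> 100000 * ln (real d) ^ 3 * (real d ^ 2 * ln (real p))"
    by (rule mult_right_mono) (use prime_ge_2_nat[OF p] in auto)
  moreover have "9000 * real d ^ 2 * real k \<le> 9000 * real d ^ 2 * (3 * ln (real p))"
    by (intro mult_left_mono k(3)) simp
  ultimately have "9000 * real k * real d ^ 2 \<le> 100000 * real d ^ 2 * ln (real d) ^ 3 * ln (real p)"
    by (simp add: mult_ac)
  with average_operations_cantor_zassenhaus[OF p _ k(1,2), of d] d show ?thesis
    by (auto intro: average_at_most_mono)
qed

theorem theorem1:
  shows
    "(\<forall>p d rf tr. prime p \<and> 1 \<le> d \<longrightarrow>
        (AE F in random_coeffs p d.
           no_singular_roots p (poly_of d F) \<and>
           run_correct p (poly_of d F) (strassman rf tr p (padic_int p) (poly_of d F)))) \<and>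
     (\<exists>C. \<forall>p d. prime p \<and> 2 \<le> d \<longrightarrow>
        average_at_most (random_coeffs p d)
          (\<lambda>F. expected_operations
             (strassman Cantor_Zassenhaus At_Count p (padic_int p) (poly_of d F)))
          (C * real d ^ 2 * ln (real d) ^ 3 * ln (real p))) \<and>
     (\<exists>C. \<forall>p d rf tr. prime p \<and> 1 \<le> d \<longrightarrow>
        average_at_most (random_coeffs p d)
          (\<lambda>F. precision_needed rf tr p (poly_of d F))
          (real d + C)) \<and>
     (\<forall>K. \<exists>C. \<forall>p d. prime p \<and> 1 \<le> d \<and> real p \<le> K * real d \<longrightarrow>
        average_at_most (random_coeffs p d)
          (\<lambda>F. expected_operations
             (strassman Exhaustive_Search At_Multiplicity p (padic_int p) (poly_of d F)))
          (C * (real d * real p)) \<and>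
        C * (real d * real p) \<le> C * K * real d ^ 2)"
proof (intro conjI)
  show "\<forall>p d rf tr. prime p \<and> 1 \<le> d \<longrightarrow>
        (AE F in random_coeffs p d.
           no_singular_roots p (poly_of d F) \<and>
           run_correct p (poly_of d F) (strassman rf tr p (padic_int p) (poly_of d F)))"
    using AE_correct by blast
  show "\<exists>C. \<forall>p d. prime p \<and> 2 \<le> d \<longrightarrow>
        average_at_most (random_coeffs p d)
          (\<lambda>F. expected_operations
             (strassman Cantor_Zassenhaus At_Count p (padic_int p) (poly_of d F)))
          (C * real d ^ 2 * ln (real d) ^ 3 * ln (real p))"
    using average_operations_log by blast
  show "\<exists>C. \<forall>p d rf tr. prime p \<and> 1 \<le> d \<longrightarrow>
        average_at_most (random_coeffs p d)
          (\<lambda>F. precision_needed rf tr p (poly_of d F))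
          (real d + C)"
    \<comment> \<open>The average is at most 8, and \<open>8 \<le> d + 8\<close>.\<close>
    by (intro exI[of _ 8] allI impI average_at_most_mono[OF average_precision]) auto
  show "\<forall>K. \<exists>C. \<forall>p d. prime p \<and> 1 \<le> d \<and> real p \<le> K * real d \<longrightarrow>
        average_at_most (random_coeffs p d)
          (\<lambda>F. expected_operations
             (strassman Exhaustive_Search At_Multiplicity p (padic_int p) (poly_of d F)))
          (C * (real d * real p)) \<and>
        C * (real d * real p) \<le> C * K * real d ^ 2"
  \<comment> \<open>The constant 400 is uniform in \<open>K\<close>, which enters only through the
    comparison of \<open>d * p\<close> with \<open>K * d ^ 2\<close>.\<close>
  proof (intro allI exI[of _ 400] impI conjI; elim conjE)
    fix K :: real and p d :: nat assume *: "prime p" "1 \<le> d" "real p \<le> K * real d"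
    show "average_at_most (random_coeffs p d)
        (\<lambda>F. expected_operations
           (strassman Exhaustive_Search At_Multiplicity p (padic_int p) (poly_of d F)))
        (400 * (real d * real p))"
      by (rule average_operations_exhaustive) fact+
    have "real d * real p \<le> real d * (K * real d)" by (rule mult_left_mono) (use *(3) in auto)
    then show "400 * (real d * real p) \<le> 400 * K * real d ^ 2" by (simp add: power2_eq_square mult_ac)
  qed
qed

end
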